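(* Let $\mu=(\mu_1,\dots,\mu_t)$ be a partition of $n$ with $t$ nonzero parts, let $\eta=\mu$ and $\gamma=(1^n)$, so that the associated sequence of partitions is $R=(R_1,\dots,R_t)$ with $R_i=(1^{\mu_i})$. Then for every partition $\lambda$ of $n$, $$K_{\lambda;R}(q)=\sum_S q^{\mathrm{charge}(S)},$$ where $S$ runs over the set of $R$-catabolizable tableaux of shape $\lambda$.
   Context: Polynomials. Let $\eta=(\eta_1,\dots,\eta_t)$ be a sequence of positive integers with sum $n$ and $\gamma\in\mathbb{Z}^n$. Let $\mathrm{Roots}_\eta=\{(i,j):1\le i\le\eta_1+\dots+\eta_r<j\le n\text{ for some }r\}$, $\rho=(n-1,\dots,1,0)$, $W=S_n$ acting by permuting variables $x_1,\dots,x_n$, $J(f)=\sum_{w\in W}(-1)^w\,wf$ and $\pi(f)=J(x^\rho)^{-1}J(x^\rho f)$ on Laurent polynomials. For a dominant weight $\lambda$ ($\lambda_1\ge\dots\ge\lambda_n$) put $s_\lambda(x)=\pi(x^\lambda)$. Let $B_\eta(x;q)=\prod_{(i,j)\in\mathrm{Roots}_\eta}(1-q\,x_i/x_j)^{-1}$, $H_{\eta,\gamma}(x;q)=\pi(x^\gamma B_\eta(x;q))$ (formal power series in $q$ with Laurent polynomial coefficients), and define $K_{\lambda,\gamma,\eta}(q)$ by $H_{\eta,\gamma}(x;q)=\sum_\lambda K_{\lambda,\gamma,\eta}(q)s_\lambda(x)$, $\lambda$ running over dominant weights. Let $A_i=[\eta_1+\dots+\eta_{i-1}+1,\ \eta_1+\dots+\eta_i]$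 and $R_i=(\gamma_j)_{j\in A_i}$; when all $R_i$ are partitions write $K_{\lambda;R}(q)=K_{\lambda,\gamma,\eta}(q)$ with $R=(R_1,\dots,R_t)$. Tableaux. English notation; column strict means rows weakly increase and columns strictly increase. The row-reading word is $\cdots w^2w^1$ with $w^i$ the $i$-th row read left to right. $P(u)$ is the unique column strict tableau of partition shape whose row-reading word is Knuth equivalent to $u$ (a tableau inside $P(\cdot)$ stands for its row-reading word). Catabolizability. Let $Y_i$ be the tableau of shape $R_i$ whose $j$-th row is filled with the $j$-th smallest letter of $A_i$. For a (skew) tableau $T$ let $H_r(T)=P(T_nT_s)$, where $T_n$, $T_s$ are the parts of $T$ in rows $\le r$ and in rows $>r$. If $S$ is a column strict tableau of partition shape with $S|_{A_1}=Y_1$, put $\mathrm{cat}_{R_1}(S)=H_{\eta_1}(S-Y_1)$, where $S-Y_1$ is the skew tableau obtained by removing $Y_1$. Recursively: if $R$ is empty the only $R$-catabolizable tableau is the empty one; otherwise a column strict tableau $S$ of partition shape in the alphabet $[n]$ is $R$-catabolizable iff $S|_{A_1}=Y_1$ and $\mathrm{cat}_{R_1}(S)$ is $(R_2,\dots,R_t)$-catabolizable in the alphabet $[\eta_1+1,n]$ (using the same $A_2,\dots,A_t$ and $Y_2,\dots,Y_t$). For $\gamma=(1^n)$ every $R$-catabolizable tableau is standard. Charge. For a standard tableau with row-reading word $u$ (a permutation of $1,\dots,n$) put $c_1=0$, $c_i=c_{i-1}$ if $i$ is to the left of $i-1$ in $u$, and $c_i=c_{i-1}+1$ if $i$ is to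 the right; the charge is $c_1+\dots+c_n$. *)

theory Defs
  imports
    "HOL-Library.Poly_Mapping"
    "HOL-Combinatorics.Permutations"
    "HOL-Computational_Algebra.Formal_Power_Series"
begin

section \<open>Laurent polynomials and the operator $\pi$\<close>

text \<open>
  Laurent polynomials over the integers are elements of the group algebra of the exponent
  lattice: the exponent of a monomial maps the index \<open>i\<close> of the variable \<open>x\<^sub>i\<close> to its
  (possibly negative) power. For a given \<open>n\<close> the variables are \<open>x\<^sub>1, \<dots>, x\<^sub>n\<close>. Weights in
  \<open>\<int>\<^sup>n\<close> are lists of integers of length \<open>n\<close>, so that entry \<open>i\<close> of a weight is \<open>\<gamma> ! (i - 1)\<close>.
\<close>

type_synonym laurent = "(nat \<Rightarrow>\<^sub>0 int) \<Rightarrow>\<^sub>0 int"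

definition exponent :: "int list \<Rightarrow> nat \<Rightarrow>\<^sub>0 int" where
  "exponent \<gamma> = (\<Sum>i = 1..length \<gamma>. Poly_Mapping.single i (\<gamma> ! (i - 1)))"

definition xpow :: "int list \<Rightarrow> laurent" where
  "xpow \<gamma> = Poly_Mapping.single (exponent \<gamma>) 1"

definition xratio :: "nat \<Rightarrow> nat \<Rightarrow> laurent" where
  "xratio i j = Poly_Mapping.single (Poly_Mapping.single i 1 - Poly_Mapping.single j 1) 1"

text \<open>
  The substitution sending \<open>x\<^sub>i\<close> to \<open>x\<^bsub>w i\<^esub>\<close>: the new exponent of \<open>x\<^sub>k\<close> is the old exponent
  of the variable with index \<open>inv w k\<close>.
\<close>

definition permute_vars :: "(nat \<Rightarrow> nat) \<Rightarrow> laurent \<Rightarrow> laurent" where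
  "permute_vars w f = (\<Sum>a\<in>Poly_Mapping.keys f.
     Poly_Mapping.single (Poly_Mapping.map_key (inv w) a) (Poly_Mapping.lookup f a))"

definition alternant :: "nat \<Rightarrow> laurent \<Rightarrow> laurent" where
  "alternant n f = (\<Sum>w | w permutes {1..n}. of_int (sign w) * permute_vars w f)"

definition rho :: "nat \<Rightarrow> int list" where
  "rho n = map int (rev [0..<n])"

text \<open>The quotient of \<open>J(x\<^sup>\<rho> f)\<close> by \<open>J(x\<^sup>\<rho>)\<close>, which is exact in the ring of Laurent polynomials.\<close>

definition weyl_pi :: "nat \<Rightarrow> laurent \<Rightarrow> laurent" where
  "weyl_pi n f = (THE g. alternant n (xpow (rho n)) * g = alternant n (xpow (rho n) * f))"

definition dominant :: "nat \<Rightarrow> int list \<Rightarrow> bool" where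
  "dominant n lam \<longleftrightarrow> length lam = n \<and> sorted_wrt (\<ge>) lam"

definition schur :: "nat \<Rightarrow> int list \<Rightarrow> laurent" where
  "schur n lam = weyl_pi n (xpow lam)"

definition schur_coeffs :: "nat \<Rightarrow> laurent \<Rightarrow> int list \<Rightarrow>\<^sub>0 int" where
  "schur_coeffs n g = (THE c. (\<forall>lam\<in>Poly_Mapping.keys c. dominant n lam) \<and>
     g = (\<Sum>lam\<in>Poly_Mapping.keys c. of_int (Poly_Mapping.lookup c lam) * schur n lam))"


section \<open>The polynomials $K_{\lambda,\gamma,\eta}(q)$\<close>

definition Roots :: "nat list \<Rightarrow> (nat \<times> nat) set" where
  "Roots \<eta> = {(i, j). 1 \<le> i \<and> j \<le> sum_list \<eta> \<and>
     (\<exists>r\<in>{1..length \<eta>}. i \<le> sum_list (take r \<eta>) \<and> sum_list (take r \<eta>) < j)}"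

text \<open>
  Power series in \<open>q\<close> (that is, \<^term>\<open>fps_X\<close>) over the Laurent polynomials. The coefficient
  ring is not a field, so the inverse of a series with constant term 1 is taken with
  \<^term>\<open>fps_right_inverse\<close>, whose second argument is the inverse of the constant term.
\<close>

definition B_series :: "nat list \<Rightarrow> laurent fps" where
  "B_series \<eta> = (\<Prod>(i, j)\<in>Roots \<eta>. fps_right_inverse (1 - fps_X * fps_const (xratio i j)) 1)"

lemma B_series_factor:
  "(1 - fps_X * fps_const (xratio i j)) *
     fps_right_inverse (1 - fps_X * fps_const (xratio i j)) 1 = 1"
  by (rule fps_right_inverse) simp

definition H_series :: "nat list \<Rightarrow> int list \<Rightarrow> laurent fps" where
  "H_series \<eta> \<gamma> =
     Abs_fps (\<lambda>k. weyl_pi (sum_list \<eta>) (fps_nth (fps_const (xpow \<gamma>) * B_series \<eta>) k))"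

definition K_series :: "int list \<Rightarrow> int list \<Rightarrow> nat list \<Rightarrow> int fps" where
  "K_series lam \<gamma> \<eta> =
     Abs_fps (\<lambda>k. Poly_Mapping.lookup (schur_coeffs (sum_list \<eta>) (fps_nth (H_series \<eta> \<gamma>) k)) lam)"

text \<open>The sequence \<open>R = (R\<^sub>1, \<dots>, R\<^sub>t)\<close> obtained by cutting \<open>\<gamma>\<close> into blocks of lengths \<open>\<eta>\<close>.\<close>

fun blocks :: "nat list \<Rightarrow> int list \<Rightarrow> int list list" where
  "blocks [] \<gamma> = []"
| "blocks (m # \<eta>) \<gamma> = take m \<gamma> # blocks \<eta> (drop m \<gamma>)"

lemma blocks_ones:
  "blocks \<eta> (replicate (sum_list \<eta>) 1) = map (\<lambda>m. replicate m 1) \<eta>"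
  by (induction \<eta>) auto

definition K_of_seq :: "int list \<Rightarrow> int list list \<Rightarrow> int fps" where
  "K_of_seq lam R = K_series lam (concat R) (map length R)"

definition partition_of :: "nat list \<Rightarrow> nat \<Rightarrow> bool" where
  "partition_of lam n \<longleftrightarrow> sorted_wrt (\<ge>) lam \<and> (\<forall>p\<in>set lam. 0 < p) \<and> sum_list lam = n"

text \<open>Partitions have no zero parts; as weights in \<open>\<int>\<^sup>n\<close> they are padded with zeros.\<close>

definition weight_of :: "nat \<Rightarrow> nat list \<Rightarrow> int list" where
  "weight_of n lam = map int lam @ replicate (n - length lam) 0"


section \<open>Tableaux and Knuth equivalence\<close>

text \<open>
  A tableau is the list of its rows, from top to bottom in English notation. Skew tableaux are
  represented in the same way; the horizontal offset of a row is not recorded, because only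
  row-reading words of skew tableaux are used.
\<close>

type_synonym tableau = "nat list list"

definition trow :: "tableau \<Rightarrow> nat \<Rightarrow> nat list" where
  "trow T i = (if i < length T then T ! i else [])"

definition shape :: "tableau \<Rightarrow> nat list" where
  "shape T = map length T"

definition column_strict :: "tableau \<Rightarrow> bool" where
  "column_strict T \<longleftrightarrow>
     (\<forall>r\<in>set T. r \<noteq> [] \<and> sorted r) \<and>
     (\<forall>i. Suc i < length T \<longrightarrow> length (T ! Suc i) \<le> length (T ! i) \<and>
        (\<forall>j < length (T ! Suc i). T ! i ! j < T ! Suc i ! j))"

definition row_word :: "tableau \<Rightarrow> nat list" where
  "row_word T = concat (rev T)"

inductive knuth_step :: "nat list \<Rightarrow> nat list \<Rightarrow> bool" where
  "x < y \<Longrightarrow> y \<le> z \<Longrightarrow> knuth_step (u @ [y, x, z] @ v) (u @ [y, z, x] @ v)"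
| "x \<le> y \<Longrightarrow> y < z \<Longrightarrow> knuth_step (u @ [x, z, y] @ v) (u @ [z, x, y] @ v)"

definition P_tableau :: "nat list \<Rightarrow> tableau" where
  "P_tableau u = (THE T. column_strict T \<and> equivclp knuth_step (row_word T) u)"


section \<open>Catabolizable tableaux\<close>

definition H_op :: "nat \<Rightarrow> tableau \<Rightarrow> tableau" where
  "H_op r T = P_tableau (row_word (take r T) @ row_word (drop r T))"

text \<open>
  The interval \<open>A\<^sub>1\<close> is \<open>{a + 1..a + m}\<close>, where \<open>m\<close> is the length of \<open>R\<^sub>1\<close> (zero parts included)
  and \<open>a\<close> is the total length of the blocks already processed.
\<close>

definition Y_tableau :: "nat \<Rightarrow> int list \<Rightarrow> tableau" where
  "Y_tableau a r = map (\<lambda>j. replicate (nat (r ! j)) (a + 1 + j)) [0..<length r]"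

text \<open>
  Restriction to, and removal of, a set of letters, row by row. If \<open>S|\<^bsub>A\<^esub> = Y\<close> for a set \<open>A\<close> of
  smallest letters, then \<open>S - Y\<close> is what remains after removing the letters in \<open>A\<close>.
\<close>

definition restrict_tab :: "nat set \<Rightarrow> tableau \<Rightarrow> tableau" where
  "restrict_tab A T = map (filter (\<lambda>x. x \<in> A)) T"

definition remove_tab :: "nat set \<Rightarrow> tableau \<Rightarrow> tableau" where
  "remove_tab A T = map (filter (\<lambda>x. x \<notin> A)) T"

text \<open>Equality of restricted tableaux is row by row, so that trailing empty rows do not matter.\<close>

fun catabolizable :: "nat \<Rightarrow> int list list \<Rightarrow> tableau \<Rightarrow> bool" where
  "catabolizable a [] S \<longleftrightarrow> S = []"
| "catabolizable a (r # R) S \<longleftrightarrow>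
     (let A = {a + 1..a + length r} in
        column_strict S \<and>
        set (concat S) \<subseteq> {a + 1..a + sum_list (map length (r # R))} \<and>
        (\<forall>i. trow (restrict_tab A S) i = trow (Y_tableau a r) i) \<and>
        catabolizable (a + length r) R (H_op (length r) (remove_tab A S)))"

definition R_catabolizable :: "int list list \<Rightarrow> tableau \<Rightarrow> bool" where
  "R_catabolizable R S \<longleftrightarrow> catabolizable 0 R S"


section \<open>Charge\<close>

definition left_of :: "nat list \<Rightarrow> nat \<Rightarrow> nat \<Rightarrow> bool" where
  "left_of u i j \<longleftrightarrow> (\<exists>k l. k < l \<and> l < length u \<and> u ! k = i \<and> u ! l = j)"

text \<open>The value at 0 is a dummy: the letters of a standard tableau start at 1.\<close>

fun charge_index :: "nat list \<Rightarrow> nat \<Rightarrow> nat" where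
  "charge_index u 0 = 0"
| "charge_index u (Suc 0) = 0"
| "charge_index u (Suc (Suc i)) =
     (if left_of u (Suc (Suc i)) (Suc i) then charge_index u (Suc i)
      else charge_index u (Suc i) + 1)"

definition charge :: "tableau \<Rightarrow> nat" where
  "charge S = (\<Sum>i = 1..length (row_word S). charge_index (row_word S) i)"

end

theory Submission imports Defs
begin

text \<open>
  The equality holds for every composition in place of \<open>\<mu>\<close>. Catabolizability of a standard
  tableau depends only on its greedy catabolism type \<open>ct\<close>, the successive maximal columns that can be
  catabolized. This type is invariant under Knuth equivalence and under moving the last letter to
  the front unless the smaller letters form a decreasing word. Encoding a tableau by the lattice word of the rows of its letters, the number of
  catabolizable tableaux of given shape and charge becomes an alternating sum over all words of row
  indices whose type and charge are prescribed: the words that are not lattice words cancel under the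
  involution that applies a bracketing reflection behind the first violation of the lattice condition.
  On the algebraic side, the Vandermonde product, multiplied out one variable at a time, shows that
  each block of root factors \<open>1 / (1 - q x\<^sub>i / x\<^sub>j)\<close> adjoins the corresponding labels to the words,
  up to Laurent polynomials with a negative exponent, which do not contribute for the weight
  of a partition.
\<close>

section \<open>Knuth equivalence and row insertion\<close>

text \<open>The catabolism of a block \<open>{a<..b}\<close> reads the surviving rows in the order
  \<open>b, ..., a + 1, b + N, ..., b + 1\<close>, a cyclic rotation of the usual order.
  Neighbouring rows can still exchange a letter by Knuth relations, except the rows \<open>b\<close>
  and \<open>b + 1\<close>, which are now read first and last. There the letters of row
  \<open>b + 1\<close> are rotated to the front. Each letter rotated to the front lowers the charge
  by one; when a label changes from \<open>b\<close> to \<open>b + 1\<close>, there is one more such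
  letter and one label \<open>\<le> b\<close> less, so charge plus the number of labels
  \<open>\<le> b\<close> is preserved. Rotation needs two smaller letters in increasing order.
  Behind the first violation of the lattice condition the prefix \<open>a + 1, ..., b\<close> forces
  two spare letters in row \<open>b + 1\<close>, which is why only suffixes are reflected there. The
  number of labels \<open>\<le> b\<close> is also the degree in the variables outside the remaining
  block: recording this degree by \<open>q\<close> turns \<open>x\<^sub>i / x\<^sub>j\<close> into
  \<open>q x\<^sub>i / x\<^sub>j\<close>, so an identity without \<open>q\<close> yields the one
  with \<open>q\<close>.\<close>

abbreviation knuth_eq :: "nat list \<Rightarrow> nat list \<Rightarrow> bool" (infix "\<approx>" 50) where
  "u \<approx> v \<equiv> equivclp knuth_step u v"

lemma knuth_refl [simp]: "u \<approx> u"
  by (rule equivclp_refl)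

lemma knuth_trans [trans]: "u \<approx> v \<Longrightarrow> v \<approx> w \<Longrightarrow> u \<approx> w"
  by (rule equivclp_trans)

lemma knuth_sym: "u \<approx> v \<Longrightarrow> v \<approx> u"
  by (rule equivclp_sym)

lemma knuth_eq_trans1 [trans]: "u = v \<Longrightarrow> v \<approx> w \<Longrightarrow> u \<approx> w"
  and knuth_eq_trans2 [trans]: "u \<approx> v \<Longrightarrow> v = w \<Longrightarrow> u \<approx> w"
  by simp_all

lemma knuth_step_ctx:
  assumes "knuth_step u v" shows "knuth_step (a @ u @ b) (a @ v @ b)"
  using assms
proof cases
  case (1 x y z p q)
  then show ?thesis using knuth_step.intros(1)[of x y z "a @ p" "q @ b"] by simp
next
  case (2 x y z p q)
  then show ?thesis using knuth_step.intros(2)[of x y z "a @ p" "q @ b"] by simp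
qed

lemma knuth_ctx:
  assumes "u \<approx> v" shows "a @ u @ b \<approx> a @ v @ b"
  using assms
proof (induction rule: equivclp_induct)
  case base then show ?case by simp
next
  case (step y z)
  then have "a @ y @ b \<approx> a @ z @ b"
    using knuth_step_ctx[of y z a b] knuth_step_ctx[of z y a b]
    by (auto intro: r_into_equivclp converse_r_into_equivclp)
  with step.IH show ?case by (rule knuth_trans)
qed

lemma knuth_app_left: "u \<approx> v \<Longrightarrow> a @ u \<approx> a @ v"
  using knuth_ctx[of u v a "[]"] by simp

lemma knuth_app_right: "u \<approx> v \<Longrightarrow> u @ b \<approx> v @ b"
  using knuth_ctx[of u v "[]" b] by simp

lemma knuth_cons: "u \<approx> v \<Longrightarrow> x # u \<approx> x # v"
  using knuth_ctx[of u v "[x]" "[]"] by simp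

lemma knuth_yxz: "x < y \<Longrightarrow> y < z \<Longrightarrow> y # x # z # v \<approx> y # z # x # v"
  using knuth_step.intros(1)[of x y z "[]" v] by (auto intro: r_into_equivclp)

lemma knuth_xzy: "x < y \<Longrightarrow> y < z \<Longrightarrow> x # z # y # v \<approx> z # x # y # v"
  using knuth_step.intros(2)[of x y z "[]" v] by (auto intro: r_into_equivclp)

lemma knuth_mset: "u \<approx> v \<Longrightarrow> mset u = mset v"
proof (induction rule: equivclp_induct)
  case (step y z)
  have "mset a = mset b" if "knuth_step a b" for a b
    using that by cases auto
  with step show ?case by metis
qed simp

lemma knuth_set: "u \<approx> v \<Longrightarrow> set u = set v"
  by (metis knuth_mset set_mset_mset)

lemma knuth_length: "u \<approx> v \<Longrightarrow> length u = length v"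
  by (metis knuth_mset size_mset)

lemma knuth_distinct: "u \<approx> v \<Longrightarrow> distinct u \<longleftrightarrow> distinct v"
  by (metis knuth_mset mset_eq_imp_distinct_iff)

text \<open>A Knuth step exchanges its smallest and its largest letter. If the filter drops one of
  them nothing changes; if it keeps both, convexity of \<open>P\<close> keeps the middle letter that
  witnesses the step.\<close>

lemma knuth_filter:
  assumes "u \<approx> v" and conv: "\<And>x y z. x \<le> y \<Longrightarrow> y \<le> z \<Longrightarrow> P x \<Longrightarrow> P z \<Longrightarrow> P y"
  shows "filter P u \<approx> filter P v"
proof -
  have st: "filter P a \<approx> filter P b" if "knuth_step a b" for a b
    using that
  proof cases
    case (1 x y z p q)
    show ?thesis
    proof (cases "P x \<and> P z")
      case True
      then have "P y" using conv 1 by (metis less_imp_le)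
      then show ?thesis using True 1 knuth_step.intros(1)[of x y z "filter P p" "filter P q"]
        by (auto intro: r_into_equivclp)
    next
      case False then show ?thesis using 1 by (cases "P x") auto
    qed
  next
    case (2 x y z p q)
    show ?thesis
    proof (cases "P x \<and> P z")
      case True
      then have "P y" using conv 2 by (metis less_imp_le)
      then show ?thesis using True 2 knuth_step.intros(2)[of x y z "filter P p" "filter P q"]
        by (auto intro: r_into_equivclp)
    next
      case False then show ?thesis using 2 by (cases "P x") auto
    qed
  qed
  from assms(1) show ?thesis
  proof (induction rule: equivclp_induct)
    case (step y z)
    then have "filter P y \<approx> filter P z" using st knuth_sym by blast
    with step.IH show ?case by (rule knuth_trans)
  qed simp
qed

text \<open>Both sides of a Knuth step contain two letters in weakly increasing order, so a strictly
  decreasing word is alone in its class. Together with \<open>knuth_filter\<close> this makes the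
  initial decreasing run a Knuth invariant.\<close>

lemma knuth_decreasing:
  assumes "u \<approx> v" "sorted_wrt (>) u" shows "v = u"
  using assms
proof (induction rule: equivclp_induct)
  case (step y z)
  have "\<not> sorted_wrt (>) a \<and> \<not> sorted_wrt (>) b" if "knuth_step a b" for a b
    using that by cases (auto simp: sorted_wrt_append)
  with step show ?case by metis
qed simp

text \<open>When \<open>x\<close> crosses a letter of \<open>Q\<close>, the left neighbour of that
  letter is the witness; hence \<open>x\<close> can cross all of \<open>Q\<close> but stops behind
  \<open>y\<close>.\<close>

lemma knuth_pass:
  "sorted_wrt (<) (y # Q) \<Longrightarrow> x < y \<Longrightarrow> y # Q @ [x] \<approx> y # x # Q"
proof (induction Q rule: rev_induct)
  case (snoc q Q)
  obtain p P where pP: "y # Q = P @ [p]" by (metis append_butlast_last_id list.distinct(1))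
  have "p \<in> set (y # Q)" unfolding pP by simp
  then have "x < p" using snoc.prems by (auto simp: sorted_wrt_append)
  moreover have "p < q" using \<open>p \<in> set (y # Q)\<close> snoc.prems by (auto simp: sorted_wrt_append)
  ultimately have "[p, q, x] \<approx> [p, x, q]" using knuth_yxz[of x p q "[]"] knuth_sym by blast
  then have "P @ [p, q, x] \<approx> P @ [p, x, q]" by (rule knuth_app_left)
  moreover have "y # (Q @ [q]) @ [x] = P @ [p, q, x]" and e2: "P @ [p, x, q] = (y # Q @ [x]) @ [q]"
    using pP by (metis append.assoc append_Cons append_Nil)+
  moreover have "(y # Q @ [x]) @ [q] \<approx> (y # x # Q) @ [q]"
    using snoc by (intro knuth_app_right snoc.IH) (auto simp: sorted_wrt_append)
  ultimately show ?case by (metis append_Cons knuth_trans)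
qed simp

text \<open>Schensted's row insertion of \<open>x\<close>, which bumps \<open>y\<close>:
  \<open>knuth_pass\<close> brings \<open>x\<close> next to \<open>y\<close>, and afterwards
  \<open>y\<close> moves left over the letters of \<open>P\<close> one at a time.\<close>

lemma knuth_row_bump:
  "sorted_wrt (<) (P @ x # y # Q) \<Longrightarrow> P @ y # Q @ [x] \<approx> y # P @ x # Q"
proof (induction P arbitrary: x Q rule: rev_induct)
  case Nil then show ?case using knuth_pass[of y Q x] by (auto simp: sorted_wrt_append)
next
  case (snoc p P)
  have "(P @ [p]) @ y # Q @ [x] \<approx> (P @ [p]) @ y # x # Q"
    using snoc.prems by (intro knuth_app_left knuth_pass) (auto simp: sorted_wrt_append)
  also have "(P @ [p]) @ y # x # Q = P @ (p # y # x # Q)" by simp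
  also have "\<dots> \<approx> P @ (y # p # x # Q)"
    using snoc.prems by (intro knuth_app_left knuth_xzy) (auto simp: sorted_wrt_append)
  also have "\<dots> = (P @ [y, p]) @ x # Q" by simp
  also have "\<dots> \<approx> (y # P @ [p]) @ x # Q"
  proof (rule knuth_app_right)
    have "P @ y # [] @ [p] \<approx> y # P @ p # []"
      using snoc.prems by (intro snoc.IH) (auto simp: sorted_wrt_append)
    then show "P @ [y, p] \<approx> y # P @ [p]" by simp
  qed
  finally show ?case by simp
qed

section \<open>Rows that fit below one another, and insertion of a whole row into a row\<close>

definition stacked2 :: "nat list \<Rightarrow> nat list \<Rightarrow> bool" where
  "stacked2 r s \<longleftrightarrow> length s \<le> length r \<and> (\<forall>i < length s. r ! i < s ! i)"

lemma stacked2_Nil [simp]: "stacked2 r []"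
  by (simp add: stacked2_def)

lemma stacked2_Nil_left [simp]: "stacked2 [] s \<longleftrightarrow> s = []"
  by (auto simp: stacked2_def)

lemma stacked2_Cons: "stacked2 (a # r) (b # s) \<longleftrightarrow> a < b \<and> stacked2 r s"
  by (auto simp: stacked2_def nth_Cons less_Suc_eq_0_disj split: nat.splits)

lemma stacked2_shift:
  "sorted_wrt (<) (b # r) \<Longrightarrow> stacked2 r s \<Longrightarrow> stacked2 (b # r) s"
  unfolding stacked2_def
proof (intro conjI allI impI, simp)
  fix i assume a: "sorted_wrt (<) (b # r)" "length s \<le> length r \<and> (\<forall>i<length s. r ! i < s ! i)" "i < length s"
  then have "r ! i < s ! i" "i < length r" by auto
  moreover have "(b # r) ! i < (b # r) ! Suc i"
    using a by (intro sorted_wrt_nth_less[of "(<)"]) auto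
  ultimately show "(b # r) ! i < s ! i" by simp
qed

text \<open>The letters of \<open>\<alpha>\<close> are inserted one by one, and each bumps the
  letter of \<open>\<beta>\<close> in the same position. An inserted letter joins \<open>P\<close>,
  which is why the induction is over all \<open>P\<close>.\<close>

lemma knuth_insert_stacked:
  assumes "length \<alpha> = length \<beta>" "stacked2 \<alpha> \<beta>"
    "sorted_wrt (<) (P @ \<beta> @ \<gamma>)" "sorted_wrt (<) (P @ \<alpha> @ \<gamma>)"
  shows "P @ \<beta> @ \<gamma> @ \<alpha> \<approx> \<beta> @ P @ \<alpha> @ \<gamma>"
  using assms
proof (induction \<alpha> \<beta> arbitrary: P rule: list_induct2)
  case Nil then show ?case by simp
next
  case (Cons a \<alpha> b \<beta>)
  have ab: "a < b" "stacked2 \<alpha> \<beta>" using Cons.prems(1) by (auto simp: stacked2_Cons)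
  have srt: "sorted_wrt (<) (P @ a # b # \<beta> @ \<gamma>)" "sorted_wrt (<) ((P @ [a]) @ \<beta> @ \<gamma>)"
    using Cons.prems(2,3) ab by (auto simp: sorted_wrt_append ball_Un dest: order.strict_trans[OF ab(1)])
  have "P @ (b # \<beta>) @ \<gamma> @ (a # \<alpha>) = (P @ b # (\<beta> @ \<gamma>) @ [a]) @ \<alpha>" by simp
  also have "\<dots> \<approx> (b # P @ a # \<beta> @ \<gamma>) @ \<alpha>"
    using srt(1) by (intro knuth_app_right knuth_row_bump) simp
  also have "\<dots> = b # (P @ [a]) @ \<beta> @ \<gamma> @ \<alpha>" by simp
  also have "\<dots> \<approx> b # \<beta> @ (P @ [a]) @ \<alpha> @ \<gamma>"
    using Cons.prems(3) srt(2) ab by (intro knuth_cons Cons.IH) simp_all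
  finally show ?case by simp
qed

text \<open>The first component consists of the bumped letters.\<close>

fun insert_row :: "nat list \<Rightarrow> nat list \<Rightarrow> nat list \<times> nat list" where
  "insert_row \<beta> [] = ([], \<beta>)"
| "insert_row [] \<alpha> = ([], \<alpha>)"
| "insert_row (b # \<beta>) (a # \<alpha>) =
     (if a < b then (b # fst (insert_row \<beta> \<alpha>), a # snd (insert_row \<beta> \<alpha>))
      else (fst (insert_row \<beta> (a # \<alpha>)), b # snd (insert_row \<beta> (a # \<alpha>))))"

lemma insert_row_Nil [simp]: "insert_row [] \<alpha> = ([], \<alpha>)"
  by (cases \<alpha>) auto

lemma insert_row_sets:
  "set (fst (insert_row \<beta> \<alpha>)) \<subseteq> set \<beta>"
  "set \<alpha> \<subseteq> set (snd (insert_row \<beta> \<alpha>))"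
  "set (snd (insert_row \<beta> \<alpha>)) \<subseteq> set \<beta> \<union> set \<alpha>"
  by (induction \<beta> \<alpha> rule: insert_row.induct) auto

lemma insert_row_length:
  "length (fst (insert_row \<beta> \<alpha>)) + length (snd (insert_row \<beta> \<alpha>)) = length \<beta> + length \<alpha>"
  "length \<alpha> \<le> length (snd (insert_row \<beta> \<alpha>))"
  by (induction \<beta> \<alpha> rule: insert_row.induct) auto

text \<open>Every letter of \<open>\<beta>\<close> that is not bumped lengthens the new row, so
  equality of lengths means that all of \<open>\<beta>\<close> is bumped. Read contrapositively,
  this gives the strict decrease in the straightening of fillings.\<close>

lemma insert_row_trivial:
  "length (snd (insert_row \<beta> \<alpha>)) = length \<alpha> \<Longrightarrow> insert_row \<beta> \<alpha> = (\<beta>, \<alpha>)"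
proof (induction \<beta> \<alpha> rule: insert_row.induct)
  case (3 b \<beta> a \<alpha>)
  show ?case
  proof (cases "a < b")
    case True then show ?thesis using "3.prems" "3.IH"(1)[OF True] by simp
  next
    case False
    then show ?thesis using "3.prems" insert_row_length(2)[of "a # \<alpha>" \<beta>] by simp
  qed
qed auto

lemma insert_row_props:
  assumes "sorted_wrt (<) \<beta>" "sorted_wrt (<) \<alpha>" "set \<beta> \<inter> set \<alpha> = {}"
  shows "sorted_wrt (<) (fst (insert_row \<beta> \<alpha>)) \<and> sorted_wrt (<) (snd (insert_row \<beta> \<alpha>)) \<and>
    stacked2 (snd (insert_row \<beta> \<alpha>)) (fst (insert_row \<beta> \<alpha>)) \<and>
    \<beta> @ \<alpha> \<approx> fst (insert_row \<beta> \<alpha>) @ snd (insert_row \<beta> \<alpha>)"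
  using assms
proof (induction \<beta> \<alpha> rule: insert_row.induct)
  case (3 b \<beta> a \<alpha>)
  show ?case
  proof (cases "a < b")
    case True
    obtain K R where KR: "insert_row \<beta> \<alpha> = (K, R)" by force
    have IH: "sorted_wrt (<) K" "sorted_wrt (<) R" "stacked2 R K" "\<beta> @ \<alpha> \<approx> K @ R"
      using "3.IH"(1)[OF True] "3.prems" by (auto simp: KR)
    have sub: "set K \<subseteq> set \<beta>" "set R \<subseteq> set \<beta> \<union> set \<alpha>"
      using insert_row_sets[where \<beta>=\<beta> and \<alpha>=\<alpha>] by (auto simp: KR)
    have sK: "sorted_wrt (<) (b # K)" "sorted_wrt (<) (a # R)"
      using IH sub "3.prems" True by fastforce+
    have "(b # \<beta>) @ (a # \<alpha>) = (b # \<beta> @ [a]) @ \<alpha>" by simp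
    also have "\<dots> \<approx> (b # a # \<beta>) @ \<alpha>"
      using "3.prems" True by (intro knuth_app_right knuth_pass) auto
    also have "\<dots> \<approx> [b, a] @ K @ R"
      using knuth_app_left[OF IH(4), of "[b, a]"] by simp
    also have "\<dots> = (b # a # K) @ R" by simp
    also have "\<dots> \<approx> (b # K @ [a]) @ R"
      using sK True by (intro knuth_app_right knuth_sym[OF knuth_pass]) auto
    finally show ?thesis using True sK IH by (simp add: KR stacked2_Cons)
  next
    case False
    then have ba: "b < a" using "3.prems"(3) by force
    obtain K R where KR: "insert_row \<beta> (a # \<alpha>) = (K, R)" by force
    have IH: "sorted_wrt (<) K" "sorted_wrt (<) R" "stacked2 R K" "\<beta> @ a # \<alpha> \<approx> K @ R"
      using "3.IH"(3)[OF False] "3.prems" by (auto simp: KR)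
    have sub: "set K \<subseteq> set \<beta>" "set R \<subseteq> set \<beta> \<union> set (a # \<alpha>)"
      using insert_row_sets[where \<beta>=\<beta> and \<alpha>="a # \<alpha>"] by (auto simp: KR)
    have sR: "sorted_wrt (<) (b # R)" "sorted_wrt (<) (b # K)"
      using IH sub "3.prems" ba by fastforce+
    \<comment> \<open>A letter \<open>b\<close> that is not bumped still stands in front of the
      bumped letters \<open>K\<close>. As \<open>K\<close> fits below \<open>R\<close>, it fits
      below the part \<open>R1\<close> of the same length, and \<open>knuth_insert_stacked\<close>
      with \<open>P = [b]\<close> carries \<open>b\<close> over to the row \<open>R\<close>.\<close>
    define R1 R2 where "R1 = take (length K) R" and "R2 = drop (length K) R"
    have R: "R = R1 @ R2" "length R1 = length K" "stacked2 R1 K"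
      using IH(3) by (auto simp: R1_def R2_def stacked2_def)
    have "(b # \<beta>) @ (a # \<alpha>) \<approx> b # K @ R" using knuth_cons[OF IH(4)] by simp
    also have "\<dots> = ([b] @ K @ [] @ R1) @ R2" using R by simp
    also have "\<dots> \<approx> (K @ [b] @ R1 @ []) @ R2"
      using R sR by (intro knuth_app_right knuth_insert_stacked) (auto simp: sorted_wrt_append)
    also have "\<dots> = K @ (b # R)" using R by simp
    finally show ?thesis using False sR IH by (simp add: KR stacked2_shift)
  qed
qed auto

lemma row_word_Nil [simp]: "row_word [] = []"
  and row_word_Cons [simp]: "row_word (r # T) = row_word T @ r"
  and row_word_append [simp]: "row_word (T @ T') = row_word T' @ row_word T"
  by (simp_all add: row_word_def)

lemma set_row_word: "set (row_word T) = \<Union> (set ` set T)"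
  by (induction T) auto

fun stacked :: "nat list list \<Rightarrow> bool" where
  "stacked (r # s # T) \<longleftrightarrow> stacked2 r s \<and> stacked (s # T)"
| "stacked _ \<longleftrightarrow> True"

lemma stacked_conv_nth: "stacked T \<longleftrightarrow> (\<forall>i. Suc i < length T \<longrightarrow> stacked2 (T ! i) (T ! Suc i))"
  by (induction T rule: stacked.induct) (auto simp: nth_Cons split: nat.splits)

lemma stacked_append:
  "stacked (A @ B) \<longleftrightarrow> stacked A \<and> stacked B \<and> (A \<noteq> [] \<longrightarrow> B \<noteq> [] \<longrightarrow> stacked2 (last A) (hd B))"
proof (induction A rule: stacked.induct)
  case ("2_2" r) then show ?case by (cases B) auto
qed auto

lemma column_strict_conv:
  "column_strict T \<longleftrightarrow> (\<forall>r\<in>set T. r \<noteq> [] \<and> sorted r) \<and> stacked T"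
  unfolding column_strict_def stacked_conv_nth stacked2_def by auto

lemma sorted_wrt_less_distinct: "sorted r \<Longrightarrow> distinct r \<Longrightarrow> sorted_wrt (<) r"
  by (simp add: strict_sorted_iff)

lemma distinct_row_word: "distinct (row_word T) \<Longrightarrow> r \<in> set T \<Longrightarrow> distinct r"
  by (induction T) auto

section \<open>Insertion of single letters into rows, blocks of rows and tableaux\<close>

fun row_insert :: "nat \<Rightarrow> nat list \<Rightarrow> nat list \<times> nat list" where
  "row_insert z [] = ([z], [])"
| "row_insert z (y # r) = (if z < y then (z # r, [y])
     else (y # fst (row_insert z r), snd (row_insert z r)))"

lemma row_insert_cases:
  assumes "sorted_wrt (<) r" "z \<notin> set r"
  obtains (append) "row_insert z r = (r @ [z], [])" "\<forall>x\<in>set r. x < z"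
  | (bump) P y Q where "r = P @ y # Q" "row_insert z r = (P @ z # Q, [y])" "z < y" "\<forall>x\<in>set P. x < z"
  using assms
proof (induction r arbitrary: thesis)
  case (Cons y r)
  show ?case
  proof (cases "z < y")
    case True then show ?thesis using Cons.prems(2)[of "[]" y r] by simp
  next
    case False
    then have yz: "y < z" using Cons.prems by auto
    show ?thesis
    proof (rule Cons.IH)
      assume "row_insert z r = (r @ [z], [])" "\<forall>x\<in>set r. x < z"
      then show thesis using Cons.prems(1) yz by simp
    next
      fix P y' Q assume "r = P @ y' # Q" "row_insert z r = (P @ z # Q, [y'])" "z < y'" "\<forall>x\<in>set P. x < z"
      then show thesis using Cons.prems(2)[of "y # P" y' Q] yz by simp
    qed (use Cons.prems in auto)
  qed
qed auto

text \<open>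
  Insertion into a block of rows returns the new block and the list (of length at most one)
  of letters bumped out of the last row.
\<close>

fun block_insert :: "nat \<Rightarrow> nat list list \<Rightarrow> nat list list \<times> nat list" where
  "block_insert z [] = ([], [z])"
| "block_insert z (r # T) = (case row_insert z r of (r', []) \<Rightarrow> (r' # T, [])
     | (r', y # _) \<Rightarrow> (r' # fst (block_insert y T), snd (block_insert y T)))"

fun block_insert_word :: "nat list \<Rightarrow> nat list list \<Rightarrow> nat list list \<times> nat list" where
  "block_insert_word [] T = (T, [])"
| "block_insert_word (z # u) T =
     (fst (block_insert_word u (fst (block_insert z T))),
      snd (block_insert z T) @ snd (block_insert_word u (fst (block_insert z T))))"

fun tab_insert :: "nat \<Rightarrow> tableau \<Rightarrow> tableau" where
  "tab_insert z [] = [[z]]"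
| "tab_insert z (r # T) = (case row_insert z r of (r', []) \<Rightarrow> r' # T
     | (r', y # _) \<Rightarrow> r' # tab_insert y T)"

lemma row_insert_knuth:
  assumes "sorted_wrt (<) r" "z \<notin> set r"
  shows "r @ [z] \<approx> snd (row_insert z r) @ fst (row_insert z r)"
  using assms
proof (cases rule: row_insert_cases)
  case (bump P y Q)
  have "\<forall>x\<in>set Q. z < x" using assms(1) bump(1,3) by (auto simp: sorted_wrt_append)
  then show ?thesis using assms bump knuth_row_bump[of P z y Q] by (auto simp: sorted_wrt_append)
qed auto

lemma row_insert_sorted:
  assumes "sorted_wrt (<) r" "z \<notin> set r"
  shows "sorted_wrt (<) (fst (row_insert z r))" "fst (row_insert z r) \<noteq> []"
  using assms by (cases rule: row_insert_cases; auto simp: sorted_wrt_append)+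

lemma row_insert_mset: "mset (fst (row_insert z r)) + mset (snd (row_insert z r)) = add_mset z (mset r)"
  by (induction r) auto

lemma row_insert_snd: "snd (row_insert z r) = [] \<or> (\<exists>y\<in>set r. z < y \<and> snd (row_insert z r) = [y])"
  by (induction r) auto

lemma block_insert_simps2:
  "snd (row_insert z r) = [] \<Longrightarrow> block_insert z (r # T) = (fst (row_insert z r) # T, [])"
  "snd (row_insert z r) = [y] \<Longrightarrow> block_insert z (r # T) =
     (fst (row_insert z r) # fst (block_insert y T), snd (block_insert y T))"
  "snd (row_insert z r) = [] \<Longrightarrow> tab_insert z (r # T) = fst (row_insert z r) # T"
  "snd (row_insert z r) = [y] \<Longrightarrow> tab_insert z (r # T) = fst (row_insert z r) # tab_insert y T"
  by (auto split: prod.splits list.splits)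

declare block_insert.simps(2) [simp del] tab_insert.simps(2) [simp del]

lemma block_insert_props:
  assumes "\<forall>r\<in>set T. sorted_wrt (<) r" "distinct (row_word T)" "z \<notin> set (row_word T)"
  shows "length (fst (block_insert z T)) = length T \<and>
    (\<forall>r\<in>set (fst (block_insert z T)). sorted_wrt (<) r) \<and>
    row_word T @ [z] \<approx> snd (block_insert z T) @ row_word (fst (block_insert z T)) \<and>
    (snd (block_insert z T) = [] \<or> T = [] \<or> (\<exists>y\<in>set (row_word T). z < y \<and> snd (block_insert z T) = [y])) \<and>
    (T \<noteq> [] \<longrightarrow> z \<in> set (hd (fst (block_insert z T))))"
  using assms
proof (induction T arbitrary: z)
  case (Cons r T)
  have r: "sorted_wrt (<) r" "z \<notin> set r" using Cons.prems by auto
  have zin: "z \<in> set (fst (row_insert z r))"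
    using r by (cases rule: row_insert_cases) auto
  consider "snd (row_insert z r) = []" | y where "y \<in> set r" "z < y" "snd (row_insert z r) = [y]"
    using row_insert_snd by blast
  then show ?case
  proof cases
    case 1
    have "r @ [z] \<approx> fst (row_insert z r)" using row_insert_knuth[OF r] 1 by simp
    then have "row_word T @ r @ [z] \<approx> row_word T @ fst (row_insert z r)" by (rule knuth_app_left)
    then show ?thesis using 1 Cons.prems row_insert_sorted[OF r] zin by (simp add: block_insert_simps2)
  next
    case (2 y)
    have IH: "length (fst (block_insert y T)) = length T"
      "\<forall>r\<in>set (fst (block_insert y T)). sorted_wrt (<) r"
      "row_word T @ [y] \<approx> snd (block_insert y T) @ row_word (fst (block_insert y T))"
      "snd (block_insert y T) = [] \<or> T = [] \<or> (\<exists>y'\<in>set (row_word T). y < y' \<and> snd (block_insert y T) = [y'])"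
      using Cons.IH[of y] Cons.prems 2 by auto
    have "row_word T @ r @ [z] \<approx> row_word T @ [y] @ fst (row_insert z r)"
      using row_insert_knuth[OF r] 2 by (intro knuth_app_left) simp
    also have "\<dots> = (row_word T @ [y]) @ fst (row_insert z r)" by simp
    also have "\<dots> \<approx> (snd (block_insert y T) @ row_word (fst (block_insert y T))) @ fst (row_insert z r)"
      using IH(3) by (rule knuth_app_right)
    finally have K: "row_word (r # T) @ [z] \<approx> snd (block_insert y T) @ row_word (fst (block_insert y T)) @ fst (row_insert z r)"
      by simp
    have D: "snd (block_insert y T) = [] \<or> (\<exists>y'\<in>set (row_word (r # T)). z < y' \<and> snd (block_insert y T) = [y'])"
    proof (cases "T = []")
      case True then show ?thesis using 2 by auto
    next
      case False
      then show ?thesis using IH(4) 2(1,2) by (auto intro: less_trans)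
    qed
    show ?thesis using K D IH(1,2) 2 row_insert_sorted[OF r] zin by (simp add: block_insert_simps2)
  qed
qed simp

lemma tab_insert_append:
  "tab_insert z (A @ B) = fst (block_insert z A) @ fold tab_insert (snd (block_insert z A)) B"
  by (induction A arbitrary: z)
    (auto simp: block_insert.simps(2) tab_insert.simps(2) split: prod.splits list.splits)

text \<open>The lower rows see only the overflow of the upper block, in the order in which it
  arises. In \<open>ct_catw\<close> this separates the first \<open>m\<close> rows from the
  rest.\<close>

lemma fold_tab_insert_append:
  "fold tab_insert u (A @ B) = fst (block_insert_word u A) @ fold tab_insert (snd (block_insert_word u A)) B"
proof (induction u arbitrary: A B)
  case (Cons z u)
  show ?case by (simp add: tab_insert_append Cons.IH)
qed simp

lemma block_insert_word_props:
  assumes "\<forall>r\<in>set T. sorted_wrt (<) r" "distinct (row_word T @ u)"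
  shows "length (fst (block_insert_word u T)) = length T \<and>
    (\<forall>r\<in>set (fst (block_insert_word u T)). sorted_wrt (<) r) \<and>
    row_word T @ u \<approx> snd (block_insert_word u T) @ row_word (fst (block_insert_word u T))"
  using assms
proof (induction u arbitrary: T)
  case (Cons z u)
  let ?T = "fst (block_insert z T)" and ?o = "snd (block_insert z T)"
  have P: "length ?T = length T" "\<forall>r\<in>set ?T. sorted_wrt (<) r" "row_word T @ [z] \<approx> ?o @ row_word ?T"
    using block_insert_props[of T z] Cons.prems by auto
  have "distinct (row_word T @ [z])" "mset (row_word T @ [z]) = mset (?o @ row_word ?T)"
    using Cons.prems knuth_mset[OF P(3)] by auto
  then have "distinct (?o @ row_word ?T)" "set (?o @ row_word ?T) = set (row_word T @ [z])"
    by (metis mset_eq_imp_distinct_iff, metis mset_eq_setD)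
  then have d: "distinct (row_word ?T @ u)" using Cons.prems by (auto simp: disjoint_iff)
  note IH = Cons.IH[OF P(2) d]
  have "row_word T @ z # u = (row_word T @ [z]) @ u" by simp
  also have "\<dots> \<approx> (?o @ row_word ?T) @ u" using P(3) by (rule knuth_app_right)
  also have "\<dots> = ?o @ (row_word ?T @ u)" by simp
  also have "\<dots> \<approx> ?o @ snd (block_insert_word u ?T) @ row_word (fst (block_insert_word u ?T))"
    using IH by (intro knuth_app_left) blast
  finally show ?case using IH P by simp
qed simp

text \<open>The bumped letter moves weakly to the left: an entry of \<open>s\<close> below the old
  place of \<open>y\<close> exceeds \<open>y\<close>, so \<open>y\<close> settles in a column not to
  the right of that place. Entries of \<open>r\<close> only become smaller, so the other columns
  stay strict.\<close>

lemma stacked2_insert: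
  assumes "sorted_wrt (<) r" "sorted_wrt (<) s" "stacked2 r s" "r = P @ y # Q" "z < y" "\<forall>x\<in>set P. x < z"
    "y \<notin> set s"
  shows "stacked2 (P @ z # Q) (fst (row_insert y s))"
  using assms(2,7)
proof (cases rule: row_insert_cases)
  case append
  have le: "length s \<le> length P"
  proof (rule ccontr)
    assume "\<not> length s \<le> length P"
    then have "r ! length P < s ! length P" using assms(3) by (auto simp: stacked2_def)
    moreover have "s ! length P \<in> set s" using \<open>\<not> length s \<le> length P\<close> by simp
    ultimately show False using append(2) assms(4) by fastforce
  qed
  show ?thesis unfolding append stacked2_def
  proof (intro conjI allI impI)
    fix i assume "i < length (fst (s @ [y], []))"
    then consider "i < length s" | "i = length s" by fastforce
    then show "(P @ z # Q) ! i < fst (s @ [y], []) ! i"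
    proof cases
      case 1
      then show ?thesis using assms(3,4) le by (auto simp: stacked2_def nth_append)
    next
      case 2
      then show ?thesis using le assms(5,6) by (cases "length s = length P") (auto simp: nth_append dest: less_trans)
    qed
  qed (use le in auto)
next
  case (bump P' y' Q')
  have le: "length P' \<le> length P"
  proof (rule ccontr)
    assume a: "\<not> length P' \<le> length P"
    then have "r ! length P < s ! length P" using assms(3) bump by (auto simp: stacked2_def)
    moreover have "s ! length P \<in> set P'" using a bump(1) by (simp add: nth_append)
    ultimately show False using bump(4) assms(4) by fastforce
  qed
  show ?thesis unfolding bump(2) stacked2_def
  proof (intro conjI allI impI)
    fix i assume i: "i < length (fst (P' @ y # Q', [y']))"
    then have s: "r ! i < s ! i" using assms(3) bump(1) by (auto simp: stacked2_def)
    have rz: "(P @ z # Q) ! i \<le> r ! i" using assms(4,5) by (cases "i = length P") (auto simp: nth_append nth_Cons')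
    show "(P @ z # Q) ! i < fst (P' @ y # Q', [y']) ! i"
    proof (cases "i = length P'")
      case True
      have "(P @ z # Q) ! i < y"
        using True le assms(5,6) by (cases "i = length P") (auto simp: nth_append dest: less_trans)
      then show ?thesis using True by simp
    next
      case False
      then have "fst (P' @ y # Q', [y']) ! i = s ! i" using bump(1) by (auto simp: nth_append nth_Cons')
      then show ?thesis using s rz by simp
    qed
  qed (use assms(3,4) bump(1) in \<open>auto simp: stacked2_def\<close>)
qed

lemma stacked2_row_append: "stacked2 r s \<Longrightarrow> stacked2 (r @ [z]) s"
  by (auto simp: stacked2_def nth_append)

lemma tab_insert_column_strict:
  assumes "column_strict T" "distinct (row_word T)" "z \<notin> set (row_word T)"
  shows "column_strict (tab_insert z T) \<and> row_word (tab_insert z T) \<approx> row_word T @ [z]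
    \<and> (\<exists>s S. tab_insert z T = s # S \<and> (T = [] \<longrightarrow> s = [z]) \<and> (T \<noteq> [] \<longrightarrow> s = fst (row_insert z (hd T))))"
  using assms
proof (induction T arbitrary: z)
  case Nil then show ?case by (simp add: column_strict_conv)
next
  case (Cons r T)
  have r: "sorted_wrt (<) r" "z \<notin> set r" "r \<noteq> []"
    using Cons.prems by (auto simp: column_strict_conv intro: sorted_wrt_less_distinct)
  have T: "column_strict T" using Cons.prems(1) by (cases T) (auto simp: column_strict_conv)
  have st: "T \<noteq> [] \<Longrightarrow> stacked2 r (hd T)" using Cons.prems(1) by (cases T) (auto simp: column_strict_conv)
  have kn: "r @ [z] \<approx> snd (row_insert z r) @ fst (row_insert z r)" by (rule row_insert_knuth) fact+
  show ?case using r(1,2)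
  proof (cases rule: row_insert_cases)
    case append
    then show ?thesis using Cons.prems T st row_insert_sorted[OF r(1,2)]
      by (cases T) (auto simp: column_strict_conv stacked2_row_append sorted_append less_imp_le block_insert_simps2)
  next
    case (bump P y Q)
    have y: "y \<notin> set (row_word T)" using Cons.prems bump(1) by auto
    obtain s S where sS: "tab_insert y T = s # S" "T = [] \<longrightarrow> s = [y]" "T \<noteq> [] \<longrightarrow> s = fst (row_insert y (hd T))"
      "column_strict (tab_insert y T)" "row_word (tab_insert y T) \<approx> row_word T @ [y]"
      using Cons.IH[OF T _ y] Cons.prems by auto
    have "stacked2 (P @ z # Q) s"
    proof (cases "T = []")
      case True then show ?thesis using sS(2) bump(3,4) by (cases P) (auto simp: stacked2_def)
    next
      case False
      have "hd T \<in> set T" using False by simp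
      then have "sorted_wrt (<) (hd T)" "y \<notin> set (hd T)"
        using T Cons.prems(2) y by (auto simp: column_strict_conv set_row_word intro: sorted_wrt_less_distinct distinct_row_word)
      then show ?thesis using stacked2_insert[OF r(1) _ st bump(1,3,4)] False sS(3) by simp
    qed
    moreover have "sorted_wrt (<) (P @ z # Q)" using row_insert_sorted[OF r(1,2)] bump by simp
    ultimately have cs: "column_strict ((P @ z # Q) # s # S)"
      using sS by (auto simp: column_strict_conv dest: strict_sorted_imp_sorted)
    have "row_word (tab_insert y T) @ P @ z # Q \<approx> (row_word T @ [y]) @ P @ z # Q"
      using sS(5) by (rule knuth_app_right)
    also have "\<dots> = row_word T @ (y # P @ z # Q)" by simp
    also have "\<dots> \<approx> row_word T @ (r @ [z])" using kn unfolding bump(2) by (intro knuth_app_left, intro knuth_sym[of "r @ [z]"]) simp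
    finally show ?thesis using cs bump sS(1) by (simp add: block_insert_simps2)
  qed
qed

lemma fold_tab_insert:
  assumes "column_strict T" "distinct (row_word T @ u)"
  shows "column_strict (fold tab_insert u T) \<and> row_word (fold tab_insert u T) \<approx> row_word T @ u"
  using assms
proof (induction u arbitrary: T)
  case (Cons z u)
  have T: "column_strict (tab_insert z T)" "row_word (tab_insert z T) \<approx> row_word T @ [z]"
    using tab_insert_column_strict[of T z] Cons.prems by auto
  have "row_word (tab_insert z T) @ u \<approx> row_word T @ z # u"
    using knuth_app_right[OF T(2), of u] by simp
  moreover from this have "distinct (row_word (tab_insert z T) @ u)"
    using Cons.prems(2) knuth_distinct by blast
  ultimately show ?case using Cons.IH[OF T(1)] knuth_trans by auto
qed simp

subsection \<open>Uniqueness of the tableau in a Knuth class\<close>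

text \<open>
  The letters of the first row after inserting a word, as a set, and the word of the letters bumped
  out of that row. Both are Knuth invariant (the second one up to Knuth equivalence), and applied to
  a tableau they return its first row and the word of the remaining rows.
\<close>

definition set_insert :: "nat set \<Rightarrow> nat \<Rightarrow> nat set \<times> nat list" where
  "set_insert R x = (if \<exists>r\<in>R. x < r then (insert x (R - {Min {r\<in>R. x < r}}), [Min {r\<in>R. x < r}])
     else (insert x R, []))"

fun set_insert_word :: "nat set \<Rightarrow> nat list \<Rightarrow> nat set \<times> nat list" where
  "set_insert_word R [] = (R, [])"
| "set_insert_word R (x # u) =
     (fst (set_insert_word (fst (set_insert R x)) u),
      snd (set_insert R x) @ snd (set_insert_word (fst (set_insert R x)) u))"

lemma set_insert_word_append:
  "set_insert_word R (u @ v) =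
     (fst (set_insert_word (fst (set_insert_word R u)) v),
      snd (set_insert_word R u) @ snd (set_insert_word (fst (set_insert_word R u)) v))"
  by (induction u arbitrary: R) auto

lemma set_insert_None: "\<forall>r\<in>R. \<not> x < r \<Longrightarrow> set_insert R x = (insert x R, [])"
  by (simp add: set_insert_def)

lemma set_insert_Some:
  assumes "finite R" "b \<in> R" "x < b" "\<forall>r\<in>R. x < r \<longrightarrow> b \<le> r"
  shows "set_insert R x = (insert x (R - {b}), [b])"
proof -
  have "Min {r\<in>R. x < r} = b" using assms by (intro Min_eqI) auto
  then show ?thesis using assms by (auto simp: set_insert_def)
qed

lemma set_insert_cases:
  assumes "finite R" "x \<notin> R"
  obtains "\<forall>r\<in>R. r < x" "set_insert R x = (insert x R, [])"
  | b where "b \<in> R" "x < b" "\<forall>r\<in>R. x < r \<longrightarrow> b \<le> r" "set_insert R x = (insert x (R - {b}), [b])"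
proof (cases "\<exists>r\<in>R. x < r")
  case True
  define b where "b = Min {r\<in>R. x < r}"
  have f: "finite {r\<in>R. x < r}" "{r\<in>R. x < r} \<noteq> {}" using assms True by auto
  have "b \<in> R" "x < b" "\<forall>r\<in>R. x < r \<longrightarrow> b \<le> r"
    using Min_in[OF f] Min_le[OF f(1)] unfolding b_def by auto
  then show thesis using that(2) set_insert_Some[of R b x] assms by blast
next
  case False
  then have "\<forall>r\<in>R. r < x" using assms by (metis linorder_neqE_nat)
  then show thesis using that(1) set_insert_None[of R x] False by auto
qed

lemma set_insert_word_finite: "finite R \<Longrightarrow> finite (fst (set_insert_word R u))"
  by (induction u arbitrary: R) (auto simp: set_insert_def)

lemma set_insert_word_set:
  "finite R \<Longrightarrow> fst (set_insert_word R u) \<subseteq> R \<union> set u \<and> set (snd (set_insert_word R u)) \<subseteq> R \<union> set u"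
proof (induction u arbitrary: R)
  case (Cons x u)
  have "fst (set_insert R x) \<subseteq> insert x R \<and> set (snd (set_insert R x)) \<subseteq> R"
  proof (cases "\<exists>r\<in>R. x < r")
    case True
    then have "Min {r\<in>R. x < r} \<in> {r\<in>R. x < r}" using Cons.prems by (intro Min_in) auto
    then show ?thesis using True by (auto simp: set_insert_def)
  qed (auto simp: set_insert_def)
  moreover have "finite (fst (set_insert R x))" using Cons.prems by (auto simp: set_insert_def)
  ultimately show ?case using Cons.IH[of "fst (set_insert R x)"] by auto
qed simp

text \<open>The local form of the Knuth invariance of insertion. In each case the final sets agree,
  and the bumped words are equal or differ by one Knuth relation among the bumped letters. Keeping
  the row as a set makes the final rows comparable without tracking positions.\<close>

lemma set_insert_triple:
  assumes R: "finite R" "x \<notin> R" "y \<notin> R" "z \<notin> R" and xyz: "x < y" "y < z"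
  shows "fst (set_insert_word R [y, x, z]) = fst (set_insert_word R [y, z, x]) \<and>
      snd (set_insert_word R [y, x, z]) \<approx> snd (set_insert_word R [y, z, x])" (is ?A)
    and "fst (set_insert_word R [x, z, y]) = fst (set_insert_word R [z, x, y]) \<and>
      snd (set_insert_word R [x, z, y]) \<approx> snd (set_insert_word R [z, x, y])" (is ?B)
proof -
  show ?A
  proof (cases rule: set_insert_cases[OF R(1,3)])
    case 1
    have x1: "set_insert (insert y R) x = (insert x (insert y R - {b}), [b])"
      if "b \<in> insert y R" "x < b" "\<forall>r\<in>insert y R. x < r \<longrightarrow> b \<le> r" for b
      using that R by (intro set_insert_Some) auto
    obtain b where b: "b \<in> insert y R" "x < b" "\<forall>r\<in>insert y R. x < r \<longrightarrow> b \<le> r"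
      using set_insert_cases[of "insert y R" x] R xyz by (metis finite_insert insertCI insertE less_irrefl_nat not_less_iff_gr_or_eq)
    have "b \<le> y" using b xyz by auto
    have z1: "set_insert (insert y R) z = (insert z (insert y R), [])"
      "set_insert (insert x (insert y R - {b})) z = (insert z (insert x (insert y R - {b})), [])"
      using 1 xyz by (fastforce intro!: set_insert_None)+
    have x2: "set_insert (insert z (insert y R)) x = (insert x (insert z (insert y R) - {b}), [b])"
      using b xyz R by (intro set_insert_Some) auto
    show ?thesis using 1 x1[OF b] z1 x2 \<open>b \<le> y\<close> xyz by auto
  next
    case (2 c)
    let ?R = "insert y (R - {c})"
    obtain b where b: "b \<in> ?R" "x < b" "\<forall>r\<in>?R. x < r \<longrightarrow> b \<le> r"
      using set_insert_cases[of ?R x] R xyz by (metis DiffD1 finite_Diff finite_insert insertCI insertE less_irrefl_nat not_less_iff_gr_or_eq)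
    have by': "b \<le> y" using b xyz by auto
    have x1: "set_insert ?R x = (insert x (?R - {b}), [b])" using b R by (intro set_insert_Some) auto
    have fR: "finite ?R" "z \<notin> ?R" using R xyz by auto
    show ?thesis
    proof (cases rule: set_insert_cases[OF fR])
      case 3: 1
      have "\<not> z < r" if "r \<in> ?R" for r using that 3(1) less_asym by blast
      then have "set_insert (insert x (?R - {b})) z = (insert z (insert x (?R - {b})), [])"
        using xyz by (intro set_insert_None) auto
      moreover have "set_insert (insert z ?R) x = (insert x (insert z ?R - {b}), [b])"
        using b xyz R by (intro set_insert_Some) auto
      ultimately show ?thesis using 2 3 x1 by' xyz by auto
    next
      case 3: (2 d)
      have d: "d \<in> R" "d \<noteq> c" "b \<noteq> d" "z < d" using 3 xyz by' by auto
      then have cd: "c < d" using 2 xyz by (metis le_neq_implies_less less_trans)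
      have "set_insert (insert x (?R - {b})) z = (insert z (insert x (?R - {b}) - {d}), [d])"
        using 3 xyz R d by (intro set_insert_Some) auto
      moreover have "set_insert (insert z (?R - {d})) x = (insert x (insert z (?R - {d}) - {b}), [b])"
        using b xyz R d by' by (intro set_insert_Some) auto
      moreover have "[c, b, d] \<approx> [c, d, b]" using knuth_yxz[of b c d "[]"] by' 2 cd by auto
      moreover have "insert z (insert x (?R - {b}) - {d}) = insert x (insert z (?R - {d}) - {b})"
        using by' xyz d by auto
      ultimately show ?thesis using 2(4) 3(4) x1 by simp
    qed
  qed
next
  show ?B
  proof (cases rule: set_insert_cases[OF R(1,2)])
    case 1
    have "set_insert (insert x R) z = (insert z (insert x R), [])" "set_insert R z = (insert z R, [])"
      using 1 xyz by (fastforce intro!: set_insert_None)+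
    moreover have "set_insert (insert z R) x = (insert x (insert z R - {z}), [z])"
      "set_insert (insert z (insert x R)) y = (insert y (insert z (insert x R) - {z}), [z])"
      by (rule set_insert_Some; use 1 xyz R in auto)+
    moreover have "set_insert (insert x (insert z R - {z})) y = (insert y (insert x R), [])"
      using 1 xyz R by (subst set_insert_None) auto
    ultimately show ?thesis using 1 xyz R by auto
  next
    case (2 b)
    show ?thesis
    proof (cases "b < z")
      case True
      let ?S = "insert x (R - {b})"
      show ?thesis
      proof (cases rule: set_insert_cases[OF R(1,4)])
        case 3: 1
        have "set_insert ?S z = (insert z ?S, [])" using 3 xyz by (intro set_insert_None) fastforce
        moreover have "set_insert (insert z R) x = (insert x (insert z R - {b}), [b])"
          using 2 True xyz R by (intro set_insert_Some) auto
        moreover have "insert x (insert z R - {b}) = insert z ?S" using True by auto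
        ultimately show ?thesis using 2 3 by simp
      next
        case 3: (2 d)
        have d: "d \<noteq> b" using 3 True by auto
        have 4: "set_insert ?S z = (insert z (?S - {d}), [d])" using 3 xyz R d by (intro set_insert_Some) auto
        have 5: "set_insert (insert z (R - {d})) x = (insert x (insert z (R - {d}) - {b}), [b])"
          using 2 True xyz R d by (intro set_insert_Some) auto
        have 6: "insert x (insert z (R - {d}) - {b}) = insert z (?S - {d})" using True 3(2) xyz by auto
        let ?U = "insert z (?S - {d})"
        have "y \<notin> ?U" using R xyz by auto
        obtain c where c: "c \<in> ?U" "y < c" "\<forall>r\<in>?U. y < r \<longrightarrow> c \<le> r" "set_insert ?U y = (insert y (?U - {c}), [c])"
          using set_insert_cases[of ?U y] R xyz \<open>y \<notin> ?U\<close>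
          by (metis (no_types, lifting) finite_Diff finite_insert insertI1 not_less_iff_gr_or_eq)
        have "c \<le> z" using c xyz by auto
        have "b < c" using c 2 xyz True by (auto simp: order.strict_iff_order)
        have "c < d" using \<open>c \<le> z\<close> 3 by simp
        have "[b, d, c] \<approx> [d, b, c]" using knuth_xzy[OF \<open>b < c\<close> \<open>c < d\<close>] .
        then show ?thesis using 2 3 4 5 6 c by simp
      qed
    next
      case False
      then have zb: "z < b" using 2 R by (metis linorder_neqE_nat)
      have gap: "\<forall>r\<in>R. r < x \<or> b \<le> r" using 2 R by (metis linorder_neqE_nat)
      let ?S = "R - {b}"
      have 3: "set_insert R z = (insert z ?S, [b])" using 2 zb xyz R gap by (intro set_insert_Some) auto
      have 4: "set_insert (insert z ?S) x = (insert x (insert z ?S - {z}), [z])"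
        using gap zb xyz R 2 by (intro set_insert_Some) auto
      have 5: "insert x (insert z ?S - {z}) = insert x ?S" using R by auto
      show ?thesis
      proof (cases "\<exists>r\<in>?S. b < r")
        case False
        then have f: "\<forall>r\<in>?S. r < x" using gap by (metis DiffE insertI1 le_neq_implies_less)
        have g: "\<not> z < r" "\<not> y < r" if "r \<in> ?S" for r
          using bspec[OF f that] xyz by (auto dest: less_trans)
        have "set_insert (insert x ?S) z = (insert z (insert x ?S), [])"
          by (rule set_insert_None) (use g xyz in auto)
        moreover have "set_insert (insert z (insert x ?S)) y = (insert y (insert z (insert x ?S) - {z}), [z])"
          by (rule set_insert_Some) (use g xyz R in auto)
        moreover have "set_insert (insert x ?S) y = (insert y (insert x ?S), [])"
          by (rule set_insert_None) (use g xyz in auto)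
        ultimately show ?thesis using 2 3 4 5 R xyz by auto
      next
        case True
        define d where "d = Min {r\<in>?S. b < r}"
        have "d \<in> {r\<in>?S. b < r}" unfolding d_def using True R by (intro Min_in) auto
        moreover have "\<forall>r\<in>?S. b < r \<longrightarrow> d \<le> r" unfolding d_def using R by auto
        ultimately have d: "d \<in> R" "b < d" "\<forall>r\<in>?S. r < x \<or> d \<le> r"
          using gap by (auto simp: order.order_iff_strict)
        have g: "d \<le> r" if "r \<in> ?S" "x < r" for r using bspec[OF d(3) that(1)] that(2) by auto
        have g': "d \<le> r" if "r \<in> ?S" "y < r" for r using g[of r] that xyz by auto
        have g'': "d \<le> r" if "r \<in> ?S" "z < r" for r using g[of r] that xyz by auto
        have zd: "z < d" using zb d by simp
        have "set_insert (insert x ?S) z = (insert z (insert x ?S - {d}), [d])"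
          by (rule set_insert_Some) (use g'' zd d xyz R in auto)
        moreover have "set_insert (insert z (insert x ?S - {d})) y = (insert y (insert z (insert x ?S - {d}) - {z}), [z])"
          by (rule set_insert_Some) (use g' zd d xyz R in \<open>auto dest: le_trans[OF less_imp_le[OF zd]]\<close>)
        moreover have "set_insert (insert x ?S) y = (insert y (insert x ?S - {d}), [d])"
          by (rule set_insert_Some) (use g' zd d xyz R in auto)
        moreover have "[b, d, z] \<approx> [b, z, d]" using knuth_yxz[of z b d "[]"] zb d knuth_sym by blast
        moreover have "insert z (insert x ?S - {d}) - {z} = insert x ?S - {d}" using R xyz by auto
        ultimately show ?thesis using 2 3 4 5 by simp
      qed
    qed
  qed
qed

lemma set_insert_word_knuth:
  assumes "u \<approx> v" "distinct u"
  shows "fst (set_insert_word {} u) = fst (set_insert_word {} v)"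
    "snd (set_insert_word {} u) \<approx> snd (set_insert_word {} v)"
proof -
  have ctx: "fst (set_insert_word {} (p @ a @ q)) = fst (set_insert_word {} (p @ b @ q)) \<and>
      snd (set_insert_word {} (p @ a @ q)) \<approx> snd (set_insert_word {} (p @ b @ q))"
    if "\<And>R. finite R \<Longrightarrow> R \<inter> set a = {} \<Longrightarrow> fst (set_insert_word R a) = fst (set_insert_word R b) \<and>
        snd (set_insert_word R a) \<approx> snd (set_insert_word R b)" "distinct (p @ a)" for p a b q
  proof -
    let ?R = "fst (set_insert_word {} p)"
    have "finite ?R" "?R \<inter> set a = {}"
      using that(2) set_insert_word_finite[of "{}" p] set_insert_word_set[of "{}" p] by auto
    then show ?thesis using that(1)[of ?R] by (auto simp: set_insert_word_append intro: knuth_app_left knuth_app_right)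
  qed
  have st: "fst (set_insert_word {} a) = fst (set_insert_word {} b) \<and>
      snd (set_insert_word {} a) \<approx> snd (set_insert_word {} b)" if "knuth_step a b" "distinct a" for a b
    using that
  proof cases
    case (1 x y z p q)
    then have "x < y" "y < z" using that(2) by auto
    then show ?thesis unfolding 1 using that(2) 1 set_insert_triple(1)[of _ x y z]
      by (intro ctx) (auto simp del: set_insert_word.simps)
  next
    case (2 x y z p q)
    then have "x < y" "y < z" using that(2) by (auto simp: le_less)
    then show ?thesis unfolding 2 using that(2) 2 set_insert_triple(2)[of _ x y z]
      by (intro ctx) (auto simp del: set_insert_word.simps)
  qed
  have "fst (set_insert_word {} u) = fst (set_insert_word {} v) \<and>
    snd (set_insert_word {} u) \<approx> snd (set_insert_word {} v)"
    using assms
  proof (induction rule: equivclp_induct)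
    case (step y z)
    have "distinct y" "distinct z"
      using step knuth_distinct by (metis equivclp_into_equivclp)+
    then have "fst (set_insert_word {} y) = fst (set_insert_word {} z) \<and>
      snd (set_insert_word {} y) \<approx> snd (set_insert_word {} z)"
      using step.hyps(2) st[of y z] st[of z y] knuth_sym by metis
    then show ?case using step knuth_trans by metis
  qed simp
  then show "fst (set_insert_word {} u) = fst (set_insert_word {} v)"
    "snd (set_insert_word {} u) \<approx> snd (set_insert_word {} v)" by auto
qed

lemma set_insert_word_greater:
  "\<forall>x\<in>R. \<forall>y\<in>set r. x < y \<Longrightarrow> sorted_wrt (<) r \<Longrightarrow> set_insert_word R r = (R \<union> set r, [])"
proof (induction r arbitrary: R)
  case (Cons a r)
  have "set_insert R a = (insert a R, [])" using Cons.prems by (intro set_insert_None) auto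
  then show ?case using Cons.IH[of "insert a R"] Cons.prems by auto
qed simp

text \<open>The letters of \<open>P\<close> are too small to be bumped, so the first letter of
  \<open>r\<close> bumps the first letter of \<open>s\<close>; after that it belongs to
  \<open>P\<close>. Once \<open>s\<close> is used up, the remaining letters of \<open>r\<close> are
  appended.\<close>

lemma set_insert_row:
  assumes "stacked2 r s" "sorted_wrt (<) (P @ r)" "sorted_wrt (<) s" "\<forall>x\<in>set P. \<forall>y\<in>set s. x < y"
  shows "set_insert_word (set P \<union> set s) r = (set (P @ r), s)"
  using assms
proof (induction r arbitrary: P s)
  case Nil
  then show ?case by simp
next
  case (Cons a r)
  show ?case
  proof (cases s)
    case Nil
    have "set_insert_word (set P) (a # r) = (set P \<union> set (a # r), [])"
      using Cons.prems by (intro set_insert_word_greater) (auto simp: sorted_wrt_append)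
    then show ?thesis using Nil by (simp del: set_insert_word.simps)
  next
    case (Cons b s')
    have ab: "a < b" "stacked2 r s'" using Cons.prems(1) Cons by (auto simp: stacked2_Cons)
    have "a \<notin> set s'" using Cons.prems Cons ab by auto
    have 1: "set_insert (set P \<union> set s) a = (insert a (set P \<union> set s - {b}), [b])"
      using Cons.prems Cons ab by (intro set_insert_Some) (auto simp: sorted_wrt_append)
    have 2: "insert a (set P \<union> set s - {b}) = set (P @ [a]) \<union> set s'"
      using Cons.prems Cons by (auto simp: sorted_wrt_append)
    have "set_insert_word (set (P @ [a]) \<union> set s') r = (set ((P @ [a]) @ r), s')"
      using Cons.prems Cons ab by (intro Cons.IH) auto
    then show ?thesis using 1 2 Cons by simp
  qed
qed

lemma set_insert_word_tableau:
  assumes "column_strict T" "distinct (row_word T)"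
  shows "set_insert_word {} (row_word T) = (if T = [] then ({}, []) else (set (hd T), row_word (tl T)))"
  using assms
proof (induction T)
  case (Cons r T)
  have T: "column_strict T" using Cons.prems(1) by (cases T) (auto simp: column_strict_conv)
  have r: "sorted_wrt (<) r"
    using Cons.prems by (auto simp: column_strict_conv intro: sorted_wrt_less_distinct)
  show ?case
  proof (cases T)
    case Nil then show ?thesis using r set_insert_word_greater[of "{}" r] by simp
  next
    case (Cons s T')
    have s: "sorted_wrt (<) s" "stacked2 r s"
      using Cons.prems Cons by (auto simp: column_strict_conv intro: sorted_wrt_less_distinct)
    have "set_insert_word (set s) r = (set r, s)"
      using set_insert_row[of r s "[]"] r s by simp
    moreover have "set_insert_word {} (row_word T) = (set s, row_word T')"
      using Cons.IH[OF T] Cons.prems(2) unfolding Cons by (simp add: Int_Un_distrib)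
    ultimately have "set_insert_word {} (row_word T @ r) = (set r, row_word T' @ s)"
      by (simp add: set_insert_word_append)
    then show ?thesis using Cons by simp
  qed
qed simp

text \<open>The two invariants computed by \<open>set_insert_word\<close> are the first row and the
  class of the word of the remaining rows, so a tableau is recovered from its class row by
  row.\<close>

lemma tableau_unique:
  assumes "column_strict T" "column_strict T'" "row_word T \<approx> row_word T'" "distinct (row_word T)"
  shows "T = T'"
  using assms
proof (induction T arbitrary: T')
  case Nil
  then have "row_word T' = []" using knuth_length by fastforce
  then show ?case using Nil.prems(2) by (cases T') (auto simp: column_strict_conv)
next
  case (Cons r T)
  have d': "distinct (row_word T')" using Cons.prems knuth_distinct by blast
  have "r \<noteq> []" using Cons.prems(1) by (simp add: column_strict_conv)
  then have "T' \<noteq> []" using Cons.prems(3) knuth_length by fastforce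
  then obtain r' T1 where T': "T' = r' # T1" by (cases T') auto
  have rows: "set r = set r'" "row_word T \<approx> row_word T1"
    using set_insert_word_knuth[OF Cons.prems(3,4)] set_insert_word_tableau[OF Cons.prems(1,4)]
      set_insert_word_tableau[OF Cons.prems(2) d'] T' by auto
  have "sorted r" "sorted r'" "distinct r" "distinct r'"
    using Cons.prems T' d' by (auto simp: column_strict_conv)
  then have "r = r'" using rows(1) by (simp add: sorted_distinct_set_unique)
  moreover have "column_strict T" "column_strict T1"
    using Cons.prems(1,2) T' by (cases T; cases T1; auto simp: column_strict_conv)+
  ultimately show ?case using Cons.IH[of T1] rows(2) Cons.prems(4) T' by simp
qed

lemma P_tableau_props:
  assumes "distinct u"
  shows "column_strict (P_tableau u)" "row_word (P_tableau u) \<approx> u"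
proof -
  define T where "T = fold tab_insert u []"
  have T: "column_strict T \<and> row_word T \<approx> u"
    using fold_tab_insert[of "[]" u] assms unfolding T_def by (simp add: column_strict_conv)
  have "P_tableau u = T" unfolding P_tableau_def
  proof (rule the_equality)
    fix T' assume "column_strict T' \<and> row_word T' \<approx> u"
    then have "column_strict T'" "row_word T' \<approx> u" by auto
    moreover have "row_word T' \<approx> row_word T" using \<open>row_word T' \<approx> u\<close> T knuth_sym knuth_trans by blast
    moreover have "distinct (row_word T')" using \<open>row_word T' \<approx> u\<close> assms knuth_distinct by blast
    ultimately show "T' = T" using T tableau_unique by blast
  qed (use T in blast)
  with T show "column_strict (P_tableau u)" "row_word (P_tableau u) \<approx> u" by auto
qed

lemma P_tableau_eq:
  assumes "column_strict T" "row_word T \<approx> u" "distinct u"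
  shows "P_tableau u = T"
proof -
  have "row_word T \<approx> row_word (P_tableau u)"
    using P_tableau_props(2)[OF assms(3)] assms(2) knuth_sym knuth_trans by blast
  moreover have "distinct (row_word T)" using assms knuth_distinct by blast
  ultimately show ?thesis using tableau_unique P_tableau_props(1)[OF assms(3)] assms(1) by metis
qed

lemma P_tableau_knuth:
  assumes "u \<approx> v" shows "P_tableau u = P_tableau v"
proof -
  have "row_word T \<approx> u \<longleftrightarrow> row_word T \<approx> v" for T using assms knuth_sym knuth_trans by blast
  then show ?thesis unfolding P_tableau_def by simp
qed

declare upt_Suc [simp del]

section \<open>Greedy catabolism\<close>

subsection \<open>Words on an interval and their initial decreasing run\<close>

definition word_on :: "nat \<Rightarrow> nat list \<Rightarrow> bool" where
  "word_on a u \<longleftrightarrow> distinct u \<and> set u = {a<..a + length u}"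

text \<open>In the reading word of a tableau on these letters this means that
  \<open>a + 1, ..., a + M\<close> are the first \<open>M\<close> cells of the first column, see
  \<open>tableau_xrows\<close>.\<close>

definition decr :: "nat \<Rightarrow> nat \<Rightarrow> nat list \<Rightarrow> bool" where
  "decr a M u \<longleftrightarrow> filter (\<lambda>x. x \<le> a + M) u = rev [Suc a..<Suc (a + M)]"

definition run :: "nat \<Rightarrow> nat list \<Rightarrow> nat" where
  "run a u = Max {M. M \<le> length u \<and> decr a M u}"

lemma word_on_mset: "mset u = mset v \<Longrightarrow> word_on a u \<longleftrightarrow> word_on a v"
  unfolding word_on_def by (metis mset_eq_imp_distinct_iff mset_eq_length mset_eq_setD)

lemma word_on_knuth: "u \<approx> v \<Longrightarrow> word_on a u \<longleftrightarrow> word_on a v"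
  by (rule word_on_mset) (rule knuth_mset)

lemma sorted_rev_upt: "sorted_wrt (>) (rev [i..<j])"
  by (simp add: sorted_wrt_rev)

lemma decr_alt:
  assumes "word_on a u" "M \<le> length u"
  shows "decr a M u \<longleftrightarrow> sorted_wrt (>) (filter (\<lambda>x. x \<le> a + M) u)"
proof
  assume "sorted_wrt (>) (filter (\<lambda>x. x \<le> a + M) u)"
  then have "sorted_wrt (<) (rev (filter (\<lambda>x. x \<le> a + M) u))" by (simp add: sorted_wrt_rev)
  moreover have "set (rev (filter (\<lambda>x. x \<le> a + M) u)) = set [Suc a..<Suc (a + M)]"
    using assms by (auto simp: word_on_def)
  ultimately have "rev (filter (\<lambda>x. x \<le> a + M) u) = [Suc a..<Suc (a + M)]"
    by (intro strict_sorted_equal) simp_all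
  then show "decr a M u" unfolding decr_def by (metis rev_rev_ident)
qed (auto simp: decr_def sorted_rev_upt)

lemma decr_le_length:
  assumes "word_on a u" "decr a M u" shows "M \<le> length u"
proof -
  have "length (rev [Suc a..<Suc (a + M)]) \<le> length u"
    using assms(2) unfolding decr_def by (metis length_filter_le)
  then show ?thesis by simp
qed

lemma decr_mono:
  assumes "word_on a u" "decr a M u" "M' \<le> M" shows "decr a M' u"
proof -
  have "sorted_wrt (>) (filter (\<lambda>x. x \<le> a + M') (filter (\<lambda>x. x \<le> a + M) u))"
    using assms(2) sorted_rev_upt unfolding decr_def by (metis sorted_wrt_filter)
  moreover have "filter (\<lambda>x. x \<le> a + M') (filter (\<lambda>x. x \<le> a + M) u) = filter (\<lambda>x. x \<le> a + M') u"
    using assms(3) by (auto intro!: filter_cong)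
  ultimately show ?thesis using decr_alt[OF assms(1)] decr_le_length[OF assms(1,2)] assms(3) by simp
qed

lemma decr_knuth:
  assumes "u \<approx> v" shows "decr a M u \<longleftrightarrow> decr a M v"
proof -
  have *: "decr a M v" if "decr a M u" "u \<approx> v" for u v
  proof -
    have "filter (\<lambda>x. x \<le> a + M) u \<approx> filter (\<lambda>x. x \<le> a + M) v" using that(2) by (rule knuth_filter) auto
    then show ?thesis using that(1) knuth_decreasing sorted_rev_upt unfolding decr_def by metis
  qed
  show ?thesis using *[OF _ assms] *[OF _ knuth_sym[OF assms]] by blast
qed

lemma decr_0: "word_on a u \<Longrightarrow> decr a 0 u"
  by (auto simp: decr_def word_on_def filter_empty_conv)

lemma run_props:
  assumes "word_on a u"
  shows "run a u \<le> length u" "decr a (run a u) u" "\<And>M. decr a M u \<Longrightarrow> M \<le> run a u"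
proof -
  let ?S = "{M. M \<le> length u \<and> decr a M u}"
  have f: "finite ?S" "?S \<noteq> {}" using decr_0[OF assms] by (auto intro: exI[of _ 0])
  show "run a u \<le> length u" "decr a (run a u) u" using Max_in[OF f] unfolding run_def by auto
  fix M assume "decr a M u"
  then have "M \<in> ?S" using decr_le_length[OF assms] by simp
  then show "M \<le> run a u" unfolding run_def using Max_ge[OF f(1)] by blast
qed

lemma run_eqI:
  assumes "word_on a u" "decr a M u" "M = length u \<or> \<not> decr a (Suc M) u"
  shows "run a u = M"
proof (rule antisym)
  show "M \<le> run a u" using run_props(3) assms by blast
  show "run a u \<le> M"
  proof (rule ccontr)
    assume "\<not> run a u \<le> M"
    then have "decr a (Suc M) u" using decr_mono[OF assms(1) run_props(2)[OF assms(1)]] by simp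
    then show False using assms \<open>\<not> run a u \<le> M\<close> run_props(1)[OF assms(1)] by auto
  qed
qed

lemma run_pos:
  assumes "word_on a u" "u \<noteq> []" shows "0 < run a u"
proof -
  have "Suc a \<in> set u" using assms by (cases u) (auto simp: word_on_def)
  then obtain p q where u: "u = p @ Suc a # q" by (meson split_list)
  have "\<forall>x\<in>set u. a < x" using assms(1) by (simp add: word_on_def)
  moreover have "Suc a \<notin> set p \<union> set q" using assms(1) by (simp add: word_on_def u)
  ultimately have n: "\<not> x \<le> Suc a" if "x \<in> set p \<union> set q" for x
    using that unfolding u by (metis Suc_leI UnE Un_iff insert_iff le_antisym list.simps(15) set_append)
  then have "filter (\<lambda>x. x \<le> Suc a) p = []" "filter (\<lambda>x. x \<le> Suc a) q = []"
    by (simp_all add: filter_empty_conv)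
  then have "decr a 1 u" unfolding decr_def u by (simp add: upt_rec)
  then show ?thesis using run_props(3)[OF assms(1)] by fastforce
qed

lemma run_knuth: "u \<approx> v \<Longrightarrow> run a u = run a v"
  unfolding run_def using decr_knuth[of u v a] knuth_length[of u v] by simp

lemma filter_eq_snoc:
  assumes "filter P p @ filter P q = r @ [x]" "x \<in> set p" "distinct (p @ q)"
  shows "filter P q = []"
proof (rule ccontr)
  assume n: "filter P q \<noteq> []"
  then have "last (filter P p @ filter P q) = last (filter P q)" by simp
  then have "x \<in> set (filter P q)" using assms(1) n by (metis last_in_set last_snoc)
  then show False using assms(2,3) by auto
qed

subsection \<open>Tableaux containing a column of smallest letters\<close>

text \<open>Attaches a column of smallest letters at the left; \<open>A\<close> is what is left of
  these rows when the column is removed. Catabolisms are computed on fillings of the form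
  \<open>xrows a A @ B\<close>.\<close>

fun xrows :: "nat \<Rightarrow> nat list list \<Rightarrow> nat list list" where
  "xrows a [] = []"
| "xrows a (r # A) = (Suc a # r) # xrows (Suc a) A"

lemma length_xrows [simp]: "length (xrows a A) = length A"
  by (induction A arbitrary: a) auto

lemma xrows_append: "xrows a (A @ B) = xrows a A @ xrows (a + length A) B"
  by (induction A arbitrary: a) auto

lemma upt_Suc_Cons: "[Suc a..<Suc (a + Suc n)] = Suc a # [Suc (Suc a)..<Suc (Suc a + n)]"
  by (simp add: upt_rec[of "Suc a"])

lemma mset_xrows: "mset (row_word (xrows a A)) = mset [Suc a..<Suc (a + length A)] + mset (row_word A)"
proof (induction A arbitrary: a)
  case (Cons r A)
  show ?case using Cons[of "Suc a"] unfolding list.size(4) add_Suc_right add_0_right Suc_eq_plus1[symmetric]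
    by (simp add: upt_Suc_Cons[simplified] del: mset_upt)
qed simp

lemma set_xrows: "set (row_word (xrows a A)) = {a<..a + length A} \<union> set (row_word A)"
proof -
  have "set (row_word (xrows a A)) = set_mset (mset [Suc a..<Suc (a + length A)] + mset (row_word A))"
    by (metis mset_xrows set_mset_mset)
  also have "\<dots> = set [Suc a..<Suc (a + length A)] \<union> set (row_word A)" by simp
  also have "set [Suc a..<Suc (a + length A)] = {a<..a + length A}" by (auto)
  finally show ?thesis .
qed

lemma filter_xrows:
  assumes "\<forall>x\<in>set (row_word A). c < x" "a + length A \<le> c"
  shows "filter (\<lambda>x. x \<le> c) (row_word (xrows a A)) = rev [Suc a..<Suc (a + length A)]"
  using assms
proof (induction A arbitrary: a)
  case (Cons r A)
  then have "filter (\<lambda>x. x \<le> c) r = []" by (auto simp: filter_empty_conv not_le)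
  then show ?case using Cons.IH[of "Suc a"] Cons.prems upt_Suc_Cons[of a "length A"] by simp
qed simp

lemma stacked_xrows: "stacked (xrows a A) \<longleftrightarrow> stacked A"
proof (induction A arbitrary: a rule: stacked.induct)
  case (1 r s T)
  then show ?case using xrows.simps(2)[of "Suc a" s T] by (simp add: stacked2_Cons del: xrows.simps(2)) (simp add: stacked2_Cons)
qed auto

lemma last_xrows: "last (xrows a (A @ [r])) = (a + Suc (length A)) # r"
  by (simp add: xrows_append)

lemma xrows_sorted:
  assumes "\<forall>r\<in>set A. sorted_wrt (<) r" "\<forall>x\<in>set (row_word A). a + length A < x"
  shows "\<forall>r\<in>set (xrows a A). sorted_wrt (<) r \<and> r \<noteq> []"
  using assms
proof (induction A arbitrary: a)
  case (Cons r A)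
  have "\<forall>x\<in>set (row_word A). Suc a + length A < x" "\<forall>x\<in>set r. Suc a < x" using Cons.prems(2) by (fastforce dest: bspec)+
  then show ?case using Cons.IH[of "Suc a"] Cons.prems(1) by simp
qed simp

lemma xform_word:
  assumes "word_on a u" "u \<approx> row_word (xrows a A @ B)"
  shows "word_on (a + length A) (row_word A @ row_word B)" "length u = length A + length (row_word A @ row_word B)"
proof -
  have m: "mset u = mset [Suc a..<Suc (a + length A)] + mset (row_word A @ row_word B)"
    using knuth_mset[OF assms(2)] mset_xrows[of a A] by simp
  then show l: "length u = length A + length (row_word A @ row_word B)"
    by (metis diff_Suc_Suc diff_add_inverse length_upt mset_append size_mset size_union)
  have "mset ([Suc a..<Suc (a + length A)] @ row_word A @ row_word B) = mset u" using m by simp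
  then have w: "word_on a ([Suc a..<Suc (a + length A)] @ row_word A @ row_word B)" (is "word_on a (?c @ ?w)")
    using assms(1) word_on_mset by blast
  then have d: "distinct ?w" "set ?c \<inter> set ?w = {}" "set ?c \<union> set ?w = {a<..a + length (?c @ ?w)}"
    unfolding word_on_def by (auto)
  have "set ?w = {a<..a + length (?c @ ?w)} - set ?c" using d(2,3) by blast
  also have "\<dots> = {a + length A<..a + length A + length ?w}" by auto
  finally show "word_on (a + length A) ?w" using d(1) by (simp add: word_on_def)
qed

lemma stacked_hd:
  assumes "stacked (r # T)" "s \<in> set T" "s \<noteq> []"
  shows "r \<noteq> [] \<and> hd r < hd s"
  using assms
proof (induction T arbitrary: r)
  case (Cons t T)
  have st: "stacked2 r t" "stacked (t # T)" using Cons.prems by auto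
  have "t \<noteq> [] \<Longrightarrow> r \<noteq> [] \<and> hd r < hd t" using st(1) by (cases r; cases t) (auto simp: stacked2_Cons)
  then show ?case using Cons.IH[OF st(2)] Cons.prems by fastforce
qed simp

lemma stacked_Cons: "stacked (r # T) \<Longrightarrow> stacked T"
  by (cases T) auto

lemma stacked_hd_nth:
  assumes "stacked T" "i < j" "j < length T" "T ! j \<noteq> []"
  shows "T ! i \<noteq> [] \<and> hd (T ! i) < hd (T ! j)"
  using assms
proof (induction T arbitrary: i j)
  case (Cons r T)
  show ?case
  proof (cases i)
    case 0
    then show ?thesis using Cons.prems stacked_hd[of r T "T ! (j - 1)"] by (cases j) auto
  next
    case (Suc i')
    then show ?thesis using Cons.prems Cons.IH[of i' "j - 1"] stacked_Cons by (cases j) auto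
  qed
qed simp

text \<open>The smallest letter \<open>a + 1\<close> heads the first row. In the decreasing word it
  comes last, so the rest of the run lies in the lower rows, to which the induction applies.\<close>

lemma tableau_xrows:
  assumes "stacked T" "\<forall>r\<in>set T. sorted_wrt (<) r" "\<forall>x\<in>set (row_word T). a < x" "distinct (row_word T)"
    "filter (\<lambda>x. x \<le> a + M) (row_word T) = rev [Suc a..<Suc (a + M)]"
  obtains A B where "T = xrows a A @ B" "length A = M" "\<forall>x\<in>set (row_word A) \<union> set (row_word B). a + M < x"
  using assms
proof (induction M arbitrary: a T thesis)
  case 0
  then have "\<forall>x\<in>set (row_word T). a < x" by simp
  then show ?case using 0(1)[of "[]" T] by simp
next
  case (Suc M)
  have "Suc a \<in> set (filter (\<lambda>x. x \<le> a + Suc M) (row_word T))" unfolding Suc.prems(6) by simp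
  then have ina: "Suc a \<in> set (row_word T)" by simp
  then obtain r T' where T: "T = r # T'" by (cases T) auto
  have "\<exists>r'. r = Suc a # r'"
  proof (cases "Suc a \<in> set r")
    case True
    then obtain b r' where "r = b # r'" by (cases r) auto
    moreover have "b \<le> Suc a" "a < b" using True Suc.prems(3,4) T calculation by auto
    ultimately show ?thesis by auto
  next
    case False
    then obtain s where s: "s \<in> set T'" "Suc a \<in> set s" using ina T by (auto simp: set_row_word)
    have ss: "sorted_wrt (<) s" using Suc.prems(3) s(1) T by simp
    obtain b s' where "s = b # s'" using s(2) by (cases s) auto
    then have "s \<noteq> []" "hd s \<le> Suc a" using s(2) ss by auto
    then have "r \<noteq> []" "hd r \<le> a" using stacked_hd[of r T' s] Suc.prems(2) s(1) T by simp_all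
    then show ?thesis using Suc.prems(4) T by (cases r) simp_all
  qed
  then obtain r' where r: "r = Suc a # r'" by auto
  have e: "filter (\<lambda>x. x \<le> a + Suc M) (row_word T' @ [Suc a]) @ filter (\<lambda>x. x \<le> a + Suc M) r' =
      rev [Suc (Suc a)..<Suc (Suc a + M)] @ [Suc a]"
    using Suc.prems(6) unfolding T r upt_Suc_Cons by simp
  have f: "filter (\<lambda>x. x \<le> a + Suc M) r' = []"
    using Suc.prems(5) T r by (intro filter_eq_snoc[OF e]) auto
  then have e': "filter (\<lambda>x. x \<le> Suc a + M) (row_word T') = rev [Suc (Suc a)..<Suc (Suc a + M)]"
    using e by simp
  have gt: "\<forall>x\<in>set (row_word T'). Suc a < x"
  proof
    fix x assume "x \<in> set (row_word T')"
    then have "a < x" "x \<noteq> Suc a" using Suc.prems(4,5) T r by auto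
    then show "Suc a < x" by simp
  qed
  obtain A B where AB: "T' = xrows (Suc a) A @ B" "length A = M" "\<forall>x\<in>set (row_word A) \<union> set (row_word B). Suc a + M < x"
    using Suc.IH[OF _ _ _ gt _ e'] Suc.prems(2,3,5) T stacked_Cons by auto
  have "\<forall>x\<in>set r'. a + Suc M < x" using f by (auto simp: filter_empty_conv)
  then show ?case using AB T r by (intro Suc.prems(1)[of "r' # A" B]) auto
qed

lemma knuth_pass_column:
  "sorted_wrt (<) (y # Q) \<Longrightarrow> sorted_wrt (>) (y # D) \<Longrightarrow> y # Q @ D \<approx> y # D @ Q"
proof (induction D arbitrary: y)
  case (Cons d D)
  have "y # Q @ d # D = (y # Q @ [d]) @ D" by simp
  also have "\<dots> \<approx> (y # d # Q) @ D" using Cons.prems by (intro knuth_app_right knuth_pass) auto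
  also have "\<dots> = y # (d # Q @ D)" by simp
  also have "\<dots> \<approx> y # (d # D @ Q)" using Cons.prems by (intro knuth_cons[OF Cons.IH]) auto
  finally show ?case by simp
qed simp

text \<open>Treat the last row at the end: the column letters of the rows above it are smaller than
  its head and therefore pass its other letters by \<open>knuth_pass_column\<close>.\<close>

lemma knuth_column_first:
  assumes "\<forall>r\<in>set A. sorted_wrt (<) r" "\<forall>x\<in>set (row_word A). a + length A < x"
  shows "row_word (xrows a A) \<approx> rev [Suc a..<Suc (a + length A)] @ row_word A"
  using assms
proof (induction A rule: rev_induct)
  case (snoc r A)
  let ?c = "a + Suc (length A)" and ?D = "rev [Suc a..<Suc (a + length A)]"
  have "row_word (xrows a (A @ [r])) = ?c # r @ row_word (xrows a A)" by (simp add: xrows_append)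
  also have "\<dots> \<approx> ?c # r @ ?D @ row_word A"
  proof -
    have "row_word (xrows a A) \<approx> ?D @ row_word A"
    proof (rule snoc.IH)
      show "\<forall>x\<in>set (row_word A). a + length A < x"
      proof
        fix x assume "x \<in> set (row_word A)"
        then have "a + length (A @ [r]) < x" using snoc.prems(2) by simp
        then show "a + length A < x" by simp
      qed
    qed (use snoc.prems in auto)
    from knuth_app_left[OF this, of "?c # r"] show ?thesis by simp
  qed
  also have "\<dots> = (?c # r @ ?D) @ row_word A" by simp
  also have "\<dots> \<approx> (?c # ?D @ r) @ row_word A"
    using snoc.prems knuth_pass_column[of ?c r ?D]
    by (intro knuth_app_right) (auto simp: sorted_wrt_rev)
  also have "\<dots> = rev [Suc a..<Suc (a + length (A @ [r]))] @ row_word (A @ [r])" by (simp add: upt_Suc)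
  finally show ?case .
qed simp

subsection \<open>The catabolism type\<close>

text \<open>
  \<open>catw a m T\<close> is the word \<open>T\<^sub>n T\<^sub>s\<close> of the catabolism that removes the letters
  \<open>a + 1, \<dots>, a + m\<close>; \<open>ct a u\<close> lists the sizes of the columns removed by the greedy catabolism
  of \<open>P(u)\<close>.
\<close>

definition catw :: "nat \<Rightarrow> nat \<Rightarrow> tableau \<Rightarrow> nat list" where
  "catw a m T = row_word (take m (remove_tab {a + 1..a + m} T)) @ row_word (drop m (remove_tab {a + 1..a + m} T))"

function ct :: "nat \<Rightarrow> nat list \<Rightarrow> nat list" where
  "ct a u = (let M = run a u; w = catw a M (P_tableau u) in if length w < length u then M # ct (a + M) w else [])"
  by auto
text \<open>For arbitrary arguments only the length test in the body guarantees a decrease. For a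
  nonempty word on an interval the test succeeds, because the run is positive by
  \<open>run_pos\<close>.\<close>

termination by (relation "measure (\<lambda>(a, u). length u)") auto

declare ct.simps [simp del]

lemma ct_knuth: "u \<approx> v \<Longrightarrow> ct a u = ct a v"
  using run_knuth[of u v a] P_tableau_knuth[of u v] knuth_length[of u v] by (simp add: ct.simps[of a u] ct.simps[of a v])

lemma ct_Nil [simp]: "ct a [] = []"
  by (simp add: ct.simps)

lemma remove_tab_id: "\<forall>x\<in>set (row_word T). x \<notin> S \<Longrightarrow> remove_tab S T = T"
  unfolding remove_tab_def by (induction T) (auto intro: filter_True)

lemma remove_tab_append: "remove_tab S (T @ T') = remove_tab S T @ remove_tab S T'"
  by (simp add: remove_tab_def)

lemma remove_tab_xrows:
  "{a<..a + length A} \<subseteq> S \<Longrightarrow> \<forall>x\<in>set (row_word A). x \<notin> S \<Longrightarrow> remove_tab S (xrows a A) = A"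
proof (induction A arbitrary: a)
  case (Cons r A)
  have "{Suc a<..Suc a + length A} \<subseteq> S" "Suc a \<in> S" using Cons.prems(1) by auto
  then show ?case using Cons.IH[of "Suc a"] Cons.prems(2)
    by (auto simp: remove_tab_def intro!: filter_True)
qed (simp add: remove_tab_def)

lemma catw_xrows:
  assumes "m \<le> length A" "\<forall>x\<in>set (row_word A) \<union> set (row_word B). a + m < x"
  shows "catw a m (xrows a A @ B) = row_word (take m A) @ row_word B @ row_word (xrows (a + m) (drop m A))"
proof -
  let ?S = "{a + 1..a + m}"
  have A: "xrows a A = xrows a (take m A) @ xrows (a + m) (drop m A)"
    using xrows_append[of a "take m A" "drop m A"] assms(1) by simp
  have sub: "set (row_word (take m A)) \<subseteq> set (row_word A)" "set (row_word (drop m A)) \<subseteq> set (row_word A)"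
    by (auto simp: set_row_word dest: in_set_takeD in_set_dropD)
  have gt: "a + m < x" if "x \<in> set (row_word A) \<or> x \<in> set (row_word B)" for x
    using assms(2) that by auto
  have 1: "remove_tab ?S (xrows a (take m A)) = take m A"
    using assms(1) gt sub(1) by (intro remove_tab_xrows) fastforce+
  have 2: "remove_tab ?S (xrows (a + m) (drop m A) @ B) = xrows (a + m) (drop m A) @ B"
  proof (rule remove_tab_id, rule ballI)
    fix x assume "x \<in> set (row_word (xrows (a + m) (drop m A) @ B))"
    then have "a + m < x" using sub gt by (auto simp: set_xrows)
    then show "x \<notin> ?S" by simp
  qed
  have "remove_tab ?S (xrows a A @ B) = take m A @ xrows (a + m) (drop m A) @ B"
    by (subst A) (metis 1 2 append_assoc remove_tab_append)
  then show ?thesis using assms(1) by (simp add: catw_def)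
qed

text \<open>In its row the letter \<open>a + length A + 1\<close> stands to the right of a column
  letter, which is smaller and hence precedes it in the word.\<close>

lemma not_decr_xform:
  assumes "\<forall>x\<in>set (row_word A). a + length A < x" "Suc (a + length A) \<in> set (row_word A)"
  shows "\<not> decr a (Suc (length A)) (row_word (xrows a A @ B))"
proof
  assume d: "decr a (Suc (length A)) (row_word (xrows a A @ B))"
  define h where "h = Suc (a + length A)"
  obtain r where r: "r \<in> set A" "h \<in> set r" using assms(2) by (auto simp: set_row_word h_def)
  then obtain A1 A2 where A: "A = A1 @ r # A2" by (meson split_list)
  obtain p q where pq: "r = p @ h # q" using r(2) by (meson split_list)
  have "sorted_wrt (>) (filter (\<lambda>x. x \<le> h) (row_word (xrows a A @ B)))"
    using d unfolding decr_def h_def by (metis add_Suc_right sorted_rev_upt)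
  moreover have "row_word (xrows a A @ B) =
      (row_word B @ row_word (xrows (Suc (a + length A1)) A2)) @ Suc (a + length A1) # (p @ h # q @ row_word (xrows a A1))"
    by (simp add: A pq xrows_append)
  moreover have c: "Suc (a + length A1) < h" by (simp add: h_def A)
  ultimately show False by (simp add: sorted_wrt_append)
qed

text \<open>The assumption \<open>ex\<close> puts the next letter into one of the rows met by the
  column, so that the run stops exactly there; its second alternative covers the word that consists
  of the column alone.\<close>

lemma ct_tableau:
  assumes T: "column_strict (xrows a A @ B)" "word_on a u" "u \<approx> row_word (xrows a A @ B)" "A \<noteq> []"
    and ex: "Suc (a + length A) \<in> set (row_word A) \<or> row_word A @ row_word B = []"
  shows "ct a u = length A # ct (a + length A) (row_word A @ row_word B)" "run a u = length A"
proof -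
  note w = xform_word[OF assms(2,3)]
  have gt: "\<forall>x\<in>set (row_word A) \<union> set (row_word B). a + length A < x" using w(1) by (auto simp: word_on_def)
  have P: "P_tableau u = xrows a A @ B"
    using assms by (intro P_tableau_eq) (auto simp: word_on_def intro: knuth_sym)
  have "decr a (length A) (row_word (xrows a A @ B))"
    using gt filter_xrows[of A "a + length A" a] by (auto simp: decr_def filter_empty_conv not_le)
  then have d: "decr a (length A) u" using decr_knuth[OF assms(3)] by simp
  show r: "run a u = length A"
  proof (rule run_eqI[OF assms(2) d])
    show "length A = length u \<or> \<not> decr a (Suc (length A)) u"
      using ex not_decr_xform[of A a B] gt decr_knuth[OF assms(3)] w(2) by fastforce
  qed
  have "catw a (length A) (xrows a A @ B) = row_word A @ row_word B"
    using catw_xrows[of "length A" A B a] gt by simp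
  then show "ct a u = length A # ct (a + length A) (row_word A @ row_word B)"
    using r P w(2) assms(4) by (subst ct.simps) (simp add: Let_def)
qed

lemma P_tableau_xrows:
  assumes "word_on a u" "decr a m u"
  obtains A B where "P_tableau u = xrows a A @ B" "length A = m"
    "\<forall>x\<in>set (row_word A) \<union> set (row_word B). a + m < x"
    "\<forall>r\<in>set A \<union> set B. sorted_wrt (<) r" "stacked A"
proof -
  let ?T = "P_tableau u"
  have d: "distinct u" using assms(1) by (simp add: word_on_def)
  note P = P_tableau_props[OF d]
  have dT: "distinct (row_word ?T)" using P(2) d knuth_distinct by blast
  have sT: "\<forall>r\<in>set ?T. sorted_wrt (<) r"
    using P(1) dT by (auto simp: column_strict_conv intro: sorted_wrt_less_distinct distinct_row_word)
  have "set (row_word ?T) = set u" using P(2) by (rule knuth_set)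
  then have gt: "\<forall>x\<in>set (row_word ?T). a < x" using assms(1) by (auto simp: word_on_def)
  have "decr a m (row_word ?T)" using assms(2) decr_knuth[OF P(2)] by blast
  then obtain A B where AB: "?T = xrows a A @ B" "length A = m" "\<forall>x\<in>set (row_word A) \<union> set (row_word B). a + m < x"
    using tableau_xrows[of ?T a m] P(1) sT gt dT by (auto simp: column_strict_conv decr_def)
  have "\<forall>r\<in>set (xrows a A). sorted_wrt (<) r" using sT AB(1) by auto
  then have "\<forall>r\<in>set A. sorted_wrt (<) r" by (induction A arbitrary: a) auto
  then have "\<forall>r\<in>set A \<union> set B. sorted_wrt (<) r" using sT AB(1) by auto
  moreover have "stacked A" using P(1) AB(1) stacked_xrows by (auto simp: column_strict_conv stacked_append)
  ultimately show thesis using that AB by blast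
qed

lemma ct_run:
  assumes "word_on a u" "u \<noteq> []"
  obtains A B where "P_tableau u = xrows a A @ B" "length A = run a u"
    "\<forall>x\<in>set (row_word A) \<union> set (row_word B). a + run a u < x"
    "\<forall>r\<in>set A \<union> set B. sorted_wrt (<) r" "stacked A" "A \<noteq> []"
    "Suc (a + length A) \<in> set (row_word A) \<or> row_word A @ row_word B = []"
    "ct a u = run a u # ct (a + run a u) (row_word A @ row_word B)"
    "u \<approx> row_word (xrows a A @ B)"
proof -
  obtain A B where AB: "P_tableau u = xrows a A @ B" "length A = run a u"
    "\<forall>x\<in>set (row_word A) \<union> set (row_word B). a + run a u < x"
    "\<forall>r\<in>set A \<union> set B. sorted_wrt (<) r" "stacked A"
    using P_tableau_xrows[OF assms(1) run_props(2)[OF assms(1)]] by metis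
  have d: "distinct u" using assms(1) by (simp add: word_on_def)
  have u: "u \<approx> row_word (xrows a A @ B)" using P_tableau_props(2)[OF d] AB(1) knuth_sym by simp
  have A: "A \<noteq> []" using run_pos[OF assms] AB(2) by auto
  \<comment> \<open>If the next letter were in \<open>B\<close>, it would be read before the whole
    column and would lengthen the run.\<close>
  have ex: "Suc (a + length A) \<in> set (row_word A) \<or> row_word A @ row_word B = []"
  proof (rule ccontr)
    assume n: "\<not> ?thesis"
    have "Suc (a + length A) \<in> set (row_word A @ row_word B)"
      using xform_word(1)[OF assms(1) u] n unfolding word_on_def
      by (cases "length (row_word A @ row_word B)") auto
    then have "Suc (a + length A) \<in> set (row_word B)" using n by auto
    then obtain p q where B: "row_word B = p @ Suc (a + length A) # q" by (meson split_list)
    have "distinct (row_word B)" using xform_word(1)[OF assms(1) u] by (simp add: word_on_def)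
    then have "filter (\<lambda>x. x \<le> Suc (a + length A)) (row_word B) = [Suc (a + length A)]"
    proof -
      assume dB: "distinct (row_word B)"
      have "\<not> x \<le> Suc (a + length A)" if "x \<in> set p \<union> set q" for x
      proof -
        have "a + length A < x" using AB(2,3) B that by auto
        moreover have "x \<noteq> Suc (a + length A)" using dB B that by auto
        ultimately show ?thesis by simp
      qed
      then show ?thesis unfolding B by (simp add: filter_empty_conv)
    qed
    moreover have "\<forall>x\<in>set (row_word A). Suc (a + length A) < x"
    proof
      fix x assume "x \<in> set (row_word A)"
      then have "a + length A < x" "x \<noteq> Suc (a + length A)" using AB(2,3) n by auto
      then show "Suc (a + length A) < x" by simp
    qed
    then have "filter (\<lambda>x. x \<le> Suc (a + length A)) (row_word (xrows a A)) = rev [Suc a..<Suc (a + length A)]"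
      by (intro filter_xrows) auto
    ultimately have "decr a (Suc (length A)) (row_word (xrows a A @ B))" by (simp add: decr_def upt_Suc)
    then have "decr a (Suc (length A)) u" using decr_knuth[OF u] by simp
    then show False using run_props(3)[OF assms(1)] AB(2) by fastforce
  qed
  have "column_strict (xrows a A @ B)" using P_tableau_props(1)[OF d] AB(1) by simp
  from ct_tableau(1)[OF this assms(1) u A ex]
  have "ct a u = run a u # ct (a + run a u) (row_word A @ row_word B)" by (simp only: AB(2))
  from that[OF AB A ex this u] show thesis .
qed

subsection \<open>Rotating letters\<close>

text \<open>
  Moving the last letter \<open>z\<close> of a word to the front does not change the catabolism type, unless the
  letters smaller than \<open>z\<close> are decreasing.
\<close>

definition rotatable :: "nat \<Rightarrow> bool" where
  "rotatable N \<longleftrightarrow> (\<forall>a w z. length (w @ [z]) \<le> N \<longrightarrow> word_on a (w @ [z]) \<longrightarrow>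
     \<not> sorted_wrt (>) (filter (\<lambda>x. x < z) w) \<longrightarrow> ct a (w @ [z]) = ct a (z # w))"

text \<open>Letters already moved to the front only add to \<open>w\<close>, so an obstruction to
  being decreasing that lies in \<open>w\<close> stays available for the next letter.\<close>

lemma rotate_many:
  assumes "rotatable N" "length (w @ q) \<le> N" "word_on a (w @ q)"
    "\<forall>z\<in>set q. \<not> sorted_wrt (>) (filter (\<lambda>x. x < z) w)"
  shows "ct a (w @ q) = ct a (q @ w)"
  using assms(2-)
proof (induction q arbitrary: w rule: rev_induct)
  case (snoc z q)
  have "\<not> sorted_wrt (>) (filter (\<lambda>x. x < z) (w @ q))" using snoc.prems by (auto simp: sorted_wrt_append)
  then have "ct a ((w @ q) @ [z]) = ct a (z # w @ q)"
    using assms(1) snoc.prems(1,2) unfolding rotatable_def by (metis append_assoc)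
  also have "\<dots> = ct a ((z # w) @ q)" by simp
  also have "\<dots> = ct a (q @ z # w)"
  proof (rule snoc.IH)
    show "word_on a ((z # w) @ q)" using snoc.prems(2) by (subst word_on_mset[of _ "w @ q @ [z]"]) auto
    show "\<forall>y\<in>set q. \<not> sorted_wrt (>) (filter (\<lambda>x. x < y) (z # w))" using snoc.prems(3) by auto
  qed (use snoc.prems in auto)
  finally show ?case by simp
qed simp

section \<open>Straightening a filling that starts with a column of smallest letters\<close>

lemma not_sorted_pair:
  "(h::nat) \<in> set p \<Longrightarrow> b \<in> set q \<Longrightarrow> h < b \<Longrightarrow> b < z \<Longrightarrow> \<not> sorted_wrt (>) (filter (\<lambda>x. x < z) (p @ q))"
proof
  assume a: "h \<in> set p" "b \<in> set q" "h < b" "b < z" and "sorted_wrt (>) (filter (\<lambda>x. x < z) (p @ q))"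
  then have "\<forall>x\<in>set (filter (\<lambda>x. x < z) p). \<forall>y\<in>set (filter (\<lambda>x. x < z) q). y < x"
    by (simp add: sorted_wrt_append)
  moreover have "h < z" using a by simp
  ultimately show False using a by fastforce
qed

lemma not_stacked_split: "\<not> stacked T \<Longrightarrow> \<exists>P r s Q. T = P @ r # s # Q \<and> \<not> stacked2 r s"
proof (induction T rule: stacked.induct)
  case (1 r s T)
  show ?case
  proof (cases "stacked2 r s")
    case True
    then obtain P r' s' Q where "s # T = P @ r' # s' # Q" "\<not> stacked2 r' s'" using 1 by auto
    then show ?thesis by (metis append_Cons)
  next
    case False then show ?thesis by (metis append_Nil)
  qed
qed auto

lemma stacked_filter: "stacked T \<Longrightarrow> stacked (filter (\<lambda>r. r \<noteq> []) T)"
proof (induction T rule: stacked.induct)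
  case (1 r s T)
  show ?case
  proof (cases "s = []")
    case True
    have "\<forall>t\<in>set T. t = []" using 1(2) True stacked_hd[of "[]" T] by auto
    then have "filter (\<lambda>r. r \<noteq> []) (s # T) = []" using True by (auto simp: filter_empty_conv)
    then show ?thesis by (auto simp: filter_empty_conv)
  next
    case False
    then show ?thesis using 1 by auto
  qed
qed auto

lemma row_word_filter: "row_word (filter (\<lambda>r. r \<noteq> []) T) = row_word T"
  by (induction T) auto

text \<open>Each letter is counted with the index of its row, the top row having index 0.
  Straightening moves letters upwards, so this is the measure of the induction in
  \<open>ct_xform_aux\<close>.\<close>

fun row_weight :: "nat list list \<Rightarrow> nat" where
  "row_weight [] = 0"
| "row_weight (r # T) = row_weight T + length (row_word T)"

lemma row_weight_less:
  "length r + length s = length r' + length s' \<Longrightarrow> length s' < length s \<Longrightarrow>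
   row_weight (P @ r' # s' # Q) < row_weight (P @ r # s # Q)"
  by (induction P) auto

lemma insert_row_less:
  assumes "\<not> stacked2 r s" "sorted_wrt (<) s" "sorted_wrt (<) r" "set s \<inter> set r = {}"
  shows "length (fst (insert_row s r)) < length s"
proof (rule ccontr)
  assume "\<not> ?thesis"
  then have "length (snd (insert_row s r)) = length r" using insert_row_length(1)[of s r] insert_row_length(2)[where \<alpha>=r and \<beta>=s] by linarith
  then have "insert_row s r = (s, r)" by (rule insert_row_trivial)
  then show False using insert_row_props[OF assms(2-4)] assms(1) by simp
qed

text \<open>
  The rows of a word that starts with the column can be straightened by row insertions. Only the
  step between the last row of the column and the row below it changes the Knuth class of
  \<open>row_word A @ row_word B\<close>; there the letters of the lower row other than its first letter \<open>b\<close> are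
  rotated to the front, which is possible because of the pair \<open>h < b\<close>.
\<close>

lemma ct_xform_aux:
  assumes rot: "rotatable N" and "length (row_word A @ row_word B) \<le> N"
    and "word_on a u" "u \<approx> row_word (xrows a A @ B)" "A \<noteq> []"
    and "\<forall>r\<in>set A \<union> set B. sorted_wrt (<) r"
    and "Suc (a + length A) \<in> set (row_word A) \<or> row_word A @ row_word B = []"
  shows "ct a u = length A # ct (a + length A) (row_word A @ row_word B)"
  using assms(2-)
proof (induction "row_weight (xrows a A @ B)" arbitrary: A B rule: less_induct)
  case (less A B)
  note w = xform_word[OF less.prems(2,3)]
  let ?M = "length A"
  have gt: "\<forall>x\<in>set (row_word A) \<union> set (row_word B). a + ?M < x" using w(1) by (auto simp: word_on_def)
  have dis: "distinct (row_word A @ row_word B)" using w(1) by (simp add: word_on_def)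
  consider "stacked (xrows a A @ B)" | "\<not> stacked A" | "\<not> stacked B"
    | "stacked A" "stacked B" "B \<noteq> []" "\<not> stacked2 (last (xrows a A)) (hd B)"
    using stacked_append[of "xrows a A" B] stacked_xrows[of a A] by blast
  then show ?case
  proof cases
    case 1
    have "filter (\<lambda>r. r \<noteq> []) (xrows a A) = xrows a A"
      using xrows_sorted[of A a] less.prems(5) gt by (auto intro: filter_True)
    then have f: "filter (\<lambda>r. r \<noteq> []) (xrows a A @ B) = xrows a A @ filter (\<lambda>r. r \<noteq> []) B" by simp
    have "\<forall>r\<in>set (xrows a A @ B). sorted r"
      using xrows_sorted[of A a] less.prems(5) gt by (auto intro: strict_sorted_imp_sorted)
    then have "column_strict (xrows a A @ filter (\<lambda>r. r \<noteq> []) B)"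
      using stacked_filter[OF 1] unfolding f[symmetric] column_strict_conv by auto
    then show ?thesis
      using ct_tableau(1)[of a A "filter (\<lambda>r. r \<noteq> []) B" u] less.prems by (simp add: row_word_filter)
  next
    case 2
    then obtain P r s Q where A: "A = P @ r # s # Q" "\<not> stacked2 r s" using not_stacked_split by blast
    obtain K R where KR: "insert_row s r = (K, R)" by force
    have rs: "sorted_wrt (<) s" "sorted_wrt (<) r" "set s \<inter> set r = {}" using less.prems(5) dis A by auto
    have p: "sorted_wrt (<) K" "sorted_wrt (<) R" "s @ r \<approx> K @ R" using insert_row_props[OF rs] KR by auto
    have sub: "set K \<subseteq> set s" "set r \<subseteq> set R" "set R \<subseteq> set s \<union> set r"
      using insert_row_sets[where \<beta>=s and \<alpha>=r] KR by auto
    have len: "length r + length s = length R + length K" "length K < length s"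
      using insert_row_length(1)[of s r] insert_row_less[OF A(2) rs] KR by auto
    let ?c = "Suc (a + length P)" and ?A = "P @ R # K # Q"
    \<comment> \<open>The two column letters form one more bumped pair, so inserting the rows with
      or without the column gives the same \<open>K\<close> and \<open>R\<close>.\<close>
    have KR': "insert_row (Suc ?c # s) (?c # r) = (Suc ?c # K, ?c # R)" using KR by simp
    have "sorted_wrt (<) (Suc ?c # s)" "sorted_wrt (<) (?c # r)" "set (Suc ?c # s) \<inter> set (?c # r) = {}"
    proof -
      have "Suc ?c < x" if "x \<in> set r \<union> set s" for x
      proof -
        have "a + length A < x" using gt that A by auto
        then show ?thesis by (simp add: A)
      qed
      then have "\<forall>x\<in>set s. Suc ?c < x" "\<forall>x\<in>set r. Suc ?c < x" by auto
      then show "sorted_wrt (<) (Suc ?c # s)" "sorted_wrt (<) (?c # r)" "set (Suc ?c # s) \<inter> set (?c # r) = {}"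
        using rs by fastforce+
    qed
    from insert_row_props[OF this] KR'
    have "(Suc ?c # s) @ (?c # r) \<approx> (Suc ?c # K) @ (?c # R)" by simp
    then have "row_word (xrows (Suc ?c) Q) @ ((Suc ?c # s) @ (?c # r)) @ row_word (xrows a P) \<approx>
        row_word (xrows (Suc ?c) Q) @ ((Suc ?c # K) @ (?c # R)) @ row_word (xrows a P)"
      by (rule knuth_ctx)
    then have "row_word (xrows a A) \<approx> row_word (xrows a ?A)" unfolding A by (simp add: xrows_append)
    then have u': "u \<approx> row_word (xrows a ?A @ B)"
      using less.prems(3) knuth_app_left[of _ _ "row_word B"] knuth_trans by fastforce
    have c': "row_word A @ row_word B \<approx> row_word ?A @ row_word B"
      using knuth_ctx[OF p(3), of "row_word Q" "row_word P @ row_word B"] unfolding A by simp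
    have "row_weight (xrows a ?A @ B) < row_weight (xrows a A @ B)"
      using row_weight_less[of "?c # r" "Suc ?c # s" "?c # R" "Suc ?c # K" "xrows a P" "xrows (Suc ?c) Q @ B"] len
      unfolding A by (simp add: xrows_append)
    moreover have "set (row_word ?A) = set (row_word A)"
      using knuth_set[OF p(3)] unfolding A by auto
    ultimately have "ct a u = length ?A # ct (a + length ?A) (row_word ?A @ row_word B)"
      using less.prems u' p A knuth_length[OF c'] by (intro less.hyps) auto
    then show ?thesis using ct_knuth[OF c'] A by simp
  next
    case 3
    then obtain P r s Q where B: "B = P @ r # s # Q" "\<not> stacked2 r s" using not_stacked_split by blast
    obtain K R where KR: "insert_row s r = (K, R)" by force
    have rs: "sorted_wrt (<) s" "sorted_wrt (<) r" "set s \<inter> set r = {}" using less.prems(5) dis B by auto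
    have p: "sorted_wrt (<) K" "sorted_wrt (<) R" "s @ r \<approx> K @ R" using insert_row_props[OF rs] KR by auto
    have len: "length r + length s = length R + length K" "length K < length s"
      using insert_row_length(1)[of s r] insert_row_less[OF B(2) rs] KR by auto
    let ?B = "P @ R # K # Q"
    have b': "row_word B \<approx> row_word ?B"
      using knuth_ctx[OF p(3), of "row_word Q" "row_word P"] unfolding B by simp
    then have u': "u \<approx> row_word (xrows a A @ ?B)"
      using less.prems(3) knuth_app_right[OF b', of "row_word (xrows a A)"] knuth_trans by fastforce
    have c': "row_word A @ row_word B \<approx> row_word A @ row_word ?B" using b' by (rule knuth_app_left)
    have "row_weight (xrows a A @ ?B) < row_weight (xrows a A @ B)"
      using row_weight_less[of r s R K "xrows a A @ P" Q] len unfolding B by simp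
    then have "ct a u = length A # ct (a + length A) (row_word A @ row_word ?B)"
      using less.prems u' p B knuth_length[OF c'] knuth_length[OF b'] by (intro less.hyps) auto
    then show ?thesis using ct_knuth[OF c'] by simp
  next
    case 4
    obtain P r where A: "A = P @ [r]" using less.prems(4) by (metis append_butlast_last_id)
    obtain s0 Q where B0: "B = s0 # Q" using 4 by (cases B) auto
    have ns0: "\<not> stacked2 ((a + ?M) # r) s0" using 4(4) A B0 last_xrows[of a P r] by simp
    then obtain b s where s0: "s0 = b # s" by (cases s0) auto
    have ab: "a + ?M < b" using gt B0 s0 by auto
    have ns: "\<not> stacked2 r s" using ns0 ab s0 by (simp add: stacked2_Cons)
    obtain K R where KR: "insert_row s r = (K, R)" by force
    have rs: "sorted_wrt (<) s" "sorted_wrt (<) r" "set s \<inter> set r = {}" "\<forall>x\<in>set s. b < x"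
      using less.prems(5) dis A B0 s0 by auto
    have p: "sorted_wrt (<) K" "sorted_wrt (<) R" "s @ r \<approx> K @ R" using insert_row_props[OF rs(1-3)] KR by auto
    have sub: "set K \<subseteq> set s" "set r \<subseteq> set R" "set R \<subseteq> set s \<union> set r"
      using insert_row_sets[where \<beta>=s and \<alpha>=r] KR by auto
    have len: "length r + length s = length R + length K" "length K < length s"
      using insert_row_length(1)[of s r] insert_row_less[OF ns rs(1-3)] KR by auto
    let ?A = "P @ [R]" and ?B = "(b # K) # Q" and ?c = "a + ?M"
    \<comment> \<open>At the junction the column letter \<open>?c\<close> bumps the head
      \<open>b\<close>. Without the column nothing bumps \<open>b\<close>; it keeps its place, and
      only the rest \<open>s\<close> of the lower row meets \<open>r\<close>.\<close>
    have KR': "insert_row (b # s) (?c # r) = (b # K, ?c # R)" using KR ab by simp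
    have "sorted_wrt (<) (b # s)" "sorted_wrt (<) (?c # r)" "set (b # s) \<inter> set (?c # r) = {}"
      using rs gt A B0 s0 dis by auto
    from insert_row_props[OF this] KR'
    have kb: "(b # s) @ (?c # r) \<approx> (b # K) @ (?c # R)" by simp
    have e1: "row_word (xrows a A @ B) = row_word Q @ ((b # s) @ (?c # r)) @ row_word (xrows a P)"
      "row_word (xrows a ?A @ ?B) = row_word Q @ ((b # K) @ (?c # R)) @ row_word (xrows a P)"
      unfolding A B0 s0 by (simp_all add: xrows_append)
    have u': "u \<approx> row_word (xrows a ?A @ ?B)"
      using less.prems(3) knuth_ctx[OF kb] unfolding e1 by (rule knuth_trans)
    have h: "Suc ?c \<in> set (row_word A)" using less.prems(6) B0 s0 by auto
    then have h': "Suc ?c \<in> set (row_word ?A)" using sub A by auto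
    have hb: "Suc ?c < b"
    proof -
      have "Suc ?c \<noteq> b" using h dis B0 s0 by auto
      then show ?thesis using ab by simp
    qed
    \<comment> \<open>The part of the word that stands between \<open>r\<close> and
      \<open>s\<close>: the stripped word is \<open>r @ v @ s\<close>, and \<open>v\<close> ends
      with \<open>b\<close>. The letter \<open>a + length A + 1\<close> comes before
      \<open>b\<close>, so this pair allows the rotation of \<open>s\<close>, and later of
      \<open>K\<close>.\<close>
    define v where "v = row_word P @ row_word Q @ [b]"
    have lenN: "length (r @ v @ s) \<le> N" "length (R @ v @ K) \<le> N"
      using less.prems(1) len unfolding A B0 s0 v_def by auto
    have wd: "word_on ?c (r @ v @ s)" using w(1) unfolding A B0 s0 v_def by simp
    have mR: "mset (R @ v @ K) = mset (r @ v @ s)" using knuth_mset[OF p(3)] by (simp add: ac_simps)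
    have "ct ?c ((r @ v) @ s) = ct ?c (s @ r @ v)"
    proof (rule rotate_many[OF rot])
      show "\<forall>z\<in>set s. \<not> sorted_wrt (>) (filter (\<lambda>x. x < z) (r @ v))"
      proof
        fix z assume "z \<in> set s"
        then have "b < z" using rs by auto
        then show "\<not> sorted_wrt (>) (filter (\<lambda>x. x < z) (r @ v))"
          using not_sorted_pair[of "Suc ?c" "r @ row_word P" b "row_word Q @ [b]" z] h hb A by (simp add: v_def)
      qed
    qed (use lenN wd in auto)
    also have "\<dots> = ct ?c (K @ R @ v)"
      using knuth_app_right[OF p(3), of v] by (intro ct_knuth) simp
    also have "\<dots> = ct ?c ((R @ v) @ K)"
    proof (rule rotate_many[OF rot, symmetric])
      show "\<forall>z\<in>set K. \<not> sorted_wrt (>) (filter (\<lambda>x. x < z) (R @ v))"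
      proof
        fix z assume "z \<in> set K"
        then have "b < z" using rs sub by auto
        then show "\<not> sorted_wrt (>) (filter (\<lambda>x. x < z) (R @ v))"
          using not_sorted_pair[of "Suc ?c" "R @ row_word P" b "row_word Q @ [b]" z] h' hb by (simp add: v_def)
      qed
      show "word_on ?c ((R @ v) @ K)" using wd mR word_on_mset by (metis append_assoc)
    qed (use lenN in auto)
    finally have cc: "ct ?c (row_word A @ row_word B) = ct ?c (row_word ?A @ row_word ?B)"
      unfolding A B0 s0 v_def by simp
    have "row_weight (xrows a ?A @ ?B) < row_weight (xrows a A @ B)"
      using row_weight_less[of "?c # r" "b # s" "?c # R" "b # K" "xrows a P" Q] len
      unfolding A B0 s0 by (simp add: xrows_append)
    moreover have "\<forall>t\<in>set ?A \<union> set ?B. sorted_wrt (<) t"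
      using less.prems(5) p rs sub unfolding A B0 s0 by auto
    moreover have "length (row_word ?A @ row_word ?B) \<le> N" using lenN(2) by (simp add: v_def)
    ultimately have "ct a u = length ?A # ct (a + length ?A) (row_word ?A @ row_word ?B)"
      using less.prems u' h' A by (intro less.hyps) auto
    then show ?thesis using cc A by simp
  qed
qed

section \<open>Insertion into the rows of the column, and the rotation theorem\<close>

lemma block_insert_mset:
  "mset (row_word (fst (block_insert z T))) + mset (snd (block_insert z T)) = add_mset z (mset (row_word T))"
proof (induction T arbitrary: z)
  case (Cons r T)
  consider "snd (row_insert z r) = []" | y where "snd (row_insert z r) = [y]"
    using row_insert_snd by blast
  then show ?case
  proof cases
    case 1
    then show ?thesis using row_insert_mset[of z r] by (simp add: block_insert_simps2)
  next
    case (2 y)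
    then show ?thesis using row_insert_mset[of z r] Cons.IH[of y]
      by (simp add: block_insert_simps2) (metis add.commute add_mset_add_single union_mset_add_mset_left union_assoc)
  qed
qed simp

lemma block_insert_set:
  "set (row_word (fst (block_insert z T))) \<union> set (snd (block_insert z T)) = insert z (set (row_word T))"
  by (metis block_insert_mset set_mset_mset set_mset_union set_mset_add_mset_insert)

lemma block_insert_xrows:
  assumes "\<forall>x\<in>set (row_word A). a + length A < x" "a + length A < z"
  shows "block_insert z (xrows a A) = (xrows a (fst (block_insert z A)), snd (block_insert z A))"
  using assms
proof (induction A arbitrary: a z)
  case (Cons r A)
  have z: "Suc a < z" using Cons.prems(2) by simp
  have A: "\<forall>x\<in>set (row_word A). Suc a + length A < x" using Cons.prems(1) by auto
  consider "snd (row_insert z r) = []" | y where "y \<in> set r" "snd (row_insert z r) = [y]"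
    using row_insert_snd by blast
  then show ?case
  proof cases
    case 1
    then show ?thesis using z by (simp add: block_insert_simps2)
  next
    case (2 y)
    have "Suc a + length A < y" using Cons.prems(1) 2(1) by auto
    then show ?thesis using z 2 Cons.IH[OF A] by (simp add: block_insert_simps2)
  qed
qed simp

lemma block_insert_word_set:
  "set (row_word (fst (block_insert_word u T))) \<union> set (snd (block_insert_word u T)) = set u \<union> set (row_word T)"
proof (induction u arbitrary: T)
  case (Cons z u)
  then show ?case using block_insert_set[of z T] by (simp add: Un_ac)
qed simp

lemma block_insert_length: "length (fst (block_insert z T)) = length T"
proof (induction T arbitrary: z)
  case (Cons r T)
  then show ?case using row_insert_snd[of z r] by (auto simp: block_insert_simps2)
qed simp

lemma block_insert_word_xrows:
  assumes "\<forall>x\<in>set (row_word A) \<union> set u. a + length A < x"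
  shows "block_insert_word u (xrows a A) = (xrows a (fst (block_insert_word u A)), snd (block_insert_word u A))"
  using assms
proof (induction u arbitrary: A)
  case (Cons z u)
  have "block_insert z (xrows a A) = (xrows a (fst (block_insert z A)), snd (block_insert z A))"
    using Cons.prems by (intro block_insert_xrows) auto
  moreover have "\<forall>x\<in>set (row_word (fst (block_insert z A))) \<union> set u. a + length (fst (block_insert z A)) < x"
    using Cons.prems block_insert_set[of z A] by (auto simp: block_insert_length)
  ultimately show ?case using Cons.IH by simp
qed simp

text \<open>The analogue of \<open>ct_run\<close> for a word from which one larger letter is
  missing, so that it is not a word on an interval.\<close>

lemma tableau_split:
  assumes "distinct w" "\<forall>x\<in>set w. a < x" "Suc (a + M) \<in> set w"
    and "filter (\<lambda>x. x \<le> a + M) w = rev [Suc a..<Suc (a + M)]"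
    and "filter (\<lambda>x. x \<le> a + Suc M) w \<noteq> rev [Suc a..<Suc (a + Suc M)]"
  obtains A B where "P_tableau w = xrows a A @ B" "length A = M"
    "\<forall>x\<in>set (row_word A) \<union> set (row_word B). a + M < x"
    "\<forall>r\<in>set A \<union> set B. sorted_wrt (<) r" "Suc (a + M) \<in> set (row_word A)"
proof -
  let ?T = "P_tableau w"
  note P = P_tableau_props[OF assms(1)]
  have dT: "distinct (row_word ?T)" using P(2) assms(1) knuth_distinct by blast
  have sT: "\<forall>r\<in>set ?T. sorted_wrt (<) r"
    using P(1) dT by (auto simp: column_strict_conv intro: sorted_wrt_less_distinct distinct_row_word)
  have set: "set (row_word ?T) = set w" using P(2) by (rule knuth_set)
  have fil: "filter (\<lambda>x. x \<le> c) (row_word ?T) = rev [Suc a..<Suc c] \<longleftrightarrow> filter (\<lambda>x. x \<le> c) w = rev [Suc a..<Suc c]" for c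
  proof -
    have "filter (\<lambda>x. x \<le> c) (row_word ?T) \<approx> filter (\<lambda>x. x \<le> c) w" using P(2) by (rule knuth_filter) auto
    then show ?thesis using knuth_decreasing sorted_rev_upt knuth_sym by metis
  qed
  obtain A B where AB: "?T = xrows a A @ B" "length A = M" "\<forall>x\<in>set (row_word A) \<union> set (row_word B). a + M < x"
    using tableau_xrows[of ?T a M] P(1) sT dT set assms(2) fil[of "a + M"] assms(4) by (auto simp: column_strict_conv)
  have "\<forall>r\<in>set (xrows a A). sorted_wrt (<) r" using sT AB(1) by auto
  then have "\<forall>r\<in>set A. sorted_wrt (<) r" by (induction A arbitrary: a) auto
  then have s: "\<forall>r\<in>set A \<union> set B. sorted_wrt (<) r" using sT AB(1) by auto
  have "Suc (a + M) \<in> set (row_word A)"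
  proof (rule ccontr)
    assume n: "\<not> ?thesis"
    have "Suc (a + M) \<in> set (row_word (xrows a A @ B))" using set AB(1) assms(3) by simp
    then have "Suc (a + M) \<in> set (row_word B)" using n AB(2) by (auto simp: set_xrows)
    then obtain p q where B: "row_word B = p @ Suc (a + M) # q" by (meson split_list)
    have "\<not> x \<le> Suc (a + M)" if "x \<in> set p \<union> set q" for x
    proof -
      have "a + M < x" using AB(3) B that by auto
      moreover have "x \<noteq> Suc (a + M)" using dT AB(1) B that by auto
      ultimately show ?thesis by simp
    qed
    then have 1: "filter (\<lambda>x. x \<le> Suc (a + M)) (row_word B) = [Suc (a + M)]"
      unfolding B by (simp add: filter_empty_conv)
    have "\<forall>x\<in>set (row_word A). Suc (a + M) < x"
    proof
      fix x assume "x \<in> set (row_word A)"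
      then have "a + M < x" "x \<noteq> Suc (a + M)" using AB(3) n by auto
      then show "Suc (a + M) < x" by simp
    qed
    then have "filter (\<lambda>x. x \<le> Suc (a + M)) (row_word (xrows a A)) = rev [Suc a..<Suc (a + length A)]"
      using AB(2) by (intro filter_xrows) auto
    then have "filter (\<lambda>x. x \<le> a + Suc M) (row_word ?T) = rev [Suc a..<Suc (a + Suc M)]"
      using 1 AB(1,2) by (simp add: upt_Suc)
    then show False using fil[of "a + Suc M"] assms(5) by simp
  qed
  from that[OF AB s this] show thesis .
qed

lemma sorted_wrt_filter_subset:
  "sorted_wrt P (filter Q w) \<Longrightarrow> (\<And>x. x \<in> set w \<Longrightarrow> Q' x \<Longrightarrow> Q x) \<Longrightarrow> sorted_wrt P (filter Q' w)"
proof -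
  assume a: "sorted_wrt P (filter Q w)" "\<And>x. x \<in> set w \<Longrightarrow> Q' x \<Longrightarrow> Q x"
  have "filter Q' w = filter Q' (filter Q w)" using a(2) by (induction w) auto
  then show ?thesis using sorted_wrt_filter[OF a(1)] by simp
qed

text \<open>Induction on the length. In \<open>z # w\<close> the letter \<open>z\<close> forms a new
  bottom row; in \<open>w @ [z]\<close> it is inserted into the rows of the column, from which at
  most one letter \<open>z'\<close> overflows. After the column is stripped, the two words are Knuth
  equivalent up to the position of \<open>z'\<close>, first or last, and the induction hypothesis
  rotates it.\<close>

lemma rotatable_all: "rotatable N"
proof (induction N)
  case 0 show ?case by (simp add: rotatable_def)
next
  case (Suc N)
  show ?case unfolding rotatable_def
  proof (intro allI impI)
    fix a w z
    assume len: "length (w @ [z]) \<le> Suc N" and wd: "word_on a (w @ [z])"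
      and ns: "\<not> sorted_wrt (>) (filter (\<lambda>x. x < z) w)"
    define M where "M = run a (w @ [z])"
    note R = run_props[OF wd, folded M_def]
    have fs: "sorted_wrt (>) (filter (\<lambda>x. x \<le> a + M) (w @ [z]))"
      using R(1,2) decr_alt[OF wd] by blast
    then have fsw: "sorted_wrt (>) (filter (\<lambda>x. x \<le> a + M) w)" by (simp add: sorted_wrt_append split: if_splits)
    \<comment> \<open>Otherwise the letters below \<open>z\<close> all belong to the run and are
      decreasing. Consequently \<open>z\<close> does not affect the column, and \<open>w\<close>
      alone has the same run.\<close>
    have zM: "\<not> z \<le> Suc (a + M)"
    proof
      assume z: "z \<le> Suc (a + M)"
      from fsw have "sorted_wrt (>) (filter (\<lambda>x. x < z) w)" by (rule sorted_wrt_filter_subset) (use z in auto)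
      then show False using ns by simp
    qed
    have lM: "M < length (w @ [z])"
    proof -
      have "z \<le> a + length (w @ [z])" using wd by (auto simp: word_on_def)
      then show ?thesis using zM by simp
    qed
    have M0: "0 < M" unfolding M_def using run_pos[OF wd] by simp
    have nd: "\<not> decr a (Suc M) (w @ [z])" using R(3) by (meson not_less_eq_eq order_refl)
    obtain A B where AB: "P_tableau w = xrows a A @ B" "length A = M"
      "\<forall>x\<in>set (row_word A) \<union> set (row_word B). a + M < x"
      "\<forall>r\<in>set A \<union> set B. sorted_wrt (<) r" "Suc (a + M) \<in> set (row_word A)"
    proof (rule tableau_split)
      show "distinct w" "\<forall>x\<in>set w. a < x" using wd by (auto simp: word_on_def)
      have "Suc (a + M) \<in> set (w @ [z])" using wd lM unfolding word_on_def by auto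
      then show "Suc (a + M) \<in> set w" using zM by auto
      show "filter (\<lambda>x. x \<le> a + M) w = rev [Suc a..<Suc (a + M)]"
        using R(2) zM unfolding decr_def by simp
      show "filter (\<lambda>x. x \<le> a + Suc M) w \<noteq> rev [Suc a..<Suc (a + Suc M)]"
        using nd zM unfolding decr_def by simp
    qed
    have dw: "distinct w" using wd by (simp add: word_on_def)
    have w: "w \<approx> row_word (xrows a A @ B)" using P_tableau_props(2)[OF dw] AB(1) knuth_sym by simp
    have A0: "A \<noteq> []" using AB(2) M0 by auto
    have wd': "word_on a (z # w)" using wd by (subst word_on_mset[of _ "w @ [z]"]) auto
    have lw: "length w = M + length (row_word A @ row_word B)"
      using knuth_length[OF w] arg_cong[OF mset_xrows[of a A], of size] AB(2) by simp
    have lA: "length (row_word A @ z # row_word B) \<le> N" using lw len M0 by simp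
    have zl: "a + length A < z" using zM AB(2) by simp
    let ?A = "fst (block_insert z A)" and ?o = "snd (block_insert z A)"
    have "z # w \<approx> z # row_word (xrows a A @ B)" using w by (rule knuth_cons)
    then have zw: "z # w \<approx> row_word (xrows a A @ (B @ [[z]]))" by simp
    have ct1: "ct a (z # w) = M # ct (a + M) (row_word A @ z # row_word B)"
      using ct_xform_aux[OF Suc.IH _ wd' zw A0] AB(2,4,5) lA by auto
    have bx: "block_insert z (xrows a A) = (xrows a ?A, ?o)"
      using AB(2,3) zl by (intro block_insert_xrows) auto
    have dA: "distinct (row_word A)" "z \<notin> set (row_word A)" "distinct (row_word (xrows a A))"
      "z \<notin> set (row_word (xrows a A))"
    proof -
      have "distinct (row_word (xrows a A @ B))" "set (row_word (xrows a A @ B)) = set w" "z \<notin> set w"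
        using knuth_distinct[OF w] knuth_set[OF w] wd by (auto simp: word_on_def)
      then show d: "distinct (row_word (xrows a A))" "z \<notin> set (row_word (xrows a A))" by auto
      then show "z \<notin> set (row_word A)" by (simp add: set_xrows)
      have "distinct (row_word (xrows a A)) \<longleftrightarrow> distinct ([Suc a..<Suc (a + length A)] @ row_word A)"
        by (rule mset_eq_imp_distinct_iff) (simp add: mset_xrows del: mset_upt)
      then show "distinct (row_word A)" using d by simp
    qed
    have "\<forall>r\<in>set (xrows a A). sorted_wrt (<) r"
      using xrows_sorted[of A a] AB(2,3,4) by auto
    from block_insert_props[OF this dA(3,4)]
    have bkx: "row_word (xrows a A) @ [z] \<approx> ?o @ row_word (xrows a ?A)" using bx by simp
    have "\<forall>r\<in>set A. sorted_wrt (<) r" using AB(4) by simp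
    note bp = block_insert_props[OF this dA(1,2)]
    have bk: "row_word A @ [z] \<approx> ?o @ row_word ?A" using bp by blast
    have "(w @ [z]) \<approx> row_word (xrows a A @ B) @ [z]" using w by (rule knuth_app_right)
    also have "\<dots> = row_word B @ (row_word (xrows a A) @ [z])" by simp
    also have "\<dots> \<approx> row_word B @ ?o @ row_word (xrows a ?A)" using bkx by (rule knuth_app_left)
    finally have wz: "w @ [z] \<approx> row_word B @ ?o @ row_word (xrows a ?A)" .
    have A': "?A \<noteq> []" "length ?A = M" "\<forall>r\<in>set ?A. sorted_wrt (<) r"
      using bp A0 AB(2) by auto
    have "row_word A @ [z] @ row_word B \<approx> (?o @ row_word ?A) @ row_word B"
      using knuth_app_right[OF bk] by simp
    then have ct2: "ct (a + M) (row_word A @ z # row_word B) = ct (a + M) (?o @ row_word ?A @ row_word B)"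
      using ct_knuth by simp
    have lA': "length (?o @ row_word ?A @ row_word B) \<le> N"
      using knuth_length[OF bk] lA by simp
    have stA: "set (row_word A) \<union> {z} = set ?o \<union> set (row_word ?A)" using knuth_set[OF bk] by auto
    consider "?o = []" | z' where "z < z'" "z' \<in> set (row_word A)" "?o = [z']"
      using bp A0 by auto
    then show "ct a (w @ [z]) = ct a (z # w)"
    proof cases
      case 1
      have "w @ [z] \<approx> row_word (xrows a ?A @ B)" using wz 1 by simp
      from ct_xform_aux[OF Suc.IH _ wd this A'(1)]
      have "ct a (w @ [z]) = M # ct (a + M) (row_word ?A @ row_word B)"
        using A' AB(2,4,5) lA' 1 stA by auto
      then show ?thesis using ct1 ct2 1 by simp
    next
      case (2 z')
      have h: "Suc (a + M) \<in> set (row_word ?A)" using stA 2 AB(5) zM by auto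
      have u: "w @ [z] \<approx> row_word (xrows a ?A @ ([z'] # B))" using wz 2 by simp
      from ct_xform_aux[OF Suc.IH _ wd u A'(1)]
      have "ct a (w @ [z]) = M # ct (a + M) ((row_word ?A @ row_word B) @ [z'])"
        using A' AB(2,4) h lA' 2 by auto
      moreover have "ct (a + M) ((row_word ?A @ row_word B) @ [z']) = ct (a + M) (z' # row_word ?A @ row_word B)"
      proof -
        obtain r A2 where rA: "?A = r # A2" using A'(1) by (cases "?A") auto
        have zr: "z \<in> set r" "sorted_wrt (<) r" using bp A0 A'(3) rA by auto
        have hz: "Suc (a + M) < z" using zM by simp
        \<comment> \<open>The increasing pair is \<open>a + M + 1\<close> and \<open>z\<close>: the
          inserted \<open>z\<close> lies in the first row of the new block, which is read last in
          it, and \<open>a + M + 1\<close> is in a lower row of the block or further left in the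
          same row. Both are smaller than \<open>z'\<close>.\<close>
        have "\<not> sorted_wrt (>) (filter (\<lambda>x. x < z') (row_word ?A @ row_word B))"
        proof (cases "Suc (a + M) \<in> set r")
          case True
          obtain p q where r: "r = p @ z # q" using zr(1) by (meson split_list)
          have "\<forall>y\<in>set q. z < y" using zr(2) r by (simp add: sorted_wrt_append)
          then have "Suc (a + M) \<in> set p" using True r hz by auto
          then show ?thesis
            using not_sorted_pair[of "Suc (a + M)" "row_word A2 @ p" z "z # q @ row_word B" z'] hz 2(1) rA r by simp
        next
          case False
          then have "Suc (a + M) \<in> set (row_word A2)" using h rA by auto
          then show ?thesis
            using not_sorted_pair[of "Suc (a + M)" "row_word A2" z "r @ row_word B" z'] hz 2(1) rA zr(1) by simp
        qed
        moreover have "word_on (a + M) ((row_word ?A @ row_word B) @ [z'])"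
          using xform_word(1)[OF wd u] A'(2) by simp
        moreover have "length ((row_word ?A @ row_word B) @ [z']) \<le> N" using lA' 2 by simp
        ultimately show ?thesis using Suc.IH unfolding rotatable_def by blast
      qed
      ultimately show ?thesis using ct1 ct2 2 by simp
    qed
  qed
qed

lemma ct_rotate:
  assumes "word_on a (w @ q)" "\<forall>z\<in>set q. \<not> sorted_wrt (>) (filter (\<lambda>x. x < z) w)"
  shows "ct a (w @ q) = ct a (q @ w)"
  by (rule rotate_many[OF rotatable_all order_refl assms])

lemmas ct_xform = ct_xform_aux[OF rotatable_all order_refl]

lemma row_word_replicate_Nil [simp]: "row_word (replicate e []) = []"
  by (induction e) auto

lemma row_word_xrows_replicate: "row_word (xrows a (replicate e [])) = rev [Suc a..<Suc (a + e)]"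
proof (induction e arbitrary: a)
  case (Suc e)
  then show ?case using upt_Suc_Cons[of a e] by simp
qed simp

lemma row_word_singletons [simp]: "row_word (map (\<lambda>x. [x]) w) = rev w"
  by (induction w) auto

text \<open>The new letters head rows that are otherwise empty, placed above the rows of the column
  of \<open>x\<close>; together they form one longer column. This filling need not be a tableau, but
  \<open>ct_xform\<close> does not ask for stacked rows.\<close>

lemma ct_append_column:
  assumes wd: "word_on a (x @ rev [Suc a..<Suc (a + e)])" and e: "0 < e"
  shows "ct a (x @ rev [Suc a..<Suc (a + e)]) = (if x = [] then [e] else (run (a + e) x + e) # tl (ct (a + e) x))"
proof (cases "x = []")
  case True
  have "x @ rev [Suc a..<Suc (a + e)] \<approx> row_word (xrows a (replicate e []) @ [])"
    using True by (simp add: row_word_xrows_replicate)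
  from ct_xform[OF wd this] show ?thesis using e True by simp
next
  case False
  let ?col = "rev [Suc a..<Suc (a + e)]"
  have "x @ ?col \<approx> row_word (xrows a (replicate e []) @ [x])" by (simp add: row_word_xrows_replicate)
  from xform_word(1)[OF wd this] have wx: "word_on (a + e) x" by simp
  obtain A B where AB: "length A = run (a + e) x"
    "\<forall>r\<in>set A \<union> set B. sorted_wrt (<) r" "A \<noteq> []"
    "Suc (a + e + length A) \<in> set (row_word A) \<or> row_word A @ row_word B = []"
    "ct (a + e) x = run (a + e) x # ct (a + e + run (a + e) x) (row_word A @ row_word B)"
    "x \<approx> row_word (xrows (a + e) A @ B)"
    using ct_run[OF wx False] by metis
  have "x @ ?col \<approx> row_word (xrows (a + e) A @ B) @ ?col" using AB(6) by (rule knuth_app_right)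
  also have "\<dots> = row_word (xrows a (replicate e [] @ A) @ B)" by (simp add: xrows_append row_word_xrows_replicate)
  finally have "x @ ?col \<approx> row_word (xrows a (replicate e [] @ A) @ B)" .
  from ct_xform[OF wd this] have "ct a (x @ ?col) = (e + run (a + e) x) # ct (a + (e + run (a + e) x)) (row_word A @ row_word B)"
    using AB(1-4) set_replicate_conv_if[of e "[]::nat list"] by (auto simp: ac_simps)
  then show ?thesis using False AB(5) by (simp add: ac_simps)
qed

subsection \<open>Removing part of the first column\<close>

text \<open>The type of what remains when only \<open>m\<close> of the \<open>M\<close> letters of
  the first column are removed, see \<open>ct_catw\<close>. If the second column has at most
  \<open>m\<close> letters, the \<open>M - m\<close> leftover letters are joined to it. Otherwise
  \<open>m\<close> letters of the second column refill the first one to length \<open>M\<close>, and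
  the same question recurs for the rest.\<close>

fun fct :: "nat \<Rightarrow> nat list \<Rightarrow> nat list" where
  "fct m [] = []"
| "fct m (M # \<kappa>) = (if M = m then \<kappa> else if \<kappa> = [] then [M - m]
     else if hd \<kappa> \<le> m then (hd \<kappa> + M - m) # tl \<kappa> else M # fct m \<kappa>)"

text \<open>Here \<open>A\<close> are the first \<open>m\<close> stripped rows, \<open>R\<close> the
  rows whose \<open>e = M - m\<close> column letters survive, and \<open>k\<close> is the second
  part of the type. If \<open>k \<le> m\<close>, the letters of \<open>R\<close> can be rotated to
  the front, which leaves \<open>x\<close> followed by the surviving column. If
  \<open>k > m\<close>, the rows \<open>A\<close> themselves begin with the column
  \<open>b + 1, ..., b + m\<close>, which continues the surviving one; stripping both leads to the
  same problem for the shorter word \<open>x\<close>.\<close>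

lemma ct_catw:
  "word_on a u \<Longrightarrow> 1 \<le> m \<Longrightarrow> m \<le> run a u \<Longrightarrow> ct (a + m) (catw a m (P_tableau u)) = fct m (ct a u)"
proof (induction u arbitrary: a rule: length_induct)
  case (1 u)
  note wd = "1.prems"(1)
  define M where "M = run a u"
  have "u \<noteq> []" using "1.prems"(2,3) run_props(1)[OF wd] by auto
  then obtain As Bs where P: "P_tableau u = xrows a As @ Bs" and lM: "length As = M"
    and gt: "\<forall>x\<in>set (row_word As) \<union> set (row_word Bs). a + M < x"
    and srt: "\<forall>r\<in>set As \<union> set Bs. sorted_wrt (<) r" and st: "stacked As" and ne: "As \<noteq> []"
    and ex: "Suc (a + length As) \<in> set (row_word As) \<or> row_word As @ row_word Bs = []"
    and ct: "ct a u = M # ct (a + M) (row_word As @ row_word Bs)"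
    and u: "u \<approx> row_word (xrows a As @ Bs)"
    using ct_run[OF wd] unfolding M_def by metis
  have mM: "m \<le> M" using "1.prems"(3) by (simp add: M_def)
  define x where "x = row_word As @ row_word Bs"
  define A R e b where "A = take m As" and "R = drop m As" and "e = M - m" and "b = a + M"
  have AR: "As = A @ R" "length A = m" "length R = e" using lM mM by (auto simp: A_def R_def e_def)
  have xR: "x = row_word R @ row_word A @ row_word Bs" by (simp add: x_def AR(1))
  have wx: "word_on b x" and lu: "length u = M + length x"
    using xform_word[OF wd u] lM by (auto simp: x_def b_def)
  define c where "c = row_word A @ row_word Bs @ row_word (xrows (a + m) R)"
  have gtm: "\<forall>y\<in>set (row_word As) \<union> set (row_word Bs). a + m < y" using gt mM by (meson add_left_mono le_less_trans)
  have cc: "catw a m (P_tableau u) = c"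
    using catw_xrows[of m As Bs a] gtm mM lM by (simp add: P c_def A_def R_def)
  have ctx: "ct a u = M # ct b x" using ct by (simp add: x_def b_def)
  show ?case
  proof (cases "m = M")
    case True
    then have "R = []" using AR(3) by (simp add: e_def)
    then have "c = x" by (simp add: c_def xR)
    then show ?thesis unfolding cc ctx using True by (simp add: b_def)
  next
    case False
    then have e0: "0 < e" and bme: "b = a + m + e" using mM by (auto simp: e_def b_def)
    have R0: "R \<noteq> []" using AR(3) e0 by auto
    have gtb: "b < y" if "y \<in> set (row_word A) \<union> set (row_word R) \<union> set (row_word Bs)" for y
      using gt that AR(1) by (auto simp: b_def)
    have mc: "mset c = mset (rev [Suc (a + m)..<Suc (a + m + e)] @ x)"
      by (simp add: c_def xR mset_xrows AR(3) del: mset_upt)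
    have wc: "word_on (a + m) c"
    proof -
      have "word_on (a + m) (rev [Suc (a + m)..<Suc (a + m + e)] @ x)"
      proof -
        have "set [Suc (a + m)..<Suc (a + m + e)] = {a + m<..b}" unfolding bme by auto
        moreover have "set x = {b<..b + length x}" "distinct x" using wx by (auto simp: word_on_def)
        ultimately show ?thesis unfolding word_on_def bme by auto
      qed
      then show ?thesis using word_on_mset[OF mc] by blast
    qed
    have srtR: "\<forall>r\<in>set R. sorted_wrt (<) r" "\<forall>r\<in>set A. sorted_wrt (<) r" using srt AR(1) by auto
    show ?thesis
    proof (cases "x = []")
      case True
      then have "c = row_word (xrows (a + m) R @ [])" by (simp add: c_def xR)
      then have "c \<approx> row_word (xrows (a + m) R @ [])" by simp
      from ct_xform[OF wc this R0] have "ct (a + m) c = [e]" using True srtR AR(3) by (simp add: xR)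
      then show ?thesis unfolding cc ctx using True False by (simp add: e_def)
    next
      case x0: False
      define k where "k = run b x"
      obtain \<kappa> where k: "ct b x = k # \<kappa>" using ct_run[OF wx x0] unfolding k_def by metis
      show ?thesis
      proof (cases "k \<le> m")
        case True
        let ?col = "rev [Suc (a + m)..<Suc (a + m + e)]" and ?w = "row_word A @ row_word Bs"
        have "row_word (xrows (a + m) R) \<approx> ?col @ row_word R"
          using knuth_column_first[of R "a + m"] srtR gtb AR(3) bme by auto
        from knuth_app_left[OF this, of ?w] have c: "c \<approx> (?w @ ?col) @ row_word R" by (simp add: c_def)
        have "ct (a + m) ((?w @ ?col) @ row_word R) = ct (a + m) (row_word R @ ?w @ ?col)"
        proof (rule ct_rotate)
          show "word_on (a + m) ((?w @ ?col) @ row_word R)" using wc word_on_knuth[OF c] by blast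
          show "\<forall>z\<in>set (row_word R). \<not> sorted_wrt (>) (filter (\<lambda>y. y < z) (?w @ ?col))"
          proof (intro ballI notI)
            fix z assume z: "z \<in> set (row_word R)" and sz: "sorted_wrt (>) (filter (\<lambda>y. y < z) (?w @ ?col))"
            \<comment> \<open>The smallest letter of \<open>R\<close>. If the rotation failed, the
              letters of \<open>x\<close> up to \<open>q\<close> would be a decreasing run, whence
              \<open>q - b \<le> k \<le> m\<close>. But the \<open>m\<close> rows above the row of
              \<open>q\<close> have distinct heads strictly between \<open>b\<close> and
              \<open>q\<close>, whence \<open>m < q - b\<close>.\<close>
            define q where "q = Min (set (row_word R))"
            have q: "q \<in> set (row_word R)" "\<And>y. y \<in> set (row_word R) \<Longrightarrow> q \<le> y"
              using z Min_in[of "set (row_word R)"] unfolding q_def by fastforce+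
            have bq: "b < q" using gtb q(1) by auto
            have "sorted_wrt (>) (filter (\<lambda>y. y < z) ?w)" using sz by (simp add: sorted_wrt_append)
            then have sq: "sorted_wrt (>) (filter (\<lambda>y. y < q) ?w)"
              by (rule sorted_wrt_filter_subset) (use q(2)[OF z] in auto)
            have dx: "distinct x" using wx by (simp add: word_on_def)
            have fw: "filter (\<lambda>y. y \<le> q) ?w = filter (\<lambda>y. y < q) ?w"
              using dx q(1) unfolding xR by (intro filter_cong) auto
            have fR: "filter (\<lambda>y. y \<le> q) (row_word R) = [q]"
            proof -
              obtain r1 r2 where r: "row_word R = r1 @ q # r2" using q(1) by (meson split_list)
              have "q \<notin> set r1 \<union> set r2" using dx unfolding xR r by simp
              then have "\<not> y \<le> q" if "y \<in> set r1 \<union> set r2" for y using q(2)[of y] that r by (auto simp: le_less)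
              then show ?thesis unfolding r by (simp add: filter_empty_conv)
            qed
            have "filter (\<lambda>y. y \<le> q) x = q # filter (\<lambda>y. y < q) ?w" using fw fR by (simp add: xR)
            then have "sorted_wrt (>) (filter (\<lambda>y. y \<le> b + (q - b)) x)" using sq bq by auto
            moreover have "q - b \<le> length x"
            proof -
              have "q \<in> set x" using q(1) by (simp add: xR)
              then have "q \<in> {b<..b + length x}" using wx unfolding word_on_def by blast
              then show ?thesis by auto
            qed
            ultimately have "decr b (q - b) x" using decr_alt[OF wx] by blast
            then have "q - b \<le> m" using run_props(3)[OF wx] True k_def by (meson le_trans)
            moreover have "m \<le> q - Suc b"
            proof -
              obtain r where r: "r \<in> set R" "q \<in> set r" using q(1) by (auto simp: set_row_word)
              then obtain j where j: "j < length R" "R ! j = r" by (meson in_set_conv_nth)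
              have asj: "As ! (m + j) = r" using j AR(1,2) by (simp add: nth_append)
              have hr: "hd r \<le> q" "r \<noteq> []"
              proof -
                obtain h r' where hr: "r = h # r'" using r(2) by (cases r) auto
                have "sorted_wrt (<) r" using r(1) srtR(1) by blast
                then show "hd r \<le> q" "r \<noteq> []" using r(2) unfolding hr by auto
              qed
              have nth: "As ! i \<noteq> [] \<and> hd (As ! i) < q" if "i < m" for i
                using stacked_hd_nth[OF st, of i "m + j"] that j AR asj hr by auto
              have "inj_on (\<lambda>i. hd (As ! i)) {..<m}"
              proof (rule linorder_inj_onI')
                fix i j assume "i \<in> {..<m}" "j \<in> {..<m}" "i < j"
                then show "hd (As ! i) \<noteq> hd (As ! j)"
                  using stacked_hd_nth[OF st, of i j] nth[of j] mM lM by auto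
              qed
              then have "m = card ((\<lambda>i. hd (As ! i)) ` {..<m})" by (simp add: card_image)
              also have "\<dots> \<le> card {b<..<q}"
              proof (rule card_mono)
                show "(\<lambda>i. hd (As ! i)) ` {..<m} \<subseteq> {b<..<q}"
                proof
                  fix y assume "y \<in> (\<lambda>i. hd (As ! i)) ` {..<m}"
                  then obtain i where i: "i < m" "y = hd (As ! i)" by auto
                  have "hd (As ! i) \<in> set (row_word As)"
                    using nth[OF i(1)] i(1) mM lM by (auto simp: set_row_word intro!: bexI[of _ "As ! i"])
                  then show "y \<in> {b<..<q}" using nth[OF i(1)] i(2) gt by (auto simp: b_def)
                qed
              qed simp
              finally show ?thesis by simp
            qed
            ultimately show False using bq by simp
          qed
        qed
        also have "row_word R @ ?w @ ?col = x @ ?col" by (simp add: xR)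
        also have "ct (a + m) (x @ ?col) = (k + e) # \<kappa>"
        proof -
          have "word_on (a + m) (x @ ?col)"
            using wc word_on_mset[of c "x @ ?col"] mc by (simp add: ac_simps del: mset_upt)
          from ct_append_column[OF this e0] show ?thesis using x0 k bme by (simp add: k_def ac_simps)
        qed
        finally have "ct (a + m) c = (k + e) # \<kappa>" using ct_knuth[OF c] by simp
        then show ?thesis unfolding cc ctx using False True k mM by (simp add: e_def)
      next
        case km: False
        \<comment> \<open>The last letter of this run is \<open>b + 1\<close>, and it lies in
          \<open>As\<close>, which is read before \<open>Bs\<close>. So the first
          \<open>m + 1\<close> letters of the second column are all in \<open>As\<close>:
          \<open>m\<close> of them head the rows of \<open>A\<close>, and \<open>b + m + 1\<close>
          heads the first row of \<open>R\<close>.\<close>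
        then have "decr b (Suc m) x" using decr_mono[OF wx run_props(2)[OF wx]] k_def by simp
        then have fx: "filter (\<lambda>y. y \<le> b + Suc m) (row_word As) @ filter (\<lambda>y. y \<le> b + Suc m) (row_word Bs) =
            rev [Suc (Suc b)..<Suc (b + Suc m)] @ [Suc b]"
          using upt_Suc_Cons[of b m] unfolding decr_def by (simp add: x_def)
        have exb: "Suc b \<in> set (row_word As)" using ex x0 unfolding x_def b_def lM by blast
        have dx: "distinct (row_word As @ row_word Bs)" using wx by (simp add: word_on_def x_def)
        have fB: "filter (\<lambda>y. y \<le> b + Suc m) (row_word Bs) = []" by (rule filter_eq_snoc[OF fx exb dx])
        have fA: "filter (\<lambda>y. y \<le> b + Suc m) (row_word As) = rev [Suc b..<Suc (b + Suc m)]"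
          using fx fB upt_Suc_Cons[of b m] by simp
        obtain A1 R1 where A1: "As = xrows b A1 @ R1" "length A1 = Suc m"
          "\<forall>y\<in>set (row_word A1) \<union> set (row_word R1). b + Suc m < y"
          using tableau_xrows[OF st _ _ _ fA] srt gt dx by (auto simp: b_def)
        obtain A0 r0 where A0: "A1 = A0 @ [r0]" "length A0 = m"
          using A1(2) by (metis append_butlast_last_id length_butlast diff_Suc_1 list.size(3) nat.distinct(1))
        have As: "As = xrows b A0 @ ((Suc (b + m) # r0) # R1)" using A1(1) A0 by (simp add: xrows_append)
        have A: "A = xrows b A0" and R: "R = (Suc (b + m) # r0) # R1"
          using As A0(2) by (auto simp: A_def R_def)
        have gB: "\<forall>y\<in>set (row_word Bs). b + Suc m < y" using fB by (auto simp: filter_empty_conv not_le)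
        have gA: "\<forall>y\<in>set (row_word A0) \<union> set (row_word Bs). b + length A0 < y"
        proof
          fix y assume "y \<in> set (row_word A0) \<union> set (row_word Bs)"
          then have "b + Suc m < y" using gB A1(3) A0(1) by auto
          then show "b + length A0 < y" using A0(2) by simp
        qed
        have gR: "\<forall>y\<in>set (row_word R). b + m < y"
        proof
          fix y assume "y \<in> set (row_word R)"
          then have "y = Suc (b + m) \<or> b + Suc m < y" using A1(3) A0(1) unfolding R by auto
          then show "b + m < y" by auto
        qed
        \<comment> \<open>Insert the letters of \<open>Bs\<close> into the block \<open>A\<close>:
          \<open>A'\<close> is the resulting block without its column, \<open>low\<close> is the
          overflow.\<close>
        define A' low where "A' = fst (block_insert_word (row_word Bs) A0)" and "low = snd (block_insert_word (row_word Bs) A0)"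
        have bx: "block_insert_word (row_word Bs) (xrows b A0) = (xrows b A', low)"
          using block_insert_word_xrows[OF gA] by (simp add: A'_def low_def)
        have setA': "set (row_word A') \<union> set low = set (row_word Bs) \<union> set (row_word A0)"
          using block_insert_word_set[of "row_word Bs" A0] by (simp add: A'_def low_def)
        have dA: "distinct (row_word A @ row_word Bs)" "distinct (row_word R @ row_word A @ row_word Bs)"
          using dx by (auto simp: AR(1))
        have sA0: "\<forall>r\<in>set A0. sorted_wrt (<) r"
        proof -
          have "\<forall>r\<in>set (xrows b A0). sorted_wrt (<) r" using srtR(2) A by simp
          then show ?thesis by (induction A0 arbitrary: b) auto
        qed
        have dA0: "distinct (row_word A0 @ row_word Bs)"
        proof -
          have "mset (row_word A @ row_word Bs) = mset ([Suc b..<Suc (b + length A0)] @ row_word A0 @ row_word Bs)"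
            by (simp add: A mset_xrows del: mset_upt)
          then show ?thesis using dA(1) mset_eq_imp_distinct_iff by (metis distinct_append)
        qed
        have kA0: "length A' = m" "\<forall>r\<in>set A'. sorted_wrt (<) r"
          using block_insert_word_props[OF sA0 dA0] A0(2) by (auto simp: A'_def)
        have kA: "row_word A @ row_word Bs \<approx> low @ row_word (xrows b A')"
          using block_insert_word_props[of A "row_word Bs"] srtR(2) dA(1) bx by (simp add: A)
        \<comment> \<open>The overflow is written as rows of one letter each, in whatever order they
          come; \<open>ct_xform\<close> accepts such rows below the column. Since
          \<open>a + m + e = b\<close>, the columns of \<open>R\<close> and \<open>A'\<close> join
          to one of length \<open>M\<close>.\<close>
        have xf: "row_word (xrows (a + m) (R @ A') @ map (\<lambda>y. [y]) (rev low)) =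
            low @ row_word (xrows b A') @ row_word (xrows (a + m) R)"
          using bme AR(3) by (simp add: xrows_append)
        have "c \<approx> row_word (xrows (a + m) (R @ A') @ map (\<lambda>y. [y]) (rev low))"
          using knuth_app_right[OF kA, of "row_word (xrows (a + m) R)"] unfolding xf by (simp add: c_def)
        note cX = this
        have lRA: "length (R @ A') = M" "a + m + M = b + m" using AR(3) kA0(1) mM by (auto simp: e_def b_def)
        have "ct (a + m) c = length (R @ A') # ct (a + m + length (R @ A'))
            (row_word (R @ A') @ row_word (map (\<lambda>y. [y]) (rev low)))"
        proof (rule ct_xform[OF wc cX])
          show "R @ A' \<noteq> []" using R0 by simp
          show "\<forall>r\<in>set (R @ A') \<union> set (map (\<lambda>y. [y]) (rev low)). sorted_wrt (<) r"
            using srtR(1) kA0(2) by auto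
          have "Suc (b + m) \<in> set (row_word (R @ A'))" unfolding R by simp
          then show "Suc (a + m + length (R @ A')) \<in> set (row_word (R @ A')) \<or>
              row_word (R @ A') @ row_word (map (\<lambda>y. [y]) (rev low)) = []"
            unfolding lRA by blast
        qed
        then have ctc: "ct (a + m) c = M # ct (b + m) (row_word A' @ row_word R @ low)"
          unfolding lRA by simp
        have "catw b m (P_tableau x) \<approx> row_word A' @ row_word R @ low"
        proof -
          let ?F = "filter (\<lambda>r. r \<noteq> [])"
          have fX: "?F (xrows b A') = xrows b A'" if "True" for A' by (induction A' arbitrary: b) auto
          have FAs: "?F As = xrows b A0 @ ?F R"
            unfolding AR(1) A using fX by simp
          have csF: "column_strict (?F T)" if "stacked T" "set T \<subseteq> set As" for T
            using stacked_filter[OF that(1)] that(2) srt by (auto simp: column_strict_conv dest: strict_sorted_imp_sorted)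
          have stR: "stacked R" using st unfolding AR(1) by (simp add: stacked_append)
          let ?G = "fold tab_insert low (?F R)"
          \<comment> \<open>The tableau of \<open>x\<close> arises by inserting \<open>Bs\<close>
            into the rows of \<open>As\<close>. It splits in the same way: the first
            \<open>m\<close> rows become \<open>xrows b A'\<close>, and the overflow is inserted
            into \<open>R\<close>. Its catabolism therefore has the word just found, up to Knuth
            equivalence.\<close>
          have ft: "fold tab_insert (row_word Bs) (?F As) = xrows b A' @ ?G"
            using fold_tab_insert_append[of "row_word Bs" "xrows b A0" "?F R"] bx FAs by simp
          have "column_strict (xrows b A' @ ?G)" "row_word (xrows b A' @ ?G) \<approx> x"
            using fold_tab_insert[of "?F As" "row_word Bs"] csF[OF st] dx unfolding ft by (auto simp: row_word_filter x_def)
          then have Px: "P_tableau x = xrows b A' @ ?G" using dx by (intro P_tableau_eq) (auto simp: x_def)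
          have lowsub: "distinct (row_word R @ low)"
          proof -
            have "distinct (low @ row_word (xrows b A'))" using knuth_distinct[OF kA] dA(1) by simp
            moreover have "set low \<inter> set (row_word R) = {}"
              using knuth_set[OF kA] dA(2) by auto
            ultimately show ?thesis using dA(2) by auto
          qed
          have G: "row_word ?G \<approx> row_word R @ low"
            using fold_tab_insert[of "?F R" low] csF[OF stR] lowsub AR(1) by (simp add: row_word_filter)
          have "\<forall>y\<in>set (row_word A') \<union> set (row_word ?G). b + m < y"
            using knuth_set[OF G] gR gA setA' A0(2) by auto
          then have "catw b m (P_tableau x) = row_word A' @ row_word ?G"
            using catw_xrows[of m A' ?G b] kA0(1) unfolding Px by simp
          then show ?thesis using knuth_app_left[OF G, of "row_word A'"] by simp
        qed
        then have "ct (b + m) (row_word A' @ row_word R @ low) = ct (b + m) (catw b m (P_tableau x))"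
          by (rule ct_knuth[OF knuth_sym])
        also have "\<dots> = fct m (ct b x)"
          using "1.IH" lu "1.prems"(2) mM wx km k_def by auto
        finally have "ct (a + m) c = M # fct m (ct b x)" using ctc by simp
        then show ?thesis unfolding cc ctx using False km k by simp
      qed
    qed
  qed
qed

section \<open>Catabolizability in terms of the catabolism type\<close>

subsection \<open>Standardization\<close>

text \<open>
  Ties between equal letters are broken from left to right; \<open>M\<close> is the multiset of the letters
  already read and \<open>N\<close> a bound on the length of the whole word.
\<close>

fun stdz :: "nat \<Rightarrow> nat multiset \<Rightarrow> nat list \<Rightarrow> nat list" where
  "stdz N M [] = []"
| "stdz N M (x # u) = (x * N + count M x) # stdz N (add_mset x M) u"

lemma stdz_append: "stdz N M (u @ v) = stdz N M u @ stdz N (M + mset u) v"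
  by (induction u arbitrary: M) (auto simp: ac_simps)

lemma length_stdz [simp]: "length (stdz N M u) = length u"
  by (induction u arbitrary: M) auto

lemma count_le_size': "count M x \<le> size M"
  by (metis count_le_replicate_mset_subset_eq size_mset_mono size_replicate_mset order_refl)

lemma stdz_div:
  "size M + length u \<le> N \<Longrightarrow> map (\<lambda>x. x div N) (stdz N M u) = u"
proof (induction u arbitrary: M)
  case (Cons x u)
  have "count M x < N" using Cons.prems count_le_size'[of M x] by simp
  then show ?case using Cons by simp
qed simp

lemma stdz_bound:
  "y \<in> set (stdz N M u) \<Longrightarrow> size M + length u \<le> N \<Longrightarrow>
    \<exists>x c. y = x * N + c \<and> count M x \<le> c \<and> c < N \<and> x \<in> set u"
proof (induction u arbitrary: M)
  case (Cons x u)
  show ?case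
  proof (cases "y = x * N + count M x")
    case True
    then show ?thesis using Cons.prems(2) count_le_size'[of M x] by (intro exI[of _ x] exI[of _ "count M x"]) simp
  next
    case False
    then have "y \<in> set (stdz N (add_mset x M) u)" using Cons.prems(1) by simp
    then obtain x' c where "y = x' * N + c" "count (add_mset x M) x' \<le> c" "c < N" "x' \<in> set u"
      using Cons.IH[of "add_mset x M"] Cons.prems(2) by auto
    moreover have "count M x' \<le> count (add_mset x M) x'" by simp
    ultimately show ?thesis by (intro exI[of _ x'] exI[of _ c]) auto
  qed
qed simp

lemma div_mod_eq:
  assumes "x * N + c = x' * N + c'" "c < N" "c' < (N::nat)" shows "x = x' \<and> c = c'"
proof -
  have "(x * N + c) div N = x" "(x' * N + c') div N = x'" using assms(2,3) by simp_all
  then have "x = x'" using assms(1) by simp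
  then show ?thesis using assms(1) by simp
qed

lemma distinct_stdz: "size M + length u \<le> N \<Longrightarrow> distinct (stdz N M u)"
proof (induction u arbitrary: M)
  case (Cons x u)
  have "x * N + count M x \<notin> set (stdz N (add_mset x M) u)"
  proof
    assume "x * N + count M x \<in> set (stdz N (add_mset x M) u)"
    then obtain x' c where *: "x * N + count M x = x' * N + c" "count (add_mset x M) x' \<le> c" "c < N"
      using stdz_bound[of _ N "add_mset x M" u] Cons.prems by force
    have "count M x < N" using Cons.prems count_le_size'[of M x] by simp
    from div_mod_eq[OF *(1) this *(3)] *(2) show False by auto
  qed
  then show ?case using Cons by simp
qed simp

lemma less_div_less: "x < y \<Longrightarrow> c < N \<Longrightarrow> x * N + c < y * (N::nat) + d"
proof -
  assume a: "x < y" "c < N"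
  then have "Suc x * N \<le> y * N" by (intro mult_right_mono) auto
  then show ?thesis using a by simp
qed

text \<open>The two letters of a Knuth step that may coincide keep their relative order, so after
  breaking ties from left to right both inequalities are strict.\<close>

lemma stdz_knuth:
  assumes "u \<approx> v" "length u \<le> N" shows "stdz N {#} u \<approx> stdz N {#} v"
  using assms
proof (induction rule: equivclp_induct)
  case (step v w)
  have l: "length v \<le> N" using step.hyps(1) knuth_length step.prems by simp
  have *: "stdz N {#} p \<approx> stdz N {#} q" if "knuth_step p q" "length p \<le> N" for p q
    using that
  proof cases
    case (1 x y z p' q')
    let ?M = "mset p'"
    have c: "count ?M w < N" "count ?M w + 1 < N" for w
      using count_le_size'[of ?M w] that(2) 1 by auto
    have e: "stdz N {#} p = stdz N {#} p' @ [y * N + count ?M y, x * N + count ?M x,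
        z * N + count (add_mset y ?M) z] @ stdz N (?M + {#x, y, z#}) q'"
      using 1 by (simp add: stdz_append add_mset_commute)
    have e': "stdz N {#} q = stdz N {#} p' @ [y * N + count ?M y, z * N + count (add_mset y ?M) z,
        x * N + count ?M x] @ stdz N (?M + {#x, y, z#}) q'"
      using 1 by (simp add: stdz_append add_mset_commute)
    have "x * N + count ?M x < y * N + count ?M y" using 1 c by (intro less_div_less) auto
    moreover have "y * N + count ?M y < z * N + count (add_mset y ?M) z"
      using 1 c less_div_less[of y z "count ?M y" N] by (cases "y = z") auto
    ultimately have "[y * N + count ?M y, x * N + count ?M x, z * N + count (add_mset y ?M) z] \<approx>
        [y * N + count ?M y, z * N + count (add_mset y ?M) z, x * N + count ?M x]"
      by (rule knuth_yxz)
    then show ?thesis unfolding e e' by (rule knuth_ctx)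
  next
    case (2 x y z p' q')
    let ?M = "mset p'"
    have c: "count ?M w < N" "count ?M w + 1 < N" for w
      using count_le_size'[of ?M w] that(2) 2 by auto
    have e: "stdz N {#} p = stdz N {#} p' @ [x * N + count ?M x, z * N + count ?M z,
        y * N + count (add_mset x ?M) y] @ stdz N (?M + {#x, y, z#}) q'"
      using 2 by (simp add: stdz_append add_mset_commute)
    have e': "stdz N {#} q = stdz N {#} p' @ [z * N + count ?M z, x * N + count ?M x,
        y * N + count (add_mset x ?M) y] @ stdz N (?M + {#x, y, z#}) q'"
      using 2 by (simp add: stdz_append add_mset_commute)
    have "x * N + count ?M x < y * N + count (add_mset x ?M) y"
      using 2 c less_div_less[of x y "count ?M x" N] by (cases "x = y") auto
    moreover have "y * N + count (add_mset x ?M) y < z * N + count ?M z"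
      using 2 c by (intro less_div_less) auto
    ultimately have "[x * N + count ?M x, z * N + count ?M z, y * N + count (add_mset x ?M) y] \<approx>
        [z * N + count ?M z, x * N + count ?M x, y * N + count (add_mset x ?M) y]"
      by (rule knuth_xzy)
    then show ?thesis unfolding e e' by (rule knuth_ctx)
  qed
  have "stdz N {#} v \<approx> stdz N {#} w"
    using step.hyps(2)
  proof
    assume "knuth_step v w" then show ?thesis using * l by blast
  next
    assume "knuth_step w v"
    moreover from this have "length w \<le> N" using l by cases auto
    ultimately show ?thesis using * knuth_sym by blast
  qed
  then show ?case using step.IH step.prems knuth_trans by blast
qed simp

text \<open>
  In a word that is Knuth equivalent to a standardization, letters with equal quotient by \<open>N\<close>
  increase from left to right; therefore forgetting the tie-breaking respects Knuth steps.
\<close>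

lemma knuth_increasing:
  assumes "u \<approx> v" "sorted_wrt (<) u" shows "v = u"
  using assms
proof (induction rule: equivclp_induct)
  case (step y z)
  have "\<not> sorted_wrt (<) a \<and> \<not> sorted_wrt (<) b" if "knuth_step a b" for a b
    using that by cases (auto simp: sorted_wrt_append)
  with step show ?case by metis
qed simp

definition ties :: "nat \<Rightarrow> nat list \<Rightarrow> bool" where
  "ties N u \<longleftrightarrow> (\<forall>c. sorted_wrt (<) (filter (\<lambda>x. x div N = c) u))"

lemma ties_stdz: "size M + length u \<le> N \<Longrightarrow> ties N (stdz N M u)"
proof (induction u arbitrary: M)
  case (Cons x u)
  have c: "count M x < N" using Cons.prems count_le_size'[of M x] by simp
  have "x * N + count M x < y" if y: "y \<in> set (stdz N (add_mset x M) u)" "y div N = x" for y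
  proof -
    obtain x' c' where *: "y = x' * N + c'" "count (add_mset x M) x' \<le> c'" "c' < N"
      using stdz_bound[OF y(1)] Cons.prems by force
    then have "x' = x" using y(2) by auto
    then show ?thesis using * by simp
  qed
  then show ?case using Cons c by (auto simp: ties_def)
qed (simp add: ties_def)

lemma ties_knuth:
  assumes "u \<approx> v" "ties N u" shows "ties N v"
  unfolding ties_def
proof
  fix c
  have "filter (\<lambda>x. x div N = c) u \<approx> filter (\<lambda>x. x div N = c) v"
  proof (rule knuth_filter[OF assms(1)])
    fix x y z :: nat assume "x \<le> y" "y \<le> z" "x div N = c" "z div N = c"
    then show "y div N = c" by (metis div_le_mono le_antisym)
  qed
  then show "sorted_wrt (<) (filter (\<lambda>x. x div N = c) v)"
    using knuth_increasing assms(2) unfolding ties_def by metis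
qed

lemma ties_less:
  assumes "ties N (p @ x # q @ y # r)" "y \<le> x" shows "y div N < x div N"
proof (rule ccontr)
  assume "\<not> ?thesis"
  then have "x div N = y div N" using div_le_mono[OF assms(2), of N] by simp
  moreover have "sorted_wrt (<) (filter (\<lambda>z. z div N = x div N) (p @ x # q @ y # r))"
    using assms(1) unfolding ties_def by blast
  ultimately show False using assms(2) by (simp add: sorted_wrt_append)
qed

lemma knuth_map_div:
  assumes "u \<approx> v" "ties N u" shows "map (\<lambda>x. x div N) u \<approx> map (\<lambda>x. x div N) v"
  using assms
proof (induction rule: equivclp_induct)
  case (step v w)
  have tv: "ties N v" using ties_knuth[OF step.hyps(1) step.prems] .
  have *: "map (\<lambda>x. x div N) p \<approx> map (\<lambda>x. x div N) q" if "knuth_step p q" "ties N p" for p q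
    using that
  proof cases
    case (1 x y z p' q')
    have "x div N < y div N" using ties_less[of N p' y "[]" x "z # q'"] that(2) 1 by simp
    moreover have "y div N \<le> z div N" using 1 by (simp add: div_le_mono)
    ultimately show ?thesis unfolding 1 using knuth_step.intros(1) by (simp add: r_into_equivclp)
  next
    case (2 x y z p' q')
    have "y div N < z div N" using ties_less[of N "p' @ [x]" z "[]" y q'] that(2) 2 by simp
    moreover have "x div N \<le> y div N" using 2 by (simp add: div_le_mono)
    ultimately show ?thesis unfolding 2 using knuth_step.intros(2) by (simp add: r_into_equivclp)
  qed
  have "map (\<lambda>x. x div N) v \<approx> map (\<lambda>x. x div N) w"
    using step.hyps(2)
  proof
    assume "knuth_step v w" then show ?thesis using * tv by blast
  next
    assume wv: "knuth_step w v"
    then have "v \<approx> w" by (intro knuth_sym[of w v]) (simp add: r_into_equivclp)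
    then show ?thesis using * wv ties_knuth[OF _ tv] knuth_sym by blast
  qed
  then show ?case using step.IH step.prems knuth_trans by blast
qed simp

fun stdz_tab :: "nat \<Rightarrow> tableau \<Rightarrow> tableau" where
  "stdz_tab N [] = []"
| "stdz_tab N (r # T) = stdz N (mset (row_word T)) r # stdz_tab N T"

lemma row_word_stdz_tab: "row_word (stdz_tab N T) = stdz N {#} (row_word T)"
  by (induction T) (auto simp: stdz_append)

lemma sorted_stdz:
  "sorted r \<Longrightarrow> size M + length r \<le> N \<Longrightarrow> sorted_wrt (<) (stdz N M r)"
proof (induction r arbitrary: M)
  case (Cons x r)
  have c: "count M x < N" using Cons.prems count_le_size'[of M x] by simp
  have "x * N + count M x < y" if y: "y \<in> set (stdz N (add_mset x M) r)" for y
  proof -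
    obtain x' c' where *: "y = x' * N + c'" "count (add_mset x M) x' \<le> c'" "x' \<in> set r"
      using stdz_bound[OF y] Cons.prems by force
    show ?thesis
    proof (cases "x = x'")
      case False
      then have "x < x'" using *(3) Cons.prems(1) by auto
      then show ?thesis using * c less_div_less by simp
    qed (use * in auto)
  qed
  then show ?case using Cons by auto
qed simp

lemma stdz_nth:
  assumes "i < length u" "size M + length u \<le> N"
  shows "u ! i * N \<le> stdz N M u ! i \<and> stdz N M u ! i < Suc (u ! i) * N"
proof -
  have "stdz N M u ! i div N = u ! i"
    using stdz_div[OF assms(2)] assms(1) by (metis length_stdz nth_map)
  moreover have "0 < N" using assms by simp
  ultimately show ?thesis
    by (metis div_less_iff_less_mult div_times_less_eq_dividend lessI)
qed

lemma column_strict_stdz: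
  "column_strict T \<Longrightarrow> length (row_word T) \<le> N \<Longrightarrow> column_strict (stdz_tab N T)"
proof (induction T)
  case (Cons r T)
  have T: "column_strict T" using Cons.prems(1) by (cases T) (auto simp: column_strict_conv)
  have r: "sorted_wrt (<) (stdz N (mset (row_word T)) r)" "stdz N (mset (row_word T)) r \<noteq> []"
  proof -
    have "sorted r" "r \<noteq> []" using Cons.prems(1) by (simp_all add: column_strict_conv)
    then show "sorted_wrt (<) (stdz N (mset (row_word T)) r)" "stdz N (mset (row_word T)) r \<noteq> []"
      using Cons.prems(2) sorted_stdz[of r "mset (row_word T)" N] by (simp, cases r) simp_all
  qed
  have "stacked2 (stdz N (mset (row_word T)) r) (stdz N (mset (row_word T')) s)" if "T = s # T'" for s T'
    unfolding stacked2_def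
  proof (intro conjI allI impI)
    have st: "stacked2 r s" using Cons.prems(1) that by (simp add: column_strict_conv)
    then show "length (stdz N (mset (row_word T')) s) \<le> length (stdz N (mset (row_word T)) r)"
      by (simp add: stacked2_def)
    fix i assume i: "i < length (stdz N (mset (row_word T')) s)"
    then have "r ! i < s ! i" "i < length r" using st by (auto simp: stacked2_def)
    moreover have "stdz N (mset (row_word T)) r ! i < Suc (r ! i) * N"
      using stdz_nth[of i r "mset (row_word T)" N] calculation(2) Cons.prems(2) by simp
    moreover have "s ! i * N \<le> stdz N (mset (row_word T')) s ! i"
      using stdz_nth[of i s "mset (row_word T')" N] i Cons.prems(2) that by simp
    moreover have "Suc (r ! i) * N \<le> s ! i * N" using calculation(1) by (intro mult_right_mono) auto
    ultimately show "stdz N (mset (row_word T)) r ! i < stdz N (mset (row_word T')) s ! i" by linarith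
  qed
  then show ?case using Cons.IH[OF T] Cons.prems(2) r
    by (cases T) (auto simp: column_strict_conv strict_sorted_imp_sorted)
qed (simp add: column_strict_conv)

lemma stdz_tab_div:
  "length (row_word T) \<le> N \<Longrightarrow> map (map (\<lambda>x. x div N)) (stdz_tab N T) = T"
  by (induction T) (auto simp: stdz_div)

lemma sorted_map_div: "sorted (r::nat list) \<Longrightarrow> sorted (map (\<lambda>x. x div N) r)"
  by (induction r) (auto intro: div_le_mono)

lemma column_strict_div:
  assumes "column_strict T" "ties N (row_word T)"
  shows "column_strict (map (map (\<lambda>x. x div N)) T)"
  using assms
proof (induction T)
  case (Cons r T)
  have T: "column_strict T" using Cons.prems(1) by (cases T) (auto simp: column_strict_conv)
  have tT: "ties N (row_word T)"
    unfolding ties_def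
  proof
    fix c
    have "sorted_wrt (<) (filter (\<lambda>x. x div N = c) (row_word T @ r))"
      using Cons.prems(2) unfolding ties_def by simp
    then show "sorted_wrt (<) (filter (\<lambda>x. x div N = c) (row_word T))"
      unfolding filter_append sorted_wrt_append by blast
  qed
  have "sorted (map (\<lambda>x. x div N) r)" "r \<noteq> []"
    using Cons.prems(1) sorted_map_div[of r N] by (simp_all add: column_strict_conv)
  moreover have "stacked2 (map (\<lambda>x. x div N) r) (map (\<lambda>x. x div N) s)" if T: "T = s # T'" for s T'
    unfolding stacked2_def
  proof (intro conjI allI impI)
    have st: "stacked2 r s" using Cons.prems(1) T by (simp add: column_strict_conv)
    then show "length (map (\<lambda>x. x div N) s) \<le> length (map (\<lambda>x. x div N) r)" by (simp add: stacked2_def)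
    fix i assume "i < length (map (\<lambda>x. x div N) s)"
    then have i: "i < length s" "i < length r" "r ! i < s ! i" using st by (auto simp: stacked2_def)
    have s: "s = take i s @ s ! i # drop (Suc i) s" and r: "r = take i r @ r ! i # drop (Suc i) r"
      using i id_take_nth_drop by blast+
    have "row_word (r # T) = (row_word T' @ take i s) @ s ! i # (drop (Suc i) s @ take i r) @ r ! i # drop (Suc i) r"
      using s r T by (metis append.assoc append_Cons row_word_Cons)
    then have "r ! i div N < s ! i div N" using ties_less Cons.prems(2) i(3) by (metis less_imp_le)
    then show "map (\<lambda>x. x div N) r ! i < map (\<lambda>x. x div N) s ! i" using i by simp
  qed
  ultimately show ?case using Cons.IH[OF T tT] by (cases T) (auto simp: column_strict_conv)
qed (simp add: column_strict_conv)

lemma row_word_map: "row_word (map (map f) T) = map f (row_word T)"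
  by (induction T) auto

text \<open>The recursion of \<open>catabolizable\<close> forms a tableau \<open>P\<close> before
  its letters are known to be distinct. Existence and uniqueness for all words are obtained from the
  standard case by standardizing and dividing by \<open>N\<close>.\<close>

lemma P_tableau_general: "column_strict (P_tableau u) \<and> row_word (P_tableau u) \<approx> u"
proof -
  define N where "N = length u"
  define T where "T = map (map (\<lambda>x. x div N)) (P_tableau (stdz N {#} u))"
  have d: "distinct (stdz N {#} u)" by (intro distinct_stdz) (simp add: N_def)
  note P = P_tableau_props[OF d]
  have t: "ties N (stdz N {#} u)" by (intro ties_stdz) (simp add: N_def)
  have tP: "ties N (row_word (P_tableau (stdz N {#} u)))"
    using ties_knuth[OF knuth_sym[OF P(2)] t] .
  have T: "column_strict T" unfolding T_def by (rule column_strict_div[OF P(1) tP])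
  have "row_word T \<approx> map (\<lambda>x. x div N) (stdz N {#} u)"
    unfolding T_def row_word_map by (rule knuth_map_div[OF P(2) tP])
  then have Tu: "row_word T \<approx> u" using stdz_div[of "{#}" u N] by (simp add: N_def)
  have "P_tableau u = T" unfolding P_tableau_def
  proof (rule the_equality)
    fix T' assume T': "column_strict T' \<and> row_word T' \<approx> u"
    have uniq: "stdz_tab N S = P_tableau (stdz N {#} u)" if S: "column_strict S" "row_word S \<approx> u" for S
    proof -
      have l: "length (row_word S) \<le> N" using knuth_length[OF S(2)] by (simp add: N_def)
      have "row_word (stdz_tab N S) \<approx> stdz N {#} u"
        unfolding row_word_stdz_tab by (rule stdz_knuth[OF S(2) l])
      then show ?thesis using P_tableau_eq[OF column_strict_stdz[OF S(1) l] _ d] by simp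
    qed
    have l: "length (row_word T') \<le> N" using knuth_length[of "row_word T'" u] T' by (simp add: N_def)
    show "T' = T" unfolding T_def using uniq[of T'] stdz_tab_div[OF l] T' by simp
  qed (use T Tu in blast)
  with T Tu show ?thesis by simp
qed

subsection \<open>The criterion\<close>

text \<open>By \<open>ct_catw\<close> the list \<open>fct m \<kappa>\<close> is the type after a
  column of size \<open>m\<close> has been removed. Thus the whole recursion of catabolizability
  becomes arithmetic on one list.\<close>

fun good :: "nat list \<Rightarrow> nat list \<Rightarrow> bool" where
  "good [] \<kappa> \<longleftrightarrow> \<kappa> = []"
| "good (m # \<eta>) \<kappa> \<longleftrightarrow> \<kappa> \<noteq> [] \<and> m \<le> hd \<kappa> \<and> good \<eta> (fct m \<kappa>)"

lemma row_word_trow: "(\<forall>i. trow T i = trow T' i) \<Longrightarrow> row_word T = row_word T'"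
proof (induction T arbitrary: T')
  case Nil
  then have "\<forall>r\<in>set T'. r = []" by (auto simp: trow_def in_set_conv_nth) metis
  then show ?case by (induction T') auto
next
  case (Cons r T)
  show ?case
  proof (cases T')
    case Nil
    have "\<forall>s\<in>set (r # T). s = []"
    proof
      fix s assume "s \<in> set (r # T)"
      then obtain i where "i < length (r # T)" "(r # T) ! i = s" by (meson in_set_conv_nth)
      then show "s = []" using Cons.prems[rule_format, of i] Nil by (simp add: trow_def)
    qed
    then have "row_word (r # T) = []" by (induction T) auto
    then show ?thesis using Nil by simp
  next
    case T': (Cons r' T1)
    have "r = r'" using Cons.prems[rule_format, of 0] T' by (simp add: trow_def)
    moreover have "\<forall>i. trow T i = trow T1 i"
    proof
      fix i show "trow T i = trow T1 i" using Cons.prems[rule_format, of "Suc i"] T' by (simp add: trow_def split: if_splits)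
    qed
    ultimately show ?thesis using Cons.IH T' by simp
  qed
qed

lemma row_word_restrict: "row_word (restrict_tab A S) = filter (\<lambda>x. x \<in> A) (row_word S)"
  unfolding restrict_tab_def by (induction S) auto

lemma Y_tableau_ones: "Y_tableau a (replicate m 1) = xrows a (replicate m [])"
proof (induction m arbitrary: a)
  case (Suc m)
  have "Y_tableau a (replicate (Suc m) 1) = [a + 1] # Y_tableau (Suc a) (replicate m 1)"
    unfolding Y_tableau_def length_replicate upt_conv_Cons[OF zero_less_Suc]
    by (simp add: map_Suc_upt[symmetric] del: map_Suc_upt replicate_Suc) simp
  then show ?case using Suc by simp
qed (simp add: Y_tableau_def)

lemma H_op_catw: "H_op m (remove_tab {a + 1..a + m} S) = P_tableau (catw a m S)"
  by (simp add: H_op_def catw_def)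

lemma ct_length_pos: "word_on a u \<Longrightarrow> u \<noteq> [] \<Longrightarrow> ct a u \<noteq> [] \<and> hd (ct a u) = run a u"
  by (metis ct_run list.sel(1) list.distinct(1))

lemma restrict_xrows:
  assumes "\<forall>x\<in>set (row_word A) \<union> set (row_word B). a + length A < x"
  shows "trow (restrict_tab {a + 1..a + length A} (xrows a A @ B)) i = trow (xrows a (replicate (length A) [])) i"
proof -
  have 1: "restrict_tab {c + 1..d} (xrows a A) = xrows a (replicate (length A) [])"
    if "c \<le> a" "a + length A \<le> d" "\<forall>x\<in>set (row_word A). d < x" for c d
    using that
  proof (induction A arbitrary: a)
    case (Cons r A)
    have "\<forall>x\<in>set r. d < x" using Cons.prems(3) by simp
    then have "filter (\<lambda>x. c + 1 \<le> x \<and> x \<le> d) r = []" by (auto simp: filter_empty_conv not_le)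
    then show ?case using Cons.IH[of "Suc a"] Cons.prems by (simp add: restrict_tab_def)
  qed (simp add: restrict_tab_def)
  have 2: "\<forall>r\<in>set (restrict_tab {a + 1..a + length A} B). r = []"
  proof
    fix r assume "r \<in> set (restrict_tab {a + 1..a + length A} B)"
    then obtain s where s: "s \<in> set B" "r = filter (\<lambda>x. x \<in> {a + 1..a + length A}) s"
      by (auto simp: restrict_tab_def)
    then have "\<forall>x\<in>set s. a + length A < x" using assms by (auto simp: set_row_word)
    then show "r = []" unfolding s(2) by (auto simp: filter_empty_conv not_le)
  qed
  let ?Z = "restrict_tab {a + 1..a + length A} B"
  have "restrict_tab {a + 1..a + length A} (xrows a A @ B) = xrows a (replicate (length A) []) @ ?Z"
    using 1[of a "a + length A"] assms by (simp add: restrict_tab_def)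
  moreover have "trow (X @ ?Z) i = trow X i" for X
    using 2 by (auto simp: trow_def nth_append)
  ultimately show ?thesis by simp
qed

text \<open>The criterion sees only the Knuth class of the reading word, which is what makes
  catabolizability accessible to operations on words.\<close>

theorem catabolizable_iff:
  assumes "\<forall>m\<in>set \<eta>. 0 < m"
  shows "catabolizable a (map (\<lambda>m. replicate m 1) \<eta>) S \<longleftrightarrow>
    column_strict S \<and> word_on a (row_word S) \<and> length (row_word S) = sum_list \<eta> \<and> good \<eta> (ct a (row_word S))"
  using assms
proof (induction \<eta> arbitrary: a S)
  case Nil
  have "column_strict S \<Longrightarrow> row_word S = [] \<Longrightarrow> S = []"
    by (cases S) (auto simp: column_strict_conv)
  then show ?case by (auto simp: column_strict_conv word_on_def)
next
  case (Cons m \<eta>)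
  have m: "0 < m" using Cons.prems by simp
  let ?A = "{a + 1..a + m}" and ?S = "P_tableau (catw a m S)"
  have len: "map (\<lambda>m. length (replicate m (1::int))) \<eta> = \<eta>" by simp
  have IH: "catabolizable (a + m) (map (\<lambda>m. replicate m 1) \<eta>) T \<longleftrightarrow>
    column_strict T \<and> word_on (a + m) (row_word T) \<and> length (row_word T) = sum_list \<eta> \<and> good \<eta> (ct (a + m) (row_word T))" for T
    using Cons by simp
  have cat: "catabolizable a (map (\<lambda>m. replicate m 1) (m # \<eta>)) S \<longleftrightarrow>
      column_strict S \<and> set (row_word S) \<subseteq> {a + 1..a + (m + sum_list \<eta>)} \<and>
      (\<forall>i. trow (restrict_tab ?A S) i = trow (xrows a (replicate m [])) i) \<and>
      word_on (a + m) (row_word ?S) \<and> length (row_word ?S) = sum_list \<eta> \<and> good \<eta> (ct (a + m) (row_word ?S))"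
    using P_tableau_general[of "catw a m S"]
    by (simp add: Let_def IH H_op_catw[simplified] Y_tableau_ones set_row_word comp_def)
  have k: "row_word ?S \<approx> catw a m S" using P_tableau_general by blast
  have ctS: "ct (a + m) (row_word ?S) = ct (a + m) (catw a m S)" by (rule ct_knuth[OF k])
  have wS: "word_on (a + m) (row_word ?S) = word_on (a + m) (catw a m S)" by (rule word_on_knuth[OF k])
  have lS: "length (row_word ?S) = length (catw a m S)" by (rule knuth_length[OF k])
  show ?case
  proof
    assume "catabolizable a (map (\<lambda>m. replicate m 1) (m # \<eta>)) S"
    then have S: "column_strict S" "set (row_word S) \<subseteq> {a + 1..a + (m + sum_list \<eta>)}"
      "\<forall>i. trow (restrict_tab ?A S) i = trow (xrows a (replicate m [])) i"
      "word_on (a + m) (catw a m S)" "length (catw a m S) = sum_list \<eta>" "good \<eta> (ct (a + m) (catw a m S))"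
      using cat ctS wS lS by auto
    have f: "filter (\<lambda>x. x \<in> ?A) (row_word S) = rev [Suc a..<Suc (a + m)]"
      using row_word_trow[OF S(3)] by (simp add: row_word_restrict row_word_xrows_replicate)
    have cw: "mset (catw a m S) = mset (filter (\<lambda>x. x \<notin> ?A) (row_word S))"
    proof -
      have "mset (catw a m S) = mset (row_word (remove_tab ?A S))"
        unfolding catw_def mset_append
        by (subst add.commute) (metis (no_types) append_take_drop_id mset_append row_word_append)
      also have "row_word (remove_tab ?A S) = filter (\<lambda>x. x \<notin> ?A) (row_word S)"
        unfolding remove_tab_def by (induction S) auto
      finally show ?thesis .
    qed
    \<comment> \<open>Standardness of \<open>S\<close> is derived here: the restriction to the first
      block is a column containing each of its letters once, and the other letters are those of the
      next tableau.\<close>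
    have ms: "mset (row_word S) = mset (rev [Suc a..<Suc (a + m)] @ catw a m S)"
      by (metis cw f mset_append mset_filter multiset_partition)
    have w: "word_on a (row_word S)"
    proof -
      have "set [Suc a..<Suc (a + m)] = {a<..a + m}" by auto
      moreover have "set (catw a m S) = {a + m<..a + m + sum_list \<eta>}" "distinct (catw a m S)"
        using S(4,5) by (auto simp: word_on_def)
      ultimately have "word_on a (rev [Suc a..<Suc (a + m)] @ catw a m S)"
        using S(5) unfolding word_on_def by auto
      then show ?thesis using ms word_on_mset by blast
    qed
    have l: "length (row_word S) = m + sum_list \<eta>" using arg_cong[OF ms, of size] S(5) by simp
    have "filter (\<lambda>x. x \<le> a + m) (row_word S) = filter (\<lambda>x. x \<in> ?A) (row_word S)"
      using S(2) by (intro filter_cong) auto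
    then have "decr a m (row_word S)" using f by (simp add: decr_def)
    then have mr: "m \<le> run a (row_word S)" using run_props(3)[OF w] by blast
    have "P_tableau (row_word S) = S" using S(1) w by (intro P_tableau_eq) (auto simp: word_on_def)
    then have "ct (a + m) (catw a m S) = fct m (ct a (row_word S))"
      using ct_catw[OF w _ mr] m by simp
    moreover have "ct a (row_word S) \<noteq> [] \<and> hd (ct a (row_word S)) = run a (row_word S)"
      using ct_length_pos[OF w] l m by force
    ultimately show "column_strict S \<and> word_on a (row_word S) \<and> length (row_word S) = sum_list (m # \<eta>) \<and>
        good (m # \<eta>) (ct a (row_word S))"
      using S w l mr by simp
  next
    assume "column_strict S \<and> word_on a (row_word S) \<and> length (row_word S) = sum_list (m # \<eta>) \<and>
        good (m # \<eta>) (ct a (row_word S))"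
    then have S: "column_strict S" "word_on a (row_word S)" "length (row_word S) = m + sum_list \<eta>"
      "m \<le> hd (ct a (row_word S))" "good \<eta> (fct m (ct a (row_word S)))" by auto
    have ne: "row_word S \<noteq> []" using S(3) m by auto
    have mr: "m \<le> run a (row_word S)" using ct_length_pos[OF S(2) ne] S(4) by simp
    have PS: "P_tableau (row_word S) = S" using S(1,2) by (intro P_tableau_eq) (auto simp: word_on_def)
    have dm: "decr a m (row_word S)" using decr_mono[OF S(2) run_props(2)[OF S(2)] mr] .
    obtain A B where AB: "S = xrows a A @ B" "length A = m"
      "\<forall>x\<in>set (row_word A) \<union> set (row_word B). a + m < x"
      using P_tableau_xrows[OF S(2) dm] unfolding PS by metis
    have cw: "catw a m S = row_word A @ row_word B" using catw_xrows[of m A B a] AB by simp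
    have "word_on (a + m) (catw a m S)" "length (catw a m S) = sum_list \<eta>"
      using xform_word[OF S(2), of A B] S(3) AB cw by auto
    moreover have "good \<eta> (ct (a + m) (catw a m S))"
      using ct_catw[OF S(2) _ mr] m S(5) PS by simp
    moreover have "\<forall>i. trow (restrict_tab ?A S) i = trow (xrows a (replicate m [])) i"
      using restrict_xrows[of A B a] AB by simp
    moreover have "set (row_word S) \<subseteq> {a + 1..a + (m + sum_list \<eta>)}"
      using S(2,3) by (auto simp: word_on_def)
    ultimately show "catabolizable a (map (\<lambda>m. replicate m 1) (m # \<eta>)) S"
      unfolding cat ctS wS lS using S(1) by blast
  qed
qed

section \<open>Charge\<close>

text \<open>The letter \<open>i\<close> contributes the number of letters that are larger than it if it precedes \<open>i + 1\<close>.\<close>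

definition chg :: "nat \<Rightarrow> nat list \<Rightarrow> nat" where
  "chg a u = (\<Sum>i\<in>{a<..<a + length u}. if filter (\<lambda>x. x = i \<or> x = Suc i) u = [i, Suc i] then a + length u - i else 0)"

lemma chg_knuth:
  assumes "u \<approx> v" shows "chg a u = chg a v"
proof -
  have *: "filter (\<lambda>x. x = i \<or> x = Suc i) v = [i, Suc i]"
    if "u \<approx> v" "filter (\<lambda>x. x = i \<or> x = Suc i) u = [i, Suc i]" for i u v
  proof -
    have "filter (\<lambda>x. x = i \<or> x = Suc i) u \<approx> filter (\<lambda>x. x = i \<or> x = Suc i) v"
      using that(1) by (rule knuth_filter) auto
    then show ?thesis using knuth_increasing[of "[i, Suc i]"] that(2) by simp
  qed
  have "filter (\<lambda>x. x = i \<or> x = Suc i) u = [i, Suc i] \<longleftrightarrow> filter (\<lambda>x. x = i \<or> x = Suc i) v = [i, Suc i]" for i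
    using *[OF assms] *[OF knuth_sym[OF assms]] by blast
  then show ?thesis unfolding chg_def knuth_length[OF assms] by simp
qed

lemma filter_single:
  "distinct w \<Longrightarrow> y \<in> set w \<Longrightarrow> z \<notin> set w \<Longrightarrow> filter (\<lambda>x. x = y \<or> x = z) w = [y]"
proof (induction w)
  case (Cons x w)
  show ?case
  proof (cases "x = y")
    case True
    then have "filter (\<lambda>x. x = y \<or> x = z) w = []" using Cons.prems by (auto simp: filter_empty_conv)
    then show ?thesis using True by simp
  qed (use Cons in auto)
qed simp

lemma filter_single':
  "distinct w \<Longrightarrow> y \<in> set w \<Longrightarrow> z \<notin> set w \<Longrightarrow> filter (\<lambda>x. x = z \<or> x = y) w = [y]"
  using filter_single[of w y z] by (simp add: disj_commute)

text \<open>Only the pairs \<open>(z - 1, z)\<close> and \<open>(z, z + 1)\<close> change their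
  order. At the end of the word \<open>z\<close> completes the first pair, at the front it opens the
  second, whose contribution is smaller by one. If \<open>z\<close> is the largest letter, the
  second pair is absent and the first contributes exactly 1.\<close>

lemma chg_rotate:
  assumes "word_on a (w @ [z])" "z \<noteq> Suc a"
  shows "chg a (w @ [z]) = chg a (z # w) + 1"
proof -
  define n where "n = Suc (length w)"
  have d: "distinct w" "z \<notin> set w" and s: "insert z (set w) = {a<..a + n}"
    using assms(1) by (auto simp: word_on_def n_def)
  have zin: "a < z" "z \<le> a + n" using s by auto
  define y where "y = z - 1"
  have y: "z = Suc y" "a < y" "y < a + n" using zin assms(2) by (auto simp: y_def)
  have yw: "y \<in> set w"
  proof -
    have "y \<in> insert z (set w)" unfolding s using y by simp
    then show ?thesis using y by simp
  qed
  define F where "F u i = (if filter (\<lambda>x. x = i \<or> x = Suc i) u = [i, Suc i] then a + n - i else 0)" for u i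
  let ?S = "{a<..<a + n}" and ?u = "w @ [z]" and ?v = "z # w"
  have c: "chg a ?u = (\<Sum>i\<in>?S. F ?u i)" "chg a ?v = (\<Sum>i\<in>?S. F ?v i)"
    unfolding chg_def F_def n_def by (simp_all only: length_append length_Cons list.size(3) add_0_right add_Suc_right)
  have Fy: "F ?u y = a + n - y" "F ?v y = 0"
    using filter_single[OF d(1) yw d(2)] y(1) by (auto simp: F_def)
  have rest: "F ?u i = F ?v i" if "i \<noteq> y" "i \<noteq> z" for i using that y(1) by (auto simp: F_def)
  have yS: "y \<in> ?S" using y by simp
  have e: "(\<Sum>i\<in>?S. F u i) = F u y + (\<Sum>i\<in>?S - {y}. F u i)" for u
    using yS by (simp add: sum.remove)
  show ?thesis
  proof (cases "z = a + n")
    case True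
    then have "z \<notin> ?S" by simp
    then have "(\<Sum>i\<in>?S - {y}. F ?u i) = (\<Sum>i\<in>?S - {y}. F ?v i)" by (intro sum.cong refl rest) auto
    moreover have "a + n - y = 1" using True y(1) by simp
    ultimately show ?thesis unfolding c e using Fy by linarith
  next
    case False
    then have zS: "z \<in> ?S - {y}" using zin y by auto
    have zw: "Suc z \<in> set w"
    proof -
      have "Suc z \<in> insert z (set w)" unfolding s using zS by auto
      then show ?thesis by simp
    qed
    have Fz: "F ?u z = 0" "F ?v z = a + n - z"
      using filter_single'[OF d(1) zw d(2)] by (auto simp: F_def)
    have e2: "(\<Sum>i\<in>?S - {y}. F u i) = F u z + (\<Sum>i\<in>?S - {y} - {z}. F u i)" for u
      using zS by (simp add: sum.remove)
    have "(\<Sum>i\<in>?S - {y} - {z}. F ?u i) = (\<Sum>i\<in>?S - {y} - {z}. F ?v i)" by (intro sum.cong refl rest) auto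
    moreover have "a + n - y = 1 + (a + n - z)" using y(1) zS by auto
    ultimately show ?thesis unfolding c e e2 using Fy Fz by linarith
  qed
qed

lemma chg_rotate_many:
  "word_on a (w @ q) \<Longrightarrow> Suc a \<notin> set q \<Longrightarrow> chg a (w @ q) = chg a (q @ w) + length q"
proof (induction q arbitrary: w rule: rev_induct)
  case (snoc z q)
  have "chg a ((w @ q) @ [z]) = chg a (z # w @ q) + 1"
    using snoc.prems by (intro chg_rotate) auto
  moreover have "chg a ((z # w) @ q) = chg a (q @ z # w) + length q"
  proof (rule snoc.IH)
    show "word_on a ((z # w) @ q)" using snoc.prems(1) by (subst word_on_mset[of _ "w @ q @ [z]"]) auto
  qed (use snoc.prems in auto)
  ultimately show ?case by simp
qed simp

text \<open>Each letter of a final decreasing column follows its successor and contributes nothing;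
  removing the smallest letter from the end leaves the other contributions unchanged.\<close>

lemma chg_column:
  "word_on a (x @ rev [Suc a..<Suc (a + m)]) \<Longrightarrow> chg a (x @ rev [Suc a..<Suc (a + m)]) = chg (a + m) x"
proof (induction m arbitrary: a)
  case (Suc m)
  define w where "w = x @ rev [Suc (Suc a)..<Suc (Suc a + m)]"
  have e: "x @ rev [Suc a..<Suc (a + Suc m)] = w @ [Suc a]" unfolding upt_Suc_Cons by (simp add: w_def)
  have wd: "word_on a (w @ [Suc a])" using Suc.prems unfolding e .
  then have d: "distinct w" "Suc a \<notin> set w" and s: "insert (Suc a) (set w) = {a<..a + Suc (length w)}"
    by (auto simp: word_on_def)
  have "set w = {a<..a + Suc (length w)} - {Suc a}" using d(2) s by blast
  also have "\<dots> = {Suc a<..Suc a + length w}" by auto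
  finally have sw: "set w = {Suc a<..Suc a + length w}" .
  have wd': "word_on (Suc a) w" using d sw by (simp add: word_on_def)
  let ?F = "\<lambda>i. if filter (\<lambda>x. x = i \<or> x = Suc i) (w @ [Suc a]) = [i, Suc i] then a + length (w @ [Suc a]) - i else 0"
  have 0: "?F (Suc a) = 0"
  proof -
    have "last (filter (\<lambda>x. x = Suc a \<or> x = Suc (Suc a)) (w @ [Suc a])) = Suc a" by simp
    then have "filter (\<lambda>x. x = Suc a \<or> x = Suc (Suc a)) (w @ [Suc a]) \<noteq> [Suc a, Suc (Suc a)]" by force
    then show ?thesis by simp
  qed
  have "chg a (w @ [Suc a]) = sum ?F {a<..<a + length (w @ [Suc a])}" by (simp only: chg_def)
  also have "\<dots> = sum ?F {Suc a<..<Suc a + length w}"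
  proof (rule sum.mono_neutral_right)
    show "\<forall>i\<in>{a<..<a + length (w @ [Suc a])} - {Suc a<..<Suc a + length w}. ?F i = 0"
    proof
      fix i assume "i \<in> {a<..<a + length (w @ [Suc a])} - {Suc a<..<Suc a + length w}"
      then have "i = Suc a" by auto
      then show "?F i = 0" using 0 by simp
    qed
  qed auto
  also have "\<dots> = chg (Suc a) w"
    unfolding chg_def by (intro sum.cong) auto
  also have "\<dots> = chg (Suc a + m) x" unfolding w_def by (rule Suc.IH) (use wd' in \<open>simp add: w_def\<close>)
  finally show ?case unfolding e by simp
qed simp

lemma left_of_filter:
  assumes "distinct u" "i \<in> set u" "j \<in> set u" "i \<noteq> j"
  shows "left_of u i j \<longleftrightarrow> filter (\<lambda>x. x = i \<or> x = j) u = [i, j]"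
proof -
  obtain p q where u: "u = p @ i # q" using assms(2) by (meson split_list)
  have n: "i \<notin> set p" "i \<notin> set q" "distinct p" "distinct q" using assms(1) u by auto
  have "left_of u i j \<longleftrightarrow> j \<in> set q"
  proof
    assume "left_of u i j"
    then obtain k l where kl: "k < l" "l < length u" "u ! k = i" "u ! l = j" by (auto simp: left_of_def)
    have "u ! length p = i" "length p < length u" using u by auto
    then have "k = length p" using kl assms(1) nth_eq_iff_index_eq[of u k "length p"] by auto
    then have "u ! l = q ! (l - Suc k)" "l - Suc k < length q" using kl u by (auto simp: nth_append nth_Cons')
    then show "j \<in> set q" using kl(4) nth_mem[of "l - Suc k" q] by simp
  next
    assume "j \<in> set q"
    then obtain t where "t < length q" "q ! t = j" by (auto simp: in_set_conv_nth)
    then show "left_of u i j" unfolding left_of_def u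
      by (intro exI[of _ "length p"] exI[of _ "Suc (length p + t)"]) (auto simp: nth_append)
  qed
  also have "\<dots> \<longleftrightarrow> filter (\<lambda>x. x = i \<or> x = j) u = [i, j]"
  proof (cases "j \<in> set q")
    case True
    then have "j \<notin> set p" using assms(1) u by auto
    then have "filter (\<lambda>x. x = i \<or> x = j) p = []" using n by (auto simp: filter_empty_conv)
    then show ?thesis using True filter_single'[OF n(4) True n(2)] u by simp
  next
    case False
    then have jp: "j \<in> set p" using assms(3,4) u by auto
    then show ?thesis using False filter_single'[OF n(3) jp n(1)] assms(4) u by simp
  qed
  finally show ?thesis .
qed

lemma filter_pair_cases:
  assumes "distinct u" "i \<in> set u" "j \<in> set u" "i \<noteq> j"
  shows "filter (\<lambda>x. x = i \<or> x = j) u = [i, j] \<or> filter (\<lambda>x. x = i \<or> x = j) u = [j, i]"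
proof -
  obtain p q where u: "u = p @ i # q" using assms(2) by (meson split_list)
  have n: "i \<notin> set p" "i \<notin> set q" "distinct p" "distinct q" using assms(1) u by auto
  show ?thesis
  proof (cases "j \<in> set q")
    case True
    then have "j \<notin> set p" using assms(1) u by auto
    then have "filter (\<lambda>x. x = i \<or> x = j) p = []" using n by (auto simp: filter_empty_conv)
    then show ?thesis using True filter_single'[OF n(4) True n(2)] u by simp
  next
    case False
    then have jp: "j \<in> set p" using assms(3,4) u by auto
    have "filter (\<lambda>x. x = i \<or> x = j) q = []" using n False by (auto simp: filter_empty_conv)
    then show ?thesis using filter_single'[OF n(3) jp n(1)] u by simp
  qed
qed

text \<open>The index of \<open>i\<close> is the number of \<open>j < i\<close> that precede
  \<open>j + 1\<close>. Exchanging the two summations weights each such \<open>j\<close> with the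
  number of letters larger than it.\<close>

lemma charge_chg:
  assumes "word_on 0 u" shows "(\<Sum>i = 1..length u. charge_index u i) = chg 0 u"
proof -
  define n where "n = length u"
  define b where "b j = (if filter (\<lambda>x. x = j \<or> x = Suc j) u = [j, Suc j] then 1 else 0 :: nat)" for j
  have step: "charge_index u (Suc j) = charge_index u j + b j" if "0 < j" "j < n" for j
  proof -
    obtain j' where j': "j = Suc j'" using \<open>0 < j\<close> by (cases j) auto
    have d: "distinct u" "j \<in> set u" "Suc j \<in> set u" using assms that by (auto simp: word_on_def n_def)
    have "left_of u (Suc j) j \<longleftrightarrow> filter (\<lambda>x. x = Suc j \<or> x = j) u = [Suc j, j]"
      using d by (intro left_of_filter) auto
    then have "left_of u (Suc j) j \<longleftrightarrow> filter (\<lambda>x. x = j \<or> x = Suc j) u = [Suc j, j]"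
      by (simp add: disj_commute)
    then have "left_of u (Suc j) j \<longleftrightarrow> b j = 0"
      using filter_pair_cases[OF d] by (auto simp: b_def)
    then show ?thesis unfolding j' by (auto simp: b_def)
  qed
  have ci: "charge_index u k = (\<Sum>j\<in>{0<..<k}. b j)" if "k \<le> n" for k
    using that
  proof (induction k)
    case (Suc k)
    show ?case
    proof (cases "k = 0")
      case True
      have "{0<..<Suc 0} = ({} :: nat set)" by auto
      then show ?thesis using True by simp
    next
      case False
      have "{0<..<Suc k} = insert k {0<..<k}" using False by auto
      then show ?thesis using Suc step[of k] False by simp
    qed
  qed simp
  have "(\<Sum>i = 1..k. charge_index u i) = (\<Sum>j\<in>{0<..<k}. b j * (k - j))" if "k \<le> n" for k
    using that
  proof (induction k)
    case (Suc k)
    have "(\<Sum>j\<in>{0<..<Suc k}. b j * (Suc k - j)) = (\<Sum>j\<in>{0<..<Suc k}. b j * (k - j) + b j)"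
      by (intro sum.cong) (auto simp: Suc_diff_le)
    also have "\<dots> = (\<Sum>j\<in>{0<..<Suc k}. b j * (k - j)) + (\<Sum>j\<in>{0<..<Suc k}. b j)" by (rule sum.distrib)
    also have "(\<Sum>j\<in>{0<..<Suc k}. b j * (k - j)) = (\<Sum>j\<in>{0<..<k}. b j * (k - j))"
      by (intro sum.mono_neutral_right) auto
    finally show ?case using Suc ci[of "Suc k"] by simp
  qed simp
  from this[of n] have "(\<Sum>i = 1..n. charge_index u i) = (\<Sum>j\<in>{0<..<n}. b j * (n - j))" by simp
  also have "\<dots> = chg 0 u" unfolding chg_def n_def[symmetric] by (intro sum.cong) (auto simp: b_def)
  finally show ?thesis unfolding n_def .
qed

section \<open>Words of row indices\<close>

text \<open>
  A word \<open>w\<close> of labels encodes a filling: the letter \<open>a + k\<close> lies in the row labelled by the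
  \<open>k\<close>-th entry of \<open>w\<close>.
\<close>

fun rowpos :: "nat \<Rightarrow> nat \<Rightarrow> nat list \<Rightarrow> nat list" where
  "rowpos a i [] = []"
| "rowpos a i (c # w) = (if c = i then [Suc a] else []) @ rowpos (Suc a) i w"

text \<open>The list \<open>L\<close> fixes the order in which the rows are read. Keeping it
  arbitrary covers both the usual row-reading order and the rotated order that a catabolism
  produces.\<close>

definition rd :: "nat \<Rightarrow> nat list \<Rightarrow> nat list \<Rightarrow> nat list" where
  "rd a L w = concat (map (\<lambda>i. rowpos a i w) L)"

lemma rd_simps [simp]: "rd a [] w = []" "rd a (i # L) w = rowpos a i w @ rd a L w"
  "rd a (L @ L') w = rd a L w @ rd a L' w"
  by (simp_all add: rd_def)

lemma rowpos_append: "rowpos a i (u @ v) = rowpos a i u @ rowpos (a + length u) i v"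
  by (induction u arbitrary: a) auto

lemma length_rowpos: "length (rowpos a i w) = count_list w i"
  by (induction w arbitrary: a) auto

lemma set_rowpos: "set (rowpos a i w) \<subseteq> {a<..a + length w}"
  by (induction w arbitrary: a) (fastforce split: if_splits)+

lemma in_rowpos: "Suc (a + k) \<in> set (rowpos a j x) \<longleftrightarrow> k < length x \<and> x ! k = j"
proof (induction x arbitrary: a k)
  case (Cons c x)
  show ?case
  proof (cases k)
    case 0
    have "Suc a \<notin> set (rowpos (Suc a) j x)" using set_rowpos[of "Suc a" j x] by auto
    then show ?thesis using 0 by simp
  next
    case (Suc k')
    then show ?thesis using Cons[of "Suc a" k'] by simp
  qed
qed simp

lemma sorted_rowpos: "sorted_wrt (<) (rowpos a i w)"
proof (induction w arbitrary: a)
  case (Cons c w)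
  then show ?case using set_rowpos[of "Suc a" i w] by auto
qed simp

lemma rowpos_notin: "i \<notin> set w \<Longrightarrow> rowpos a i w = []"
  by (induction w arbitrary: a) auto

lemma mset_rd_Cons:
  "distinct L \<Longrightarrow> mset (rd a L (c # w)) = (if c \<in> set L then {#Suc a#} else {#}) + mset (rd (Suc a) L w)"
  by (induction L) auto

lemma length_rd: "distinct L \<Longrightarrow> length (rd a L w) = length (filter (\<lambda>c. c \<in> set L) w)"
proof (induction w arbitrary: a)
  case Nil show ?case by (induction L) auto
next
  case (Cons c w)
  have "size (mset (rd a L (c # w))) = (if c \<in> set L then 1 else 0) + size (mset (rd (Suc a) L w))"
    using mset_rd_Cons[OF Cons.prems] by simp
  then show ?case using Cons by simp
qed

lemma mset_rd:
  "distinct L \<Longrightarrow> set w \<subseteq> set L \<Longrightarrow> mset (rd a L w) = mset [Suc a..<Suc (a + length w)]"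
proof (induction w arbitrary: a)
  case Nil
  have "rd a L [] = []" by (induction L) auto
  then show ?case by simp
next
  case (Cons c w)
  have "mset [Suc a..<Suc (a + length (c # w))] = add_mset (Suc a) (mset [Suc (Suc a)..<Suc (Suc a + length w)])"
    using upt_Suc_Cons[of a "length w"] by (simp del: mset_upt)
  then show ?case using Cons mset_rd_Cons[of L a c w] by (simp del: mset_upt)
qed

lemma word_on_upt: "word_on a [Suc a..<Suc (a + n)]"
  by (auto simp: word_on_def)

lemma word_on_rd: "distinct L \<Longrightarrow> set w \<subseteq> set L \<Longrightarrow> word_on a (rd a L w)"
  using word_on_mset[OF mset_rd] word_on_upt by blast

lemma rd_cong: "(\<And>i. i \<in> set L \<Longrightarrow> rowpos a i w = rowpos a i w') \<Longrightarrow> rd a L w = rd a L w'"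
  by (induction L) auto

subsection \<open>Changing one label\<close>

definition exc :: "nat \<Rightarrow> nat \<Rightarrow> nat list \<Rightarrow> int" where
  "exc r s w = int (count_list w r) - int (count_list w s)"

lemma exc_simps [simp]: "exc r s [] = 0" "exc r s (u @ v) = exc r s u + exc r s v"
  "exc r s (c # w) = (if c = r then 1 else 0) - (if c = s then 1 else 0) + exc r s w"
  by (auto simp: exc_def)

text \<open>
  With \<open>r\<close> read as an opening and \<open>s\<close> as a closing bracket, this closes the first unmatched
  opening bracket.
\<close>

definition fstep :: "nat \<Rightarrow> nat \<Rightarrow> nat list \<Rightarrow> nat list \<Rightarrow> bool" where
  "fstep r s w w' \<longleftrightarrow> (\<exists>u v. w = u @ [r] @ v \<and> w' = u @ [s] @ v \<and>
     (\<forall>p q. u = p @ q \<longrightarrow> exc r s q \<le> 0) \<and> (\<forall>p q. v = p @ q \<longrightarrow> 0 \<le> exc r s p))"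

text \<open>Placing \<open>\<alpha>\<close> over the last letters of \<open>\<beta>\<close> exhibits
  a letter to bump for each letter of \<open>\<alpha>\<close>; the greedy choice made by
  \<open>insert_row\<close> bumps no later than this one, so no letter of \<open>\<alpha>\<close> is
  merely appended.\<close>

lemma insert_row_end:
  "length \<alpha> \<le> length \<beta> \<Longrightarrow> stacked2 \<alpha> (drop (length \<beta> - length \<alpha>) \<beta>) \<Longrightarrow>
    length (fst (insert_row \<beta> \<alpha>)) = length \<alpha>"
proof (induction \<beta> \<alpha> rule: insert_row.induct)
  case (3 b \<beta> a \<alpha>)
  show ?case
  proof (cases "a < b")
    case True
    have le: "length \<alpha> \<le> length \<beta>" using "3.prems"(1) by simp
    have "drop (length \<beta> - length \<alpha>) (b # \<beta>) = (b # \<beta>) ! (length \<beta> - length \<alpha>) # drop (Suc (length \<beta> - length \<alpha>)) (b # \<beta>)"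
      using le by (intro Cons_nth_drop_Suc[symmetric]) simp
    then have "stacked2 \<alpha> (drop (length \<beta> - length \<alpha>) \<beta>)"
      using "3.prems"(2) by (simp add: stacked2_Cons)
    then show ?thesis using "3.IH"(1)[OF True le] True by simp
  next
    case False
    have "length (a # \<alpha>) \<noteq> length (b # \<beta>)" using "3.prems"(2) False by (auto simp: stacked2_Cons)
    then have le: "length (a # \<alpha>) \<le> length \<beta>" using "3.prems"(1) by simp
    then have "drop (length (b # \<beta>) - length (a # \<alpha>)) (b # \<beta>) = drop (length \<beta> - length (a # \<alpha>)) \<beta>"
      using drop_Suc_Cons[of "length \<beta> - Suc (length \<alpha>)" b \<beta>] by (simp add: Suc_diff_Suc Suc_le_eq)
    then show ?thesis using "3.IH"(3)[OF False le] "3.prems"(2) False by simp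
  qed
qed auto

lemma insert_row_extend:
  "length (fst (insert_row \<beta> \<alpha>)) = length \<alpha> \<Longrightarrow>
    insert_row (\<beta> @ \<gamma>) \<alpha> = (fst (insert_row \<beta> \<alpha>), snd (insert_row \<beta> \<alpha>) @ \<gamma>)"
  by (induction \<beta> \<alpha> rule: insert_row.induct) auto

text \<open>Both sides are brought to \<open>K @ \<beta>' @ R @ x # \<alpha>'\<close>, where
  inserting \<open>\<alpha>\<close> into \<open>\<beta>\<close> bumps \<open>K\<close> and leaves
  \<open>R\<close>. On the left \<open>\<beta>'\<close> is bumped by the letters from
  \<open>x\<close> on, on the right by those behind \<open>x\<close>; it fits below either of
  them.\<close>

lemma knuth_raise:
  assumes srt: "sorted_wrt (<) (\<alpha> @ [x] @ \<alpha>')" "sorted_wrt (<) (\<beta> @ [x] @ \<beta>')"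
    and disj: "set \<alpha> \<inter> set \<beta> = {}" "set (\<alpha> @ \<alpha>') \<inter> set (\<beta> @ \<beta>') = {}"
    and le: "length \<alpha> \<le> length \<beta>" "stacked2 \<alpha> (drop (length \<beta> - length \<alpha>) \<beta>)" and st: "stacked2 \<alpha>' \<beta>'"
  shows "(\<beta> @ \<beta>') @ (\<alpha> @ [x] @ \<alpha>') \<approx> (\<beta> @ [x] @ \<beta>') @ (\<alpha> @ \<alpha>')"
proof -
  obtain K R where KR: "insert_row \<beta> \<alpha> = (K, R)" by force
  have lK: "length K = length \<alpha>" using insert_row_end[OF le] KR by simp
  have ext: "insert_row (\<beta> @ \<gamma>) \<alpha> = (K, R @ \<gamma>)" for \<gamma> using insert_row_extend[of \<beta> \<alpha> \<gamma>] KR lK by simp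
  have Rlt: "y < x" if "y \<in> set R" for y
  proof -
    have "set R \<subseteq> set \<beta> \<union> set \<alpha>" using insert_row_sets(3)[of \<beta> \<alpha>] KR by simp
    then show ?thesis using srt that by (auto simp: sorted_wrt_append)
  qed
  have sR: "sorted_wrt (<) R"
    using insert_row_props[of \<beta> \<alpha>] srt disj KR by (auto simp: sorted_wrt_append)
  have 1: "(\<beta> @ \<beta>') @ \<alpha> \<approx> K @ R @ \<beta>'"
    using insert_row_props[of "\<beta> @ \<beta>'" \<alpha>] srt disj ext[of \<beta>'] by (auto simp: sorted_wrt_append)
  have 2: "(\<beta> @ [x] @ \<beta>') @ \<alpha> \<approx> K @ R @ [x] @ \<beta>'"
  proof -
    have "x \<notin> set \<alpha>" using srt(1) by (auto simp: sorted_wrt_append)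
    then show ?thesis
      using insert_row_props[of "\<beta> @ [x] @ \<beta>'" \<alpha>] srt disj ext[of "[x] @ \<beta>'"] by (auto simp: sorted_wrt_append)
  qed
  define k where "k = length \<beta>'"
  define \<alpha>1 \<alpha>2 where "\<alpha>1 = take k \<alpha>'" and "\<alpha>2 = drop k \<alpha>'"
  have kl: "k \<le> length \<alpha>'" using st by (simp add: stacked2_def k_def)
  have a': "\<alpha>' = \<alpha>1 @ \<alpha>2" "length \<alpha>1 = length \<beta>'" using kl by (auto simp: \<alpha>1_def \<alpha>2_def k_def)
  have st1: "stacked2 \<alpha>1 \<beta>'" using st kl by (auto simp: stacked2_def \<alpha>1_def k_def)
  have sx: "sorted_wrt (<) ((R @ [x]) @ \<beta>' @ [])" "sorted_wrt (<) ((R @ [x]) @ \<alpha>1 @ [])"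
    using sR srt Rlt a'(1) by (auto simp: sorted_wrt_append dest: Rlt order.strict_trans)
  have 3: "(R @ [x]) @ \<beta>' @ \<alpha>1 \<approx> \<beta>' @ (R @ [x]) @ \<alpha>1"
    using knuth_insert_stacked[OF a'(2) st1 sx] by simp
  define \<delta> \<epsilon> where "\<delta> = take k (x # \<alpha>1)" and "\<epsilon> = drop k (x # \<alpha>1)"
  have de: "x # \<alpha>1 = \<delta> @ \<epsilon>" "length \<delta> = length \<beta>'" using a'(2) by (auto simp: \<delta>_def \<epsilon>_def k_def)
  have "sorted_wrt (<) (x # \<alpha>1)" using srt(1) a'(1) by (auto simp: sorted_wrt_append)
  from stacked2_shift[OF this st1] have st2: "stacked2 \<delta> \<beta>'" using a'(2) by (auto simp: stacked2_def \<delta>_def k_def)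
  have "sorted_wrt (<) (R @ (\<delta> @ \<epsilon>))" using sx(2) unfolding de(1)[symmetric] by simp
  then have sx2: "sorted_wrt (<) (R @ \<beta>' @ [])" "sorted_wrt (<) (R @ \<delta> @ [])"
    using sx(1) by (auto simp: sorted_wrt_append)
  have "(R @ \<beta>' @ \<delta>) @ \<epsilon> \<approx> (\<beta>' @ R @ \<delta>) @ \<epsilon>"
    using knuth_insert_stacked[OF de(2) st2 sx2] by (intro knuth_app_right) simp
  then have 4: "R @ \<beta>' @ x # \<alpha>1 \<approx> \<beta>' @ R @ x # \<alpha>1" unfolding de(1) by simp
  have "(\<beta> @ \<beta>') @ (\<alpha> @ [x] @ \<alpha>') = ((\<beta> @ \<beta>') @ \<alpha>) @ x # \<alpha>1 @ \<alpha>2" by (simp add: a')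
  also have "\<dots> \<approx> (K @ R @ \<beta>') @ x # \<alpha>1 @ \<alpha>2" using 1 by (rule knuth_app_right)
  also have "\<dots> = K @ (R @ \<beta>' @ x # \<alpha>1) @ \<alpha>2" by simp
  also have "\<dots> \<approx> K @ (\<beta>' @ R @ x # \<alpha>1) @ \<alpha>2" using 4 by (rule knuth_ctx)
  also have "\<dots> = K @ (\<beta>' @ (R @ [x]) @ \<alpha>1) @ \<alpha>2" by simp
  also have "\<dots> \<approx> K @ ((R @ [x]) @ \<beta>' @ \<alpha>1) @ \<alpha>2" using knuth_sym[OF 3] by (rule knuth_ctx)
  also have "\<dots> = (K @ R @ [x] @ \<beta>') @ \<alpha>'" by (simp add: a')
  also have "\<dots> \<approx> ((\<beta> @ [x] @ \<beta>') @ \<alpha>) @ \<alpha>'" using knuth_sym[OF 2] by (rule knuth_app_right)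
  finally show ?thesis by simp
qed

text \<open>The condition on suffixes matches every \<open>r\<close> with a later \<open>s\<close>,
  so the rows compare when they are aligned at their right ends. In \<open>front_stacked\<close> the
  condition on prefixes aligns them at their left ends. These are the two hypotheses of
  \<open>knuth_raise\<close>.\<close>

lemma end_stacked:
  assumes "r \<noteq> s" "\<forall>p q. u = p @ q \<longrightarrow> exc r s q \<le> 0"
  shows "length (rowpos a r u) \<le> length (rowpos a s u) \<and>
    stacked2 (rowpos a r u) (drop (length (rowpos a s u) - length (rowpos a r u)) (rowpos a s u))"
  using assms(2)
proof (induction u arbitrary: a)
  case (Cons c u)
  have "\<forall>p q. u = p @ q \<longrightarrow> exc r s q \<le> 0" using Cons.prems by (metis append_Cons)
  note IH = Cons.IH[OF this, of "Suc a"]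
  have tot: "exc r s (c # u) \<le> 0" using Cons.prems by blast
  let ?\<alpha> = "rowpos (Suc a) r u" and ?\<beta> = "rowpos (Suc a) s u"
  consider "c \<noteq> r" "c \<noteq> s" | "c = s" | "c = r" by blast
  then show ?case
  proof cases
    case 2
    then show ?thesis using IH assms(1) by (simp add: Suc_diff_le)
  next
    case 3
    then have lt: "length ?\<alpha> < length ?\<beta>" using tot assms(1) by (simp add: exc_def length_rowpos)
    define d where "d = length ?\<beta> - Suc (length ?\<alpha>)"
    have d: "length ?\<beta> - length ?\<alpha> = Suc d" "d < length ?\<beta>" using lt by (auto simp: d_def)
    have dr: "drop d ?\<beta> = ?\<beta> ! d # drop (Suc d) ?\<beta>" using Cons_nth_drop_Suc[OF d(2)] by simp
    have "Suc a < ?\<beta> ! d" using set_rowpos[of "Suc a" s u] nth_mem[OF d(2)] by auto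
    then show ?thesis using 3 assms(1) IH lt d by (simp add: stacked2_Cons dr d_def[symmetric])
  qed (use IH in auto)
qed simp

lemma front_stacked:
  assumes "r \<noteq> s" "\<forall>p q. v = p @ q \<longrightarrow> 0 \<le> exc r s p"
  shows "stacked2 (rowpos a r v) (rowpos a s v)"
  using assms(2)
proof (induction v rule: rev_induct)
  case (snoc c v)
  have "\<forall>p q. v = p @ q \<longrightarrow> 0 \<le> exc r s p" using snoc.prems by (metis append_assoc)
  note IH = snoc.IH[OF this]
  have "0 \<le> exc r s (v @ [c])" using snoc.prems by blast
  then have le: "length (rowpos a s (v @ [c])) \<le> length (rowpos a r (v @ [c]))" by (simp add: exc_def length_rowpos)
  have lt: "y \<le> a + length v" if "y \<in> set (rowpos a r v)" for y using set_rowpos[of a r v] that by auto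
  consider "c \<noteq> r" "c \<noteq> s" | "c = s" | "c = r" by blast
  then show ?case
  proof cases
    case 2
    show ?thesis unfolding stacked2_def
    proof (intro conjI allI impI)
      fix i assume i: "i < length (rowpos a s (v @ [c]))"
      show "rowpos a r (v @ [c]) ! i < rowpos a s (v @ [c]) ! i"
      proof (cases "i < length (rowpos a s v)")
        case True
        then show ?thesis using IH 2 assms(1) by (auto simp: rowpos_append nth_append stacked2_def)
      next
        case False
        then have ii: "i = length (rowpos a s v)" using i 2 by (simp add: rowpos_append)
        have il: "i < length (rowpos a r v)" using i le 2 assms(1) by (simp add: rowpos_append)
        then have "rowpos a r v ! i \<le> a + length v" using lt nth_mem by blast
        then show ?thesis using ii 2 assms(1) by (simp add: rowpos_append nth_append)
      qed
    qed (rule le)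
  next
    case 3
    then show ?thesis using IH assms(1) stacked2_row_append by (simp add: rowpos_append)
  qed (use IH in \<open>simp add: rowpos_append\<close>)
qed simp

lemma front_stacked_conv:
  assumes "r \<noteq> s" "stacked2 (rowpos a r v) (rowpos a s v)" "v = p @ q"
  shows "0 \<le> exc r s p"
proof (rule ccontr)
  assume "\<not> 0 \<le> exc r s p"
  then have lt: "length (rowpos a r p) < length (rowpos a s p)" (is "?k < ?l") by (simp add: exc_def length_rowpos)
  have e: "rowpos a i v = rowpos a i p @ rowpos (a + length p) i q" for i
    unfolding assms(3) by (rule rowpos_append)
  have k: "?k < length (rowpos a s v)" "?k < length (rowpos a r v)"
    using lt assms(2) by (auto simp: e[of s] stacked2_def)
  have "rowpos a r v ! ?k < rowpos a s v ! ?k" using assms(2) k by (simp add: stacked2_def)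
  moreover have "rowpos a s v ! ?k = rowpos a s p ! ?k" using lt by (simp add: e nth_append)
  moreover have "rowpos a s p ! ?k \<le> a + length p" using set_rowpos[of a s p] nth_mem[OF lt] by auto
  moreover have "rowpos a r v ! ?k \<in> set (rowpos (a + length p) r q)"
    using k(2) by (simp add: e nth_append)
  then have "a + length p < rowpos a r v ! ?k" using set_rowpos[of "a + length p" r q] by auto
  ultimately show False by simp
qed

lemma rowpos_disjoint: "r \<noteq> s \<Longrightarrow> set (rowpos a r w) \<inter> set (rowpos a s w) = {}"
proof -
  assume rs: "r \<noteq> s"
  have False if "y \<in> set (rowpos a r w)" "y \<in> set (rowpos a s w)" for y
  proof -
    have "a < y" using set_rowpos[of a r w] that by auto
    then obtain k where "y = Suc (a + k)" using less_iff_Suc_add by blast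
    then show False using that rs by (simp add: in_rowpos)
  qed
  then show ?thesis by blast
qed

lemma fstep_rowpos:
  assumes "fstep r s w w'" "r \<noteq> s"
  obtains \<alpha> \<alpha>' \<beta> \<beta>' x where "rowpos a r w = \<alpha> @ [x] @ \<alpha>'" "rowpos a s w = \<beta> @ \<beta>'"
    "rowpos a r w' = \<alpha> @ \<alpha>'" "rowpos a s w' = \<beta> @ [x] @ \<beta>'"
    "\<And>i. i \<noteq> r \<Longrightarrow> i \<noteq> s \<Longrightarrow> rowpos a i w' = rowpos a i w"
    "length \<alpha> \<le> length \<beta>" "stacked2 \<alpha> (drop (length \<beta> - length \<alpha>) \<beta>)" "stacked2 \<alpha>' \<beta>'"
proof -
  obtain u v where uv: "w = u @ [r] @ v" "w' = u @ [s] @ v"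
    "\<forall>p q. u = p @ q \<longrightarrow> exc r s q \<le> 0" "\<forall>p q. v = p @ q \<longrightarrow> 0 \<le> exc r s p"
    using assms(1) unfolding fstep_def by blast
  let ?b = "Suc (a + length u)"
  show thesis
  proof (rule that)
    show "rowpos a r w = rowpos a r u @ [?b] @ rowpos ?b r v" "rowpos a s w = rowpos a s u @ rowpos ?b s v"
      "rowpos a r w' = rowpos a r u @ rowpos ?b r v" "rowpos a s w' = rowpos a s u @ [?b] @ rowpos ?b s v"
      "\<And>i. i \<noteq> r \<Longrightarrow> i \<noteq> s \<Longrightarrow> rowpos a i w' = rowpos a i w"
      using assms(2) by (auto simp: uv rowpos_append)
    show "length (rowpos a r u) \<le> length (rowpos a s u)"
      "stacked2 (rowpos a r u) (drop (length (rowpos a s u) - length (rowpos a r u)) (rowpos a s u))"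
      using end_stacked[OF assms(2) uv(3)] by auto
    show "stacked2 (rowpos ?b r v) (rowpos ?b s v)" by (rule front_stacked[OF assms(2) uv(4)])
  qed
qed

lemma fstep_knuth:
  assumes "fstep r s w w'" "r \<noteq> s"
  shows "rowpos a s w @ rowpos a r w \<approx> rowpos a s w' @ rowpos a r w'"
proof -
  obtain \<alpha> \<alpha>' \<beta> \<beta>' x where F: "rowpos a r w = \<alpha> @ [x] @ \<alpha>'" "rowpos a s w = \<beta> @ \<beta>'"
    "rowpos a r w' = \<alpha> @ \<alpha>'" "rowpos a s w' = \<beta> @ [x] @ \<beta>'"
    "length \<alpha> \<le> length \<beta>" "stacked2 \<alpha> (drop (length \<beta> - length \<alpha>) \<beta>)" "stacked2 \<alpha>' \<beta>'"
    by (rule fstep_rowpos[OF assms, of a]) blast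
  have "sorted_wrt (<) (\<alpha> @ [x] @ \<alpha>')" "sorted_wrt (<) (\<beta> @ [x] @ \<beta>')"
    using sorted_rowpos[of a r w] sorted_rowpos[of a s w'] F by simp_all
  moreover have "set (\<alpha> @ \<alpha>') \<inter> set (\<beta> @ \<beta>') = {}"
    using rowpos_disjoint[OF assms(2), of a w] F by auto
  ultimately show ?thesis unfolding F(1-4) using F(5-7) by (intro knuth_raise) auto
qed

lemma fstep_rd:
  assumes "fstep r s w w'" "r \<noteq> s" "distinct (L1 @ [s, r] @ L2)"
  shows "rd a (L1 @ [s, r] @ L2) w \<approx> rd a (L1 @ [s, r] @ L2) w'"
proof -
  have "rowpos a i w' = rowpos a i w" if "i \<noteq> r" "i \<noteq> s" for i
    by (rule fstep_rowpos[OF assms(1,2), of a]) (use that in blast)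
  then have "rd a L1 w = rd a L1 w'" "rd a L2 w = rd a L2 w'"
    using assms(3) by (intro rd_cong; metis Un_iff disjoint_iff distinct.simps(2) distinct_append list.set_intros set_append)+
  then show ?thesis using knuth_ctx[OF fstep_knuth[OF assms(1,2)], of "rd a L1 w" a "rd a L2 w"] by simp
qed

text \<open>With a surplus of two labels \<open>s\<close> in front, the comparison at the right ends
  leaves the first two letters of row \<open>s\<close> out, so the step is a Knuth equivalence
  without them. They remain as the increasing pair that later permits rotation.\<close>

lemma fstep_held:
  assumes uv: "w = u @ [r] @ v" "w' = u @ [s] @ v"
    "\<forall>p q. u = p @ q \<longrightarrow> exc r s q \<le> 0" "\<forall>p q. v = p @ q \<longrightarrow> 0 \<le> exc r s p"
    and rs: "r \<noteq> s" and big: "exc r s u \<le> - 2"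
  obtains y1 y2 \<beta> \<beta>' where "rowpos a s w = y1 # y2 # \<beta>" "rowpos a s w' = y1 # y2 # \<beta>'"
    "\<beta> @ rowpos a r w \<approx> \<beta>' @ rowpos a r w'" "length \<beta>' = Suc (length \<beta>)"
proof -
  let ?b = "Suc (a + length u)"
  define \<alpha> \<alpha>' \<beta> \<beta>' where "\<alpha> = rowpos a r u" and "\<alpha>' = rowpos ?b r v" and "\<beta> = rowpos a s u" and "\<beta>' = rowpos ?b s v"
  have F: "rowpos a r w = \<alpha> @ [?b] @ \<alpha>'" "rowpos a s w = \<beta> @ \<beta>'"
    "rowpos a r w' = \<alpha> @ \<alpha>'" "rowpos a s w' = \<beta> @ [?b] @ \<beta>'"
    using rs by (auto simp: uv rowpos_append \<alpha>_def \<alpha>'_def \<beta>_def \<beta>'_def)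
  have es: "length \<alpha> \<le> length \<beta>" "stacked2 \<alpha> (drop (length \<beta> - length \<alpha>) \<beta>)"
    using end_stacked[OF rs uv(3), of a] by (auto simp: \<alpha>_def \<beta>_def)
  have l2: "length \<alpha> + 2 \<le> length \<beta>" using big by (simp add: exc_def length_rowpos \<alpha>_def \<beta>_def)
  then obtain y1 \<beta>1 where b1: "\<beta> = y1 # \<beta>1" by (cases \<beta>) auto
  obtain y2 \<beta>2 where b2: "\<beta>1 = y2 # \<beta>2" using l2 b1 by (cases \<beta>1) auto
  have b: "\<beta> = y1 # y2 # \<beta>2" using b1 b2 by simp
  have es2: "length \<alpha> \<le> length \<beta>2" "stacked2 \<alpha> (drop (length \<beta>2 - length \<alpha>) \<beta>2)"
  proof -
    show "length \<alpha> \<le> length \<beta>2" using l2 b by simp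
    then have "length \<beta> - length \<alpha> = Suc (Suc (length \<beta>2 - length \<alpha>))" using b by simp
    then show "stacked2 \<alpha> (drop (length \<beta>2 - length \<alpha>) \<beta>2)" using es(2) b by simp
  qed
  have "sorted_wrt (<) (\<alpha> @ [?b] @ \<alpha>')" "sorted_wrt (<) (\<beta> @ [?b] @ \<beta>')"
    using sorted_rowpos[of a r w] sorted_rowpos[of a s w'] F by simp_all
  moreover have "set (\<alpha> @ \<alpha>') \<inter> set (\<beta> @ \<beta>') = {}"
    using rowpos_disjoint[OF rs, of a w] F by auto
  ultimately have "(\<beta>2 @ \<beta>') @ (\<alpha> @ [?b] @ \<alpha>') \<approx> (\<beta>2 @ [?b] @ \<beta>') @ (\<alpha> @ \<alpha>')"
    using es2 front_stacked[OF rs uv(4), of ?b] b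
    by (intro knuth_raise) (auto simp: \<alpha>'_def \<beta>'_def)
  then show thesis using that[of y1 y2 "\<beta>2 @ \<beta>'" "\<beta>2 @ [?b] @ \<beta>'"] F b by simp
qed

text \<open>Between two candidates stands a word \<open>p\<close>. As a prefix of what follows the
  first candidate it has excess at least 0; preceded by that candidate it is a suffix of what comes
  before the second one, so its excess is at most -1.\<close>

lemma fstep_unique:
  assumes "fstep r s w w1" "fstep r s w w2" "r \<noteq> s"
  shows "w1 = w2"
proof -
  obtain u1 v1 where 1: "w = u1 @ [r] @ v1" "w1 = u1 @ [s] @ v1"
    "\<forall>p q. u1 = p @ q \<longrightarrow> exc r s q \<le> 0" "\<forall>p q. v1 = p @ q \<longrightarrow> 0 \<le> exc r s p"
    using assms(1) unfolding fstep_def by blast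
  obtain u2 v2 where 2: "w = u2 @ [r] @ v2" "w2 = u2 @ [s] @ v2"
    "\<forall>p q. u2 = p @ q \<longrightarrow> exc r s q \<le> 0" "\<forall>p q. v2 = p @ q \<longrightarrow> 0 \<le> exc r s p"
    using assms(2) unfolding fstep_def by blast
  have no: False if "u @ [r] @ p = u'" "v = p @ [r] @ v'" "\<forall>p q. u' = p @ q \<longrightarrow> exc r s q \<le> 0"
    "\<forall>p q. v = p @ q \<longrightarrow> 0 \<le> exc r s p" for u p u' v v'
  proof -
    have "exc r s ([r] @ p) \<le> 0" using that(1,3) by blast
    moreover have "0 \<le> exc r s p" using that(2,4) by blast
    ultimately show False using assms(3) by simp
  qed
  obtain t where t: "(u1 = u2 @ t \<and> t @ [r] @ v1 = [r] @ v2) \<or> (u1 @ t = u2 \<and> [r] @ v1 = t @ [r] @ v2)"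
    using 1(1) 2(1) append_eq_append_conv2[of u1 "[r] @ v1" u2 "[r] @ v2"] by auto
  show ?thesis
  proof (cases t)
    case Nil
    then show ?thesis using t 1 2 by auto
  next
    case (Cons c t')
    from t show ?thesis
    proof
      assume "u1 = u2 @ t \<and> t @ [r] @ v1 = [r] @ v2"
      then have "u2 @ [r] @ t' = u1" "v2 = t' @ [r] @ v1" using Cons by auto
      from no[OF this 1(3) 2(4)] show ?thesis ..
    next
      assume "u1 @ t = u2 \<and> [r] @ v1 = t @ [r] @ v2"
      then have "u1 @ [r] @ t' = u2" "v1 = t' @ [r] @ v2" using Cons by auto
      from no[OF this 2(3) 1(4)] show ?thesis ..
    qed
  qed
qed

lemma exc_rev [simp]: "exc r s (rev w) = exc r s w"
  by (induction w) auto

lemma exc_swap: "exc s r w = - exc r s w"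
  by (simp add: exc_def)

lemma fstep_rev: "fstep r s w w' \<Longrightarrow> fstep s r (rev w') (rev w)"
proof -
  assume "fstep r s w w'"
  then obtain u v where uv: "w = u @ [r] @ v" "w' = u @ [s] @ v"
    "\<forall>p q. u = p @ q \<longrightarrow> exc r s q \<le> 0" "\<forall>p q. v = p @ q \<longrightarrow> 0 \<le> exc r s p"
    unfolding fstep_def by blast
  have "exc s r q \<le> 0" if "rev v = p @ q" for p q
  proof -
    have "v = rev q @ rev p" using that by (metis rev_append rev_rev_ident)
    then show ?thesis using uv(4) by (metis exc_rev exc_swap neg_le_0_iff_le)
  qed
  moreover have "0 \<le> exc s r p" if "rev u = p @ q" for p q
  proof -
    have "u = rev q @ rev p" using that by (metis rev_append rev_rev_ident)
    then show ?thesis using uv(3) by (metis exc_rev exc_swap neg_0_le_iff_le)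
  qed
  ultimately show ?thesis unfolding fstep_def
    by (intro exI[of _ "rev v"] exI[of _ "rev u"]) (simp add: uv)
qed

lemma fstep_inj: "fstep r s w1 w \<Longrightarrow> fstep r s w2 w \<Longrightarrow> r \<noteq> s \<Longrightarrow> w1 = w2"
  using fstep_unique[of s r "rev w" "rev w1" "rev w2"] fstep_rev by (metis rev_rev_ident)

lemma fstep_count:
  "fstep r s w w' \<Longrightarrow> r \<noteq> s \<Longrightarrow> exc r s w' = exc r s w - 2 \<and> length w' = length w \<and>
    count_list w' r + count_list w' s = count_list w r + count_list w s \<and>
    (\<forall>i. i \<noteq> r \<longrightarrow> i \<noteq> s \<longrightarrow> count_list w' i = count_list w i)"
  unfolding fstep_def by auto

lemma fstep_set: "fstep r s w w' \<Longrightarrow> set w' \<subseteq> insert s (set w) \<and> set w \<subseteq> insert r (set w')"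
  unfolding fstep_def by auto

text \<open>The first unmatched opening bracket stands after the last minimum of the prefix heights.\<close>

lemma fstep_total:
  assumes rs: "r \<noteq> s" and w: "w = p @ q" and q: "int (Suc d) \<le> exc r s q"
  shows "\<exists>w' p' q'. fstep r s w w' \<and> w' = p' @ q' \<and> int d \<le> exc r s q'"
proof -
  define h where "h j = exc r s (take j w)" for j
  define N where "N = length w"
  have fin: "finite (h ` {..N})" "h ` {..N} \<noteq> {}" by auto
  define mn where "mn = Min (h ` {..N})"
  have mn: "mn \<in> h ` {..N}" "\<And>j. j \<le> N \<Longrightarrow> mn \<le> h j"
    using Min_in[OF fin] Min_le[OF fin(1)] by (auto simp: mn_def)
  define K where "K = {j. j \<le> N \<and> h j = mn}"
  have K: "finite K" "K \<noteq> {}" using mn(1) by (auto simp: K_def)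
  define k where "k = Max K"
  have k: "k \<le> N" "h k = mn" using Max_in[OF K] by (auto simp: K_def k_def)
  have gt: "mn < h j" if "k < j" "j \<le> N" for j
  proof (rule ccontr)
    assume "\<not> mn < h j"
    then have "j \<in> K" using mn(2)[OF that(2)] that(2) by (simp add: K_def)
    then show False using Max_ge[OF K(1)] that(1) by (fastforce simp: k_def)
  qed
  have hp: "h (length p) = exc r s p" "h N = exc r s p + exc r s q" by (simp_all add: h_def w N_def)
  have lp: "length p \<le> N" by (simp add: w N_def)
  have kN: "k < N"
  proof -
    have "h k \<noteq> h N" using k(2) mn(2)[OF lp] hp q by simp
    then show ?thesis using k(1) by (metis le_neq_implies_less)
  qed
  define u v where "u = take k w" and "v = drop (Suc k) w"
  have wk: "w = u @ [w ! k] @ v" using kN by (simp add: u_def v_def N_def id_take_nth_drop)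
  have lu: "length u = k" using kN by (simp add: u_def N_def)
  have "h (Suc k) = h k + exc r s [w ! k]"
    using kN by (simp add: h_def take_Suc_conv_app_nth N_def)
  then have "0 < exc r s [w ! k]" using gt[of "Suc k"] kN k(2) by simp
  then have wr: "w ! k = r" using rs by (auto split: if_splits)
  have hu: "exc r s u = mn" using k(2) by (simp add: h_def u_def)
  have su: "exc r s q' \<le> 0" if "u = p' @ q'" for p' q'
  proof -
    have "w = p' @ q' @ [w ! k] @ v" using wk that by simp
    then have "take (length p') w = p'" by (metis append_eq_conv_conj)
    then have "h (length p') = exc r s p'" by (simp add: h_def)
    moreover have "length p' \<le> N" using that k(1) lu by simp
    ultimately have "mn \<le> exc r s p'" using mn(2) by metis
    then show ?thesis using hu that by simp
  qed
  have sv: "0 \<le> exc r s p'" if "v = p' @ q'" for p' q'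
  proof -
    have "take (Suc k + length p') w = u @ [r] @ p'"
      using that lu by (subst wk) (simp add: wr)
    then have "h (Suc k + length p') = mn + 1 + exc r s p'" using hu rs by (simp add: h_def)
    moreover have "Suc k + length p' \<le> N"
    proof -
      have "N = length u + 1 + length v" using arg_cong[OF wk, of length] by (simp add: N_def)
      then show ?thesis using that lu by simp
    qed
    ultimately show ?thesis using gt[of "Suc k + length p'"] by simp
  qed
  \<comment> \<open>The height after \<open>p\<close> is at least the minimum, so the part
    \<open>v\<close> behind the changed label loses at most one unit of the excess of
    \<open>q\<close>. This lets \<open>fsteps_total\<close> repeat the step.\<close>
  have "exc r s w = mn + 1 + exc r s v" using hu rs by (subst wk) (simp add: wr)
  moreover have "exc r s w = h (length p) + exc r s q" using hp by (simp add: w)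
  ultimately have "int d \<le> exc r s v" using q mn(2)[OF lp] by simp
  moreover have "fstep r s w (u @ [s] @ v)" unfolding fstep_def using wk wr su sv by blast
  ultimately show ?thesis by (metis append_assoc)
qed

text \<open>Every step lowers the excess by 2, so as many steps as the excess exchange the two
  numbers of labels. A negative excess means going the same number of steps backwards.\<close>

definition flip :: "nat \<Rightarrow> nat \<Rightarrow> nat list \<Rightarrow> nat list \<Rightarrow> bool" where
  "flip r s v v' \<longleftrightarrow> (if 0 \<le> exc r s v then (fstep r s ^^ nat (exc r s v)) v v'
     else (fstep r s ^^ nat (- exc r s v)) v' v)"

lemma fsteps_count:
  assumes "r \<noteq> s"
  shows "(fstep r s ^^ d) w w' \<Longrightarrow> exc r s w' = exc r s w - 2 * int d \<and> length w' = length w \<and>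
    count_list w' r + count_list w' s = count_list w r + count_list w s \<and>
    (\<forall>i. i \<noteq> r \<longrightarrow> i \<noteq> s \<longrightarrow> count_list w' i = count_list w i)"
proof (induction d arbitrary: w')
  case (Suc d)
  then obtain y where "(fstep r s ^^ d) w y" "fstep r s y w'" by auto
  then show ?case using Suc.IH fstep_count[of r s y w'] assms by fastforce
qed simp

lemma fsteps_unique:
  assumes "r \<noteq> s" shows "(fstep r s ^^ d) w w1 \<Longrightarrow> (fstep r s ^^ d) w w2 \<Longrightarrow> w1 = w2"
proof (induction d arbitrary: w1 w2)
  case (Suc d)
  then obtain y1 y2 where "(fstep r s ^^ d) w y1" "fstep r s y1 w1" "(fstep r s ^^ d) w y2" "fstep r s y2 w2" by auto
  then show ?case using Suc.IH fstep_unique assms by blast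
qed simp

lemma fsteps_inj:
  assumes "r \<noteq> s" shows "(fstep r s ^^ d) w1 w \<Longrightarrow> (fstep r s ^^ d) w2 w \<Longrightarrow> w1 = w2"
proof (induction d arbitrary: w)
  case (Suc d)
  then obtain y1 y2 where "(fstep r s ^^ d) w1 y1" "fstep r s y1 w" "(fstep r s ^^ d) w2 y2" "fstep r s y2 w" by auto
  then show ?case using Suc.IH fstep_inj assms by blast
qed simp

lemma fsteps_total:
  assumes "r \<noteq> s"
  shows "w = p @ q \<Longrightarrow> int d \<le> exc r s q \<Longrightarrow> \<exists>w'. (fstep r s ^^ d) w w'"
proof (induction d arbitrary: w p q)
  case (Suc d)
  obtain w1 p1 q1 where "fstep r s w w1" "w1 = p1 @ q1" "int d \<le> exc r s q1"
    using fstep_total[OF assms Suc.prems] by blast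
  then show ?case using Suc.IH[of w1 p1 q1] by (metis relpowp_Suc_I2)
qed auto

lemma fsteps_rev: "(fstep r s ^^ d) w w' \<Longrightarrow> (fstep s r ^^ d) (rev w') (rev w)"
proof (induction d arbitrary: w')
  case (Suc d)
  then obtain y where "(fstep r s ^^ d) w y" "fstep r s y w'" by auto
  then show ?case using Suc.IH fstep_rev by (metis relpowp_Suc_I2)
qed simp

lemma flip_total: assumes "r \<noteq> s" shows "\<exists>v'. flip r s v v'"
proof (cases "0 \<le> exc r s v")
  case True
  then show ?thesis using fsteps_total[OF assms, of v "[]" v "nat (exc r s v)"] by (simp add: flip_def)
next
  case False
  then obtain w where "(fstep s r ^^ nat (- exc r s v)) (rev v) w"
    using fsteps_total[of s r "rev v" "[]" "rev v" "nat (- exc r s v)"] assms by (auto simp: exc_swap[of s r])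
  from fsteps_rev[OF this] show ?thesis using False by (auto simp: flip_def)
qed

lemma flip_unique: "flip r s v v1 \<Longrightarrow> flip r s v v2 \<Longrightarrow> r \<noteq> s \<Longrightarrow> v1 = v2"
  using fsteps_unique[of r s] fsteps_inj[of r s] unfolding flip_def by (cases "0 \<le> exc r s v") auto

lemma flip_count:
  assumes "flip r s v v'" "r \<noteq> s"
  shows "count_list v' r = count_list v s" "count_list v' s = count_list v r" "length v' = length v"
    "i \<noteq> r \<Longrightarrow> i \<noteq> s \<Longrightarrow> count_list v' i = count_list v i" "exc r s v' = - exc r s v"
proof -
  have *: "exc r s v' = - exc r s v \<and> length v' = length v \<and>
    count_list v' r + count_list v' s = count_list v r + count_list v s \<and>
    (\<forall>i. i \<noteq> r \<longrightarrow> i \<noteq> s \<longrightarrow> count_list v' i = count_list v i)"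
  proof (cases "0 \<le> exc r s v")
    case True
    have "(fstep r s ^^ nat (exc r s v)) v v'" using assms(1) True by (simp add: flip_def)
    from fsteps_count[OF assms(2) this] show ?thesis using True by simp
  next
    case False
    have "(fstep r s ^^ nat (- exc r s v)) v' v" using assms(1) False by (simp add: flip_def)
    from fsteps_count[OF assms(2) this] show ?thesis using False by simp
  qed
  then show "length v' = length v" "i \<noteq> r \<Longrightarrow> i \<noteq> s \<Longrightarrow> count_list v' i = count_list v i"
    "exc r s v' = - exc r s v" by auto
  show "count_list v' r = count_list v s" "count_list v' s = count_list v r"
    using * by (auto simp: exc_def)
qed

lemma flip_sym: "flip r s v v' \<Longrightarrow> r \<noteq> s \<Longrightarrow> flip r s v' v"
proof -
  assume f: "flip r s v v'" and rs: "r \<noteq> s"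
  have e: "exc r s v' = - exc r s v" by (rule flip_count(5)[OF f rs])
  consider "exc r s v = 0" | "0 < exc r s v" | "exc r s v < 0" by linarith
  then show ?thesis using f e by cases (auto simp: flip_def)
qed

lemma flip_closed:
  assumes "flip r s v v'" "v \<in> Y" "\<And>v v'. fstep r s v v' \<Longrightarrow> v \<in> Y \<longleftrightarrow> v' \<in> Y"
  shows "v' \<in> Y"
proof -
  have "(fstep r s ^^ d) v v' \<Longrightarrow> v \<in> Y \<longleftrightarrow> v' \<in> Y" for d v v'
  proof (induction d arbitrary: v')
    case (Suc d)
    then obtain y where "(fstep r s ^^ d) v y" "fstep r s y v'" by auto
    then show ?case using Suc.IH assms(3) by blast
  qed simp
  then show ?thesis using assms(1,2) unfolding flip_def by (auto split: if_splits)
qed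

text \<open>The reflection is an involution that preserves every set closed under single steps; the
  generating polynomial of such a set is therefore invariant under exchanging the two
  variables.\<close>

lemma content_swap:
  assumes "\<And>v v'. fstep r s v v' \<Longrightarrow> v \<in> Y \<longleftrightarrow> v' \<in> Y" "r \<noteq> s"
  obtains \<phi> where "bij_betw \<phi> Y Y"
    "\<And>v i. v \<in> Y \<Longrightarrow> count_list (\<phi> v) i = count_list v (Transposition.transpose r s i)"
proof -
  define \<phi> where "\<phi> v = (SOME v'. flip r s v v')" for v
  have \<phi>: "flip r s v (\<phi> v)" for v unfolding \<phi>_def by (rule someI_ex[OF flip_total[OF assms(2)]])
  have inv: "\<phi> (\<phi> v) = v" for v
    using flip_unique[OF \<phi> flip_sym[OF \<phi>]] assms(2) by blast
  have cl: "\<phi> v \<in> Y" if "v \<in> Y" for v using flip_closed[OF \<phi> that] assms(1) by blast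
  show thesis
  proof (rule that)
    show "bij_betw \<phi> Y Y" by (rule bij_betw_byWitness[of _ \<phi>]) (use inv cl in auto)
    show "count_list (\<phi> v) i = count_list v (Transposition.transpose r s i)" for v i
      using flip_count(1-3)[OF \<phi>[of v] assms(2)] flip_count(4)[OF \<phi>[of v] assms(2), of i]
      by (cases "i = r"; cases "i = s"; simp)
  qed
qed

section \<open>Lattice words\<close>

definition lattice :: "nat \<Rightarrow> nat \<Rightarrow> nat list \<Rightarrow> bool" where
  "lattice a n x \<longleftrightarrow> (\<forall>p q r. x = p @ q \<longrightarrow> a < r \<longrightarrow> r < a + n \<longrightarrow> 0 \<le> exc r (Suc r) p)"

text \<open>The label \<open>r + 1\<close> behind \<open>p\<close> is the first violation. Right
  after it, the number of labels \<open>r + 1\<close> exceeds that of labels \<open>r\<close> by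
  one, so the values of count minus label agree for \<open>r\<close> and \<open>r + 1\<close>; this
  is what makes reflecting \<open>v\<close> a transposition of these values.\<close>

definition badsplit :: "nat \<Rightarrow> nat \<Rightarrow> nat list \<Rightarrow> nat \<Rightarrow> nat list \<Rightarrow> nat list \<Rightarrow> bool" where
  "badsplit a n x r p v \<longleftrightarrow> x = p @ [Suc r] @ v \<and> lattice a n p \<and> a < r \<and> r < a + n \<and> exc r (Suc r) p = 0"

lemma badsplit_ex: "\<not> lattice a n x \<Longrightarrow> \<exists>r p v. badsplit a n x r p v"
proof (induction x rule: rev_induct)
  case Nil then show ?case by (simp add: lattice_def)
next
  case (snoc c x)
  show ?case
  proof (cases "lattice a n x")
    case False
    then obtain r p v where "badsplit a n x r p v" using snoc.IH by blast
    then show ?thesis unfolding badsplit_def by (metis append_assoc)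
  next
    case True
    obtain p q r where p: "x @ [c] = p @ q" "a < r" "r < a + n" "exc r (Suc r) p < 0"
      using snoc.prems unfolding lattice_def by (auto simp: not_le)
    have "q = []"
    proof (rule ccontr)
      assume "q \<noteq> []"
      then have "\<exists>q'. x = p @ q'" using p(1) by (metis append_butlast_last_id append_assoc butlast_append butlast_snoc)
      then show False using True p unfolding lattice_def by (metis not_le)
    qed
    then have e: "exc r (Suc r) (x @ [c]) < 0" using p by simp
    have e0: "0 \<le> exc r (Suc r) x" using True p(2,3) unfolding lattice_def by (metis append_Nil2)
    then have "c = Suc r \<and> exc r (Suc r) x = 0" using e by (auto split: if_splits)
    then show ?thesis unfolding badsplit_def using True p(2,3) by (metis append_Nil2)
  qed
qed

lemma badsplit_lattice: "badsplit a n x r p v \<Longrightarrow> \<not> lattice a n x"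
proof
  assume b: "badsplit a n x r p v" and l: "lattice a n x"
  then have "x = (p @ [Suc r]) @ v" "a < r" "r < a + n" by (auto simp: badsplit_def)
  then have "0 \<le> exc r (Suc r) (p @ [Suc r])" using l unfolding lattice_def by blast
  then show False using b by (simp add: badsplit_def)
qed

lemma badsplit_unique:
  assumes "badsplit a n x r p v" "badsplit a n x r' p' v'"
  shows "r = r' \<and> p = p' \<and> v = v'"
proof -
  have no: "\<not> (\<exists>t. q @ [Suc k] @ t = q')" if "badsplit a n x k q y" "badsplit a n x k' q' y'" for k q y k' q' y'
  proof
    assume "\<exists>t. q @ [Suc k] @ t = q'"
    then obtain t where t: "q' = q @ [Suc k] @ t" by blast
    then have "badsplit a n q' k q t" using that(1) by (simp add: badsplit_def)
    then show False using badsplit_lattice that(2) by (auto simp: badsplit_def)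
  qed
  have x: "p @ [Suc r] @ v = p' @ [Suc r'] @ v'" using assms by (auto simp: badsplit_def)
  then obtain t where t: "(p = p' @ t \<and> t @ [Suc r] @ v = [Suc r'] @ v') \<or> (p @ t = p' \<and> [Suc r] @ v = t @ [Suc r'] @ v')"
    using append_eq_append_conv2[of p "[Suc r] @ v" p' "[Suc r'] @ v'"] by auto
  show ?thesis
  proof (cases t)
    case Nil
    then show ?thesis using t by auto
  next
    case (Cons c t')
    then have "(p' @ [Suc r'] @ t' = p) \<or> (p @ [Suc r] @ t' = p')" using t by auto
    then show ?thesis using no[OF assms] no[OF assms(2,1)] by blast
  qed
qed

text \<open>
  Reflecting the part of a non-lattice word after its first violation exchanges the shifted
  contents of two consecutive labels; hence the non-lattice words cancel.
\<close>

definition suffix_closed :: "nat \<Rightarrow> nat \<Rightarrow> nat list set \<Rightarrow> bool" where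
  "suffix_closed a n X \<longleftrightarrow> (\<forall>r p v v'. lattice a n p \<longrightarrow> a < r \<longrightarrow> r < a + n \<longrightarrow> exc r (Suc r) p = 0 \<longrightarrow>
     fstep r (Suc r) v v' \<longrightarrow> p @ [Suc r] @ v \<in> X \<longleftrightarrow> p @ [Suc r] @ v' \<in> X)"

lemma increasing_permutation:
  assumes "\<sigma> permutes {a<..a + n::nat}" "\<And>i j. a < i \<Longrightarrow> i < j \<Longrightarrow> j \<le> a + n \<Longrightarrow> \<sigma> i < \<sigma> j"
  shows "\<sigma> = id"
proof (rule permutes_natset_ge)
  show "\<sigma> permutes {a<..a + n}" by fact
  show "\<forall>i\<in>{a<..a + n}. i \<le> \<sigma> i"
  proof
    fix i assume "i \<in> {a<..a + n}"
    then have "a < i" "i \<le> a + n" by auto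
    then show "i \<le> \<sigma> i"
    proof (induction i)
      case (Suc i)
      have mem: "\<sigma> (Suc i) \<in> {a<..a + n}" using permutes_in_image[OF assms(1)] Suc.prems by simp
      show ?case
      proof (cases "a < i")
        case True
        then have "i \<le> \<sigma> i" "\<sigma> i < \<sigma> (Suc i)" using Suc assms(2)[of i "Suc i"] by auto
        then show ?thesis by simp
      qed (use mem Suc.prems in auto)
    qed simp
  qed
qed

lemma strict_dec_chain:
  fixes L :: "nat \<Rightarrow> int"
  assumes "\<And>i. a < i \<Longrightarrow> i < a + n \<Longrightarrow> L (Suc i) < L i" "a < i" "i < j" "j \<le> a + n"
  shows "L j < L i"
  using assms(3,4)
proof (induction j)
  case (Suc j)
  show ?case
  proof (cases "i = j")
    case True then show ?thesis using assms(1)[of i] assms(2) Suc.prems by simp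
  next
    case False
    then have "L j < L i" using Suc by simp
    moreover have "L (Suc j) < L j" using assms(1)[of j] assms(2) Suc.prems False by simp
    ultimately show ?thesis by simp
  qed
qed simp

theorem lattice_signed_count:
  fixes lam :: "nat \<Rightarrow> int"
  assumes fin: "finite X" and cl: "suffix_closed a n X"
    and dec: "\<And>i. a < i \<Longrightarrow> i < a + n \<Longrightarrow> lam (Suc i) \<le> lam i"
  shows "(\<Sum>\<sigma> | \<sigma> permutes {a<..a + n}. sign \<sigma> *
      int (card {x\<in>X. \<forall>i\<in>{a<..a + n}. int (count_list x i) - int i = lam (\<sigma> i) - int (\<sigma> i)})) =
    int (card {x\<in>X. lattice a n x \<and> (\<forall>i\<in>{a<..a + n}. int (count_list x i) = lam i)})"
proof -
  let ?V = "{a<..a + n}" and ?P = "{\<sigma>. \<sigma> permutes {a<..a + n}}"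
  define D where "D x i = int (count_list x i) - int i" for x i
  define L where "L i = lam i - int i" for i
  define \<epsilon> :: "nat list \<Rightarrow> int" where
    "\<epsilon> x = (\<Sum>\<sigma>\<in>?P. sign \<sigma> * (if \<forall>i\<in>?V. D x i = L (\<sigma> i) then 1 else 0))" for x
  have finP: "finite ?P" by (rule finite_permutations) simp
  have Ldec: "L j < L i" if "a < i" "i < j" "j \<le> a + n" for i j
    using strict_dec_chain[of a n L i j] dec that by (fastforce simp: L_def)
  have "(\<Sum>\<sigma>\<in>?P. sign \<sigma> * int (card {x\<in>X. \<forall>i\<in>?V. D x i = L (\<sigma> i)})) =
      (\<Sum>\<sigma>\<in>?P. \<Sum>x\<in>X. sign \<sigma> * (if \<forall>i\<in>?V. D x i = L (\<sigma> i) then 1 else 0))"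
  proof (intro sum.cong refl)
    fix \<sigma>
    have "int (card {x\<in>X. \<forall>i\<in>?V. D x i = L (\<sigma> i)}) = (\<Sum>x\<in>X. if \<forall>i\<in>?V. D x i = L (\<sigma> i) then 1 else 0)"
      using fin by (simp add: sum.If_cases Int_def)
    then show "sign \<sigma> * int (card {x\<in>X. \<forall>i\<in>?V. D x i = L (\<sigma> i)}) =
        (\<Sum>x\<in>X. sign \<sigma> * (if \<forall>i\<in>?V. D x i = L (\<sigma> i) then 1 else 0))"
      by (simp add: sum_distrib_left)
  qed
  also have "\<dots> = (\<Sum>x\<in>X. \<epsilon> x)" unfolding \<epsilon>_def by (rule sum.swap)
  also have "\<dots> = (\<Sum>x\<in>{x\<in>X. lattice a n x}. \<epsilon> x) + (\<Sum>x\<in>{x\<in>X. \<not> lattice a n x}. \<epsilon> x)"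
  proof -
    have "X = {x\<in>X. lattice a n x} \<union> {x\<in>X. \<not> lattice a n x}" by auto
    then show ?thesis using fin by (subst (1) \<open>X = _\<close>) (intro sum.union_disjoint; auto)
  qed
  also have "(\<Sum>x\<in>{x\<in>X. \<not> lattice a n x}. \<epsilon> x) = 0"
  proof -
    let ?B = "{x\<in>X. \<not> lattice a n x}"
    define R where "R x y \<longleftrightarrow> (\<exists>r p v v'. badsplit a n x r p v \<and> flip r (Suc r) v v' \<and> y = p @ [Suc r] @ v')" for x y
    define \<phi> where "\<phi> x = (SOME y. R x y)" for x
    have ex: "\<exists>y. R x y" if x: "x \<in> ?B" for x
    proof -
      obtain r p v where "badsplit a n x r p v" using badsplit_ex x by blast
      moreover obtain v' where "flip r (Suc r) v v'" using flip_total by (metis n_not_Suc_n)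
      ultimately show ?thesis unfolding R_def by blast
    qed
    have R: "R x (\<phi> x)" if "x \<in> ?B" for x unfolding \<phi>_def by (rule someI_ex[OF ex[OF that]])
    have Rsym: "R y x" if xy: "R x y" for x y
    proof -
      obtain r p v v' where *: "badsplit a n x r p v" "flip r (Suc r) v v'" "y = p @ [Suc r] @ v'"
        using xy unfolding R_def by blast
      then have "badsplit a n y r p v'" "x = p @ [Suc r] @ v" by (auto simp: badsplit_def)
      then show ?thesis unfolding R_def using flip_sym[OF *(2)] by auto
    qed
    have Runique: "y = z" if "R x y" "R x z" for x y z
      using that unfolding R_def using badsplit_unique flip_unique by (metis n_not_Suc_n)
    have RB: "y \<in> ?B" if xy: "R x y" "x \<in> ?B" for x y
    proof -
      obtain r p v v' where *: "badsplit a n x r p v" "flip r (Suc r) v v'" "y = p @ [Suc r] @ v'"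
        using xy(1) unfolding R_def by blast
      then have "badsplit a n y r p v'" by (auto simp: badsplit_def)
      then have "\<not> lattice a n y" by (rule badsplit_lattice)
      moreover have "v' \<in> {v. p @ [Suc r] @ v \<in> X}"
      proof (rule flip_closed[OF *(2)])
        show "v \<in> {v. p @ [Suc r] @ v \<in> X}" using *(1) xy(2) by (simp add: badsplit_def)
        show "u \<in> {v. p @ [Suc r] @ v \<in> X} \<longleftrightarrow> u' \<in> {v. p @ [Suc r] @ v \<in> X}" if "fstep r (Suc r) u u'" for u u'
          using cl *(1) that unfolding suffix_closed_def badsplit_def by blast
      qed
      ultimately show ?thesis using *(3) by simp
    qed
    have bij: "bij_betw \<phi> ?B ?B"
    proof (rule bij_betw_byWitness[of _ \<phi>])
      show "\<phi> ` ?B \<subseteq> ?B" using R RB by blast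
      then show "\<phi> ` ?B \<subseteq> ?B" .
      have "\<phi> (\<phi> x) = x" if "x \<in> ?B" for x
        using Runique[OF R[OF RB[OF R[OF that] that]] Rsym[OF R[OF that]]] .
      then show "\<forall>x\<in>?B. \<phi> (\<phi> x) = x" "\<forall>x\<in>?B. \<phi> (\<phi> x) = x" by blast+
    qed
    have neg: "\<epsilon> (\<phi> x) = - \<epsilon> x" if x: "x \<in> ?B" for x
    proof -
      obtain r p v v' where *: "badsplit a n x r p v" "flip r (Suc r) v v'" "\<phi> x = p @ [Suc r] @ v'"
        using R[OF x] unfolding R_def by blast
      let ?t = "Transposition.transpose r (Suc r)"
      have rV: "a < r" "r < a + n" "x = p @ [Suc r] @ v" "exc r (Suc r) p = 0" using *(1) by (auto simp: badsplit_def)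
      have tp: "?t permutes ?V" using rV by (intro permutes_swap_id) auto
      \<comment> \<open>Up to the violating label the counts of \<open>r\<close> and
        \<open>r + 1\<close> differ by exactly the difference of the two labels. Exchanging the
        counts inside \<open>v\<close> therefore exchanges the shifted contents of the entire
        word.\<close>
      have Dt: "D (\<phi> x) i = D x (?t i)" for i
      proof -
        have e: "D (\<phi> x) i = int (count_list (p @ [Suc r] @ v') i) - int i"
          "D x j = int (count_list (p @ [Suc r] @ v) j) - int j" for j
          unfolding D_def *(3) by (simp_all only: rV(3))
        consider "i = r" | "i = Suc r" | "i \<noteq> r" "i \<noteq> Suc r" by blast
        then show ?thesis unfolding e
          using flip_count(1-3)[OF *(2)] flip_count(4)[OF *(2), of i] rV(4)
          by cases (auto simp: exc_def)
      qed
      have "\<epsilon> (\<phi> x) = (\<Sum>\<sigma>\<in>?P. sign (\<sigma> \<circ> ?t) * (if \<forall>i\<in>?V. D (\<phi> x) i = L ((\<sigma> \<circ> ?t) i) then 1 else 0))"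
        unfolding \<epsilon>_def by (rule sum_permutations_compose_right[OF tp])
      also have "\<dots> = (\<Sum>\<sigma>\<in>?P. - (sign \<sigma> * (if \<forall>i\<in>?V. D x i = L (\<sigma> i) then 1 else 0)))"
      proof (intro sum.cong refl)
        fix \<sigma> assume s: "\<sigma> \<in> ?P"
        have "permutation \<sigma>" "permutation ?t" using s tp permutation_permutes by blast+
        then have sg: "sign (\<sigma> \<circ> ?t) = - sign \<sigma>" by (simp add: sign_compose sign_swap_id)
        have "(\<forall>i\<in>?V. D (\<phi> x) i = L ((\<sigma> \<circ> ?t) i)) \<longleftrightarrow> (\<forall>i\<in>?V. D x i = L (\<sigma> i))"
        proof -
          have "(\<forall>i\<in>?V. D x (?t i) = L (\<sigma> (?t i))) \<longleftrightarrow> (\<forall>i\<in>?t ` ?V. D x i = L (\<sigma> i))" by blast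
          then show ?thesis unfolding Dt permutes_image[OF tp] by simp
        qed
        then show "sign (\<sigma> \<circ> ?t) * (if \<forall>i\<in>?V. D (\<phi> x) i = L ((\<sigma> \<circ> ?t) i) then 1 else 0) =
            - (sign \<sigma> * (if \<forall>i\<in>?V. D x i = L (\<sigma> i) then 1 else 0))" using sg by simp
      qed
      also have "\<dots> = - \<epsilon> x" by (simp add: \<epsilon>_def sum_negf)
      finally show ?thesis .
    qed
    have "(\<Sum>x\<in>?B. \<epsilon> x) = (\<Sum>x\<in>?B. \<epsilon> (\<phi> x))" by (rule sum.reindex_bij_betw[OF bij, symmetric])
    also have "\<dots> = (\<Sum>x\<in>?B. - \<epsilon> x)" by (intro sum.cong refl neg)
    also have "\<dots> = - (\<Sum>x\<in>?B. \<epsilon> x)" by (rule sum_negf)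
    finally show ?thesis by simp
  qed
  also have "(\<Sum>x\<in>{x\<in>X. lattice a n x}. \<epsilon> x) =
      (\<Sum>x\<in>{x\<in>X. lattice a n x}. if \<forall>i\<in>?V. int (count_list x i) = lam i then 1 else 0)"
  proof (intro sum.cong refl)
    fix x assume "x \<in> {x\<in>X. lattice a n x}"
    then have l: "lattice a n x" by simp
    \<comment> \<open>Weakly decreasing counts become strictly decreasing after subtraction of the
      label. The same holds for \<open>L\<close>, and a permutation matching two strictly decreasing
      sequences is the identity.\<close>
    have Dd: "D x j < D x i" if "a < i" "i < j" "j \<le> a + n" for i j
    proof (rule strict_dec_chain[of a n "D x"])
      show "D x (Suc i) < D x i" if "a < i" "i < a + n" for i
      proof -
        have "0 \<le> exc i (Suc i) x" using l that unfolding lattice_def by (metis append_Nil2)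
        then show ?thesis by (simp add: D_def exc_def)
      qed
    qed (use that in auto)
    have "\<sigma> = id" if s: "\<sigma> permutes ?V" "\<forall>i\<in>?V. D x i = L (\<sigma> i)" for \<sigma>
    proof (rule increasing_permutation[OF s(1)])
      fix i j assume ij: "a < i" "i < j" "j \<le> a + n"
      have m: "\<sigma> i \<in> ?V" "\<sigma> j \<in> ?V" using permutes_in_image[OF s(1)] ij by auto
      have "L (\<sigma> j) < L (\<sigma> i)" using Dd[OF ij] s(2) ij by auto
      then show "\<sigma> i < \<sigma> j" using Ldec[of "\<sigma> j" "\<sigma> i"] m by (metis greaterThanAtMost_iff linorder_neqE_nat order_less_asym order_less_irrefl)
    qed
    then have "\<epsilon> x = (\<Sum>\<sigma>\<in>?P. if \<sigma> = id then (if \<forall>i\<in>?V. D x i = L i then 1 else 0) else 0)"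
      unfolding \<epsilon>_def by (intro sum.cong refl) auto
    also have "\<dots> = (if \<forall>i\<in>?V. D x i = L i then 1 else 0)"
      using finP permutes_id[of ?V] by (subst sum.delta) auto
    finally show "\<epsilon> x = (if \<forall>i\<in>?V. int (count_list x i) = lam i then 1 else 0)"
      by (simp add: D_def L_def)
  qed
  also have "\<dots> = int (card {x\<in>X. lattice a n x \<and> (\<forall>i\<in>?V. int (count_list x i) = lam i)})"
    using fin by (simp add: sum.If_cases Int_def conj_assoc)
  finally show ?thesis by (simp add: D_def L_def)
qed

subsection \<open>Reading orders and words with a prescribed catabolism type\<close>

definition Lr :: "nat \<Rightarrow> nat \<Rightarrow> nat \<Rightarrow> nat list" where
  "Lr c b N = rev [Suc c..<Suc b] @ rev [Suc b..<Suc (b + N)]"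

text \<open>
  The rows \<open>b, \<dots>, c + 1\<close> are read before the rows \<open>b + N, \<dots>, b + 1\<close>, as in the word of the
  catabolism.
\<close>

definition cset :: "nat \<Rightarrow> nat \<Rightarrow> nat \<Rightarrow> nat list \<Rightarrow> nat \<Rightarrow> nat list set" where
  "cset c b N \<eta> k = {w. length w = N \<and> set w \<subseteq> {c<..b + N} \<and>
     good \<eta> (ct b (rd b (Lr c b N) w)) \<and> chg b (rd b (Lr c b N) w) = k}"

text \<open>The words after one catabolism, with the removed block restored as the prefix
  \<open>a + 1, ..., b\<close>. The labels \<open>\<le> b\<close> belong to the letters that the
  catabolism moves to the front; their number is the charge lost in this move, see
  \<open>lattice_catabolism\<close>.\<close>

definition Xset :: "nat \<Rightarrow> nat \<Rightarrow> nat \<Rightarrow> nat list \<Rightarrow> nat \<Rightarrow> nat list set" where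
  "Xset a b N \<eta> k = (\<lambda>w. [Suc a..<Suc b] @ w) `
     {w. \<exists>k1. w \<in> cset a b N \<eta> k1 \<and> k1 + length (filter (\<lambda>c. c \<le> b) w) = k}"

lemma set_Lr: "c \<le> b \<Longrightarrow> set (Lr c b N) = {c<..b + N}"
  by (auto simp: Lr_def)

lemma distinct_Lr: "distinct (Lr c b N)"
  by (auto simp: Lr_def)

lemma rd_Nil_notin: "(\<forall>i\<in>set L. i \<notin> set w) \<Longrightarrow> rd a L w = []"
  by (induction L) (auto simp: rowpos_notin)

lemma finite_cset: "finite (cset c b N \<eta> k)"
proof (rule finite_subset)
  show "cset c b N \<eta> k \<subseteq> {w. set w \<subseteq> {c<..b + N} \<and> length w = N}" by (auto simp: cset_def)
  show "finite {w. set w \<subseteq> {c<..b + N} \<and> length w = N}" by (rule finite_lists_length_eq) simp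
qed

lemma upt_split: "i \<le> j \<Longrightarrow> j \<le> k \<Longrightarrow> [i..<k] = [i..<j] @ [j..<k]"
  by (metis le_add_diff_inverse upt_add_eq_append)

text \<open>Rows without letters leave no trace in the reading word, so forbidding the labels
  \<open>c + 1, ..., c'\<close> gives the set defined with the shorter reading order.\<close>

lemma cset_restrict:
  assumes "c \<le> c'" "c' \<le> b"
  shows "{w \<in> cset c b N \<eta> k. set w \<subseteq> {c'<..b + N}} = cset c' b N \<eta> k"
proof -
  have "rd b (Lr c b N) w = rd b (Lr c' b N) w" if "set w \<subseteq> {c'<..b + N}" for w
  proof -
    have "rd b (rev [Suc c..<Suc c']) w = []" using that by (intro rd_Nil_notin) auto
    then show ?thesis using upt_split[of "Suc c" "Suc c'" "Suc b"] assms by (simp add: Lr_def)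
  qed
  moreover have "set w \<subseteq> {c<..b + N}" if "set w \<subseteq> {c'<..b + N}" for w using that assms by auto
  ultimately show ?thesis unfolding cset_def by auto
qed

lemma cset_step:
  assumes "Lr c b N = L1 @ [s, r] @ L2" "r \<noteq> s" "fstep r s v v'" "c \<le> b"
  shows "v \<in> cset c b N \<eta> k \<longleftrightarrow> v' \<in> cset c b N \<eta> k"
proof -
  have "r \<in> {c<..b + N}" "s \<in> {c<..b + N}" using set_Lr[OF assms(4), of N] assms(1) by auto
  then have "set v \<subseteq> {c<..b + N} \<longleftrightarrow> set v' \<subseteq> {c<..b + N}" using fstep_set[OF assms(3)] by auto
  moreover have "length v' = length v" using fstep_count[OF assms(3,2)] by blast
  moreover have "rd b (Lr c b N) v \<approx> rd b (Lr c b N) v'"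
    using fstep_rd[OF assms(3,2), of L1 L2 b] distinct_Lr[of c b N] unfolding assms(1) by blast
  ultimately show ?thesis
    using ct_knuth[of "rd b (Lr c b N) v" "rd b (Lr c b N) v'" b] chg_knuth[of "rd b (Lr c b N) v" "rd b (Lr c b N) v'" b]
    unfolding cset_def by auto
qed

lemma rev_upt_adj: "i \<le> r \<Longrightarrow> Suc r < j \<Longrightarrow> rev [i..<j] = rev [Suc (Suc r)..<j] @ [Suc r, r] @ rev [i..<r]"
proof -
  assume a: "i \<le> r" "Suc r < j"
  have "[i..<j] = [i..<r] @ [r..<j]" using a by (intro upt_split) auto
  also have "[r..<j] = r # Suc r # [Suc (Suc r)..<j]" using a by (simp add: upt_conv_Cons)
  finally show ?thesis by simp
qed

lemma Lr_adj:
  assumes "c < r" "r < b + N" "r \<noteq> b" "c \<le> b"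
  shows "\<exists>L1 L2. Lr c b N = L1 @ [Suc r, r] @ L2"
proof (cases "r < b")
  case True
  then have "rev [Suc c..<Suc b] = rev [Suc (Suc r)..<Suc b] @ [Suc r, r] @ rev [Suc c..<r]"
    using assms by (intro rev_upt_adj) auto
  then show ?thesis unfolding Lr_def by (metis append_assoc)
next
  case False
  then have "rev [Suc b..<Suc (b + N)] = rev [Suc (Suc r)..<Suc (b + N)] @ [Suc r, r] @ rev [Suc b..<r]"
    using assms by (intro rev_upt_adj) auto
  then show ?thesis unfolding Lr_def by (metis append_assoc)
qed

lemma cset_swap:
  assumes "c < r" "r < b + N" "r \<noteq> b" "c \<le> b" "fstep r (Suc r) v v'"
  shows "v \<in> cset c b N \<eta> k \<longleftrightarrow> v' \<in> cset c b N \<eta> k"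
  using Lr_adj[OF assms(1-4)] cset_step[OF _ _ assms(5,4)] by (metis n_not_Suc_n)

text \<open>In the rotated order row \<open>c + 1\<close> is read directly before row
  \<open>b + N\<close>. This replaces the missing neighbourhood of \<open>b\<close> and
  \<open>b + 1\<close>: one label outside the block becomes exchangeable with the block.\<close>

lemma cset_swap_ends:
  assumes "c < b" "0 < N" "fstep (b + N) (Suc c) v v'"
  shows "v \<in> cset c b N \<eta> k \<longleftrightarrow> v' \<in> cset c b N \<eta> k"
proof -
  have "rev [Suc c..<Suc b] = rev [Suc (Suc c)..<Suc b] @ [Suc c]" using assms(1) by (simp add: upt_conv_Cons)
  moreover have "rev [Suc b..<Suc (b + N)] = (b + N) # rev [Suc b..<b + N]" using assms(2) by (simp add: upt_Suc)
  ultimately have "Lr c b N = rev [Suc (Suc c)..<Suc b] @ [Suc c, b + N] @ rev [Suc b..<b + N]"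
    by (simp add: Lr_def)
  then show ?thesis using assms by (intro cset_step) auto
qed

subsection \<open>Reflection of suffixes\<close>

lemma rowpos_upt: "rowpos a i [Suc a..<Suc (a + m)] = (if a < i \<and> i \<le> a + m then [i] else [])"
proof (induction m)
  case (Suc m)
  have "[Suc a..<Suc (a + Suc m)] = [Suc a..<Suc (a + m)] @ [Suc (a + m)]" by (simp add: upt_Suc)
  then show ?case using Suc by (auto simp: rowpos_append)
qed simp

lemma suffix_cases: "p @ [s] @ u = q1 @ q \<Longrightarrow> (\<exists>t. u = t @ q) \<or> (\<exists>q2. p = q1 @ q2 \<and> q = q2 @ [s] @ u)"
  by (auto simp: append_eq_append_conv2 append_eq_Cons_conv Cons_eq_append_conv)

text \<open>For \<open>r \<noteq> b\<close> the rows \<open>r + 1\<close> and \<open>r\<close> are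
  neighbours in the reading order and the number of labels \<open>\<le> b\<close> is unchanged. For
  \<open>r = b\<close> the row \<open>b + 1\<close>, apart from its two smallest letters, is rotated
  to the front before the step is applied.\<close>

lemma suffix_closed_Xset:
  assumes ab: "a < b"
  shows "suffix_closed a (b - a + N) (Xset a b N \<eta> k)"
  unfolding suffix_closed_def
proof (intro allI impI)
  fix r p v v'
  assume lat: "lattice a (b - a + N) p" and r: "a < r" "r < a + (b - a + N)" and e0: "exc r (Suc r) p = 0"
    and step: "fstep r (Suc r) v v'"
  let ?I = "[Suc a..<Suc b]" and ?s = "Suc r"
  have rb: "r < b + N" using r ab by simp
  have cntI: "count_list ?I i = (if a < i \<and> i \<le> b then 1 else 0)" for i
    using length_rowpos[of a i ?I] rowpos_upt[of a i "b - a"] ab by (cases "a < i \<and> i \<le> b") auto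
  \<comment> \<open>Within the increasing prefix every label \<open>r + 1\<close> is preceded by
    \<open>r\<close> and by no earlier \<open>r + 1\<close>, which gives excess 1; so the violation
    lies behind it.\<close>
  have lenpre: "\<exists>p'. p = ?I @ p'" if pre: "p @ [?s] @ y = ?I @ w" for y w
  proof (rule ccontr)
    assume n: "\<nexists>p'. p = ?I @ p'"
    then obtain t where t: "?I = p @ t" "t @ w = [?s] @ y"
      using pre by (auto simp: append_eq_append_conv2)
    moreover have "t \<noteq> []" using t(1) n by auto
    ultimately obtain t' where t': "t = ?s # t'" by (cases t) auto
    have d: "distinct (p @ ?s # t')" using t(1) t' distinct_upt[of "Suc a" "Suc b"] by metis
    have "sorted (p @ ?s # t')" using t(1) t' sorted_upt[of "Suc a" "Suc b"] by metis
    moreover have "r \<in> set ?I"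
    proof -
      have "?s \<in> set ?I" using t(1) t' by simp
      then show ?thesis using r by auto
    qed
    ultimately have "r \<in> set p" using t(1) t' by (auto simp: sorted_append)
    moreover have "?s \<notin> set p" using d by simp
    ultimately have "0 < exc r ?s p" by (simp add: exc_def count_list_0_iff count_notin) (metis count_list_0_iff neq0_conv)
    then show False using e0 by simp
  qed
  have main: "?I @ p' @ [?s] @ v \<in> Xset a b N \<eta> k \<longleftrightarrow> ?I @ p' @ [?s] @ v' \<in> Xset a b N \<eta> k" if p: "p = ?I @ p'" for p'
  proof -
    have mem: "?I @ w \<in> Xset a b N \<eta> k \<longleftrightarrow> (\<exists>k1. w \<in> cset a b N \<eta> k1 \<and> k1 + length (filter (\<lambda>c. c \<le> b) w) = k)" for w
      unfolding Xset_def by auto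
    obtain u z where uz: "v = u @ [r] @ z" "v' = u @ [?s] @ z"
      "\<forall>p q. u = p @ q \<longrightarrow> exc r ?s q \<le> 0" "\<forall>p q. z = p @ q \<longrightarrow> 0 \<le> exc r ?s p"
      using step unfolding fstep_def by blast
    have eu: "exc r ?s u \<le> 0" using uz(3) by blast
    define U where "U = p' @ [?s] @ u"
    \<comment> \<open>Since \<open>p\<close> is a lattice word of excess 0, its suffixes have
      nonpositive excess. Hence a step inside \<open>v\<close> is also a step of the word
      \<open>w\<close> that contains it.\<close>
    have suf: "exc r ?s q2 \<le> 0" if "p' = q1 @ q2" for q1 q2
    proof -
      have "p = (?I @ q1) @ q2" using p that by simp
      then have "0 \<le> exc r ?s (?I @ q1)" using lat r unfolding lattice_def by blast
      moreover have "exc r ?s p = exc r ?s (?I @ q1) + exc r ?s q2" using p that by simp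
      ultimately show ?thesis using e0 by simp
    qed
    have U: "\<forall>q1 q. U = q1 @ q \<longrightarrow> exc r ?s q \<le> 0"
    proof (intro allI impI)
      fix q1 q assume "U = q1 @ q"
      from suffix_cases[OF this[unfolded U_def]] show "exc r ?s q \<le> 0"
      proof
        assume "\<exists>t. u = t @ q" then show ?thesis using uz(3) by blast
      next
        assume "\<exists>q2. p' = q1 @ q2 \<and> q = q2 @ [?s] @ u"
        then obtain q2 where "p' = q1 @ q2" "q = q2 @ [?s] @ u" by blast
        then show ?thesis using suf[of q1 q2] eu by simp
      qed
    qed
    define w w' where "w = p' @ [?s] @ v" and "w' = p' @ [?s] @ v'"
    have ww: "w = U @ [r] @ z" "w' = U @ [?s] @ z" by (simp_all add: w_def w'_def U_def uz)
    have fs: "fstep r ?s w w'" unfolding fstep_def using ww U uz(4) by blast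
    have "(\<exists>k1. w \<in> cset a b N \<eta> k1 \<and> k1 + length (filter (\<lambda>c. c \<le> b) w) = k) \<longleftrightarrow>
        (\<exists>k1. w' \<in> cset a b N \<eta> k1 \<and> k1 + length (filter (\<lambda>c. c \<le> b) w') = k)"
    proof (cases "r = b")
      case False
      have "length (filter (\<lambda>c. c \<le> b) w') = length (filter (\<lambda>c. c \<le> b) w)" using False by (auto simp: ww)
      then show ?thesis using cset_swap[OF r(1) rb False _ fs, of \<eta>] ab by simp
    next
      case True
      \<comment> \<open>The prefix \<open>?I\<close> contains \<open>b\<close> once and
        \<open>b + 1\<close> not at all, so \<open>p'\<close> has excess -1, and the violating label
        contributes another -1. This is the surplus that \<open>fstep_held\<close> asks for.\<close>
      have eU: "exc r ?s U \<le> - 2"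
      proof -
        have "exc r ?s p = exc r ?s ?I + exc r ?s p'" using p by simp
        moreover have "exc r ?s ?I = 1" using True r by (simp add: exc_def cntI)
        ultimately show ?thesis using e0 eu by (simp add: U_def)
      qed
      let ?L = "Lr a b N"
      define M where "M = rev [Suc a..<b] @ rev [Suc ?s..<Suc (b + N)]"
      have L: "?L = [r] @ M @ [?s]"
      proof -
        have "rev [Suc a..<Suc b] = b # rev [Suc a..<b]" using ab by (simp add: upt_Suc)
        moreover have "rev [Suc b..<Suc (b + N)] = rev [Suc (Suc b)..<Suc (b + N)] @ [Suc b]"
          using rb True by (simp add: upt_conv_Cons)
        ultimately show ?thesis using True by (simp add: Lr_def M_def)
      qed
      obtain y1 y2 \<beta> \<beta>' where H: "rowpos b ?s w = y1 # y2 # \<beta>" "rowpos b ?s w' = y1 # y2 # \<beta>'"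
        "\<beta> @ rowpos b r w \<approx> \<beta>' @ rowpos b r w'" "length \<beta>' = Suc (length \<beta>)"
        by (rule fstep_held[OF ww U uz(4) _ eU, of b]) auto
      have rM: "rd b M w = rd b M w'"
      proof (rule rd_cong)
        fix i assume "i \<in> set M"
        then have "i \<noteq> r" "i \<noteq> ?s" using True by (auto simp: M_def)
        then show "rowpos b i w = rowpos b i w'" by (simp add: ww rowpos_append)
      qed
      define m where "m = rd b M w @ [y1, y2]"
      have rdw: "rd b ?L w = (rowpos b r w @ m) @ \<beta>" "rd b ?L w' = (rowpos b r w' @ m) @ \<beta>'"
        unfolding L m_def by (simp_all add: H rM)
      have kn: "\<beta> @ rowpos b r w @ m \<approx> \<beta>' @ rowpos b r w' @ m"
        using knuth_app_right[OF H(3), of m] by simp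
      have len: "length w' = length w" by (simp add: ww)
      have sets: "set w \<subseteq> {a<..b + N} \<longleftrightarrow> set w' \<subseteq> {a<..b + N}" using r rb ab True by (auto simp: ww)
      \<comment> \<open>All letters of \<open>\<gamma>\<close> exceed \<open>y2\<close>, and
        \<open>y1 < y2\<close> stay behind in \<open>m\<close>; this pair permits the rotation for
        the type. The letters exceed \<open>b + 1\<close>, so each of them changes the charge by
        one.\<close>
      have rot: "ct b ((rowpos b r x @ m) @ \<gamma>) = ct b (\<gamma> @ rowpos b r x @ m) \<and>
          chg b ((rowpos b r x @ m) @ \<gamma>) = chg b (\<gamma> @ rowpos b r x @ m) + length \<gamma>"
        if x: "set x \<subseteq> {a<..b + N}" "rowpos b ?s x = y1 # y2 # \<gamma>" "rd b ?L x = (rowpos b r x @ m) @ \<gamma>" for x \<gamma>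
      proof -
        have wd: "word_on b ((rowpos b r x @ m) @ \<gamma>)"
          using word_on_rd[OF distinct_Lr, of x a b N b] x set_Lr[of a b N] ab by simp
        have srt: "sorted_wrt (<) (y1 # y2 # \<gamma>)" using sorted_rowpos[of b ?s x] x(2) by simp
        have "b < y1" using set_rowpos[of b ?s x] x(2) by auto
        then have "\<forall>z\<in>set \<gamma>. Suc b < z" using srt by fastforce
        moreover have "\<forall>z\<in>set \<gamma>. \<not> sorted_wrt (>) (filter (\<lambda>x. x < z) (rowpos b r x @ m))"
        proof
          fix z assume "z \<in> set \<gamma>"
          then have "y1 < y2" "y2 < z" using srt by auto
          then show "\<not> sorted_wrt (>) (filter (\<lambda>x. x < z) (rowpos b r x @ m))"
            using not_sorted_pair[of y1 "rowpos b r x @ rd b M w @ [y1]" y2 "[y2]" z] by (simp add: m_def)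
        qed
        ultimately show ?thesis using ct_rotate[OF wd] chg_rotate_many[OF wd] by fastforce
      qed
      \<comment> \<open>One label \<open>\<le> b\<close> is lost, while \<open>\<beta>'\<close> has
        one letter more than \<open>\<beta>\<close> and so one more unit of charge is set free by
        the rotation; the sum of both statistics is unchanged.\<close>
      have "length (filter (\<lambda>c. c \<le> b) w) = Suc (length (filter (\<lambda>c. c \<le> b) w'))" using True by (simp add: ww)
      moreover have "good \<eta> (ct b (rd b ?L w)) \<longleftrightarrow> good \<eta> (ct b (rd b ?L w'))"
        "chg b (rd b ?L w') = Suc (chg b (rd b ?L w))" if "set w \<subseteq> {a<..b + N}"
        using rot[OF that H(1) rdw(1)] rot[OF _ H(2) rdw(2)] that sets ct_knuth[OF kn] chg_knuth[OF kn] H(4)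
        unfolding rdw by auto
      ultimately show ?thesis unfolding cset_def using len sets by auto
    qed
    then show ?thesis using mem[of w] mem[of w'] by (simp add: w_def w'_def)
  qed
  show "p @ [?s] @ v \<in> Xset a b N \<eta> k \<longleftrightarrow> p @ [?s] @ v' \<in> Xset a b N \<eta> k"
  proof (cases "\<exists>p'. p = ?I @ p'")
    case True
    then obtain p' where "p = ?I @ p'" by blast
    from main[OF this] show ?thesis using \<open>p = ?I @ p'\<close> by simp
  next
    case False
    then have "p @ [?s] @ y \<notin> Xset a b N \<eta> k" for y unfolding Xset_def using lenpre by blast
    then show ?thesis by blast
  qed
qed

subsection \<open>Lattice words and tableaux\<close>

definition Trows :: "nat \<Rightarrow> nat \<Rightarrow> nat list \<Rightarrow> tableau" where
  "Trows a n x = map (\<lambda>i. rowpos a i x) [Suc a..<Suc (a + n)]"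

lemma length_Trows [simp]: "length (Trows a n x) = n"
  by (simp add: Trows_def)

lemma Trows_nth: "i < n \<Longrightarrow> Trows a n x ! i = rowpos a (Suc (a + i)) x"
  by (simp add: Trows_def)

lemma Lr_self: "Lr a a n = rev [Suc a..<Suc (a + n)]"
  by (simp add: Lr_def)

lemma row_word_Trows: "row_word (Trows a n x) = rd a (Lr a a n) x"
  by (simp add: row_word_def rd_def Trows_def Lr_self rev_map)

lemma stacked_Trows: "stacked (Trows a n x) \<longleftrightarrow> lattice a n x"
proof
  assume l: "lattice a n x"
  show "stacked (Trows a n x)" unfolding stacked_conv_nth
  proof (intro allI impI)
    fix i assume i: "Suc i < length (Trows a n x)"
    have "stacked2 (rowpos a (Suc (a + i)) x) (rowpos a (Suc (Suc (a + i))) x)"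
    proof (rule front_stacked)
      show "\<forall>p q. x = p @ q \<longrightarrow> 0 \<le> exc (Suc (a + i)) (Suc (Suc (a + i))) p"
        using l i unfolding lattice_def by simp
    qed simp
    then show "stacked2 (Trows a n x ! i) (Trows a n x ! Suc i)" using i by (simp add: Trows_nth)
  qed
next
  assume s: "stacked (Trows a n x)"
  show "lattice a n x" unfolding lattice_def
  proof (intro allI impI)
    fix p q r assume x: "x = p @ q" and r: "a < r" "r < a + n"
    obtain i where i: "r = Suc (a + i)" using r(1) less_iff_Suc_add by blast
    have "stacked2 (Trows a n x ! i) (Trows a n x ! Suc i)" using s r i unfolding stacked_conv_nth by simp
    then have "stacked2 (rowpos a r x) (rowpos a (Suc r) x)" using r i by (simp add: Trows_nth)
    from front_stacked_conv[OF n_not_Suc_n this x] show "0 \<le> exc r (Suc r) p" .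
  qed
qed

lemma column_strict_rows:
  assumes "stacked T" "\<forall>r\<in>set T. sorted_wrt (<) r"
  shows "column_strict (filter (\<lambda>r. r \<noteq> []) T)"
  using stacked_filter[OF assms(1)] assms(2) by (auto simp: column_strict_conv intro: strict_sorted_imp_sorted)

lemma stacked_nonempty_first:
  "stacked T \<Longrightarrow> T = filter (\<lambda>r. r \<noteq> []) T @ replicate (length T - length (filter (\<lambda>r. r \<noteq> []) T)) []"
proof (induction T)
  case (Cons r T)
  have T: "stacked T" using Cons.prems by (rule stacked_Cons)
  show ?case
  proof (cases "r = []")
    case True
    then have e: "\<forall>s\<in>set T. s = []" using stacked_hd[OF Cons.prems] by blast
    then have "filter (\<lambda>r. r \<noteq> []) T = []" by (auto simp: filter_empty_conv)
    moreover have "T = replicate (length T) []" using e by (simp add: replicate_length_same)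
    ultimately show ?thesis using True by simp
  next
    case False
    then show ?thesis using Cons.IH[OF T] by simp
  qed
qed simp

lemma sorted_Trows: "\<forall>r\<in>set (Trows a n x). sorted_wrt (<) r"
  by (auto simp: Trows_def sorted_rowpos)

lemma Trows_inj:
  assumes "Trows a n x = Trows a n y" "set x \<subseteq> {a<..a + n}" "length x = length y"
  shows "x = y"
proof (rule nth_equalityI)
  fix k assume k: "k < length x"
  then have "x ! k \<in> {a<..a + n}" using assms(2) nth_mem by blast
  then have i: "x ! k = Suc (a + (x ! k - Suc a))" "x ! k - Suc a < n" by auto
  define i where "i = x ! k - Suc a"
  have i: "x ! k = Suc (a + i)" "i < n" using i by (simp_all only: i_def)
  have "Suc (a + k) \<in> set (rowpos a (x ! k) x)" using k by (simp add: in_rowpos)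
  moreover have "rowpos a (x ! k) x = rowpos a (x ! k) y"
    using arg_cong[OF assms(1), of "\<lambda>T. T ! i"] i by (simp add: Trows_nth)
  ultimately show "x ! k = y ! k" by (simp add: in_rowpos)
qed (rule assms(3))

lemma length_rd_all: "distinct L \<Longrightarrow> set w \<subseteq> set L \<Longrightarrow> length (rd a L w) = length w"
  using arg_cong[OF mset_rd, of L w size a] by simp

text \<open>A lattice word describes a tableau, and empty rows can only come last, so the class
  determines all rows. In \<open>schur_nonneg\<close> this reduces a Knuth class to a single
  alternant.\<close>

lemma lattice_knuth_unique:
  assumes "lattice a n x" "lattice a n y" "rd a (Lr a a n) x \<approx> rd a (Lr a a n) y"
    "set x \<subseteq> {a<..a + n}" "set y \<subseteq> {a<..a + n}"
  shows "x = y"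
proof -
  let ?F = "filter (\<lambda>r. r \<noteq> ([]::nat list))"
  have st: "stacked (Trows a n x)" "stacked (Trows a n y)" using assms(1,2) stacked_Trows by auto
  have c: "column_strict (?F (Trows a n x))" "column_strict (?F (Trows a n y))"
    using column_strict_rows st sorted_Trows by auto
  have w: "word_on a (rd a (Lr a a n) x)" "word_on a (rd a (Lr a a n) y)"
    using word_on_rd[OF distinct_Lr] set_Lr[of a a n] assms(4,5) by auto
  have "?F (Trows a n x) = ?F (Trows a n y)"
    using tableau_unique[OF c] assms(3) w(1) by (simp add: row_word_filter row_word_Trows word_on_def)
  then have "Trows a n x = Trows a n y"
    using stacked_nonempty_first[OF st(1), unfolded length_Trows] stacked_nonempty_first[OF st(2), unfolded length_Trows]
    by metis
  moreover have "length x = length y"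
    using knuth_length[OF assms(3)] length_rd_all[OF distinct_Lr, of x a a n a] length_rd_all[OF distinct_Lr, of y a a n a] assms(4,5) set_Lr[of a a n] by simp
  ultimately show ?thesis using Trows_inj assms(4) by blast
qed

lemma map_xrows: "map (\<lambda>i. i # f i) [Suc a..<Suc (a + m)] = xrows a (map f [Suc a..<Suc (a + m)])"
proof (induction m arbitrary: a)
  case (Suc m)
  show ?case using Suc[of "Suc a"] unfolding upt_Suc_Cons by simp
qed simp

text \<open>The nonempty rows of \<open>xrows a A @ B\<close> are the tableau of \<open>x\<close>,
  and its catabolism reads the stripped rows in the order \<open>Lr a (a + m) N\<close>. For the
  charge, the letters of \<open>A\<close> are moved from the end of the word to the front at the
  cost of one unit each, and the column that then stands at the end contributes nothing.\<close>

lemma lattice_catabolism: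
  assumes x: "x = [Suc a..<Suc (a + m)] @ w" and m: "0 < m" and w: "length w = N" "set w \<subseteq> {a<..a + m + N}"
    and lat: "lattice a (m + N) x"
  defines "u \<equiv> rd a (Lr a a (m + N)) x" and "c \<equiv> rd (a + m) (Lr a (a + m) N) w"
  shows "good (m # \<eta>) (ct a u) \<longleftrightarrow> good \<eta> (ct (a + m) c)"
    and "chg a u = chg (a + m) c + length (filter (\<lambda>c. c \<le> a + m) w)"
proof -
  let ?f = "\<lambda>i. rowpos (a + m) i w"
  define A B where "A = map ?f [Suc a..<Suc (a + m)]" and "B = map ?f [Suc (a + m)..<Suc (a + m + N)]"
  have T: "Trows a (m + N) x = xrows a A @ B"
  proof -
    have "[Suc a..<Suc (a + (m + N))] = [Suc a..<Suc (a + m)] @ [Suc (a + m)..<Suc (a + m + N)]"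
      using upt_split[of "Suc a" "Suc (a + m)" "Suc (a + m + N)"] by (simp add: ac_simps)
    moreover have "map (\<lambda>i. rowpos a i x) [Suc a..<Suc (a + m)] = map (\<lambda>i. i # ?f i) [Suc a..<Suc (a + m)]"
      by (auto simp: x rowpos_append rowpos_upt)
    moreover have "map (\<lambda>i. rowpos a i x) [Suc (a + m)..<Suc (a + m + N)] = B"
      by (auto simp: x rowpos_append rowpos_upt B_def)
    ultimately show ?thesis by (simp add: Trows_def map_xrows A_def)
  qed
  have lA: "length A = m" by (simp add: A_def)
  have c: "c = row_word A @ row_word B"
    by (simp add: c_def row_word_def A_def B_def Lr_def rd_def rev_map)
  have u: "u = row_word (xrows a A @ B)" using T row_word_Trows[of a "m + N" x] by (simp add: u_def)
  have setx: "set x \<subseteq> {a<..a + (m + N)}" using w by (auto simp: x)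
  have wu: "word_on a u" unfolding u_def using word_on_rd[OF distinct_Lr] setx set_Lr[of a a "m + N"] by simp
  have gt: "\<forall>y\<in>set (row_word A) \<union> set (row_word B). a + m < y"
    using xform_word(1)[OF wu, of A B] u lA by (auto simp: word_on_def)
  have du: "decr a m u"
    using gt lA filter_xrows[of A "a + m" a] unfolding u decr_def by (auto simp: filter_empty_conv not_le)
  have mr: "m \<le> run a u" using run_props(3)[OF wu du] .
  have ne: "u \<noteq> []" using run_props(1)[OF wu] mr m by auto
  let ?F = "filter (\<lambda>r. r \<noteq> ([]::nat list))"
  have FT: "?F (xrows a A @ B) = xrows a A @ ?F B"
  proof -
    have "?F (xrows a A) = xrows a A" for A by (induction A arbitrary: a) auto
    then show ?thesis by simp
  qed
  have "column_strict (xrows a A @ ?F B)"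
    using column_strict_rows[OF stacked_Trows[THEN iffD2, OF lat] sorted_Trows] unfolding T FT .
  then have P: "P_tableau u = xrows a A @ ?F B"
    using wu by (intro P_tableau_eq) (auto simp: u row_word_filter word_on_def)
  have "catw a m (P_tableau u) = c"
    unfolding P c using catw_xrows[of m A "?F B" a] gt lA by (simp add: row_word_filter)
  then have "fct m (ct a u) = ct (a + m) c" using ct_catw[OF wu _ mr] m by simp
  then show "good (m # \<eta>) (ct a u) \<longleftrightarrow> good \<eta> (ct (a + m) c)"
    using ct_length_pos[OF wu ne] mr by simp
  let ?col = "rev [Suc a..<Suc (a + m)]"
  have srtA: "\<forall>r\<in>set A. sorted_wrt (<) r" by (auto simp: A_def sorted_rowpos)
  have "row_word (xrows a A) \<approx> ?col @ row_word A" using knuth_column_first[OF srtA, of a] gt lA by simp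
  from knuth_app_left[OF this, of "row_word B"] have k: "u \<approx> (row_word B @ ?col) @ row_word A" by (simp add: u)
  have wk: "word_on a ((row_word B @ ?col) @ row_word A)" using wu word_on_knuth[OF k] by blast
  have "Suc a \<notin> set (row_word A)"
  proof
    assume "Suc a \<in> set (row_word A)"
    then have "a + m < Suc a" using gt by blast
    then show False using m by simp
  qed
  from chg_rotate_many[OF wk this]
  have "chg a u = chg a ((row_word A @ row_word B) @ ?col) + length (row_word A)"
    using chg_knuth[OF k] by simp
  moreover have "word_on a ((row_word A @ row_word B) @ ?col)"
    using wk by (rule word_on_mset[THEN iffD1, rotated]) (simp add: ac_simps del: mset_upt)
  then have "chg a ((row_word A @ row_word B) @ ?col) = chg (a + m) c" unfolding c by (rule chg_column)
  moreover have "length (row_word A) = length (filter (\<lambda>c. c \<le> a + m) w)"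
  proof -
    have "row_word A = rd (a + m) (rev [Suc a..<Suc (a + m)]) w"
      by (simp add: row_word_def A_def rd_def rev_map)
    then have "length (row_word A) = length (filter (\<lambda>c. c \<in> set (rev [Suc a..<Suc (a + m)])) w)"
      by (simp only: length_rd[OF distinct_rev[THEN iffD2, OF distinct_upt]])
    also have "filter (\<lambda>c. c \<in> set (rev [Suc a..<Suc (a + m)])) w = filter (\<lambda>c. c \<le> a + m) w"
      using w(2) by (intro filter_cong) auto
    finally show ?thesis .
  qed
  ultimately show "chg a u = chg (a + m) c + length (filter (\<lambda>c. c \<le> a + m) w)" by simp
qed

text \<open>The first \<open>m\<close> letters form the column of the tableau, so the letter
  \<open>a + i\<close> heads the row with label \<open>a + i\<close>.\<close>

lemma lattice_first_column:
  assumes "length x = m + N" "set x \<subseteq> {a<..a + (m + N)}" "lattice a (m + N) x"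
    "decr a m (rd a (Lr a a (m + N)) x)"
  shows "take m x = [Suc a..<Suc (a + m)]"
proof -
  let ?T = "Trows a (m + N) x"
  have w: "word_on a (row_word ?T)"
    unfolding row_word_Trows using word_on_rd[OF distinct_Lr] assms(2) set_Lr[of a a "m + N"] by simp
  obtain A B where AB: "?T = xrows a A @ B" "length A = m"
  proof (rule tableau_xrows)
    show "stacked ?T" using assms(3) stacked_Trows by blast
    show "\<forall>r\<in>set ?T. sorted_wrt (<) r" by (rule sorted_Trows)
    show "\<forall>x\<in>set (row_word ?T). a < x" "distinct (row_word ?T)" using w by (auto simp: word_on_def)
    show "filter (\<lambda>x. x \<le> a + m) (row_word ?T) = rev [Suc a..<Suc (a + m)]"
      using assms(4) by (simp add: decr_def row_word_Trows)
  qed auto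
  have hd: "xrows a A ! i = Suc (a + i) # A ! i" if "i < length A" for i
    using that
  proof (induction A arbitrary: a i)
    case (Cons r A) then show ?case by (cases i) auto
  qed simp
  show ?thesis
  proof (rule nth_equalityI)
    fix i assume "i < length (take m x)"
    then have i: "i < m" "i < length x" using assms(1) by auto
    have "?T ! i = Suc (a + i) # A ! i" using hd[of i] AB i by (simp add: nth_append)
    then have "rowpos a (Suc (a + i)) x = Suc (a + i) # A ! i" using Trows_nth[of i "m + N" a x] i by simp
    then have "Suc (a + i) \<in> set (rowpos a (Suc (a + i)) x)" by simp
    then have "x ! i = Suc (a + i)" by (simp add: in_rowpos)
    then show "take m x ! i = [Suc a..<Suc (a + m)] ! i" using i by (simp add: nth_upt)
  qed (use assms(1) in simp)
qed

text \<open>An alternant counts only lattice words. So agreement on these is enough to replace the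
  words produced by the recursion by those of the next stage of the induction.\<close>

theorem lattice_step:
  assumes "0 < m"
  shows "{x \<in> cset a a (m + N) (m # \<eta>) k. lattice a (m + N) x} = {x \<in> Xset a (a + m) N \<eta> k. lattice a (m + N) x}"
proof (intro set_eqI iffI)
  fix x assume "x \<in> {x \<in> cset a a (m + N) (m # \<eta>) k. lattice a (m + N) x}"
  then have x: "length x = m + N" "set x \<subseteq> {a<..a + (m + N)}" "lattice a (m + N) x"
    "good (m # \<eta>) (ct a (rd a (Lr a a (m + N)) x))" "chg a (rd a (Lr a a (m + N)) x) = k"
    by (auto simp: cset_def)
  let ?u = "rd a (Lr a a (m + N)) x"
  have wu: "word_on a ?u" using word_on_rd[OF distinct_Lr] x(2) set_Lr[of a a "m + N"] by simp
  have "m \<le> run a ?u" using ct_length_pos[OF wu] x(4) by (cases "?u = []") auto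
  then have "decr a m ?u" using decr_mono[OF wu run_props(2)[OF wu]] by blast
  from lattice_first_column[OF x(1-3) this] have xw: "x = [Suc a..<Suc (a + m)] @ drop m x"
    by (metis append_take_drop_id)
  have w: "length (drop m x) = N" "set (drop m x) \<subseteq> {a<..a + m + N}"
    using x(1,2) set_drop_subset[of m x] by (auto simp: ac_simps)
  note C = lattice_catabolism[OF xw assms w x(3)]
  have "drop m x \<in> cset a (a + m) N \<eta> (chg (a + m) (rd (a + m) (Lr a (a + m) N) (drop m x)))"
    using C(1)[of \<eta>] x(4) w by (simp add: cset_def)
  then have "drop m x \<in> {w. \<exists>k1. w \<in> cset a (a + m) N \<eta> k1 \<and> k1 + length (filter (\<lambda>c. c \<le> a + m) w) = k}"
    using C(2) x(5) by auto
  then have "x \<in> Xset a (a + m) N \<eta> k" unfolding Xset_def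
    by (rule image_eqI[where f = "\<lambda>w. [Suc a..<Suc (a + m)] @ w" and x = "drop m x", OF xw])
  then show "x \<in> {x \<in> Xset a (a + m) N \<eta> k. lattice a (m + N) x}" using x(3) by simp
next
  fix x assume "x \<in> {x \<in> Xset a (a + m) N \<eta> k. lattice a (m + N) x}"
  then obtain w k1 where x: "x = [Suc a..<Suc (a + m)] @ w" "w \<in> cset a (a + m) N \<eta> k1"
    "k1 + length (filter (\<lambda>c. c \<le> a + m) w) = k" "lattice a (m + N) x"
    by (auto simp: Xset_def)
  then have w: "length w = N" "set w \<subseteq> {a<..a + m + N}" by (auto simp: cset_def)
  note C = lattice_catabolism[OF x(1) assms w x(4)]
  have "length x = m + N" "set x \<subseteq> {a<..a + (m + N)}" using x(1) w by auto
  moreover have "good (m # \<eta>) (ct a (rd a (Lr a a (m + N)) x))" using C(1)[of \<eta>] x(2) by (simp add: cset_def)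
  moreover have "chg a (rd a (Lr a a (m + N)) x) = k" using C(2) x(2,3) by (simp add: cset_def)
  ultimately show "x \<in> {x \<in> cset a a (m + N) (m # \<eta>) k. lattice a (m + N) x}"
    using x(4) by (simp add: cset_def)
qed

theorem card_tableaux:
  fixes lam :: "nat list"
  assumes lam: "\<forall>p\<in>set lam. 0 < p" "length lam \<le> n"
  shows "card {S. column_strict S \<and> word_on 0 (row_word S) \<and> length (row_word S) = n \<and> Q (row_word S) \<and> shape S = lam} =
    card {x. length x = n \<and> set x \<subseteq> {0<..n} \<and> lattice 0 n x \<and> Q (rd 0 (Lr 0 0 n) x) \<and>
      (\<forall>i<n. count_list x (Suc i) = (if i < length lam then lam ! i else 0))}"
    (is "card ?S = card ?X")
proof -
  let ?F = "filter (\<lambda>r. r \<noteq> ([]::nat list))" and ?k = "n - length lam"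
  have lens: "map length (Trows 0 n x) = lam @ replicate ?k 0" if "x \<in> ?X" for x
  proof (rule nth_equalityI)
    fix i assume "i < length (map length (Trows 0 n x))"
    then have "i < n" by simp
    then show "map length (Trows 0 n x) ! i = (lam @ replicate ?k 0) ! i"
      using that by (auto simp: Trows_nth length_rowpos nth_append)
  qed (use lam(2) in simp)
  have shp: "map length (?F T) = l" if "map length T = l @ replicate k 0" "\<forall>p\<in>set l. 0 < p" for T l k
    using that
  proof (induction l arbitrary: T)
    case Nil
    have "\<forall>r\<in>set T. r = []"
    proof
      fix r assume "r \<in> set T"
      then have "length r \<in> set (map length T)" by simp
      then have "length r = 0" unfolding Nil(1) by (auto split: if_splits)
      then show "r = []" by simp
    qed
    then show ?case by (auto simp: filter_empty_conv)
  next
    case (Cons p l)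
    then obtain r T' where T: "T = r # T'" "length r = p" "map length T' = l @ replicate k 0" by (cases T) auto
    then have "r \<noteq> []" using Cons.prems(2) by auto
    then show ?case using Cons.IH[OF T(3)] Cons.prems(2) T by simp
  qed
  have "bij_betw (\<lambda>x. ?F (Trows 0 n x)) ?X ?S"
  proof (rule bij_betw_imageI)
    show "inj_on (\<lambda>x. ?F (Trows 0 n x)) ?X"
    proof (rule inj_onI)
      fix x y assume xy: "x \<in> ?X" "y \<in> ?X" and e: "?F (Trows 0 n x) = ?F (Trows 0 n y)"
      have "stacked (Trows 0 n x)" "stacked (Trows 0 n y)" using xy stacked_Trows by auto
      then have "Trows 0 n x = Trows 0 n y"
        using stacked_nonempty_first e by (metis length_Trows)
      then show "x = y" using Trows_inj[of 0 n x y] xy by auto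
    qed
    show "(\<lambda>x. ?F (Trows 0 n x)) ` ?X = ?S"
    proof
      show "(\<lambda>x. ?F (Trows 0 n x)) ` ?X \<subseteq> ?S"
      proof
        fix S assume "S \<in> (\<lambda>x. ?F (Trows 0 n x)) ` ?X"
        then obtain x where x: "x \<in> ?X" "S = ?F (Trows 0 n x)" by blast
        have rw: "row_word S = rd 0 (Lr 0 0 n) x" by (simp add: x(2) row_word_filter row_word_Trows)
        have st: "stacked (Trows 0 n x)" using x(1) stacked_Trows by auto
        have "column_strict S" unfolding x(2) by (rule column_strict_rows[OF st sorted_Trows])
        moreover have "word_on 0 (row_word S)"
          unfolding rw using word_on_rd[OF distinct_Lr] x(1) set_Lr[of 0 0 n] by simp
        moreover have "length (row_word S) = n"
        proof -
          have "filter (\<lambda>c. c \<in> set (Lr 0 0 n)) x = x" using x(1) set_Lr[of 0 0 n] by (intro filter_True) auto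
          then show ?thesis unfolding rw using x(1) by (simp add: length_rd distinct_Lr)
        qed
        moreover have "shape S = lam" unfolding shape_def x(2) by (rule shp[OF lens[OF x(1)] lam(1)])
        ultimately show "S \<in> ?S" using x(1) rw by simp
      qed
      show "?S \<subseteq> (\<lambda>x. ?F (Trows 0 n x)) ` ?X"
      proof
        fix S assume "S \<in> ?S"
        then have S: "column_strict S" "word_on 0 (row_word S)" "length (row_word S) = n" "Q (row_word S)" "shape S = lam"
          by auto
        have lS: "length S = length lam" using S(5) unfolding shape_def by (metis length_map)
        have ds: "distinct (row_word S)" "set (row_word S) = {0<..n}" using S(2,3) by (auto simp: word_on_def)
        define idx where "idx k = (SOME j. j < length S \<and> Suc k \<in> set (S ! j))" for k
        have idx: "idx k < length S \<and> Suc k \<in> set (S ! idx k)" if "k < n" for k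
        proof -
          have "Suc k \<in> set (row_word S)" using ds(2) that by simp
          then obtain r where "r \<in> set S" "Suc k \<in> set r" by (auto simp: set_row_word)
          then have "\<exists>j. j < length S \<and> Suc k \<in> set (S ! j)" by (metis in_set_conv_nth)
          then show ?thesis unfolding idx_def by (rule someI_ex)
        qed
        have uniq: "j = j'" if "j < length S" "j' < length S" "y \<in> set (S ! j)" "y \<in> set (S ! j')" for j j' y
        proof (rule ccontr)
          assume "j \<noteq> j'"
          then have "\<exists>i i'. i < i' \<and> i' < length S \<and> y \<in> set (S ! i) \<and> y \<in> set (S ! i')"
            using that by (metis linorder_neqE_nat)
          then obtain i i' where ii: "i < i'" "i' < length S" "y \<in> set (S ! i)" "y \<in> set (S ! i')" by blast
          have "row_word S = row_word (drop i' S) @ row_word (take i' S)"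
            by (metis append_take_drop_id row_word_append)
          moreover have "S ! i' \<in> set (drop i' S)" using ii(2) by (metis Cons_nth_drop_Suc list.set_intros(1))
          then have "y \<in> set (row_word (drop i' S))" using ii(4) by (auto simp: set_row_word)
          moreover have "take i' S ! i \<in> set (take i' S)" using ii(1,2) by (intro nth_mem) simp
          then have "y \<in> set (row_word (take i' S))" using ii by (auto simp: set_row_word)
          ultimately show False using ds(1) by auto
        qed
        \<comment> \<open>The letter \<open>k + 1\<close> is recorded at position \<open>k\<close>;
          rows are indexed from 0 but labelled from 1.\<close>
        define x where "x = map (\<lambda>k. Suc (idx k)) [0..<n]"
        have lx: "length x = n" "\<And>k. k < n \<Longrightarrow> x ! k = Suc (idx k)" by (simp_all add: x_def)
        have T: "Trows 0 n x = S @ replicate ?k []"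
        proof (rule nth_equalityI)
          fix j assume "j < length (Trows 0 n x)"
          then have j: "j < n" by simp
          show "Trows 0 n x ! j = (S @ replicate ?k []) ! j"
          proof (cases "j < length S")
            case True
            have "rowpos 0 (Suc j) x = S ! j"
            proof (rule strict_sorted_equal)
              show "sorted_wrt (<) (rowpos 0 (Suc j) x)" by (rule sorted_rowpos)
              have "S ! j \<in> set S" using True by simp
              then show "sorted_wrt (<) (S ! j)"
                using S(1) ds(1) by (auto simp: column_strict_conv intro: sorted_wrt_less_distinct distinct_row_word)
              show "set (rowpos 0 (Suc j) x) = set (S ! j)"
              proof (intro set_eqI)
                fix y
                show "y \<in> set (rowpos 0 (Suc j) x) \<longleftrightarrow> y \<in> set (S ! j)"
                proof (cases y)
                  case 0
                  have "y \<notin> set (rowpos 0 (Suc j) x)" using set_rowpos[of 0 "Suc j" x] 0 by auto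
                  moreover have "y \<notin> set (S ! j)" using ds(2) True 0 by (auto simp: set_row_word)
                  ultimately show ?thesis by simp
                next
                  case (Suc k)
                  have "y \<in> set (rowpos 0 (Suc j) x) \<longleftrightarrow> k < n \<and> idx k = j"
                    using in_rowpos[of 0 k "Suc j" x] lx Suc by auto
                  also have "\<dots> \<longleftrightarrow> y \<in> set (S ! j)"
                  proof
                    assume y: "y \<in> set (S ! j)"
                    then have "y \<in> set (row_word S)" using True by (auto simp: set_row_word)
                    then have "k < n" using ds(2) Suc by auto
                    then show "k < n \<and> idx k = j" using idx uniq[of "idx k" j y] True y Suc by auto
                  qed (use idx Suc in auto)
                  finally show ?thesis .
                qed
              qed
            qed
            then show ?thesis using True j Trows_nth[of j n 0 x] by (simp add: nth_append)
          next
            case False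
            have "Suc j \<notin> set x" using False idx by (auto simp: x_def)
            then show ?thesis using False j lS Trows_nth[of j n 0 x] by (simp add: nth_append rowpos_notin)
          qed
        qed (use lam(2) lS in simp)
        have FS: "?F (Trows 0 n x) = S"
        proof -
          have "?F S = S" using S(1) by (intro filter_True) (auto simp: column_strict_conv)
          then show ?thesis unfolding T by (simp add: filter_empty_conv)
        qed
        have "stacked (S @ replicate ?k [])"
        proof -
          have "stacked S" using S(1) by (simp add: column_strict_conv)
          moreover have "stacked (replicate ?k [])" by (auto simp: stacked_conv_nth)
          ultimately show ?thesis unfolding stacked_append by (cases ?k) auto
        qed
        then have lat: "lattice 0 n x" using stacked_Trows[of 0 n x] T by simp
        have rw: "rd 0 (Lr 0 0 n) x = row_word S"
          using row_word_Trows[of 0 n x] row_word_filter[of "Trows 0 n x"] FS by simp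
        have "set x \<subseteq> {0<..n}" using idx lS lam(2) by (fastforce simp: x_def)
        moreover have "count_list x (Suc i) = (if i < length lam then lam ! i else 0)" if "i < n" for i
        proof -
          have "count_list x (Suc i) = length ((S @ replicate ?k []) ! i)"
            using length_rowpos[of 0 "Suc i" x] Trows_nth[OF that, of 0 x] T by simp
          moreover have "length (S ! i) = lam ! i" if "i < length lam"
            using S(5) that lS unfolding shape_def by (metis nth_map)
          ultimately show ?thesis using that lS by (auto simp: nth_append)
        qed
        ultimately have "x \<in> ?X" using lx lat rw S(4) by simp
        then show "S \<in> (\<lambda>x. ?F (Trows 0 n x)) ` ?X" using FS by blast
      qed
    qed
  qed
  from bij_betw_same_card[OF this] show ?thesis by (rule sym)
qed

section \<open>Laurent polynomials\<close>

abbreviation mono :: "(nat \<Rightarrow>\<^sub>0 int) \<Rightarrow> laurent" where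
  "mono e \<equiv> Poly_Mapping.single e 1"

abbreviation xv :: "nat \<Rightarrow> laurent" where
  "xv j \<equiv> mono (Poly_Mapping.single j 1)"

abbreviation lk :: "('a \<Rightarrow>\<^sub>0 'b::zero) \<Rightarrow> 'a \<Rightarrow> 'b" where "lk \<equiv> Poly_Mapping.lookup"

lemma mono_mult: "mono a * mono b = mono (a + b)"
  by (simp add: mult_single)

text \<open>With integer coefficients every element is reached from monomials by differences, so
  additive identities need to be checked on monomials only.\<close>

lemma laurent_induct [consumes 1, case_names zero mono diff]:
  assumes "Poly_Mapping.keys (f :: laurent) \<subseteq> S" "P 0" "\<And>a. a \<in> S \<Longrightarrow> P (mono a)"
    "\<And>f g. P f \<Longrightarrow> P g \<Longrightarrow> P (f - g)"
  shows "P f"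
  using frag_induction[of f S P] assms by simp

lemma lookup_of_int_mult: "lk (of_int c * (f :: laurent)) b = c * lk f b"
proof -
  have "Poly_Mapping.keys f \<subseteq> UNIV" by simp
  then show ?thesis
  proof (induction f rule: laurent_induct)
    case (mono a)
    have "(of_int c :: laurent) = Poly_Mapping.single 0 c" by (metis single_of_int of_int_eq_id id_apply)
    then have "of_int c * mono a = Poly_Mapping.single a c"
      using mult_single[of 0 c a 1] by simp
    then show ?case by (simp add: lookup_single when_def)
  qed (simp_all add: right_diff_distrib lookup_minus)
qed

lemma lookup_mono_mult: "lk (mono e * (f :: laurent)) b = lk f (b - e)"
proof -
  have "Poly_Mapping.keys f \<subseteq> UNIV" by simp
  then show ?thesis
  proof (induction f rule: laurent_induct)
    case (mono a)
    have "e + a = b \<longleftrightarrow> a = b - e" by (auto simp: algebra_simps)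
    then show ?case by (cases "e + a = b") (auto simp: mono_mult lookup_single when_def)
  qed (simp_all add: right_diff_distrib lookup_minus)
qed

subsection \<open>Permuting the variables\<close>

lemma lookup_map_key: "inj w \<Longrightarrow> lk (Poly_Mapping.map_key w a) i = lk a (w i)"
  by (simp add: map_key.rep_eq)

lemma mk_id: "Poly_Mapping.map_key id (e :: nat \<Rightarrow>\<^sub>0 int) = e"
  by (rule poly_mapping_eqI) (simp add: lookup_map_key)

lemma map_key_comp: "bij w1 \<Longrightarrow> bij w2 \<Longrightarrow>
    Poly_Mapping.map_key w2 (Poly_Mapping.map_key w1 b) = Poly_Mapping.map_key (w1 \<circ> w2) (b :: nat \<Rightarrow>\<^sub>0 int)"
  by (rule poly_mapping_eqI) (simp add: lookup_map_key bij_is_inj inj_compose)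

lemma map_key_inv_eq:
  assumes "bij w" shows "Poly_Mapping.map_key (inv w) a = b \<longleftrightarrow> a = Poly_Mapping.map_key w (b :: nat \<Rightarrow>\<^sub>0 int)"
proof -
  have i: "inj w" "inj (inv w)" "\<And>x. w (inv w x) = x" "\<And>x. inv w (w x) = x"
    using assms by (auto simp: bij_is_inj bij_is_surj surj_f_inv_f inv_f_f surj_imp_inj_inv)
  show ?thesis by (auto simp: poly_mapping_eq_iff fun_eq_iff lookup_map_key i) (metis i(3,4))+
qed

lemma lookup_pv: "bij w \<Longrightarrow> lk (permute_vars w f) b = lk f (Poly_Mapping.map_key w b)"
proof -
  assume w: "bij w"
  have "lk (permute_vars w f) b = (\<Sum>a\<in>Poly_Mapping.keys f. if a = Poly_Mapping.map_key w b then lk f a else 0)"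
    unfolding permute_vars_def lookup_sum by (intro sum.cong) (auto simp: lookup_single when_def map_key_inv_eq[OF w])
  then show ?thesis by (simp add: in_keys_iff)
qed

lemma pv_diff: "bij w \<Longrightarrow> permute_vars w (f - g) = permute_vars w f - permute_vars w g"
  by (rule poly_mapping_eqI) (simp add: lookup_pv lookup_minus)

lemma pv_sum: "bij w \<Longrightarrow> permute_vars w (sum f A) = (\<Sum>x\<in>A. permute_vars w (f x))"
  by (rule poly_mapping_eqI) (simp add: lookup_pv lookup_sum)

lemma pv_of_int: "bij w \<Longrightarrow> permute_vars w (of_int c * f) = of_int c * permute_vars w f"
  by (rule poly_mapping_eqI) (simp add: lookup_pv lookup_of_int_mult)

lemma pv_zero [simp]: "permute_vars w 0 = 0"
  by (simp add: permute_vars_def)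

lemma pv_mono: "permute_vars w (mono e) = mono (Poly_Mapping.map_key (inv w) e)"
  by (simp add: permute_vars_def)

lemma map_key_plus': "inj w \<Longrightarrow> Poly_Mapping.map_key w (a + b) = Poly_Mapping.map_key w a + Poly_Mapping.map_key w (b :: nat \<Rightarrow>\<^sub>0 int)"
  by (rule poly_mapping_eqI) (simp add: lookup_map_key lookup_add)

lemma pv_mult:
  assumes "bij w" shows "permute_vars w (f * g) = permute_vars w f * permute_vars w g"
proof -
  have i: "inj (inv w)" using assms by (simp add: bij_is_surj surj_imp_inj_inv)
  have "Poly_Mapping.keys f \<subseteq> UNIV" by simp
  then show ?thesis
  proof (induction f rule: laurent_induct)
    case (mono a)
    have "Poly_Mapping.keys g \<subseteq> UNIV" by simp
    then show ?case
    proof (induction g rule: laurent_induct)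
      case (mono b)
      then show ?case by (simp add: mono_mult pv_mono map_key_plus'[OF i])
    qed (simp_all add: right_diff_distrib pv_diff[OF assms])
  qed (simp_all add: left_diff_distrib pv_diff[OF assms])
qed

lemma pv_one: "bij w \<Longrightarrow> permute_vars w 1 = 1"
proof -
  assume "bij w"
  then have "Poly_Mapping.map_key (inv w) 0 = (0 :: nat \<Rightarrow>\<^sub>0 int)"
    by (intro poly_mapping_eqI) (simp add: lookup_map_key bij_is_surj surj_imp_inj_inv)
  then show ?thesis using pv_mono[of w 0] by simp
qed

lemma pv_prod: "bij w \<Longrightarrow> permute_vars w (prod f A) = (\<Prod>x\<in>A. permute_vars w (f x))"
  by (induction A rule: infinite_finite_induct) (simp_all add: pv_one pv_mult)

lemma pv_comp: "bij w1 \<Longrightarrow> bij w2 \<Longrightarrow> permute_vars (w1 \<circ> w2) f = permute_vars w1 (permute_vars w2 f)"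
  by (rule poly_mapping_eqI) (simp add: lookup_pv bij_comp map_key_comp)

lemma pv_id: "permute_vars id f = f"
  by (rule poly_mapping_eqI) (simp add: lookup_pv mk_id)

lemma map_key_single_perm:
  assumes "bij w" shows "Poly_Mapping.map_key (inv w) (Poly_Mapping.single j c) = Poly_Mapping.single (w j) (c :: int)"
proof -
  have i: "j = inv w k \<longleftrightarrow> w j = k" for k using assms by (metis bij_inv_eq_iff)
  have "inj (inv w)" using assms by (simp add: bij_is_surj surj_imp_inj_inv)
  then show ?thesis by (intro poly_mapping_eqI) (simp only: lookup_map_key lookup_single i)
qed

lemma pv_xv: "bij w \<Longrightarrow> permute_vars w (xv j) = xv (w j)"
  by (simp add: pv_mono map_key_single_perm)

lemma map_key_minus: "inj w \<Longrightarrow> Poly_Mapping.map_key w (a - b) = Poly_Mapping.map_key w a - Poly_Mapping.map_key w (b :: nat \<Rightarrow>\<^sub>0 int)"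
  by (rule poly_mapping_eqI) (simp add: lookup_map_key lookup_minus)

lemma pv_xratio: "bij w \<Longrightarrow> permute_vars w (xratio i j) = xratio (w i) (w j)"
  by (simp add: xratio_def pv_mono map_key_minus map_key_single_perm bij_is_surj surj_imp_inj_inv)

subsection \<open>Symmetric and antisymmetric Laurent polynomials\<close>

text \<open>Symmetry for \<open>\<epsilon> = 1\<close>, antisymmetry for
  \<open>\<epsilon> = -1\<close>. It is phrased by transpositions because the word operations
  provide exchanges of two labels; \<open>tsym_trans\<close> generates the others.\<close>

definition tsym :: "int \<Rightarrow> nat set \<Rightarrow> laurent \<Rightarrow> bool" where
  "tsym \<epsilon> S f \<longleftrightarrow> (\<forall>x\<in>S. \<forall>y\<in>S. x \<noteq> y \<longrightarrow> permute_vars (Transposition.transpose x y) f = of_int \<epsilon> * f)"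

lemma tsym_trans:
  assumes e: "\<epsilon> = 1 \<or> \<epsilon> = - 1" and d: "x \<noteq> y" "y \<noteq> z" "x \<noteq> z"
    and 1: "permute_vars (Transposition.transpose x y) f = of_int \<epsilon> * f"
    and 2: "permute_vars (Transposition.transpose y z) f = of_int \<epsilon> * f"
  shows "permute_vars (Transposition.transpose x z) f = of_int \<epsilon> * f"
proof -
  have t: "Transposition.transpose x z = Transposition.transpose x y \<circ> (Transposition.transpose y z \<circ> Transposition.transpose x y)"
    using d by (auto simp: fun_eq_iff Transposition.transpose_def)
  have b: "bij (Transposition.transpose u v)" for u v :: nat by simp
  show ?thesis unfolding t using e
    by (auto simp: pv_comp[OF b bij_comp[OF b b]] pv_comp[OF b b] 1 2 pv_of_int[OF b])
qed

lemma tsym_interval: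
  assumes e: "\<epsilon> = 1 \<or> \<epsilon> = - 1"
    and adj: "\<And>r. b < r \<Longrightarrow> r < b + N \<Longrightarrow> permute_vars (Transposition.transpose r (Suc r)) f = of_int \<epsilon> * f"
  shows "tsym \<epsilon> {b<..b + N} f"
proof -
  have *: "permute_vars (Transposition.transpose x y) f = of_int \<epsilon> * f" if "b < x" "x < y" "y \<le> b + N" for x y
    using that(2,3)
  proof (induction y)
    case (Suc y)
    show ?case
    proof (cases "x = y")
      case True then show ?thesis using adj[of x] that(1) Suc.prems by simp
    next
      case False
      then show ?thesis using Suc that(1) adj[of y] by (intro tsym_trans[OF e, of x y "Suc y"]) auto
    qed
  qed simp
  show ?thesis unfolding tsym_def
  proof (intro ballI impI)
    fix x y assume xy: "x \<in> {b<..b + N}" "y \<in> {b<..b + N}" "x \<noteq> y"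
    then show "permute_vars (Transposition.transpose x y) f = of_int \<epsilon> * f"
      using *[of x y] *[of y x] by (cases "x < y") (auto simp: transpose_commute)
  qed
qed

lemma tsym_insert:
  assumes e: "\<epsilon> = 1 \<or> \<epsilon> = - 1" and S: "tsym \<epsilon> S f" and j: "j \<in> S" "i \<notin> S"
    and ij: "permute_vars (Transposition.transpose i j) f = of_int \<epsilon> * f"
  shows "tsym \<epsilon> (insert i S) f"
proof -
  have *: "permute_vars (Transposition.transpose i y) f = of_int \<epsilon> * f" if "y \<in> S" for y
  proof (cases "y = j")
    case False
    then show ?thesis using S j that ij by (intro tsym_trans[OF e, of i j y]) (auto simp: tsym_def)
  qed (use ij in simp)
  show ?thesis unfolding tsym_def
  proof (intro ballI impI)
    fix x y assume xy: "x \<in> insert i S" "y \<in> insert i S" "x \<noteq> y"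
    consider "x = i" "y \<in> S" | "y = i" "x \<in> S" | "x \<in> S" "y \<in> S" using xy by blast
    then show "permute_vars (Transposition.transpose x y) f = of_int \<epsilon> * f"
      using *[of x] *[of y] S xy(3) by cases (auto simp: transpose_commute tsym_def)
  qed
qed

lemma tsym_mult: "tsym \<epsilon> S f \<Longrightarrow> tsym \<delta> S g \<Longrightarrow> tsym (\<epsilon> * \<delta>) S (f * g)"
  by (simp add: tsym_def pv_mult)

lemma tsym_permutes:
  assumes "\<sigma> permutes S" "finite S" "\<epsilon> = 1 \<or> \<epsilon> = - 1" "tsym \<epsilon> S f"
  shows "permute_vars \<sigma> f = of_int (if \<epsilon> = 1 then 1 else sign \<sigma>) * f"
  using assms(1,2)
proof (induction rule: permutes_induct)
  case id then show ?case by (simp add: pv_id[unfolded id_def] pv_id sign_id)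
next
  case (swap a b p)
  have b: "bij p" "permutation p" using swap.hyps assms(2) by (auto simp: permutes_bij permutation_permutes)
  have "permute_vars (Transposition.transpose a b) f = of_int \<epsilon> * f"
    using assms(4) swap.hyps unfolding tsym_def by blast
  moreover have "sign (Transposition.transpose a b \<circ> p) = - sign p"
    using swap.hyps b by (simp add: sign_compose permutation_swap_id sign_swap_id)
  moreover have "permute_vars (Transposition.transpose a b \<circ> p) f = permute_vars (Transposition.transpose a b) (permute_vars p f)"
    by (rule pv_comp) (use b in simp_all)
  ultimately have "permute_vars (Transposition.transpose a b \<circ> p) f =
      of_int (if \<epsilon> = 1 then 1 else sign (Transposition.transpose a b \<circ> p)) * f"
    using assms(3) swap.IH by (auto simp: pv_of_int simp del: o_apply)
  then show ?case by (simp add: comp_def)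
qed

lemma tsym_lookup:
  assumes "\<sigma> permutes S" "finite S" "tsym (- 1) S f"
  shows "lk f (Poly_Mapping.map_key \<sigma> e) = sign \<sigma> * lk f e"
  using arg_cong[OF tsym_permutes[OF assms(1,2) _ assms(3)], of "\<lambda>g. lk g e"] assms(1)
  by (simp add: lookup_pv permutes_bij lookup_of_int_mult)

lemma tsym_distinct:
  assumes "tsym (- 1) S f" "lk f e \<noteq> 0" shows "inj_on (lk e) S"
proof (rule inj_onI, rule ccontr)
  fix x y assume xy: "x \<in> S" "y \<in> S" "lk e x = lk e y" "x \<noteq> y"
  have "Poly_Mapping.map_key (Transposition.transpose x y) e = e"
    using xy(3) by (intro poly_mapping_eqI) (simp add: lookup_map_key Transposition.transpose_def)
  moreover have "permute_vars (Transposition.transpose x y) f = of_int (- 1) * f"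
    using assms(1) xy unfolding tsym_def by blast
  ultimately have "lk f e = - lk f e"
    using lookup_pv[of "Transposition.transpose x y" f e] lookup_of_int_mult[of "- 1" f e] by simp
  then show False using assms(2) by simp
qed

definition altV :: "nat set \<Rightarrow> laurent \<Rightarrow> laurent" where
  "altV S f = (\<Sum>\<sigma> | \<sigma> permutes S. of_int (sign \<sigma>) * permute_vars \<sigma> f)"

lemma alternant_altV: "alternant n = altV {1..n}"
  by (simp add: alternant_def altV_def fun_eq_iff)

lemma lookup_altV: "lk (altV S f) b = (\<Sum>\<sigma> | \<sigma> permutes S. sign \<sigma> * lk f (Poly_Mapping.map_key \<sigma> b))"
  unfolding altV_def lookup_sum by (intro sum.cong) (auto simp: lookup_of_int_mult lookup_pv permutes_bij)

lemma altV_diff: "altV S (f - g) = altV S f - altV S g"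
  by (rule poly_mapping_eqI) (simp add: lookup_altV lookup_minus right_diff_distrib sum_subtractf)

lemma altV_sum: "altV S (sum f A) = (\<Sum>x\<in>A. altV S (f x))"
proof -
  have "altV S (g + h) = altV S g + altV S h" for g h
    by (rule poly_mapping_eqI) (simp add: lookup_altV lookup_add distrib_left sum.distrib)
  moreover have "altV S 0 = 0" by (simp add: altV_def)
  ultimately show ?thesis by (induction A rule: infinite_finite_induct) auto
qed

lemma altV_mult_sym:
  assumes "finite S" "tsym 1 S g" shows "altV S (f * g) = altV S f * g"
  unfolding altV_def sum_distrib_right
proof (intro sum.cong refl)
  fix \<sigma> assume s: "\<sigma> \<in> {\<sigma>. \<sigma> permutes S}"
  then have "permute_vars \<sigma> g = g" using tsym_permutes[of \<sigma> S 1 g] assms by simp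
  then show "of_int (sign \<sigma>) * permute_vars \<sigma> (f * g) = of_int (sign \<sigma>) * permute_vars \<sigma> f * g"
    using s by (simp add: pv_mult permutes_bij ac_simps)
qed

lemma altV_lookup_perm:
  assumes "finite S" "\<tau> permutes S"
  shows "lk (altV S f) (Poly_Mapping.map_key \<tau> b) = sign \<tau> * lk (altV S f) b"
proof -
  have bt: "bij \<tau>" using assms(2) by (rule permutes_bij)
  have "lk (altV S f) (Poly_Mapping.map_key \<tau> b) =
      (\<Sum>\<sigma> | \<sigma> permutes S. sign \<sigma> * lk f (Poly_Mapping.map_key (\<tau> \<circ> \<sigma>) b))"
    unfolding lookup_altV by (intro sum.cong refl) (simp add: map_key_comp bt permutes_bij)
  also have "\<dots> = (\<Sum>\<sigma> | \<sigma> permutes S. sign \<tau> * (sign (\<tau> \<circ> \<sigma>) * lk f (Poly_Mapping.map_key (\<tau> \<circ> \<sigma>) b)))"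
  proof (intro sum.cong refl)
    fix \<sigma> assume "\<sigma> \<in> {\<sigma>. \<sigma> permutes S}"
    then have "permutation \<sigma>" "permutation \<tau>" using assms permutation_permutes by blast+
    then have "sign (\<tau> \<circ> \<sigma>) = sign \<tau> * sign \<sigma>" by (rule sign_compose[rotated])
    then have "sign \<sigma> = sign \<tau> * sign (\<tau> \<circ> \<sigma>)" by (simp add: mult.assoc[symmetric] sign_idempotent)
    then show "sign \<sigma> * lk f (Poly_Mapping.map_key (\<tau> \<circ> \<sigma>) b) =
        sign \<tau> * (sign (\<tau> \<circ> \<sigma>) * lk f (Poly_Mapping.map_key (\<tau> \<circ> \<sigma>) b))" by simp
  qed
  also have "\<dots> = sign \<tau> * (\<Sum>\<sigma> | \<sigma> permutes S. sign (\<tau> \<circ> \<sigma>) * lk f (Poly_Mapping.map_key (\<tau> \<circ> \<sigma>) b))"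
    by (simp add: sum_distrib_left)
  also have "(\<Sum>\<sigma> | \<sigma> permutes S. sign (\<tau> \<circ> \<sigma>) * lk f (Poly_Mapping.map_key (\<tau> \<circ> \<sigma>) b)) = lk (altV S f) b"
    unfolding lookup_altV by (rule setum_permutations_compose_left[OF assms(2), symmetric])
  finally show ?thesis .
qed

lemma tsym_altV: "finite S \<Longrightarrow> tsym (- 1) S (altV S f)"
  unfolding tsym_def
proof (intro ballI impI poly_mapping_eqI)
  fix x y e assume a: "finite S" "x \<in> S" "y \<in> S" "x \<noteq> y"
  then show "lk (permute_vars (Transposition.transpose x y) (altV S f)) e = lk (of_int (- 1) * altV S f) e"
    using altV_lookup_perm[OF a(1) permutes_swap_id[OF a(2,3)], of f e]
    by (simp add: lookup_pv sign_swap_id lookup_of_int_mult[of "- 1", simplified])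
qed

lemma altV_pv:
  assumes "finite S" and tS: "\<tau> permutes S"
  shows "altV S (of_int (sign \<tau>) * permute_vars \<tau> f) = altV S f"
proof (rule poly_mapping_eqI)
  fix b
  have "lk (altV S (of_int (sign \<tau>) * permute_vars \<tau> f)) b =
      (\<Sum>\<sigma> | \<sigma> permutes S. sign (\<sigma> \<circ> \<tau>) * lk f (Poly_Mapping.map_key (\<sigma> \<circ> \<tau>) b))"
    unfolding lookup_altV
  proof (intro sum.cong refl)
    fix \<sigma> assume "\<sigma> \<in> {\<sigma>. \<sigma> permutes S}"
    then have s: "permutation \<sigma>" "permutation \<tau>" "bij \<sigma>" "bij \<tau>"
      using assms(1) tS by (auto simp: permutation_permutes permutes_bij)
    then show "sign \<sigma> * lk (of_int (sign \<tau>) * permute_vars \<tau> f) (Poly_Mapping.map_key \<sigma> b) =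
        sign (\<sigma> \<circ> \<tau>) * lk f (Poly_Mapping.map_key (\<sigma> \<circ> \<tau>) b)"
      by (simp add: lookup_of_int_mult lookup_pv map_key_comp sign_compose)
  qed
  also have "\<dots> = lk (altV S f) b"
    unfolding lookup_altV by (rule sum_permutations_compose_right[OF tS, symmetric])
  finally show "lk (altV S (of_int (sign \<tau>) * permute_vars \<tau> f)) b = lk (altV S f) b" .
qed

text \<open>Each summand of the inner alternant has the same outer alternant, so alternating over a
  subset first only multiplies the result. This lets information modulo negligible terms for the
  inner variables enter a computation in all variables.\<close>

lemma altV_altV:
  assumes "finite S" "T \<subseteq> S"
  shows "altV S (altV T f) = of_nat (card {\<tau>. \<tau> permutes T}) * altV S f"
proof -
  have *: "altV S (of_int (sign \<tau>) * permute_vars \<tau> f) = altV S f" if "\<tau> permutes T" for \<tau>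
    using altV_pv[OF assms(1) permutes_subset[OF that assms(2)]] .
  have "altV S (altV T f) = (\<Sum>\<tau> | \<tau> permutes T. altV S (of_int (sign \<tau>) * permute_vars \<tau> f))"
    unfolding altV_def[of T] by (rule altV_sum)
  also have "\<dots> = (\<Sum>\<tau> | \<tau> permutes T. altV S f)" by (intro sum.cong refl) (simp add: *)
  finally show ?thesis by simp
qed

subsection \<open>Sorting exponents\<close>

lemma sorting_permutation:
  fixes e :: "nat \<Rightarrow> int"
  assumes "inj_on e {b<..b + N}"
  obtains \<sigma> where "\<sigma> permutes {b<..b + N}" "\<And>i j. b < i \<Longrightarrow> i < j \<Longrightarrow> j \<le> b + N \<Longrightarrow> e (\<sigma> j) < e (\<sigma> i)"
proof -
  let ?V = "{b<..b + N}"
  define G where "G i = {j \<in> ?V. e i < e j}" for i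
  define \<tau> where "\<tau> i = (if i \<in> ?V then Suc b + card (G i) else i)" for i
  have fG: "finite (G i)" for i by (simp add: G_def)
  have sub: "G i \<subset> ?V" if "i \<in> ?V" for i
  proof (rule psubsetI)
    show "G i \<subseteq> ?V" unfolding G_def by blast
    have "i \<notin> G i" by (simp add: G_def)
    then show "G i \<noteq> ?V" using that by blast
  qed
  have into: "\<tau> i \<in> ?V" if "i \<in> ?V" for i
    using psubset_card_mono[OF _ sub[OF that]] that by (simp add: \<tau>_def)
  have less: "card (G i) < card (G j)" if "i \<in> ?V" "j \<in> ?V" "e j < e i" for i j
  proof (rule psubset_card_mono[OF fG], rule psubsetI)
    show "G i \<subseteq> G j" using that(3) by (auto simp: G_def)
    have "i \<in> G j" "i \<notin> G i" using that by (simp_all add: G_def)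
    then show "G i \<noteq> G j" by blast
  qed
  have inj: "inj_on \<tau> ?V"
  proof (rule inj_onI, rule ccontr)
    fix i j assume ij: "i \<in> ?V" "j \<in> ?V" "\<tau> i = \<tau> j" "i \<noteq> j"
    then have "e i \<noteq> e j" using assms by (auto dest: inj_onD)
    moreover have "card (G i) = card (G j)" using ij by (simp add: \<tau>_def)
    ultimately show False using less[OF ij(1,2)] less[OF ij(2,1)] by (metis less_irrefl linorder_neqE)
  qed
  have p: "\<tau> permutes ?V"
  proof (rule bij_imp_permutes)
    have "\<tau> ` ?V \<subseteq> ?V" using into by blast
    then have "\<tau> ` ?V = ?V" by (rule endo_inj_surj[OF finite_greaterThanAtMost _ inj])
    then show "bij_betw \<tau> ?V ?V" using inj by (simp add: bij_betw_def)
    show "\<tau> x = x" if "x \<notin> ?V" for x unfolding \<tau>_def using that by (rule if_not_P)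
  qed
  show thesis
  proof (rule that)
    show pi: "inv \<tau> permutes ?V" using p by (rule permutes_inv)
    fix i j assume ij: "b < i" "i < j" "j \<le> b + N"
    have m: "inv \<tau> i \<in> ?V" "inv \<tau> j \<in> ?V" using permutes_in_image[OF pi] ij by auto
    have "\<tau> (inv \<tau> i) < \<tau> (inv \<tau> j)" using ij permutes_inverses(1)[OF p] by simp
    then have l: "card (G (inv \<tau> i)) < card (G (inv \<tau> j))" using m by (simp add: \<tau>_def)
    have "G (inv \<tau> j) \<subseteq> G (inv \<tau> i)" if "e (inv \<tau> i) \<le> e (inv \<tau> j)" using that by (auto simp: G_def)
    then show "e (inv \<tau> j) < e (inv \<tau> i)" using l card_mono[OF fG] by (meson not_le)
  qed
qed

lemma strict_dec_lower:
  fixes f :: "nat \<Rightarrow> int"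
  assumes "\<And>i j. b < i \<Longrightarrow> i < j \<Longrightarrow> j \<le> b + N \<Longrightarrow> f j < f i" "\<And>i. b < i \<Longrightarrow> i \<le> b + N \<Longrightarrow> 0 \<le> f i"
    and "b < i" "i \<le> b + N"
  shows "int (b + N) - int i \<le> f i"
proof -
  have "int t \<le> f (b + N - t)" if "t < N" for t
    using that
  proof (induction t)
    case (Suc t)
    have "f (b + N - t) < f (b + N - Suc t)" using Suc.prems by (intro assms(1)) auto
    then show ?case using Suc by simp
  qed (use assms(2) in auto)
  from this[of "b + N - i"] show ?thesis using assms(3,4) by simp
qed

lemma sum_distinct_lower:
  fixes T :: "int set"
  assumes "finite T" "\<forall>x\<in>T. 1 \<le> x"
  shows "(\<Sum>t<card T. 1 + int t) \<le> \<Sum>T"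
  using assms
proof (induction rule: finite_linorder_max_induct)
  case (insert m A)
  have "A \<subseteq> {1..<m}" using insert by auto
  then have "card A \<le> card {1..<m}" by (intro card_mono) auto
  moreover have "1 \<le> m" using insert.prems by simp
  ultimately have "int (card A) + 1 \<le> m" by simp
  moreover have "m \<notin> A" using insert.hyps by auto
  ultimately show ?case using insert by simp
qed simp

text \<open>The staircase \<open>N - 1, ..., 1, 0\<close> placed on the variables with index
  \<open>c + 1, ..., c + N\<close>.\<close>

definition rh :: "nat \<Rightarrow> nat \<Rightarrow> nat \<Rightarrow>\<^sub>0 int" where
  "rh c N = (\<Sum>i\<in>{c<..c + N}. Poly_Mapping.single i (int (c + N) - int i))"

lemma lookup_rh: "lk (rh c N) i = (if c < i \<and> i \<le> c + N then int (c + N) - int i else 0)"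
proof -
  have "lk (rh c N) i = (\<Sum>j\<in>{c<..c + N}. if i = j then int (c + N) - int j else 0)"
    unfolding rh_def lookup_sum by (intro sum.cong) (auto simp: lookup_single when_def)
  then show ?thesis by (simp only: sum.delta' finite_greaterThanAtMost) auto
qed

subsection \<open>The Vandermonde product\<close>

definition VD :: "nat set \<Rightarrow> laurent" where
  "VD S = (\<Prod>(j, k)\<in>{(j, k). j \<in> S \<and> k \<in> S \<and> j < k}. xv j - xv k)"

lemma finite_pairs: "finite S \<Longrightarrow> finite {(j, k). j \<in> S \<and> k \<in> S \<and> j < (k :: nat)}"
  by (rule finite_subset[of _ "S \<times> S"]) auto

lemma VD_swap:
  assumes "finite S" "p \<in> S" "q \<in> S" "p < q" "\<forall>s\<in>S. \<not> (p < s \<and> s < q)"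
  shows "permute_vars (Transposition.transpose p q) (VD S) = of_int (- 1) * VD S"
proof -
  let ?t = "Transposition.transpose p q"
  define Z where "Z = {(j, k). j \<in> S \<and> k \<in> S \<and> j < k} - {(p, q)}"
  have P: "{(j, k). j \<in> S \<and> k \<in> S \<and> j < k} = insert (p, q) Z" using assms by (auto simp: Z_def)
  have fZ: "finite Z" using finite_pairs[OF assms(1)] by (simp add: Z_def)
  have nZ: "(p, q) \<notin> Z" by (simp add: Z_def)
  have tt: "?t (?t x) = x" for x by simp
  have mem: "(?t j, ?t k) \<in> Z" if "(j, k) \<in> Z" for j k
  proof -
    have jk: "j \<in> S" "k \<in> S" "j < k" "(j, k) \<noteq> (p, q)" using that by (auto simp: Z_def)
    have "j \<le> p \<or> q \<le> j" "k \<le> p \<or> q \<le> k" using assms(5) jk(1,2) by (meson not_le)+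
    then have "?t j < ?t k" using jk(3,4) assms(4) by (auto simp: Transposition.transpose_def)
    moreover have "?t j \<in> S" "?t k \<in> S" using jk assms by (auto simp: Transposition.transpose_def)
    moreover have "(?t j, ?t k) \<noteq> (p, q)"
    proof
      assume "(?t j, ?t k) = (p, q)"
      then have "j = ?t p" "k = ?t q" by (metis prod.inject tt)+
      then show False using jk(3) assms(4) by simp
    qed
    ultimately show ?thesis by (simp add: Z_def)
  qed
  have "permute_vars ?t (VD S) = (\<Prod>(j, k)\<in>insert (p, q) Z. xv (?t j) - xv (?t k))"
    unfolding VD_def P by (simp add: pv_prod pv_diff pv_xv case_prod_unfold)
  also have "\<dots> = (xv q - xv p) * (\<Prod>(j, k)\<in>Z. xv (?t j) - xv (?t k))"
    using fZ nZ by (simp add: prod.insert)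
  also have "(\<Prod>(j, k)\<in>Z. xv (?t j) - xv (?t k)) = (\<Prod>(j, k)\<in>Z. xv j - xv k)"
    by (rule prod.reindex_bij_witness[of _ "\<lambda>(j, k). (?t j, ?t k)" "\<lambda>(j, k). (?t j, ?t k)"]) (auto simp: mem)
  also have "(xv q - xv p) * (\<Prod>(j, k)\<in>Z. xv j - xv k) = of_int (- 1) * VD S"
    unfolding VD_def P using fZ nZ by (simp add: prod.insert algebra_simps)
  finally show ?thesis .
qed

lemma VD_insert:
  assumes "finite S" "\<forall>j\<in>S. i < j"
  shows "VD (insert i S) = (\<Prod>j\<in>S. xv i - xv j) * VD S"
proof -
  let ?P = "{(j, k). j \<in> S \<and> k \<in> S \<and> j < k}"
  have "{(j, k). j \<in> insert i S \<and> k \<in> insert i S \<and> j < k} = (\<lambda>j. (i, j)) ` S \<union> ?P"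
    using assms(2) by fastforce
  moreover have "(\<lambda>j. (i, j)) ` S \<inter> ?P = {}" using assms(2) by auto
  moreover have "(\<Prod>(j, k)\<in>(\<lambda>j. (i, j)) ` S. xv j - xv k) = (\<Prod>j\<in>S. xv i - xv j)"
    by (subst prod.reindex) (auto simp: inj_on_def)
  ultimately show ?thesis
    unfolding VD_def using assms(1) finite_pairs[OF assms(1)] by (simp add: prod.union_disjoint)
qed

lemma xv_neq: "j \<noteq> k \<Longrightarrow> xv j - xv k \<noteq> 0"
proof
  assume "j \<noteq> k" "xv j - xv k = 0"
  then have "lk (xv j) (Poly_Mapping.single j 1) = lk (xv k) (Poly_Mapping.single j 1)" by simp
  then have "Poly_Mapping.single k (1::int) = Poly_Mapping.single j 1"
    by (auto simp: lookup_single when_def split: if_splits)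
  then have "lk (Poly_Mapping.single k (1::int)) j = 1" by simp
  then show False using \<open>j \<noteq> k\<close> by (simp add: lookup_single)
qed

lemma VD_nonzero: "finite S \<Longrightarrow> VD S \<noteq> 0"
  unfolding VD_def using finite_pairs[of S] xv_neq by (subst prod_zero_iff) (auto simp: case_prod_unfold)

lemma tsym_VD: "tsym (- 1) {b<..b + N} (VD {b<..b + N})"
proof (rule tsym_interval)
  fix r assume "b < r" "r < b + N"
  then show "permute_vars (Transposition.transpose r (Suc r)) (VD {b<..b + N}) = of_int (- 1) * VD {b<..b + N}"
    by (intro VD_swap) auto
qed simp

section \<open>Degree bounds, and the Vandermonde product as an alternant\<close>

definition bnd :: "nat set \<Rightarrow> nat set \<Rightarrow> nat \<Rightarrow> laurent \<Rightarrow> bool" where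
  "bnd S T d f \<longleftrightarrow> (\<forall>e\<in>Poly_Mapping.keys f. (\<forall>i. 0 \<le> lk e i) \<and> (\<forall>i. i \<notin> T \<longrightarrow> lk e i = 0) \<and> (\<Sum>i\<in>S. lk e i) \<le> int d)"

lemma bnd_mult: "bnd S T d f \<Longrightarrow> bnd S T d' g \<Longrightarrow> bnd S T (d + d') (f * g)"
  unfolding bnd_def
proof
  fix e assume a: "\<forall>e\<in>Poly_Mapping.keys f. (\<forall>i. 0 \<le> lk e i) \<and> (\<forall>i. i \<notin> T \<longrightarrow> lk e i = 0) \<and> (\<Sum>i\<in>S. lk e i) \<le> int d"
    "\<forall>e\<in>Poly_Mapping.keys g. (\<forall>i. 0 \<le> lk e i) \<and> (\<forall>i. i \<notin> T \<longrightarrow> lk e i = 0) \<and> (\<Sum>i\<in>S. lk e i) \<le> int d'"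
    and "e \<in> Poly_Mapping.keys (f * g)"
  then obtain x y where "e = x + y" "x \<in> Poly_Mapping.keys f" "y \<in> Poly_Mapping.keys g"
    using keys_mult[of f g] by blast
  then show "(\<forall>i. 0 \<le> lk e i) \<and> (\<forall>i. i \<notin> T \<longrightarrow> lk e i = 0) \<and> (\<Sum>i\<in>S. lk e i) \<le> int (d + d')"
    using a by (auto simp: lookup_add sum.distrib intro: add_mono)
qed

lemma keys_xv_diff: "Poly_Mapping.keys (xv i - xv j) \<subseteq> {Poly_Mapping.single i 1, Poly_Mapping.single j 1}"
  using keys_diff[of "xv i" "xv j"] by auto

lemma bnd_xv:
  assumes "finite S" "i \<in> T" "j \<in> T" shows "bnd S T 1 (xv i - xv j)"
  unfolding bnd_def
proof
  fix e assume "e \<in> Poly_Mapping.keys (xv i - xv j)"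
  then have "e = Poly_Mapping.single i 1 \<or> e = Poly_Mapping.single j 1" using keys_xv_diff[of i j] by blast
  then show "(\<forall>i. 0 \<le> lk e i) \<and> (\<forall>i. i \<notin> T \<longrightarrow> lk e i = 0) \<and> (\<Sum>i\<in>S. lk e i) \<le> int 1"
    using assms by (auto simp: lookup_single when_def)
qed

lemma bnd_one: "bnd S T 0 1"
  by (simp add: bnd_def)

lemma bnd_prod:
  assumes "finite A" "\<And>j. j \<in> A \<Longrightarrow> bnd S T 1 (f j)" shows "bnd S T (card A) (prod f A)"
  using assms
proof (induction rule: finite_induct)
  case (insert x A)
  then show ?case using bnd_mult[of S T 1 "f x" "card A" "prod f A"] by simp
qed (simp add: bnd_one)

lemma bnd_VD:
  "finite S \<Longrightarrow> S \<subseteq> T \<Longrightarrow> bnd S T (\<Sum>t<card S. t) (VD S)"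
proof (induction rule: finite_linorder_min_induct)
  case empty
  then show ?case by (simp add: VD_def bnd_one)
next
  case (insert i A)
  have widen: "bnd (insert i A) T d f" if "bnd A T d f" "bnd A A d f" for d f
  proof -
    have "i \<notin> A" using insert.hyps by auto
    then show ?thesis using that insert.hyps(1) unfolding bnd_def by simp
  qed
  have sup: "bnd A A d (VD A)" if "bnd A T d (VD A)" for d
  proof -
    have "bnd A A (card {(j, k). j \<in> A \<and> k \<in> A \<and> j < k}) (VD A)"
      unfolding VD_def
    proof (rule bnd_prod[OF finite_pairs[OF insert.hyps(1)]])
      fix z assume "z \<in> {(j, k). j \<in> A \<and> k \<in> A \<and> j < k}"
      then obtain j k where "z = (j, k)" "j \<in> A" "k \<in> A" by auto
      then show "bnd A A 1 (case z of (j, k) \<Rightarrow> xv j - xv k)"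
        using bnd_xv[OF insert.hyps(1)] by simp
    qed
    then show ?thesis using that by (simp add: bnd_def)
  qed
  have 1: "bnd (insert i A) T (card A) (\<Prod>j\<in>A. xv i - xv j)"
  proof (rule bnd_prod[OF insert.hyps(1)])
    fix j assume "j \<in> A"
    then show "bnd (insert i A) T 1 (xv i - xv j)"
      using insert.hyps(1) insert.prems by (intro bnd_xv) auto
  qed
  have "bnd A T (\<Sum>t<card A. t) (VD A)" using insert by simp
  then have "bnd (insert i A) T (\<Sum>t<card A. t) (VD A)" using sup widen by blast
  moreover have "i \<notin> A" using insert.hyps by auto
  ultimately show ?case
    using bnd_mult[OF 1, of "\<Sum>t<card A. t" "VD A"] VD_insert[of A i] insert.hyps
    by (simp add: add.commute[of "card A"])
qed

lemma sum_rh: "(\<Sum>i\<in>{b<..b + N}. int (b + N) - int i) = int (\<Sum>t<N. t)"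
proof -
  have "(\<Sum>i\<in>{b<..b + N}. int (b + N) - int i) = (\<Sum>t\<in>{..<N}. int t)"
    by (rule sum.reindex_bij_witness[of _ "\<lambda>t. b + N - t" "\<lambda>i. b + N - i"]) auto
  then show ?thesis by simp
qed

text \<open>Distinct nonnegative integers in decreasing order dominate the staircase entry by entry;
  the bound on the sum forces equality.\<close>

lemma sorted_exponent:
  assumes "inj_on (lk e) {b<..b + N}" "\<forall>i\<in>{b<..b + N}. 0 \<le> lk e i" "\<forall>i. i \<notin> {b<..b + N} \<longrightarrow> lk e i = 0"
    "(\<Sum>i\<in>{b<..b + N}. lk e i) \<le> int (\<Sum>t<N. t)"
  obtains \<sigma> where "\<sigma> permutes {b<..b + N}" "Poly_Mapping.map_key \<sigma> e = rh b N"
proof -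
  let ?V = "{b<..b + N}"
  obtain \<sigma> where s: "\<sigma> permutes ?V" and dec: "\<And>i j. b < i \<Longrightarrow> i < j \<Longrightarrow> j \<le> b + N \<Longrightarrow> lk e (\<sigma> j) < lk e (\<sigma> i)"
    using sorting_permutation[OF assms(1)] by blast
  have im: "i \<in> ?V \<Longrightarrow> \<sigma> i \<in> ?V" for i using permutes_in_image[OF s] by blast
  have low: "int (b + N) - int i \<le> lk e (\<sigma> i)" if "i \<in> ?V" for i
    using strict_dec_lower[of b N "\<lambda>i. lk e (\<sigma> i)" i] dec assms(2) im that by auto
  have tot: "(\<Sum>i\<in>?V. lk e (\<sigma> i)) = (\<Sum>i\<in>?V. lk e i)"
    using sum.permute[OF s, of "lk e"] by (simp add: comp_def)
  have eq: "lk e (\<sigma> i) = int (b + N) - int i" if i: "i \<in> ?V" for i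
  proof (rule ccontr)
    assume "lk e (\<sigma> i) \<noteq> int (b + N) - int i"
    then have "int (b + N) - int i < lk e (\<sigma> i)" using low[OF i] by simp
    then have "(\<Sum>i\<in>?V. int (b + N) - int i) < (\<Sum>i\<in>?V. lk e (\<sigma> i))"
      using low i by (intro sum_strict_mono_ex1) auto
    then show False using tot assms(4) by (simp only: sum_rh)
  qed
  have "Poly_Mapping.map_key \<sigma> e = rh b N"
  proof (rule poly_mapping_eqI)
    fix i
    show "lk (Poly_Mapping.map_key \<sigma> e) i = lk (rh b N) i"
    proof (cases "i \<in> ?V")
      case True
      then show ?thesis using eq[OF True] by (simp add: lookup_map_key permutes_inj[OF s] lookup_rh)
    next
      case False
      then have "\<sigma> i = i" using s by (simp add: permutes_not_in)
      then show ?thesis using False assms(3) by (auto simp: lookup_map_key permutes_inj[OF s] lookup_rh)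
    qed
  qed
  with s show thesis by (rule that)
qed

lemma lookup_alt_rh:
  assumes mu: "\<And>i j. b < i \<Longrightarrow> i < j \<Longrightarrow> j \<le> b + N \<Longrightarrow> lk e j < lk e i"
  shows "lk (altV {b<..b + N} (mono e)) e = 1"
proof -
  let ?V = "{b<..b + N}"
  have "lk (altV ?V (mono e)) e = (\<Sum>\<sigma> | \<sigma> permutes ?V. if \<sigma> = id then 1 else 0)"
    unfolding lookup_altV
  proof (intro sum.cong refl)
    fix \<sigma> assume "\<sigma> \<in> {\<sigma>. \<sigma> permutes ?V}"
    then have s: "\<sigma> permutes ?V" by simp
    have "\<sigma> = id" if eq: "Poly_Mapping.map_key \<sigma> e = e"
    proof
      fix i show "\<sigma> i = id i"
      proof (cases "i \<in> ?V")
        case True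
        then have "\<sigma> i \<in> ?V" using permutes_in_image[OF s] by blast
        moreover have "lk e (\<sigma> i) = lk e i" using arg_cong[OF eq, of "\<lambda>p. lk p i"] by (simp add: lookup_map_key permutes_inj[OF s])
        ultimately show ?thesis using mu[of i "\<sigma> i"] mu[of "\<sigma> i" i] True by (cases "\<sigma> i" i rule: linorder_cases) auto
      qed (use s in \<open>simp add: permutes_not_in\<close>)
    qed
    then show "sign \<sigma> * lk (mono e) (Poly_Mapping.map_key \<sigma> e) = (if \<sigma> = id then 1 else 0)"
      by (auto simp: lookup_single when_def mk_id sign_id)
  qed
  also have "\<dots> = 1"
    using permutes_id[of ?V] finite_permutations[of ?V] by (subst sum.delta) auto
  finally show ?thesis .
qed

text \<open>Antisymmetry makes the exponents of each monomial distinct, and the degree bound leaves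
  only rearrangements of the staircase. So \<open>\<kappa>\<close> is the coefficient of the
  staircase monomial, and it is nonzero because the product is.\<close>

theorem VD_altV: "\<exists>\<kappa>. \<kappa> \<noteq> 0 \<and> VD {b<..b + N} = of_int \<kappa> * altV {b<..b + N} (mono (rh b N))"
proof -
  let ?V = "{b<..b + N}"
  define \<kappa> where "\<kappa> = lk (VD ?V) (rh b N)"
  have eq: "VD ?V = of_int \<kappa> * altV ?V (mono (rh b N))"
  proof (rule poly_mapping_eqI)
    fix e
    show "lk (VD ?V) e = lk (of_int \<kappa> * altV ?V (mono (rh b N))) e"
    proof (cases "\<exists>\<sigma>. \<sigma> permutes ?V \<and> Poly_Mapping.map_key \<sigma> e = rh b N")
      case True
      then obtain \<sigma> where s: "\<sigma> permutes ?V" "Poly_Mapping.map_key \<sigma> e = rh b N" by blast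
      have "lk (altV ?V (mono (rh b N))) (rh b N) = 1" by (rule lookup_alt_rh) (auto simp: lookup_rh)
      then have "sign \<sigma> * lk (altV ?V (mono (rh b N))) e = 1"
        using altV_lookup_perm[of ?V \<sigma> "mono (rh b N)" e] s by simp
      moreover have "sign \<sigma> * lk (VD ?V) e = \<kappa>" using tsym_lookup[OF s(1) _ tsym_VD, of e] s(2) by (simp add: \<kappa>_def)
      ultimately show ?thesis unfolding lookup_of_int_mult
        by (cases \<sigma> rule: sign_cases) auto
    next
      case False
      have "lk (altV ?V (mono (rh b N))) e = 0"
        unfolding lookup_altV by (intro sum.neutral) (use False in \<open>auto simp: lookup_single when_def\<close>)
      moreover have "lk (VD ?V) e = 0"
      proof (rule ccontr)
        assume n: "lk (VD ?V) e \<noteq> 0"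
        then have "e \<in> Poly_Mapping.keys (VD ?V)" by (simp add: in_keys_iff)
        moreover have "bnd ?V ?V (\<Sum>t<card ?V. t) (VD ?V)" by (rule bnd_VD) auto
        ultimately have e: "\<forall>i. 0 \<le> lk e i" "\<forall>i. i \<notin> ?V \<longrightarrow> lk e i = 0" "(\<Sum>i\<in>?V. lk e i) \<le> int (\<Sum>t<N. t)"
          by (auto simp: bnd_def)
        obtain \<sigma> where "\<sigma> permutes ?V" "Poly_Mapping.map_key \<sigma> e = rh b N"
          by (rule sorted_exponent[OF tsym_distinct[OF tsym_VD n] _ e(2,3)]) (use e(1) in auto)
        then show False using False by blast
      qed
      ultimately show ?thesis by (simp add: lookup_of_int_mult)
    qed
  qed
  have "\<kappa> \<noteq> 0" using eq VD_nonzero[of ?V] by auto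
  with eq show ?thesis by blast
qed

subsection \<open>Laurent polynomials without nonnegative part\<close>

text \<open>
  The alternants of interest are only evaluated at exponents that are nonnegative on \<open>V\<close>; so
  Laurent polynomials all of whose monomials have a negative exponent in \<open>V\<close> are negligible.
\<close>

definition Neg :: "nat set \<Rightarrow> laurent \<Rightarrow> bool" where
  "Neg V f \<longleftrightarrow> (\<forall>e. lk f e \<noteq> 0 \<longrightarrow> (\<exists>j\<in>V. lk e j < 0))"

lemma Neg_zero [simp]: "Neg V 0"
  by (simp add: Neg_def)

lemma Neg_add: "Neg V f \<Longrightarrow> Neg V g \<Longrightarrow> Neg V (f + g)"
  unfolding Neg_def lookup_add by (metis add.right_neutral)

lemma Neg_uminus: "Neg V f \<Longrightarrow> Neg V (- f)"
  unfolding Neg_def by simp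

lemma Neg_diff: "Neg V f \<Longrightarrow> Neg V g \<Longrightarrow> Neg V (f - g)"
  using Neg_add[of V f "- g"] Neg_uminus[of V g] by simp

lemma Neg_sum: "(\<And>x. x \<in> A \<Longrightarrow> Neg V (f x)) \<Longrightarrow> Neg V (sum f A)"
  by (induction A rule: infinite_finite_induct) (auto intro: Neg_add)

lemma Neg_of_int: "\<kappa> \<noteq> 0 \<Longrightarrow> Neg V (of_int \<kappa> * f) \<longleftrightarrow> Neg V f"
  by (simp add: Neg_def lookup_of_int_mult)

text \<open>The multipliers under which \<open>Neg\<close> is stable; among them are the ratios
  \<open>x\<^sub>i / x\<^sub>j\<close> with \<open>j\<close> in \<open>V\<close> and
  \<open>i\<close> outside.\<close>

definition down :: "nat set \<Rightarrow> laurent \<Rightarrow> bool" where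
  "down V f \<longleftrightarrow> (\<forall>e. lk f e \<noteq> 0 \<longrightarrow> (\<forall>j\<in>V. lk e j \<le> 0))"

lemma Neg_mult: "Neg V f \<Longrightarrow> down V g \<Longrightarrow> Neg V (f * g)"
  unfolding Neg_def
proof (intro allI impI)
  fix e assume a: "\<forall>e. lk f e \<noteq> 0 \<longrightarrow> (\<exists>j\<in>V. lk e j < 0)" "down V g" "lk (f * g) e \<noteq> 0"
  then have "e \<in> Poly_Mapping.keys (f * g)" by (simp add: in_keys_iff)
  then obtain x y where xy: "e = x + y" "x \<in> Poly_Mapping.keys f" "y \<in> Poly_Mapping.keys g"
    using keys_mult[of f g] by blast
  then obtain j where "j \<in> V" "lk x j < 0" "lk y j \<le> 0" using a by (auto simp: in_keys_iff down_def)
  then show "\<exists>j\<in>V. lk e j < 0" using xy(1) by (intro bexI[of _ j]) (auto simp: lookup_add)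
qed

lemma down_mult: "down V f \<Longrightarrow> down V g \<Longrightarrow> down V (f * g)"
  unfolding down_def
proof (intro allI impI ballI)
  fix e j assume a: "\<forall>e. lk f e \<noteq> 0 \<longrightarrow> (\<forall>j\<in>V. lk e j \<le> 0)" "\<forall>e. lk g e \<noteq> 0 \<longrightarrow> (\<forall>j\<in>V. lk e j \<le> 0)"
    "lk (f * g) e \<noteq> 0" "j \<in> V"
  then have "e \<in> Poly_Mapping.keys (f * g)" by (simp add: in_keys_iff)
  then obtain x y where xy: "e = x + y" "x \<in> Poly_Mapping.keys f" "y \<in> Poly_Mapping.keys g"
    using keys_mult[of f g] by blast
  then have "lk x j \<le> 0" "lk y j \<le> 0" using a by (auto simp: in_keys_iff)
  then show "lk e j \<le> 0" using xy(1) by (simp add: lookup_add)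
qed

lemma down_one [simp]: "down V 1"
  by (auto simp: down_def lookup_one when_def split: if_splits)

lemma down_prod: "(\<And>x. x \<in> A \<Longrightarrow> down V (f x)) \<Longrightarrow> down V (prod f A)"
  by (induction A rule: infinite_finite_induct) (auto intro: down_mult)

lemma down_xratio: "i \<notin> V \<Longrightarrow> j \<in> V \<Longrightarrow> down V (xratio i j)"
  unfolding down_def xratio_def
  by (auto simp: lookup_single when_def lookup_minus split: if_splits)

lemma down_diff: "down V f \<Longrightarrow> down V g \<Longrightarrow> down V (f - g)"
  unfolding down_def lookup_minus by (metis diff_0_right diff_self)

subsection \<open>Marking the degree in some variables\<close>

text \<open>The series variable records the degree in the variables of \<open>I\<close>. A factor
  \<open>1 - x\<^sub>i / x\<^sub>j\<close> becomes \<open>1 - q x\<^sub>i / x\<^sub>j\<close> for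
  \<open>i\<close> in \<open>I\<close> and \<open>j\<close> outside. Terms of negative degree are
  lost, so multiplicativity is restricted to \<open>nonneg_deg\<close>.\<close>

definition theta :: "nat set \<Rightarrow> laurent \<Rightarrow> laurent fps" where
  "theta I f = Abs_fps (\<lambda>d. \<Sum>a | a \<in> Poly_Mapping.keys f \<and> (\<Sum>i\<in>I. lk a i) = int d. Poly_Mapping.single a (lk f a))"

lemma lookup_theta: "lk (fps_nth (theta I f) d) a = (if (\<Sum>i\<in>I. lk a i) = int d then lk f a else 0)"
proof -
  have "lk (fps_nth (theta I f) d) a =
      (\<Sum>b | b \<in> Poly_Mapping.keys f \<and> (\<Sum>i\<in>I. lk b i) = int d. if b = a then lk f b else 0)"
    unfolding theta_def fps_nth_Abs_fps lookup_sum by (intro sum.cong) (auto simp: lookup_single when_def)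
  then show ?thesis by (simp add: in_keys_iff)
qed

lemma theta_eqI: "(\<And>d a. lk (fps_nth f d) a = lk (fps_nth g d) a) \<Longrightarrow> f = (g :: laurent fps)"
  by (intro fps_ext poly_mapping_eqI)

lemma theta_diff: "theta I (f - g) = theta I f - theta I g"
  by (rule theta_eqI) (simp add: lookup_theta lookup_minus)

lemma theta_zero [simp]: "theta I 0 = 0"
  by (rule theta_eqI) (simp add: lookup_theta)

lemma theta_mono: "(\<Sum>i\<in>I. lk a i) = int d \<Longrightarrow> theta I (mono a) = fps_const (mono a) * fps_X ^ d"
  by (rule theta_eqI) (auto simp: lookup_theta lookup_single when_def fps_X_power_nth)

definition nonneg_deg :: "nat set \<Rightarrow> laurent \<Rightarrow> bool" where
  "nonneg_deg I f \<longleftrightarrow> Poly_Mapping.keys f \<subseteq> {a. 0 \<le> (\<Sum>i\<in>I. lk a i)}"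

lemma theta_mult:
  assumes "nonneg_deg I f" "nonneg_deg I g" shows "theta I (f * g) = theta I f * theta I g"
  using assms(1) unfolding nonneg_deg_def
proof (induction f rule: laurent_induct)
  case (mono a)
  show ?case using assms(2) unfolding nonneg_deg_def
  proof (induction g rule: laurent_induct)
    case (mono b)
    obtain d d' where d: "(\<Sum>i\<in>I. lk a i) = int d" "(\<Sum>i\<in>I. lk b i) = int d'"
      using mono \<open>a \<in> _\<close> by (auto elim!: nonneg_int_cases)
    then have dd: "(\<Sum>i\<in>I. lk (a + b) i) = int (d + d')" by (simp add: lookup_add sum.distrib)
    have "fps_const (mono (a + b)) = fps_const (mono a) * fps_const (mono b)" by (simp add: mono_mult)
    then show ?case
      unfolding mono_mult theta_mono[OF dd] theta_mono[OF d(1)] theta_mono[OF d(2)] by (simp only: power_add ac_simps)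
  qed (simp_all add: right_diff_distrib theta_diff)
qed (simp_all add: left_diff_distrib theta_diff)

lemma nonneg_deg_mult: "nonneg_deg I f \<Longrightarrow> nonneg_deg I g \<Longrightarrow> nonneg_deg I (f * g)"
  unfolding nonneg_deg_def
proof
  fix e assume a: "Poly_Mapping.keys f \<subseteq> {a. 0 \<le> (\<Sum>i\<in>I. lk a i)}" "Poly_Mapping.keys g \<subseteq> {a. 0 \<le> (\<Sum>i\<in>I. lk a i)}"
    "e \<in> Poly_Mapping.keys (f * g)"
  then obtain x y where "e = x + y" "x \<in> Poly_Mapping.keys f" "y \<in> Poly_Mapping.keys g"
    using keys_mult[of f g] by blast
  then show "e \<in> {a. 0 \<le> (\<Sum>i\<in>I. lk a i)}" using a by (auto simp: lookup_add sum.distrib subset_iff)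
qed

lemma nonneg_deg_one: "nonneg_deg I 1"
  by (simp add: nonneg_deg_def)

lemma theta_one: "theta I 1 = 1"
  using theta_mono[of 0 I 0] by simp

lemma theta_prod:
  "(\<And>x. x \<in> A \<Longrightarrow> nonneg_deg I (f x)) \<Longrightarrow> nonneg_deg I (prod f A) \<and> theta I (prod f A) = (\<Prod>x\<in>A. theta I (f x))"
  by (induction A rule: infinite_finite_induct) (auto simp: nonneg_deg_one theta_one theta_mult nonneg_deg_mult)

lemma theta_const: "(\<And>e. lk f e \<noteq> 0 \<Longrightarrow> (\<Sum>i\<in>I. lk e i) = 0) \<Longrightarrow> theta I f = fps_const f"
  by (rule theta_eqI) (fastforce simp: lookup_theta)

lemma nonneg_degI: "(\<And>e. lk f e \<noteq> 0 \<Longrightarrow> 0 \<le> (\<Sum>i\<in>I. lk e i)) \<Longrightarrow> nonneg_deg I f"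
  by (auto simp: nonneg_deg_def in_keys_iff)

lemma theta_ratio:
  assumes "finite I" "i \<in> I" "j \<notin> I"
  shows "nonneg_deg I (1 - xratio i j)" "theta I (1 - xratio i j) = 1 - fps_X * fps_const (xratio i j)"
proof -
  have "(\<Sum>k\<in>I. lk (Poly_Mapping.single i 1 - Poly_Mapping.single j (1::int)) k) = (\<Sum>k\<in>I. if k = i then 1 else 0)"
    using assms by (intro sum.cong) (auto simp: lookup_minus lookup_single when_def)
  then have d: "(\<Sum>k\<in>I. lk (Poly_Mapping.single i 1 - Poly_Mapping.single j (1::int)) k) = int 1"
    using assms by simp
  show "theta I (1 - xratio i j) = 1 - fps_X * fps_const (xratio i j)"
    unfolding theta_diff theta_one xratio_def theta_mono[OF d] by (simp add: mult.commute)
  show "nonneg_deg I (1 - xratio i j)"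
  proof (rule nonneg_degI)
    fix e assume "lk (1 - xratio i j) e \<noteq> 0"
    then have "e = 0 \<or> e = Poly_Mapping.single i 1 - Poly_Mapping.single j 1"
      by (auto simp: xratio_def lookup_minus lookup_one lookup_single when_def split: if_splits)
    then show "0 \<le> (\<Sum>k\<in>I. lk e k)" using d by auto
  qed
qed

subsection \<open>Adding labels one at a time\<close>

lemma bnd_lookup: "bnd S T d f \<Longrightarrow> lk f e \<noteq> 0 \<Longrightarrow> (\<forall>i. 0 \<le> lk e i) \<and> (\<forall>i. i \<notin> T \<longrightarrow> lk e i = 0) \<and> (\<Sum>i\<in>S. lk e i) \<le> int d"
  by (simp add: bnd_def in_keys_iff)

text \<open>In the application \<open>P\<close> enumerates words that may use the label
  \<open>i\<close>, and \<open>P'\<close> those that avoid it. With the factors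
  \<open>x\<^sub>i - x\<^sub>j\<close> the Vandermonde product grows by the variable
  \<open>i\<close>, so the first term is essentially antisymmetric in one more variable.
  Antisymmetry and the degree bound then kill every monomial that is nonnegative on the block and
  involves the variable \<open>i\<close>.\<close>

lemma neg_add_label:
  assumes ib: "i \<le> b"
    and sym: "tsym 1 (insert i {b<..b + N}) P"
    and bP: "bnd (insert i {b<..b + N}) UNIV N P" "bnd (insert i {b<..b + N}) UNIV N P'"
    and P': "\<And>e. lk P' e = (if lk e i = 0 then lk P e else 0)"
  shows "Neg {b<..b + N} (VD {b<..b + N} * P * (\<Prod>j\<in>{b<..b + N}. 1 - xratio i j) - VD {b<..b + N} * P')"
proof -
  let ?V = "{b<..b + N}"
  let ?S = "insert i ?V"
  have iV: "i \<notin> ?V" using ib by simp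
  define t1 where "t1 = VD ?V * P * (\<Prod>j\<in>?V. 1 - xratio i j)"
  define t2 where "t2 = VD ?V * P'"
  define A where "A = VD ?S * P"
  have VS: "VD ?S = (\<Prod>j\<in>?V. xv i - xv j) * VD ?V" using ib by (intro VD_insert) auto
  have antiVD: "tsym (- 1) ?S (VD ?S)"
  proof (cases "N = 0")
    case True then show ?thesis by (auto simp: tsym_def)
  next
    case False
    show ?thesis
    proof (rule tsym_insert[of _ _ _ "Suc b"])
      show "tsym (- 1) ?V (VD ?S)"
      proof (rule tsym_interval)
        fix r assume "b < r" "r < b + N"
        then show "permute_vars (Transposition.transpose r (Suc r)) (VD ?S) = of_int (- 1) * VD ?S"
          using ib by (intro VD_swap) auto
      qed simp
      show "permute_vars (Transposition.transpose i (Suc b)) (VD ?S) = of_int (- 1) * VD ?S"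
        using ib False by (intro VD_swap) auto
    qed (use ib False in auto)
  qed
  have antiA: "tsym (- 1) ?S A" using tsym_mult[OF antiVD sym] by (simp add: A_def)
  have cardS: "card ?S = Suc N" using iV by simp
  have bVS: "bnd ?S UNIV (\<Sum>t<Suc N. t) (VD ?S)" using bnd_VD[of ?S UNIV] cardS by simp
  have bA: "bnd ?S UNIV ((\<Sum>t<Suc N. t) + N) A" unfolding A_def by (rule bnd_mult[OF bVS bP(1)])
  define o1 where "o1 = (\<Sum>j\<in>?V. Poly_Mapping.single j (1::int))"
  have lo1: "lk o1 k = (if k \<in> ?V then 1 else 0)" for k
  proof -
    have "lk o1 k = (\<Sum>j\<in>?V. if k = j then 1 else 0)"
      unfolding o1_def lookup_sum by (intro sum.cong) (auto simp: lookup_single when_def)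
    then show ?thesis by (simp only: sum.delta' finite_greaterThanAtMost)
  qed
  have mo1: "mono o1 = (\<Prod>j\<in>?V. xv j)"
  proof -
    have "mono (\<Sum>j\<in>B. Poly_Mapping.single j 1) = (\<Prod>j\<in>B. xv j)" for B
      by (induction B rule: infinite_finite_induct) (simp_all add: mono_mult[symmetric])
    then show ?thesis by (simp add: o1_def)
  qed
  \<comment> \<open>Multiplying by all variables of the block turns each
    \<open>1 - x\<^sub>i / x\<^sub>j\<close> into \<open>x\<^sub>j - x\<^sub>i\<close>, a factor of
    the larger Vandermonde product up to sign.\<close>
  have t1A: "mono o1 * t1 = (- 1) ^ N * A"
  proof -
    have "xv j * (1 - xratio i j) = (- 1) * (xv i - xv j)" for j
    proof -
      have "Poly_Mapping.single j (1::int) + (Poly_Mapping.single i 1 - Poly_Mapping.single j 1) = Poly_Mapping.single i 1" by simp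
      then have "xv j * xratio i j = xv i" by (simp only: xratio_def mono_mult)
      then show ?thesis by (simp add: right_diff_distrib)
    qed
    then have "(\<Prod>j\<in>?V. xv j) * (\<Prod>j\<in>?V. 1 - xratio i j) = (\<Prod>j\<in>?V. (- 1) * (xv i - xv j))"
      by (simp only: prod.distrib[symmetric])
    also have "\<dots> = (- 1) ^ N * (\<Prod>j\<in>?V. xv i - xv j)" by (subst prod.distrib) simp
    finally have "(\<Prod>j\<in>?V. xv j) * (\<Prod>j\<in>?V. 1 - xratio i j) = (- 1) ^ N * (\<Prod>j\<in>?V. xv i - xv j)" .
    then show ?thesis unfolding t1_def A_def VS mo1 by (simp only: ac_simps)
  qed
  have lt1: "lk t1 e = (- 1) ^ N * lk A (e + o1)" for e
  proof -
    have "lk t1 e = lk (mono o1 * t1) (e + o1)" by (simp add: lookup_mono_mult)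
    also have "\<dots> = lk (of_int ((- 1) ^ N) * A) (e + o1)" by (simp add: t1A)
    finally show ?thesis by (simp only: lookup_of_int_mult)
  qed
  have Vi: "lk e i = 0" if "lk (VD ?V) e \<noteq> 0" for e
  proof -
    have "bnd ?V ?V (\<Sum>t<card ?V. t) (VD ?V)" by (rule bnd_VD) auto
    from bnd_lookup[OF this that] iV show ?thesis by blast
  qed
  have key: "lk t1 e = lk t2 e" if pos: "\<forall>j\<in>?V. 0 \<le> lk e j" for e
  proof (cases "lk e i = 0")
    case False
    have "lk A (e + o1) = 0"
    proof (rule ccontr)
      assume n: "lk A (e + o1) \<noteq> 0"
      note B = bnd_lookup[OF bA n]
      have ge: "\<forall>k\<in>?S. 1 \<le> lk (e + o1) k"
      proof
        fix k assume "k \<in> ?S"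
        then show "1 \<le> lk (e + o1) k"
        proof
          assume "k = i"
          then show ?thesis using B False iV by (metis add.right_neutral lo1 lookup_add int_one_le_iff_zero_less order_le_less)
        qed (use pos in \<open>simp add: lookup_add lo1\<close>)
      qed
      have inj: "inj_on (lk (e + o1)) ?S" by (rule tsym_distinct[OF antiA n])
      \<comment> \<open>Distinct positive exponents on \<open>N + 1\<close> variables sum to at
        least \<open>1 + ... + (N + 1)\<close>. This exceeds by one the degree bound, which is
        \<open>0 + ... + N\<close> for the Vandermonde product plus \<open>N\<close> for
        \<open>P\<close>.\<close>
      have "(\<Sum>t<Suc N. 1 + int t) \<le> \<Sum>(lk (e + o1) ` ?S)"
        using sum_distinct_lower[of "lk (e + o1) ` ?S"] ge inj cardS by (simp only: card_image) auto
      also have "\<Sum>(lk (e + o1) ` ?S) = (\<Sum>k\<in>?S. lk (e + o1) k)" by (simp only: sum.reindex[OF inj] comp_def)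
      also have "\<dots> \<le> int ((\<Sum>t<Suc N. t) + N)" using B by blast
      finally show False by (simp add: sum.distrib)
    qed
    moreover have "lk t2 e = 0"
    proof (rule ccontr)
      assume "lk t2 e \<noteq> 0"
      then have "e \<in> Poly_Mapping.keys (VD ?V * P')" by (simp add: in_keys_iff t2_def)
      then obtain x y where "e = x + y" "lk (VD ?V) x \<noteq> 0" "lk P' y \<noteq> 0"
        using keys_mult[of "VD ?V" P'] by (auto simp: in_keys_iff)
      then show False using Vi[of x] P'[of y] False by (auto simp: lookup_add split: if_splits)
    qed
    ultimately show ?thesis by (simp add: lt1)
  next
    case True
    \<comment> \<open>At exponent 0 of the variable \<open>i\<close> only the parts of degree 0
      contribute: \<open>P'\<close> from \<open>P\<close>, the constant 1 from the product of the
      ratios, and all of \<open>VD ?V\<close>.\<close>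
    have nd: "nonneg_deg {i} (VD ?V)" "nonneg_deg {i} P"
      using Vi bnd_lookup[OF bP(1)] by (auto intro!: nonneg_degI)
    have ndr: "nonneg_deg {i} (\<Prod>j\<in>?V. 1 - xratio i j) \<and> theta {i} (\<Prod>j\<in>?V. 1 - xratio i j) = (\<Prod>j\<in>?V. theta {i} (1 - xratio i j))"
      using iV by (intro theta_prod theta_ratio(1)) auto
    have "fps_nth (\<Prod>j\<in>?V. theta {i} (1 - xratio i j)) 0 = 1"
    proof -
      have "fps_nth (\<Prod>j\<in>B. theta {i} (1 - xratio i j)) 0 = 1" if "B \<subseteq> ?V" for B
        using that by (induction B rule: infinite_finite_induct) (use iV in \<open>auto simp: theta_ratio(2)\<close>)
      then show ?thesis by simp
    qed
    moreover have "fps_nth (theta {i} P) 0 = P'"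
      by (rule poly_mapping_eqI) (simp add: lookup_theta P')
    moreover have "fps_nth (theta {i} (VD ?V)) 0 = VD ?V"
      by (rule poly_mapping_eqI) (use Vi in \<open>auto simp: lookup_theta\<close>)
    moreover have "theta {i} t1 = theta {i} (VD ?V) * theta {i} P * (\<Prod>j\<in>?V. theta {i} (1 - xratio i j))"
      unfolding t1_def using nd ndr by (simp add: theta_mult nonneg_deg_mult)
    ultimately have "fps_nth (theta {i} t1) 0 = t2" by (simp add: t2_def)
    then show ?thesis using lookup_theta[of "{i}" t1 0 e] True by simp
  qed
  show ?thesis unfolding Neg_def t1_def[symmetric] t2_def[symmetric]
  proof (intro allI impI)
    fix e assume "lk (t1 - t2) e \<noteq> 0"
    then have "\<not> (\<forall>j\<in>?V. 0 \<le> lk e j)" using key[of e] by (auto simp: lookup_minus)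
    then show "\<exists>j\<in>?V. lk e j < 0" by (meson not_le)
  qed
qed

text \<open>The labels \<open>a + 1, ..., b\<close> are disposed of one at a time. The factors of
  the labels still to come are \<open>down\<close>, so multiplying by them keeps the error of an
  earlier stage negligible.\<close>

theorem neg_add_labels:
  assumes ab: "a \<le> b"
    and sym: "\<And>c. a \<le> c \<Longrightarrow> c < b \<Longrightarrow> tsym 1 (insert (Suc c) {b<..b + N}) (P c)"
    and bP: "\<And>c. a \<le> c \<Longrightarrow> c \<le> b \<Longrightarrow> bnd {c<..b + N} {c<..b + N} N (P c)"
    and res: "\<And>c e. a \<le> c \<Longrightarrow> c < b \<Longrightarrow> lk (P (Suc c)) e = (if lk e (Suc c) = 0 then lk (P c) e else 0)"
  shows "Neg {b<..b + N} (VD {b<..b + N} * P a * (\<Prod>i\<in>{a<..b}. \<Prod>j\<in>{b<..b + N}. 1 - xratio i j) - VD {b<..b + N} * P b)"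
  using ab
proof (induction rule: inc_induct)
  case base then show ?case by simp
next
  case (step c)
  let ?V = "{b<..b + N}"
  let ?E = "\<lambda>i. \<Prod>j\<in>?V. 1 - xratio i j"
  have bb: "bnd (insert (Suc c) ?V) UNIV N (P c')" if "c \<le> c'" "c' \<le> b" for c'
    unfolding bnd_def
  proof
    fix e assume e: "e \<in> Poly_Mapping.keys (P c')"
    have B: "(\<forall>i. 0 \<le> lk e i) \<and> (\<forall>i. i \<notin> {c'<..b + N} \<longrightarrow> lk e i = 0) \<and> (\<Sum>i\<in>{c'<..b + N}. lk e i) \<le> int N"
      using bP[of c'] that step.hyps e unfolding bnd_def by auto
    have "(\<Sum>i\<in>insert (Suc c) ?V. lk e i) \<le> (\<Sum>i\<in>insert (Suc c) {c'<..b + N}. lk e i)"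
      using B that by (intro sum_mono2) auto
    also have "\<dots> = (\<Sum>i\<in>{c'<..b + N}. lk e i)"
      using B by (cases "Suc c \<in> {c'<..b + N}") (auto simp: insert_absorb)
    finally show "(\<forall>i. 0 \<le> lk e i) \<and> (\<forall>i. i \<notin> UNIV \<longrightarrow> lk e i = 0) \<and> (\<Sum>i\<in>insert (Suc c) ?V. lk e i) \<le> int N"
      using B by simp
  qed
  have 1: "Neg ?V (VD ?V * P c * ?E (Suc c) - VD ?V * P (Suc c))"
    using step.hyps by (intro neg_add_label sym res bb) auto
  have d: "down ?V (\<Prod>i\<in>{Suc c<..b}. ?E i)"
    by (intro down_prod down_diff down_xratio down_one) auto
  have "{c<..b} = insert (Suc c) {Suc c<..b}" using step.hyps by auto
  then have "(\<Prod>i\<in>{c<..b}. ?E i) = ?E (Suc c) * (\<Prod>i\<in>{Suc c<..b}. ?E i)" by simp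
  then have eq: "VD ?V * P c * (\<Prod>i\<in>{c<..b}. ?E i) - VD ?V * P b =
      (VD ?V * P c * ?E (Suc c) - VD ?V * P (Suc c)) * (\<Prod>i\<in>{Suc c<..b}. ?E i) +
      (VD ?V * P (Suc c) * (\<Prod>i\<in>{Suc c<..b}. ?E i) - VD ?V * P b)"
    by (simp add: algebra_simps)
  show ?case unfolding eq by (rule Neg_add[OF Neg_mult[OF 1 d] step.IH])
qed

subsection \<open>Power series\<close>

definition NegF :: "nat set \<Rightarrow> laurent fps \<Rightarrow> bool" where
  "NegF V f \<longleftrightarrow> (\<forall>k. Neg V (fps_nth f k))"

abbreviation fac :: "nat \<Rightarrow> nat \<Rightarrow> laurent fps" where
  "fac i j \<equiv> 1 - fps_X * fps_const (xratio i j)"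

lemma NegF_diff: "NegF V f \<Longrightarrow> NegF V g \<Longrightarrow> NegF V (f - g)"
  by (simp add: NegF_def Neg_diff)

lemma NegF_const_mult: "down V p \<Longrightarrow> NegF V f \<Longrightarrow> NegF V (fps_const p * f)"
  unfolding NegF_def by (simp add: mult.commute[of p] Neg_mult)

text \<open>Each coefficient of \<open>f\<close> is the corresponding coefficient of the product
  plus \<open>x\<^sub>i / x\<^sub>j\<close> times the preceding coefficient of \<open>f\<close>, and
  this multiplier is \<open>down\<close>.\<close>

lemma NegF_cancel:
  assumes "i \<notin> V" "j \<in> V" "NegF V (f * fac i j)" shows "NegF V f"
  unfolding NegF_def
proof
  fix k show "Neg V (fps_nth f k)"
  proof (induction k)
    case 0
    show ?case using assms(3)[unfolded NegF_def, rule_format, of 0] by simp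
  next
    case (Suc k)
    have e: "f * fac i j = f - fps_X * (f * fps_const (xratio i j))" by (simp add: algebra_simps)
    have "Neg V (fps_nth (f * fac i j) (Suc k))" using assms(3) unfolding NegF_def by blast
    then have "Neg V (fps_nth f (Suc k) - fps_nth f k * xratio i j)" unfolding e by simp
    moreover have "Neg V (fps_nth f k * xratio i j)" by (rule Neg_mult[OF Suc down_xratio[OF assms(1,2)]])
    ultimately show ?case using Neg_add by fastforce
  qed
qed

lemma NegF_cancel_prod:
  assumes "finite Z" "\<And>i j. (i, j) \<in> Z \<Longrightarrow> i \<notin> V \<and> j \<in> V" "NegF V (f * (\<Prod>(i, j)\<in>Z. fac i j))"
  shows "NegF V f"
  using assms
proof (induction Z arbitrary: f rule: finite_induct)
  case (insert z Z)
  obtain i j where z: "z = (i, j)" by force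
  have "NegF V ((f * fac i j) * (\<Prod>(i, j)\<in>Z. fac i j))"
    using insert.prems(2) insert.hyps z by (simp add: ac_simps)
  then have "NegF V (f * fac i j)" using insert.IH insert.prems(1) by blast
  then show ?case using NegF_cancel insert.prems(1)[of i j] z by blast
qed simp

definition pvF :: "(nat \<Rightarrow> nat) \<Rightarrow> laurent fps \<Rightarrow> laurent fps" where
  "pvF w f = Abs_fps (\<lambda>k. permute_vars w (fps_nth f k))"

lemma pvF_mult: "bij w \<Longrightarrow> pvF w (f * g) = pvF w f * pvF w g"
  by (rule fps_ext) (simp add: pvF_def fps_mult_nth pv_sum pv_mult)

lemma pvF_one: "bij w \<Longrightarrow> pvF w 1 = 1"
  by (rule fps_ext) (simp add: pvF_def pv_one)

lemma pvF_prod: "bij w \<Longrightarrow> pvF w (prod f A) = (\<Prod>x\<in>A. pvF w (f x))"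
  by (induction A rule: infinite_finite_induct) (simp_all add: pvF_one pvF_mult)

lemma pvF_fac: "bij w \<Longrightarrow> pvF w (fac i j) = fac (w i) (w j)"
proof (rule fps_ext)
  fix k assume "bij w"
  then show "fps_nth (pvF w (fac i j)) k = fps_nth (fac (w i) (w j)) k"
    by (cases k) (auto simp: pvF_def pv_diff pv_one pv_xratio)
qed

lemma sym_fac_prod:
  assumes "I \<inter> V = {}"
  shows "tsym 1 V (fps_nth (\<Prod>(i, j)\<in>I \<times> V. fac i j) k)"
  unfolding tsym_def
proof (intro ballI impI)
  fix x y assume xy: "x \<in> V" "y \<in> V" "x \<noteq> y"
  let ?t = "Transposition.transpose x y"
  have b: "bij ?t" by simp
  have I: "?t i = i" if "i \<in> I" for i using that assms xy by (auto simp: Transposition.transpose_def)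
  have "pvF ?t (\<Prod>(i, j)\<in>I \<times> V. fac i j) = (\<Prod>(i, j)\<in>I \<times> V. fac i (?t j))"
    by (auto simp: pvF_prod[OF b] case_prod_unfold pvF_fac[OF b] I intro!: prod.cong)
  also have "\<dots> = (\<Prod>(i, j)\<in>I \<times> V. fac i j)"
    by (rule prod.reindex_bij_witness[of _ "\<lambda>(i, j). (i, ?t j)" "\<lambda>(i, j). (i, ?t j)"])
      (use xy in \<open>auto simp: Transposition.transpose_def\<close>)
  finally have "fps_nth (pvF ?t (\<Prod>(i, j)\<in>I \<times> V. fac i j)) k = fps_nth (\<Prod>(i, j)\<in>I \<times> V. fac i j) k" by simp
  then show "permute_vars ?t (fps_nth (\<Prod>(i, j)\<in>I \<times> V. fac i j) k) = of_int 1 * fps_nth (\<Prod>(i, j)\<in>I \<times> V. fac i j) k"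
    by (simp add: pvF_def)
qed

definition altF :: "nat set \<Rightarrow> laurent fps \<Rightarrow> laurent fps" where
  "altF V f = Abs_fps (\<lambda>k. altV V (fps_nth f k))"

lemma altF_diff: "altF V (f - g) = altF V f - altF V g"
  by (rule fps_ext) (simp add: altF_def altV_diff)

lemma altF_mult_sym:
  assumes "finite V" "\<And>k. tsym 1 V (fps_nth g k)" shows "altF V (f * g) = altF V f * g"
proof (rule fps_ext)
  fix k
  have "altV V (fps_nth (f * g) k) = (\<Sum>i=0..k. altV V (fps_nth f i * fps_nth g (k - i)))"
    by (simp add: fps_mult_nth altV_sum)
  also have "\<dots> = (\<Sum>i=0..k. altV V (fps_nth f i) * fps_nth g (k - i))"
    by (intro sum.cong refl altV_mult_sym assms)
  finally show "fps_nth (altF V (f * g)) k = fps_nth (altF V f * g) k"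
    by (simp add: altF_def fps_mult_nth)
qed

lemma tsym_mono_off: "(\<And>j. j \<in> V \<Longrightarrow> lk e j = 0) \<Longrightarrow> tsym 1 V (mono e)"
  unfolding tsym_def
proof (intro ballI impI)
  fix x y assume xy: "\<And>j. j \<in> V \<Longrightarrow> lk e j = 0" "x \<in> V" "y \<in> V" "x \<noteq> y"
  have "Poly_Mapping.map_key (Transposition.transpose x y) e = e"
    using xy by (intro poly_mapping_eqI) (simp add: lookup_map_key Transposition.transpose_def)
  then show "permute_vars (Transposition.transpose x y) (mono e) = of_int 1 * mono e"
    by (simp add: pv_mono inv_equality[of "Transposition.transpose x y" "Transposition.transpose x y"])
qed

text \<open>
  Here \<open>F\<close> and \<open>F'\<close> are the generating series before and after removing the first block, \<open>p\<close>
  counts words over \<open>V\<close> and \<open>Q\<close> words over all labels, marked by the number of labels outside \<open>V\<close>.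
\<close>

theorem alternant_step:
  fixes b N :: nat and I :: "nat set" and F F' Q p :: "laurent fps"
  defines "V \<equiv> {b<..b + N}" and "E \<equiv> (\<Prod>(i, j)\<in>I \<times> {b<..b + N}. fac i j)"
  assumes I: "I \<inter> V = {}" "finite I"
    and FE: "F * E = fps_const (mono \<epsilon>) * F'" and \<epsilon>: "\<And>j. j \<in> V \<Longrightarrow> lk \<epsilon> j = 0"
    and IH: "NegF V (altF V (fps_const (mono (rh b N)) * F') - fps_const (altV V (mono (rh b N))) * p)"
    and words: "NegF V (fps_const (VD V) * Q * E - fps_const (VD V) * p)"
    and symQ: "\<And>k. tsym 1 V (fps_nth Q k)"
  shows "NegF V (altF V (fps_const (mono (rh b N)) * (F - fps_const (mono \<epsilon>) * Q)))"
proof -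
  let ?\<rho> = "fps_const (mono (rh b N))" and ?\<epsilon> = "fps_const (mono \<epsilon>)" and ?a = "fps_const (altV V (mono (rh b N)))"
  have fin: "finite V" by (simp add: V_def)
  have symE: "tsym 1 V (fps_nth E k)" for k using sym_fac_prod[of I V k] I by (simp add: E_def V_def)
  have symm: "tsym 1 V (mono \<epsilon>)" by (rule tsym_mono_off[OF \<epsilon>])
  have sym0: "tsym 1 V 0" by (simp add: tsym_def)
  have syme: "tsym 1 V (fps_nth ?\<epsilon> k)" for k using symm sym0 by simp
  have alt\<rho>: "altF V ?\<rho> = ?a" by (rule fps_ext) (simp add: altF_def altV_def)
  \<comment> \<open>It is enough to treat \<open>h * E\<close>, by \<open>NegF_cancel_prod\<close>.
    Since \<open>E\<close> is symmetric in the block, it moves inside the alternant and clears the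
    root factors between the first block and the rest.\<close>
  define h where "h = altF V (?\<rho> * (F - ?\<epsilon> * Q))"
  have "h * E = altF V (?\<rho> * (F - ?\<epsilon> * Q) * E)" unfolding h_def by (rule altF_mult_sym[OF fin symE, symmetric])
  also have "?\<rho> * (F - ?\<epsilon> * Q) * E = ?\<rho> * F' * ?\<epsilon> - ?\<rho> * Q * E * ?\<epsilon>"
  proof -
    have "?\<rho> * (F - ?\<epsilon> * Q) * E = ?\<rho> * (F * E) - ?\<rho> * Q * E * ?\<epsilon>"
      by (simp only: left_diff_distrib right_diff_distrib ac_simps)
    then show ?thesis unfolding FE by (simp only: ac_simps)
  qed
  also have "altF V \<dots> = altF V (?\<rho> * F') * ?\<epsilon> - altF V ?\<rho> * Q * E * ?\<epsilon>"
    unfolding altF_diff altF_mult_sym[OF fin syme] altF_mult_sym[OF fin symE] altF_mult_sym[OF fin symQ] ..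
  also have "\<dots> = ?\<epsilon> * ((altF V (?\<rho> * F') - ?a * p) - (?a * Q * E - ?a * p))"
    unfolding alt\<rho> by (simp only: left_diff_distrib right_diff_distrib ac_simps) simp
  finally have hE: "h * E = ?\<epsilon> * ((altF V (?\<rho> * F') - ?a * p) - (?a * Q * E - ?a * p))" .
  \<comment> \<open>The identity for words is stated with the Vandermonde product; dividing by the
    nonzero integer \<open>\<kappa>\<close> expresses it with the alternant of the
    staircase.\<close>
  obtain \<kappa> where k: "\<kappa> \<noteq> 0" "VD V = of_int \<kappa> * altV V (mono (rh b N))" using VD_altV[of b N] by (auto simp: V_def)
  have "NegF V (?a * Q * E - ?a * p)"
    unfolding NegF_def
  proof
    fix n
    have "Neg V (fps_nth (fps_const (VD V) * Q * E - fps_const (VD V) * p) n)" using words by (simp add: NegF_def)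
    moreover have "fps_const (VD V) * Q * E - fps_const (VD V) * p = fps_const (of_int \<kappa>) * (?a * Q * E - ?a * p)"
      unfolding k(2) by (simp add: algebra_simps fps_const_mult[symmetric] del: fps_const_mult)
    ultimately show "Neg V (fps_nth (?a * Q * E - ?a * p) n)" using Neg_of_int[OF k(1)] by simp
  qed
  from NegF_diff[OF IH this] have "NegF V (h * E)"
    unfolding hE by (rule NegF_const_mult[rotated]) (auto simp: down_def lookup_single when_def \<epsilon>)
  then show ?thesis unfolding h_def[symmetric] E_def
    by (rule NegF_cancel_prod[rotated 2]) (use I in \<open>auto simp: V_def\<close>)
qed

section \<open>Generating functions of words\<close>

definition wexp :: "nat list \<Rightarrow> nat \<Rightarrow>\<^sub>0 int" where
  "wexp w = sum_list (map (\<lambda>c. Poly_Mapping.single c 1) w)"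

definition wpoly :: "nat list set \<Rightarrow> laurent" where
  "wpoly Y = (\<Sum>w\<in>Y. mono (wexp w))"

lemma lookup_wexp: "lk (wexp w) i = int (count_list w i)"
  unfolding wexp_def by (induction w) (auto simp: lookup_add lookup_single when_def)

lemma wexp_append: "wexp (u @ v) = wexp u + wexp v"
  by (simp add: wexp_def)

lemma lookup_wpoly: "finite Y \<Longrightarrow> lk (wpoly Y) e = int (card {w \<in> Y. wexp w = e})"
proof -
  assume "finite Y"
  then have "lk (wpoly Y) e = int (card {w \<in> Y. e = wexp w})"
    unfolding wpoly_def lookup_sum by (simp add: lookup_single when_def sum.If_cases Int_def eq_commute)
  then show ?thesis by (simp add: eq_commute)
qed

lemma wpoly_swap:
  assumes "\<And>v v'. fstep r s v v' \<Longrightarrow> v \<in> Y \<longleftrightarrow> v' \<in> Y" "r \<noteq> s"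
  shows "permute_vars (Transposition.transpose r s) (wpoly Y) = of_int 1 * wpoly Y"
proof -
  let ?t = "Transposition.transpose r s"
  have b: "bij ?t" by simp
  obtain \<phi> where \<phi>: "bij_betw \<phi> Y Y" "\<And>v i. v \<in> Y \<Longrightarrow> count_list (\<phi> v) i = count_list v (?t i)"
    using content_swap[of r s Y] assms by blast
  have "permute_vars ?t (wpoly Y) = (\<Sum>w\<in>Y. permute_vars ?t (mono (wexp w)))"
    unfolding wpoly_def by (rule pv_sum[OF b])
  also have "\<dots> = (\<Sum>w\<in>Y. mono (wexp (\<phi> w)))"
  proof (intro sum.cong refl)
    fix w assume "w \<in> Y"
    then have "Poly_Mapping.map_key (inv ?t) (wexp w) = wexp (\<phi> w)"
      by (intro poly_mapping_eqI) (simp add: inv_equality[of ?t ?t] lookup_map_key lookup_wexp \<phi>(2))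
    then show "permute_vars ?t (mono (wexp w)) = mono (wexp (\<phi> w))" by (simp add: pv_mono)
  qed
  also have "\<dots> = wpoly Y" unfolding wpoly_def by (rule sum.reindex_bij_betw[OF \<phi>(1)])
  finally show ?thesis by simp
qed

lemma sum_count_filter: "finite I \<Longrightarrow> (\<Sum>i\<in>I. count_list w i) = length (filter (\<lambda>c. c \<in> I) w)"
proof (induction w)
  case (Cons c w)
  have "(\<Sum>i\<in>I. count_list (c # w) i) = (\<Sum>i\<in>I. (if c = i then 1 else 0) + count_list w i)"
    by (intro sum.cong) auto
  then show ?case using Cons by (simp add: sum.distrib)
qed simp

lemma wpoly_support: "finite Y \<Longrightarrow> lk (wpoly Y) e \<noteq> 0 \<Longrightarrow> \<exists>w\<in>Y. e = wexp w"
proof -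
  assume a: "finite Y" "lk (wpoly Y) e \<noteq> 0"
  then have "{w \<in> Y. wexp w = e} \<noteq> {}" by (auto simp: lookup_wpoly simp del: card_eq_0_iff)
  then show ?thesis by blast
qed

text \<open>Expanding the alternant at \<open>e\<close> gives a signed sum over permutations of
  numbers of words with prescribed shifted content, where \<open>lam\<close> is \<open>e\<close>
  minus the staircase. By \<open>lattice_signed_count\<close> only lattice words survive.\<close>

theorem lookup_alt_words:
  assumes fin: "finite X" and cl: "suffix_closed a n X" and X: "\<And>x. x \<in> X \<Longrightarrow> set x \<subseteq> {a<..a + n}"
    and dec: "\<And>i j. a < i \<Longrightarrow> i < j \<Longrightarrow> j \<le> a + n \<Longrightarrow> lk e j < lk e i" and sup: "\<And>i. i \<notin> {a<..a + n} \<Longrightarrow> lk e i = 0"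
  shows "lk (altV {a<..a + n} (mono (rh a n) * wpoly X)) e =
    int (card {x \<in> X. lattice a n x \<and> (\<forall>i\<in>{a<..a + n}. int (count_list x i) = lk e i - (int (a + n) - int i))})"
proof -
  let ?V = "{a<..a + n}"
  define lam where "lam i = lk e i - (int (a + n) - int i)" for i
  have "lk (altV ?V (mono (rh a n) * wpoly X)) e =
      (\<Sum>\<sigma> | \<sigma> permutes ?V. sign \<sigma> * int (card {x\<in>X. \<forall>i\<in>?V. int (count_list x i) - int i = lam (\<sigma> i) - int (\<sigma> i)}))"
    unfolding lookup_altV
  proof (intro sum.cong refl)
    fix \<sigma> assume "\<sigma> \<in> {\<sigma>. \<sigma> permutes ?V}"
    then have s: "\<sigma> permutes ?V" by simp
    have "wexp x = Poly_Mapping.map_key \<sigma> e - rh a n \<longleftrightarrow> (\<forall>i\<in>?V. int (count_list x i) - int i = lam (\<sigma> i) - int (\<sigma> i))"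
      if x: "x \<in> X" for x
    proof -
      have "count_list x i = 0" if "i \<notin> ?V" for i using X[OF x] that by (auto simp: count_list_0_iff)
      moreover have "lk e (\<sigma> i) = 0" if "i \<notin> ?V" for i using sup permutes_in_image[OF s] that by blast
      ultimately have "wexp x = Poly_Mapping.map_key \<sigma> e - rh a n \<longleftrightarrow>
          (\<forall>i\<in>?V. int (count_list x i) = lk e (\<sigma> i) - (int (a + n) - int i))"
        unfolding poly_mapping_eq_iff fun_eq_iff
        by (auto simp: lookup_wexp lookup_minus lookup_map_key permutes_inj[OF s] lookup_rh)
      also have "\<dots> \<longleftrightarrow> (\<forall>i\<in>?V. int (count_list x i) - int i = lam (\<sigma> i) - int (\<sigma> i))"
        by (intro ball_cong refl) (auto simp: lam_def)
      finally show ?thesis .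
    qed
    then have "{x \<in> X. wexp x = Poly_Mapping.map_key \<sigma> e - rh a n} =
        {x\<in>X. \<forall>i\<in>?V. int (count_list x i) - int i = lam (\<sigma> i) - int (\<sigma> i)}" by blast
    then show "sign \<sigma> * lk (mono (rh a n) * wpoly X) (Poly_Mapping.map_key \<sigma> e) =
        sign \<sigma> * int (card {x\<in>X. \<forall>i\<in>?V. int (count_list x i) - int i = lam (\<sigma> i) - int (\<sigma> i)})"
      by (simp add: lookup_mono_mult lookup_wpoly[OF fin])
  qed
  also have "\<dots> = int (card {x\<in>X. lattice a n x \<and> (\<forall>i\<in>?V. int (count_list x i) = lam i)})"
  proof (rule lattice_signed_count[OF fin cl])
    fix i assume "a < i" "i < a + n"
    then show "lam (Suc i) \<le> lam i" using dec[of i "Suc i"] by (simp add: lam_def)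
  qed
  finally show ?thesis by (simp add: lam_def)
qed

text \<open>Every suffix of the part before the change keeps nonpositive excess, because
  \<open>p\<close> has excess 0 and its prefixes have nonnegative excess. Therefore closure under
  all steps implies \<open>suffix_closed\<close>.\<close>

lemma fstep_suffix:
  assumes "lattice a n p" "a < r" "r < a + n" "exc r (Suc r) p = 0" "fstep r (Suc r) v v'"
  shows "fstep r (Suc r) (p @ [Suc r] @ v) (p @ [Suc r] @ v')"
proof -
  let ?s = "Suc r"
  obtain u z where uz: "v = u @ [r] @ z" "v' = u @ [?s] @ z"
    "\<forall>p q. u = p @ q \<longrightarrow> exc r ?s q \<le> 0" "\<forall>p q. z = p @ q \<longrightarrow> 0 \<le> exc r ?s p"
    using assms(5) unfolding fstep_def by blast
  have eu: "exc r ?s u \<le> 0" using uz(3) by blast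
  have "exc r ?s q \<le> 0" if q: "p @ [?s] @ u = q1 @ q" for q1 q
    using suffix_cases[OF q]
  proof
    assume "\<exists>q2. p = q1 @ q2 \<and> q = q2 @ [?s] @ u"
    then obtain q2 where q2: "p = q1 @ q2" "q = q2 @ [?s] @ u" by blast
    have "0 \<le> exc r ?s q1" using assms(1-3) q2(1) unfolding lattice_def by blast
    then have "exc r ?s q2 \<le> 0" using assms(4) q2(1) by simp
    then show ?thesis using q2(2) eu by simp
  qed (use uz(3) in blast)
  then show ?thesis unfolding fstep_def using uz
    by (intro exI[of _ "p @ [?s] @ u"] exI[of _ z]) auto
qed

lemma suffix_closed_steps:
  assumes "\<And>r v v'. a < r \<Longrightarrow> r < a + n \<Longrightarrow> fstep r (Suc r) v v' \<Longrightarrow> v \<in> X \<longleftrightarrow> v' \<in> X"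
  shows "suffix_closed a n X"
  unfolding suffix_closed_def using assms fstep_suffix by blast

lemma sym_words:
  assumes "\<And>r v v'. a < r \<Longrightarrow> r < a + n \<Longrightarrow> fstep r (Suc r) v v' \<Longrightarrow> v \<in> X \<longleftrightarrow> v' \<in> X"
  shows "tsym 1 {a<..a + n} (wpoly X)"
proof (rule tsym_interval)
  fix r assume r: "a < r" "r < a + n"
  show "permute_vars (Transposition.transpose r (Suc r)) (wpoly X) = of_int 1 * wpoly X"
    by (rule wpoly_swap) (use assms[OF r] in auto)
qed simp

section \<open>The series attached to a composition\<close>

fun RR :: "nat \<Rightarrow> nat list \<Rightarrow> (nat \<times> nat) set" where
  "RR a [] = {}"
| "RR a (m # \<eta>) = {a<..a + m} \<times> {a + m<..a + m + sum_list \<eta>} \<union> RR (a + m) \<eta>"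

abbreviation ifac :: "nat \<Rightarrow> nat \<Rightarrow> laurent fps" where
  "ifac i j \<equiv> fps_right_inverse (fac i j) 1"

definition ones :: "nat \<Rightarrow> nat \<Rightarrow> nat \<Rightarrow>\<^sub>0 int" where
  "ones a n = (\<Sum>i\<in>{a<..a + n}. Poly_Mapping.single i 1)"

text \<open>The series \<open>x^\<gamma> B_\<eta>\<close> before \<open>\<pi>\<close> is applied,
  with all indices shifted by \<open>a\<close>, so that the tail of the composition gives a series
  of the same form on the remaining variables.\<close>

definition FF :: "nat \<Rightarrow> nat list \<Rightarrow> laurent fps" where
  "FF a \<eta> = fps_const (mono (ones a (sum_list \<eta>))) * (\<Prod>(i, j)\<in>RR a \<eta>. ifac i j)"

lemma lookup_ones: "lk (ones a n) k = (if a < k \<and> k \<le> a + n then 1 else 0)"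
proof -
  have "lk (ones a n) k = (\<Sum>j\<in>{a<..a + n}. if k = j then 1 else 0)"
    unfolding ones_def lookup_sum by (intro sum.cong) (auto simp: lookup_single when_def)
  then show ?thesis by (simp only: sum.delta' finite_greaterThanAtMost) auto
qed

lemma RR_sub: "RR a \<eta> \<subseteq> {a<..a + sum_list \<eta>} \<times> {a<..a + sum_list \<eta>}"
proof (induction a \<eta> rule: RR.induct)
  case (2 a m \<eta>)
  then show ?case by fastforce
qed simp

lemma finite_RR: "finite (RR a \<eta>)"
  by (rule finite_subset[OF RR_sub]) simp

lemma FF_Cons:
  "FF a (m # \<eta>) * (\<Prod>(i, j)\<in>{a<..a + m} \<times> {a + m<..a + m + sum_list \<eta>}. fac i j) =
    fps_const (mono (ones a m)) * FF (a + m) \<eta>"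
proof -
  let ?Z = "{a<..a + m} \<times> {a + m<..a + m + sum_list \<eta>}"
  have d: "?Z \<inter> RR (a + m) \<eta> = {}" using RR_sub[of "a + m" \<eta>] by auto
  have p: "(\<Prod>(i, j)\<in>RR a (m # \<eta>). ifac i j) = (\<Prod>(i, j)\<in>?Z. ifac i j) * (\<Prod>(i, j)\<in>RR (a + m) \<eta>. ifac i j)"
    using d finite_RR by (simp add: prod.union_disjoint)
  have "(\<Prod>(i, j)\<in>?Z. ifac i j) * (\<Prod>(i, j)\<in>?Z. fac i j) = (\<Prod>(i, j)\<in>?Z. fac i j * ifac i j)"
    by (simp add: prod.distrib case_prod_unfold mult.commute)
  also have "\<dots> = 1" by (simp add: B_series_factor case_prod_unfold)
  finally have one: "(\<Prod>(i, j)\<in>?Z. ifac i j) * (\<Prod>(i, j)\<in>?Z. fac i j) = 1" .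
  have "ones a (m + sum_list \<eta>) = ones a m + ones (a + m) (sum_list \<eta>)"
    by (rule poly_mapping_eqI) (auto simp: lookup_add lookup_ones)
  then have o: "fps_const (mono (ones a (m + sum_list \<eta>))) = fps_const (mono (ones a m)) * fps_const (mono (ones (a + m) (sum_list \<eta>)))"
    by (simp add: mono_mult)
  have "FF a (m # \<eta>) * (\<Prod>(i, j)\<in>?Z. fac i j) = fps_const (mono (ones a m)) * (fps_const (mono (ones (a + m) (sum_list \<eta>))) *
      (\<Prod>(i, j)\<in>RR (a + m) \<eta>. ifac i j)) * ((\<Prod>(i, j)\<in>?Z. ifac i j) * (\<Prod>(i, j)\<in>?Z. fac i j))"
    unfolding FF_def p sum_list.Cons o by (simp only: ac_simps)
  then show ?thesis unfolding one by (simp add: FF_def)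
qed

definition supp :: "nat set \<Rightarrow> laurent \<Rightarrow> bool" where
  "supp V f \<longleftrightarrow> (\<forall>e. lk f e \<noteq> 0 \<longrightarrow> (\<forall>i. i \<notin> V \<longrightarrow> lk e i = 0))"

lemma supp_mult: "supp V f \<Longrightarrow> supp V g \<Longrightarrow> supp V (f * g)"
  unfolding supp_def
proof (intro allI impI)
  fix e i assume a: "\<forall>e. lk f e \<noteq> 0 \<longrightarrow> (\<forall>i. i \<notin> V \<longrightarrow> lk e i = 0)" "\<forall>e. lk g e \<noteq> 0 \<longrightarrow> (\<forall>i. i \<notin> V \<longrightarrow> lk e i = 0)"
    "lk (f * g) e \<noteq> 0" "i \<notin> V"
  then have "e \<in> Poly_Mapping.keys (f * g)" by (simp add: in_keys_iff)
  then obtain x y where "e = x + y" "x \<in> Poly_Mapping.keys f" "y \<in> Poly_Mapping.keys g"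
    using keys_mult[of f g] by blast
  then show "lk e i = 0" using a by (simp add: lookup_add in_keys_iff)
qed

lemma supp_add: "supp V f \<Longrightarrow> supp V g \<Longrightarrow> supp V (f + g)"
  unfolding supp_def lookup_add by (metis add.right_neutral)

lemma supp_sum: "(\<And>x. x \<in> A \<Longrightarrow> supp V (f x)) \<Longrightarrow> supp V (sum f A)"
  by (induction A rule: infinite_finite_induct) (auto intro: supp_add simp: supp_def[of V 0])

lemma supp_mono: "(\<And>i. i \<notin> V \<Longrightarrow> lk e i = 0) \<Longrightarrow> supp V (mono e)"
  by (auto simp: supp_def lookup_single when_def split: if_splits)

lemma supp_altV:
  assumes "supp V f" shows "supp V (altV V f)"
  unfolding supp_def
proof (intro allI impI)
  fix e i assume e: "lk (altV V f) e \<noteq> 0" and i: "i \<notin> V"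
  obtain \<sigma> where s: "\<sigma> permutes V" "lk f (Poly_Mapping.map_key \<sigma> e) \<noteq> 0"
    using e unfolding lookup_altV by (metis (no_types, lifting) mem_Collect_eq mult_zero_right sum.neutral)
  then have "lk (Poly_Mapping.map_key \<sigma> e) i = 0" using assms i unfolding supp_def by blast
  then show "lk e i = 0" using s(1) i by (simp add: lookup_map_key permutes_inj permutes_not_in)
qed

lemma supp_one: "supp V 1"
  using supp_mono[of V 0] by simp

lemma supp_ifac:
  assumes "i \<in> V" "j \<in> V" shows "supp V (fps_nth (ifac i j) k)"
proof -
  define f where "f = ifac i j"
  have f: "f = 1 + fps_X * (fps_const (xratio i j) * f)"
    using B_series_factor[of i j] unfolding f_def[symmetric] by (simp add: algebra_simps)
  have e: "fps_nth f (Suc k) = xratio i j * fps_nth f k" for k by (subst f) simp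
  have e0: "fps_nth f 0 = 1" by (subst f) simp
  have x: "supp V (xratio i j)" unfolding xratio_def using assms by (intro supp_mono) (auto simp: lookup_minus lookup_single when_def)
  have "supp V (fps_nth f k)"
  proof (induction k)
    case 0 then show ?case by (simp add: e0 supp_one)
  next
    case (Suc k) then show ?case unfolding e by (intro supp_mult x)
  qed
  then show ?thesis unfolding f_def .
qed

lemma supp_FF: "supp {a<..a + sum_list \<eta>} (fps_nth (FF a \<eta>) k)"
proof -
  let ?V = "{a<..a + sum_list \<eta>}"
  have pr: "supp ?V (fps_nth (\<Prod>(i, j)\<in>Z. ifac i j) k)" if "finite Z" "Z \<subseteq> ?V \<times> ?V" for Z k
    using that
  proof (induction Z arbitrary: k rule: finite_induct)
    case (insert z Z)
    obtain i j where z: "z = (i, j)" by force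
    have ij: "i \<in> ?V" "j \<in> ?V" "Z \<subseteq> ?V \<times> ?V" using insert.prems z by auto
    show ?case
      unfolding z prod.insert[OF insert.hyps(1) insert.hyps(2)[unfolded z]] case_prod_conv fps_mult_nth
      by (intro supp_sum supp_mult supp_ifac ij insert.IH)
  qed (simp add: supp_one supp_def[of _ 0])
  have "supp ?V (mono (ones a (sum_list \<eta>)))" by (rule supp_mono) (auto simp: lookup_ones)
  then show ?thesis unfolding FF_def using pr[OF finite_RR RR_sub] by (simp add: supp_mult)
qed

section \<open>Counting lattice words\<close>

lemma cset_sub: "w \<in> cset c b N \<eta> k \<Longrightarrow> set w \<subseteq> {c<..b + N} \<and> length w = N"
  by (simp add: cset_def)

text \<open>The words of \<open>Xset\<close> without their prefix. In this form the generating
  polynomial is symmetric in the variables of the block \<open>{b<..b + N}\<close>.\<close>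

definition Qw :: "nat \<Rightarrow> nat \<Rightarrow> nat \<Rightarrow> nat list \<Rightarrow> nat \<Rightarrow> nat list set" where
  "Qw a b N \<eta> k = {w. \<exists>k1. w \<in> cset a b N \<eta> k1 \<and> k1 + length (filter (\<lambda>c. c \<le> b) w) = k}"

lemma finite_Qw: "finite (Qw a b N \<eta> k)"
proof (rule finite_subset)
  show "Qw a b N \<eta> k \<subseteq> {w. set w \<subseteq> {a<..b + N} \<and> length w = N}" unfolding Qw_def using cset_sub by blast
  show "finite {w. set w \<subseteq> {a<..b + N} \<and> length w = N}" by (rule finite_lists_length_eq) simp
qed

lemma wpoly_Xset: "wpoly (Xset a b N \<eta> k) = mono (wexp [Suc a..<Suc b]) * wpoly (Qw a b N \<eta> k)"
proof -
  have "wpoly (Xset a b N \<eta> k) = (\<Sum>w\<in>Qw a b N \<eta> k. mono (wexp ([Suc a..<Suc b] @ w)))"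
    unfolding wpoly_def Xset_def Qw_def by (subst sum.reindex) (auto simp: inj_on_def)
  then show ?thesis by (simp add: wpoly_def wexp_append mono_mult sum_distrib_left)
qed

lemma fps_mult_nth_cong: "(\<And>i. i \<le> n \<Longrightarrow> fps_nth f i = fps_nth g i) \<Longrightarrow> fps_nth (f * h) n = fps_nth (g * h) n"
  by (simp add: fps_mult_nth)

text \<open>For a fixed charge \<open>neg_add_labels\<close> is an identity without
  \<open>q\<close>. Applying \<open>theta\<close> for the variables of \<open>{a<..b}\<close> adds
  the number of labels \<open>\<le> b\<close> to the exponent of \<open>q\<close> and produces the
  factors \<open>fac i j\<close>.\<close>

theorem words_marked:
  fixes a b N \<eta>
  assumes ab: "a \<le> b"
  defines "V \<equiv> {b<..b + N}" and "E \<equiv> (\<Prod>(i, j)\<in>{a<..b} \<times> {b<..b + N}. fac i j)"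
  shows "NegF V (fps_const (VD V) * Abs_fps (\<lambda>k. wpoly (Qw a b N \<eta> k)) * E -
    fps_const (VD V) * Abs_fps (\<lambda>k. wpoly (cset b b N \<eta> k)))"
  unfolding NegF_def
proof
  fix n
  let ?I = "{a<..b}"
  define P where "P k c = wpoly (cset c b N \<eta> k)" for k c
  define U where "U k = VD V * P k a * (\<Prod>i\<in>?I. \<Prod>j\<in>V. 1 - xratio i j) - VD V * P k b" for k
  have sup: "\<exists>w\<in>cset c b N \<eta> k. e = wexp w" if "lk (P k c) e \<noteq> 0" for k c e
    using wpoly_support[OF finite_cset] that by (simp add: P_def)
  have NU: "Neg V (U k)" for k
    unfolding U_def V_def
  proof (rule neg_add_labels[OF ab])
    fix c assume c: "a \<le> c" "c < b"
    have V: "tsym 1 {b<..b + N} (P k c)" unfolding P_def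
    proof (rule sym_words)
      show "v \<in> cset c b N \<eta> k \<longleftrightarrow> v' \<in> cset c b N \<eta> k" if "b < r" "r < b + N" "fstep r (Suc r) v v'" for r v v'
        using cset_swap[of c r b N v v' \<eta> k] that c by auto
    qed
    show "tsym 1 (insert (Suc c) {b<..b + N}) (P k c)"
    proof (cases "N = 0")
      case True then show ?thesis by (auto simp: tsym_def)
    next
      case False
      \<comment> \<open>One exchange between the label \<open>c + 1\<close> and the end
        \<open>b + N\<close> of the block, together with the symmetry inside the block, yields all
        exchanges with \<open>c + 1\<close>.\<close>
      have "permute_vars (Transposition.transpose (b + N) (Suc c)) (P k c) = of_int 1 * P k c"
        unfolding P_def by (rule wpoly_swap) (use cset_swap_ends[OF c(2)] False c in auto)
      then show ?thesis using False c
        by (intro tsym_insert[OF _ V, of "b + N"]) (auto simp: transpose_commute)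
    qed
    show "lk (P k (Suc c)) e = (if lk e (Suc c) = 0 then lk (P k c) e else 0)" for e
    proof -
      have "{w \<in> cset (Suc c) b N \<eta> k. wexp w = e} = (if lk e (Suc c) = 0 then {w \<in> cset c b N \<eta> k. wexp w = e} else {})"
      proof -
        have r: "cset (Suc c) b N \<eta> k = {w \<in> cset c b N \<eta> k. set w \<subseteq> {Suc c<..b + N}}"
          using cset_restrict[of c "Suc c" b N \<eta> k] c by simp
        have "set w \<subseteq> {Suc c<..b + N} \<longleftrightarrow> lk (wexp w) (Suc c) = 0" if "w \<in> cset c b N \<eta> k" for w
        proof -
          have s: "set w \<subseteq> {c<..b + N}" using cset_sub[OF that] by simp
          have "set w \<subseteq> {Suc c<..b + N} \<longleftrightarrow> Suc c \<notin> set w"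
          proof
            assume n: "Suc c \<notin> set w"
            show "set w \<subseteq> {Suc c<..b + N}"
            proof
              fix y assume y: "y \<in> set w"
              then have "y \<noteq> Suc c" "c < y" "y \<le> b + N" using n s by auto
              then show "y \<in> {Suc c<..b + N}" by simp
            qed
          qed auto
          then show ?thesis by (simp add: lookup_wexp count_list_0_iff)
        qed
        then show ?thesis unfolding r by auto
      qed
      then show ?thesis by (simp add: P_def lookup_wpoly finite_cset)
    qed
  next
    fix c assume c: "a \<le> c" "c \<le> b"
    show "bnd {c<..b + N} {c<..b + N} N (P k c)"
      unfolding bnd_def
    proof
      fix e assume "e \<in> Poly_Mapping.keys (P k c)"
      then obtain w where w: "w \<in> cset c b N \<eta> k" "e = wexp w" using sup[of k c e] by (auto simp: in_keys_iff)
      have "(\<Sum>i\<in>{c<..b + N}. lk e i) = int (\<Sum>i\<in>{c<..b + N}. count_list w i)" by (simp add: w(2) lookup_wexp)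
      also have "(\<Sum>i\<in>{c<..b + N}. count_list w i) \<le> N"
        using cset_sub[OF w(1)] length_filter_le by (fastforce simp: sum_count_filter)
      finally have "(\<Sum>i\<in>{c<..b + N}. lk e i) \<le> int N" by simp
      moreover have "lk e i = 0" if "i \<notin> {c<..b + N}" for i
        using cset_sub[OF w(1)] that by (auto simp: w(2) lookup_wexp count_list_0_iff)
      ultimately show "(\<forall>i. 0 \<le> lk e i) \<and> (\<forall>i. i \<notin> {c<..b + N} \<longrightarrow> lk e i = 0) \<and> (\<Sum>i\<in>{c<..b + N}. lk e i) \<le> int N"
        by (simp add: w(2) lookup_wexp)
    qed
  qed
  have VD0: "(\<Sum>i\<in>?I. lk e i) = 0" if "lk (VD V) e \<noteq> 0" for e
  proof -
    have "bnd V V (\<Sum>t<card V. t) (VD V)" by (rule bnd_VD) (auto simp: V_def)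
    from bnd_lookup[OF this that] show ?thesis by (intro sum.neutral) (auto simp: V_def)
  qed
  have Pb0: "(\<Sum>i\<in>?I. lk e i) = 0" if ne: "lk (P k b) e \<noteq> 0" for e k
  proof -
    obtain w where w: "w \<in> cset b b N \<eta> k" "e = wexp w" using sup[OF ne] by blast
    then show ?thesis using cset_sub[OF w(1)] by (auto simp: lookup_wexp count_list_0_iff intro!: sum.neutral)
  qed
  have Pa: "nonneg_deg ?I (P k a)" for k
    by (rule nonneg_degI) (use sup in \<open>fastforce simp: lookup_wexp intro!: sum_nonneg\<close>)
  have VDn: "nonneg_deg ?I (VD V)" by (rule nonneg_degI) (simp add: VD0)
  have prodE: "(\<Prod>i\<in>?I. \<Prod>j\<in>V. 1 - xratio i j) = (\<Prod>(i, j)\<in>?I \<times> V. 1 - xratio i j)"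
    by (simp add: prod.cartesian_product)
  have tE: "nonneg_deg ?I (\<Prod>(i, j)\<in>?I \<times> V. 1 - xratio i j) \<and> theta ?I (\<Prod>(i, j)\<in>?I \<times> V. 1 - xratio i j) = E"
  proof -
    have "nonneg_deg ?I (\<Prod>z\<in>?I \<times> V. 1 - xratio (fst z) (snd z)) \<and>
        theta ?I (\<Prod>z\<in>?I \<times> V. 1 - xratio (fst z) (snd z)) = (\<Prod>z\<in>?I \<times> V. theta ?I (1 - xratio (fst z) (snd z)))"
      by (rule theta_prod) (auto simp: V_def intro!: theta_ratio(1))
    moreover have "(\<Prod>z\<in>?I \<times> V. theta ?I (1 - xratio (fst z) (snd z))) = E"
      unfolding E_def V_def by (intro prod.cong refl) (auto intro!: theta_ratio(2))
    ultimately show ?thesis by (simp add: case_prod_unfold)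
  qed
  have VPb: "theta ?I (VD V * P k b) = fps_const (VD V) * fps_const (P k b)" for k
    using theta_mult[OF VDn nonneg_degI[of "P k b"]] Pb0 VD0 by (simp add: theta_const)
  have tU: "theta ?I (U k) = fps_const (VD V) * theta ?I (P k a) * E - fps_const (VD V) * fps_const (P k b)" for k
    unfolding U_def theta_diff prodE VPb
    using theta_mult[OF nonneg_deg_mult[OF VDn Pa[of k]] tE[THEN conjunct1]] theta_mult[OF VDn Pa[of k]] tE theta_const[OF VD0]
    by simp
  \<comment> \<open>Only charges up to \<open>n\<close> reach the coefficient of \<open>q^n\<close>,
    so a finite sum over the charges replaces the full series.\<close>
  define QK where "QK = (\<Sum>k\<le>n. fps_X ^ k * theta ?I (P k a))"
  define pK where "pK = (\<Sum>k\<le>n. fps_X ^ k * fps_const (P k b))"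
  have Qeq: "fps_nth (Abs_fps (\<lambda>k. wpoly (Qw a b N \<eta> k))) i = fps_nth QK i" if i: "i \<le> n" for i
  proof (rule poly_mapping_eqI)
    fix e :: "nat \<Rightarrow>\<^sub>0 int"
    define d where "d = (\<Sum>i\<in>?I. lk e i)"
    \<comment> \<open>The degree of the monomial of a word in the variables of
      \<open>{a<..b}\<close> is the number of its labels \<open>\<le> b\<close>; a monomial
      therefore occurs for one charge only, namely \<open>i - nat d\<close>.\<close>
    have deg: "d = int (length (filter (\<lambda>c. c \<le> b) w))" if w: "w \<in> cset a b N \<eta> k" "wexp w = e" for w k
    proof -
      have "filter (\<lambda>c. c \<in> ?I) w = filter (\<lambda>c. c \<le> b) w" using cset_sub[OF w(1)] by (intro filter_cong) auto
      moreover have "d = int (\<Sum>i\<in>?I. count_list w i)" unfolding d_def w(2)[symmetric] by (simp add: lookup_wexp)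
      ultimately show ?thesis by (simp add: sum_count_filter)
    qed
    have "lk (fps_nth QK i) e = (\<Sum>k\<le>n. if k \<le> i \<and> d = int (i - k) then lk (P k a) e else 0)"
      unfolding QK_def fps_sum_nth lookup_sum
      by (intro sum.cong refl) (auto simp: fps_X_power_mult_nth lookup_theta d_def)
    also have "\<dots> = (\<Sum>k\<le>n. if k = i - nat d then (if 0 \<le> d \<and> d \<le> int i then lk (P k a) e else 0) else 0)"
      by (intro sum.cong refl) auto
    also have "\<dots> = (if 0 \<le> d \<and> d \<le> int i then lk (P (i - nat d) a) e else 0)"
      using i by (subst sum.delta) auto
    also have "\<dots> = int (card {w \<in> Qw a b N \<eta> i. wexp w = e})"
    proof (cases "0 \<le> d \<and> d \<le> int i")
      case True
      have "{w \<in> Qw a b N \<eta> i. wexp w = e} = {w \<in> cset a b N \<eta> (i - nat d). wexp w = e}"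
      proof (intro set_eqI iffI)
        fix w assume "w \<in> {w \<in> Qw a b N \<eta> i. wexp w = e}"
        then obtain k1 where w: "w \<in> cset a b N \<eta> k1" "k1 + length (filter (\<lambda>c. c \<le> b) w) = i" "wexp w = e" by (auto simp: Qw_def)
        then have "k1 = i - nat d" using deg[OF w(1,3)] by simp
        then show "w \<in> {w \<in> cset a b N \<eta> (i - nat d). wexp w = e}" using w by simp
      next
        fix w assume w: "w \<in> {w \<in> cset a b N \<eta> (i - nat d). wexp w = e}"
        then have "i - nat d + length (filter (\<lambda>c. c \<le> b) w) = i" using deg[of w "i - nat d"] True by auto
        then show "w \<in> {w \<in> Qw a b N \<eta> i. wexp w = e}" using w unfolding Qw_def by blast
      qed
      then show ?thesis using True by (simp add: P_def lookup_wpoly finite_cset)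
    next
      case False
      have em: "{w \<in> Qw a b N \<eta> i. wexp w = e} = {}"
      proof (rule ccontr)
        assume "{w \<in> Qw a b N \<eta> i. wexp w = e} \<noteq> {}"
        then obtain w k1 where w: "w \<in> cset a b N \<eta> k1" "k1 + length (filter (\<lambda>c. c \<le> b) w) = i" "wexp w = e" by (auto simp: Qw_def)
        then show False using deg[OF w(1,3)] False by simp
      qed
      show ?thesis unfolding em if_not_P[OF False] by simp
    qed
    finally show "lk (fps_nth (Abs_fps (\<lambda>k. wpoly (Qw a b N \<eta> k))) i) e = lk (fps_nth QK i) e"
      by (simp add: lookup_wpoly finite_Qw)
  qed
  have peq: "fps_nth (Abs_fps (\<lambda>k. wpoly (cset b b N \<eta> k))) i = fps_nth pK i" if i: "i \<le> n" for i
  proof -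
    have "fps_nth pK i = (\<Sum>k\<le>n. if k = i then P k b else 0)"
      unfolding pK_def fps_sum_nth by (intro sum.cong refl) (auto simp: fps_X_power_mult_nth)
    then show ?thesis using i by (simp add: P_def)
  qed
  have "fps_nth (fps_const (VD V) * Abs_fps (\<lambda>k. wpoly (Qw a b N \<eta> k)) * E - fps_const (VD V) * Abs_fps (\<lambda>k. wpoly (cset b b N \<eta> k))) n =
      fps_nth (fps_const (VD V) * QK * E - fps_const (VD V) * pK) n"
  proof -
    have "fps_nth (fps_const (VD V) * Abs_fps (\<lambda>k. wpoly (Qw a b N \<eta> k)) * E) n = fps_nth (fps_const (VD V) * QK * E) n"
      by (rule fps_mult_nth_cong) (simp only: fps_mult_left_const_nth Qeq)
    then show ?thesis by (simp only: fps_sub_nth fps_mult_left_const_nth peq order_refl)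
  qed
  also have "fps_const (VD V) * QK * E - fps_const (VD V) * pK = (\<Sum>k\<le>n. fps_X ^ k * theta ?I (U k))"
    unfolding tU QK_def pK_def sum_distrib_left sum_distrib_right sum_subtractf[symmetric]
    by (intro sum.cong refl) (simp only: right_diff_distrib ac_simps)
  also have "Neg V (fps_nth \<dots> n)"
    unfolding fps_sum_nth
  proof (rule Neg_sum)
    fix k
    have "Neg V (fps_nth (theta ?I (U k)) d)" for d
      using NU[of k] unfolding Neg_def lookup_theta by auto
    then show "Neg V (fps_nth (fps_X ^ k * theta ?I (U k)) n)" by (simp add: fps_X_power_mult_nth)
  qed
  finally show "Neg V (fps_nth (fps_const (VD V) * Abs_fps (\<lambda>k. wpoly (Qw a b N \<eta> k)) * E -
      fps_const (VD V) * Abs_fps (\<lambda>k. wpoly (cset b b N \<eta> k))) n)" .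
qed

lemma cset_closed: "a < r \<Longrightarrow> r < a + n \<Longrightarrow> fstep r (Suc r) v v' \<Longrightarrow> v \<in> cset a a n \<eta> k \<longleftrightarrow> v' \<in> cset a a n \<eta> k"
  using cset_swap[of a r a n v v' \<eta> k] by simp

text \<open>Induction on the blocks. The statement is confined to nonnegative exponents because the
  series is compared with generating functions of words only modulo \<open>Neg\<close>.\<close>

theorem lookup_alt_FF:
  assumes "\<forall>m\<in>set \<eta>. 0 < m" "n = sum_list \<eta>"
    and "\<And>i j. a < i \<Longrightarrow> i < j \<Longrightarrow> j \<le> a + n \<Longrightarrow> lk e j < lk e i"
    and "\<And>i. i \<in> {a<..a + n} \<Longrightarrow> 0 \<le> lk e i" and "\<And>i. i \<notin> {a<..a + n} \<Longrightarrow> lk e i = 0"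
  shows "lk (altV {a<..a + n} (mono (rh a n) * fps_nth (FF a \<eta>) k)) e =
    int (card {x \<in> cset a a n \<eta> k. lattice a n x \<and> (\<forall>i\<in>{a<..a + n}. int (count_list x i) = lk e i - (int (a + n) - int i))})"
  using assms
proof (induction \<eta> arbitrary: a n e k)
  case Nil
  have n: "n = 0" using Nil by simp
  have e: "e = 0" using Nil.prems(5) n by (intro poly_mapping_eqI) simp
  have rh0: "rh a 0 = 0" by (simp add: rh_def)
  have "FF a [] = 1" by (simp add: FF_def ones_def)
  then have l: "lk (altV {a<..a + n} (mono (rh a n) * fps_nth (FF a []) k)) e = (if k = 0 then 1 else 0)"
    unfolding n e rh0 by (simp add: lookup_altV sign_id mk_id lookup_one)
  have c0: "ct a (rd a (Lr a a 0) []) = []" "chg a (rd a (Lr a a 0) []) = 0" by (simp_all add: Lr_def chg_def)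
  have "cset a a 0 [] k = (if k = 0 then {[]} else {})" using c0 by (auto simp: cset_def)
  moreover have "lattice a 0 []" by (simp add: lattice_def)
  ultimately have "{x \<in> cset a a n [] k. lattice a n x \<and> (\<forall>i\<in>{a<..a + n}. int (count_list x i) = lk e i - (int (a + n) - int i))} =
      (if k = 0 then {[]} else {})" unfolding n by auto
  then show ?case using l by simp
next
  case (Cons m \<eta>)
  define N b where "N = sum_list \<eta>" and "b = a + m"
  have m: "0 < m" and n: "n = m + N" and abn: "a + n = b + N" using Cons.prems(1,2) by (auto simp: N_def b_def)
  have ab: "a < b" "a \<le> b" "b - a + N = n" using m n by (auto simp: b_def)
  let ?W = "{a<..a + n}" and ?V = "{b<..b + N}" and ?I = "{a<..b}"
  let ?p = "Abs_fps (\<lambda>k. wpoly (cset b b N \<eta> k))" and ?Q = "Abs_fps (\<lambda>k. wpoly (Qw a b N \<eta> k))"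
  let ?\<rho> = "mono (rh b N)" and ?F = "FF a (m # \<eta>)" and ?F' = "FF b \<eta>"
  have symp: "tsym 1 ?V (wpoly (cset b b N \<eta> k))" for k by (rule sym_words) (rule cset_closed)
  \<comment> \<open>The induction hypothesis, rewritten as an identity modulo negligible terms. It
    speaks about strictly decreasing exponents; both alternants are antisymmetric, so a disagreement
    at any exponent nonnegative on the block would survive sorting.\<close>
  have IH: "NegF ?V (altF ?V (fps_const ?\<rho> * ?F') - fps_const (altV ?V ?\<rho>) * ?p)"
    unfolding NegF_def Neg_def
  proof (intro allI impI, rule ccontr)
    fix k e assume ne: "lk (fps_nth (altF ?V (fps_const ?\<rho> * ?F') - fps_const (altV ?V ?\<rho>) * ?p) k) e \<noteq> 0"
      and "\<not> (\<exists>j\<in>?V. lk e j < 0)"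
    then have pos: "\<And>j. j \<in> ?V \<Longrightarrow> 0 \<le> lk e j" by (meson not_le)
    let ?f = "?\<rho> * fps_nth ?F' k" and ?g = "?\<rho> * wpoly (cset b b N \<eta> k)"
    have ag: "altV ?V ?g = altV ?V ?\<rho> * wpoly (cset b b N \<eta> k)" by (rule altV_mult_sym[OF _ symp]) simp
    have ne2: "lk (altV ?V ?f) e \<noteq> lk (altV ?V ?g) e" using ne by (simp add: altF_def ag lookup_minus)
    have s\<rho>: "supp ?V ?\<rho>" by (rule supp_mono) (auto simp: lookup_rh)
    have "supp ?V (wpoly (cset b b N \<eta> k))" unfolding wpoly_def
    proof (intro supp_sum supp_mono)
      fix w i assume "w \<in> cset b b N \<eta> k" "i \<notin> ?V"
      then show "lk (wexp w) i = 0" using cset_sub[of w b b N \<eta> k] by (auto simp: lookup_wexp count_list_0_iff)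
    qed
    then have sg: "supp ?V (altV ?V ?g)" by (intro supp_altV supp_mult s\<rho>)
    have sf: "supp ?V (altV ?V ?f)" using supp_FF[of b \<eta> k] by (intro supp_altV supp_mult s\<rho>) (simp add: N_def)
    have se: "\<And>i. i \<notin> ?V \<Longrightarrow> lk e i = 0" using ne2 sf sg unfolding supp_def by metis
    have af: "tsym (- 1) ?V (altV ?V ?f)" "tsym (- 1) ?V (altV ?V ?g)" by (simp_all add: tsym_altV)
    have "inj_on (lk e) ?V" using ne2 tsym_distinct[OF af(1)] tsym_distinct[OF af(2)] by metis
    then obtain \<sigma> where s: "\<sigma> permutes ?V" and dec: "\<And>i j. b < i \<Longrightarrow> i < j \<Longrightarrow> j \<le> b + N \<Longrightarrow> lk e (\<sigma> j) < lk e (\<sigma> i)"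
      using sorting_permutation by blast
    define e' where "e' = Poly_Mapping.map_key \<sigma> e"
    have le': "lk e' i = lk e (\<sigma> i)" for i by (simp add: e'_def lookup_map_key permutes_inj[OF s])
    have im: "\<sigma> i \<in> ?V \<longleftrightarrow> i \<in> ?V" for i using permutes_in_image[OF s] .
    have "lk (altV ?V ?f) e' = int (card {x \<in> cset b b N \<eta> k. lattice b N x \<and> (\<forall>i\<in>?V. int (count_list x i) = lk e' i - (int (b + N) - int i))})"
    proof (rule Cons.IH)
      show "lk e' j < lk e' i" if "b < i" "i < j" "j \<le> b + N" for i j using dec that by (simp add: le')
      show "0 \<le> lk e' i" if "i \<in> ?V" for i unfolding le' by (rule pos) (use im that in blast)
      show "lk e' i = 0" if "i \<notin> ?V" for i unfolding le' by (rule se) (use im that in blast)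
    qed (use Cons.prems(1) in \<open>auto simp: N_def\<close>)
    moreover have "lk (altV ?V ?g) e' = int (card {x \<in> cset b b N \<eta> k. lattice b N x \<and> (\<forall>i\<in>?V. int (count_list x i) = lk e' i - (int (b + N) - int i))})"
    proof (rule lookup_alt_words[OF finite_cset suffix_closed_steps])
      show "lk e' i = 0" if "i \<notin> ?V" for i using se[of "\<sigma> i"] im[of i] that by (metis le')
    qed (use cset_closed cset_sub dec in \<open>auto simp: le'\<close>)
    ultimately have "lk (altV ?V ?f) e' = lk (altV ?V ?g) e'" by simp
    then have "sign \<sigma> * lk (altV ?V ?f) e = sign \<sigma> * lk (altV ?V ?g) e"
      unfolding e'_def by (simp only: altV_lookup_perm[OF finite_greaterThanAtMost s])
    moreover have "sign \<sigma> \<noteq> 0" by (cases \<sigma> rule: sign_cases) auto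
    ultimately show False using ne2 by simp
  qed
  have symQ: "tsym 1 ?V (fps_nth ?Q k)" for k
    unfolding fps_nth_Abs_fps
  proof (rule sym_words)
    fix r v v' assume r: "b < r" "r < b + N" "fstep r (Suc r) v v'"
    have "length (filter (\<lambda>c. c \<le> b) v') = length (filter (\<lambda>c. c \<le> b) v)"
      using r unfolding fstep_def by auto
    then show "v \<in> Qw a b N \<eta> k \<longleftrightarrow> v' \<in> Qw a b N \<eta> k"
      using cset_swap[of a r b N v v' \<eta>] r ab by (simp add: Qw_def)
  qed
  have "NegF ?V (altF ?V (fps_const ?\<rho> * (?F - fps_const (mono (ones a m)) * ?Q)))"
  proof (rule alternant_step[where I = "?I"])
    show "?F * (\<Prod>(i, j)\<in>?I \<times> ?V. fac i j) = fps_const (mono (ones a m)) * ?F'"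
      using FF_Cons[of a m \<eta>] by (simp add: b_def N_def)
  qed (use IH symQ words_marked[OF ab(2), of N \<eta>] in \<open>auto simp: lookup_ones b_def\<close>)
  then have neg: "Neg ?V (altV ?V (?\<rho> * (fps_nth ?F k - mono (ones a m) * wpoly (Qw a b N \<eta> k))))"
    unfolding NegF_def by (simp add: altF_def)
  \<comment> \<open>The staircase on all variables differs from that of the block only outside the
    block, so this monomial can be taken out of the inner alternant.\<close>
  define \<delta> where "\<delta> = rh a n - rh b N"
  have ld: "lk \<delta> i = 0" if "i \<in> ?V" for i using that abn ab by (auto simp: \<delta>_def lookup_minus lookup_rh)
  have \<rho>W: "mono (rh a n) = ?\<rho> * mono \<delta>" by (simp add: mono_mult \<delta>_def)
  define D where "D = fps_nth ?F k - mono (ones a m) * wpoly (Qw a b N \<eta> k)"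
  have "altV ?V (mono (rh a n) * D) = altV ?V (?\<rho> * D * mono \<delta>)" by (simp only: \<rho>W ac_simps)
  also have "\<dots> = altV ?V (?\<rho> * D) * mono \<delta>" by (rule altV_mult_sym) (auto intro: tsym_mono_off ld)
  finally have negW: "Neg ?V (altV ?V (mono (rh a n) * D))"
    using Neg_mult[OF neg[folded D_def], of "mono \<delta>"] ld by (auto simp: down_def lookup_single when_def split: if_splits)
  have pose: "0 \<le> lk e i" for i using Cons.prems(4,5) by (cases "i \<in> ?W") auto
  \<comment> \<open>Permutations of a nonnegative exponent are nonnegative, so the negligible inner
    alternant contributes nothing. By \<open>altV_altV\<close> this is a positive multiple of the
    alternant of \<open>D\<close> in all variables.\<close>
  have "lk (altV ?W (altV ?V (mono (rh a n) * D))) e = 0"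
    unfolding lookup_altV[of ?W]
  proof (intro sum.neutral ballI)
    fix \<sigma> assume "\<sigma> \<in> {\<sigma>. \<sigma> permutes ?W}"
    then have "\<forall>i. 0 \<le> lk (Poly_Mapping.map_key \<sigma> e) i" using pose by (simp add: lookup_map_key permutes_inj)
    then have "lk (altV ?V (mono (rh a n) * D)) (Poly_Mapping.map_key \<sigma> e) = 0"
      using negW unfolding Neg_def by (metis not_le)
    then show "sign \<sigma> * lk (altV ?V (mono (rh a n) * D)) (Poly_Mapping.map_key \<sigma> e) = 0" by simp
  qed
  moreover have "?V \<subseteq> ?W" using abn ab by auto
  ultimately have "lk (of_int (int (card {\<tau>. \<tau> permutes ?V})) * altV ?W (mono (rh a n) * D)) e = 0"
    using altV_altV[of ?W ?V "mono (rh a n) * D"] by simp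
  moreover have "card {\<tau>. \<tau> permutes ?V} \<noteq> 0"
  proof -
    have "id \<in> {\<tau>. \<tau> permutes ?V}" by (simp add: permutes_id)
    then show ?thesis using finite_permutations[OF finite_greaterThanAtMost, of b "b + N"] by (metis card_0_eq emptyE)
  qed
  ultimately have zero: "lk (altV ?W (mono (rh a n) * D)) e = 0" unfolding lookup_of_int_mult by simp
  have w1: "wexp [Suc a..<Suc b] = ones a m"
  proof (rule poly_mapping_eqI)
    fix i
    have "count_list [Suc a..<Suc b] i = (if a < i \<and> i \<le> b then 1 else 0)"
      using length_rowpos[of a i "[Suc a..<Suc b]"] rowpos_upt[of a i m] by (cases "a < i \<and> i \<le> b") (auto simp: b_def)
    then show "lk (wexp [Suc a..<Suc b]) i = lk (ones a m) i" by (simp add: lookup_wexp lookup_ones b_def)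
  qed
  have DX: "D = fps_nth ?F k - wpoly (Xset a b N \<eta> k)" unfolding D_def wpoly_Xset w1 ..
  have "lk (altV ?W (mono (rh a n) * fps_nth ?F k)) e = lk (altV ?W (mono (rh a n) * wpoly (Xset a b N \<eta> k))) e"
    using zero unfolding DX right_diff_distrib altV_diff lookup_minus by simp
  also have "\<dots> = int (card {x \<in> Xset a b N \<eta> k. lattice a n x \<and> (\<forall>i\<in>?W. int (count_list x i) = lk e i - (int (a + n) - int i))})"
  proof (rule lookup_alt_words)
    show "finite (Xset a b N \<eta> k)" using finite_Qw[of a b N \<eta> k] by (simp add: Xset_def Qw_def)
    show "suffix_closed a n (Xset a b N \<eta> k)" using suffix_closed_Xset[OF ab(1), of N \<eta> k] ab(3) by simp
    show "set x \<subseteq> ?W" if "x \<in> Xset a b N \<eta> k" for x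
      using that cset_sub abn ab unfolding Xset_def by fastforce
  qed (use Cons.prems in auto)
  also have "{x \<in> Xset a b N \<eta> k. lattice a n x \<and> (\<forall>i\<in>?W. int (count_list x i) = lk e i - (int (a + n) - int i))} =
      {x \<in> cset a a n (m # \<eta>) k. lattice a n x \<and> (\<forall>i\<in>?W. int (count_list x i) = lk e i - (int (a + n) - int i))}"
    using lattice_step[OF m, of a N \<eta> k] unfolding n b_def by blast
  finally show ?case .
qed

section \<open>The operator \<open>\<pi>\<close> and Schur coefficients\<close>

lemma sorted_eq:
  assumes af: "tsym (- 1) {a<..a + n} f" "tsym (- 1) {a<..a + n} g" and sf: "supp {a<..a + n} f" "supp {a<..a + n} g"
    and eq: "\<And>e. (\<And>i j. a < i \<Longrightarrow> i < j \<Longrightarrow> j \<le> a + n \<Longrightarrow> lk e j < lk e i) \<Longrightarrow>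
      (\<And>i. i \<notin> {a<..a + n} \<Longrightarrow> lk e i = 0) \<Longrightarrow> lk f e = lk g e"
  shows "f = g"
proof (rule poly_mapping_eqI, rule ccontr)
  let ?V = "{a<..a + n}"
  fix e assume ne: "lk f e \<noteq> lk g e"
  have se: "\<And>i. i \<notin> ?V \<Longrightarrow> lk e i = 0" using ne sf unfolding supp_def by metis
  have "inj_on (lk e) ?V" using ne tsym_distinct[OF af(1)] tsym_distinct[OF af(2)] by metis
  then obtain \<sigma> where s: "\<sigma> permutes ?V" and dec: "\<And>i j. a < i \<Longrightarrow> i < j \<Longrightarrow> j \<le> a + n \<Longrightarrow> lk e (\<sigma> j) < lk e (\<sigma> i)"
    using sorting_permutation by blast
  have le': "lk (Poly_Mapping.map_key \<sigma> e) i = lk e (\<sigma> i)" for i by (simp add: lookup_map_key permutes_inj[OF s])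
  have "lk f (Poly_Mapping.map_key \<sigma> e) = lk g (Poly_Mapping.map_key \<sigma> e)"
  proof (rule eq)
    show "lk (Poly_Mapping.map_key \<sigma> e) i = 0" if "i \<notin> ?V" for i
      using se[of "\<sigma> i"] permutes_in_image[OF s, of i] that by (metis le')
  qed (simp add: le' dec)
  then have "sign \<sigma> * lk f e = sign \<sigma> * lk g e"
    using tsym_lookup[OF s _ af(1)] tsym_lookup[OF s _ af(2)] by simp
  moreover have "sign \<sigma> \<noteq> 0" by (cases \<sigma> rule: sign_cases) auto
  ultimately show False using ne by simp
qed

lemma lookup_alt_dec:
  assumes b: "\<And>i j. a < i \<Longrightarrow> i < j \<Longrightarrow> j \<le> a + n \<Longrightarrow> lk b j < lk b i"
    and e: "\<And>i j. a < i \<Longrightarrow> i < j \<Longrightarrow> j \<le> a + n \<Longrightarrow> lk e j < lk e i"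
  shows "lk (altV {a<..a + n} (mono e)) b = (if b = e then 1 else 0)"
proof (cases "b = e")
  case True
  then show ?thesis using lookup_alt_rh[of a n e] e by simp
next
  case False
  have H: "e \<noteq> Poly_Mapping.map_key \<sigma> b" if s: "\<sigma> permutes {a<..a + n}" for \<sigma>
  proof
    assume eq: "e = Poly_Mapping.map_key \<sigma> b"
    have "\<sigma> = id"
    proof (rule increasing_permutation[OF s])
      fix i j assume ij: "a < i" "i < j" "j \<le> a + n"
      have "\<sigma> i \<in> {a<..a + n}" "\<sigma> j \<in> {a<..a + n}" using permutes_in_image[OF s] ij by auto
      moreover have "lk b (\<sigma> j) < lk b (\<sigma> i)" using e[OF ij] unfolding eq by (simp add: lookup_map_key permutes_inj[OF s])
      ultimately show "\<sigma> i < \<sigma> j" using b[of "\<sigma> j" "\<sigma> i"] by (cases "\<sigma> i" "\<sigma> j" rule: linorder_cases) auto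
    qed
    then show False using eq False by (simp add: mk_id)
  qed
  have "lk (mono e) (Poly_Mapping.map_key \<sigma> b) = 0" if "\<sigma> permutes {a<..a + n}" for \<sigma>
    using H[OF that] by (auto simp: lookup_single when_def)
  then show ?thesis using False unfolding lookup_altV by simp
qed

section \<open>Divisibility of alternants by the alternant of the staircase\<close>

lemma word_with_content: "finite A \<Longrightarrow> \<exists>w. set w \<subseteq> A \<and> (\<forall>i\<in>A. count_list w i = f i)"
proof (induction rule: finite_induct)
  case (insert x A)
  then obtain w where w: "set w \<subseteq> A" "\<forall>i\<in>A. count_list w i = f i" by blast
  have "count_list (replicate k x) i = (if i = x then k else 0)" for k i by (induction k) auto
  moreover have "count_list w x = 0" using w(1) insert.hyps(2) by (auto simp: count_list_0_iff)
  ultimately show ?case using w insert.hyps(2)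
    by (intro exI[of _ "replicate (f x) x @ w"]) auto
qed simp

lemma count_list_sort: "count_list (sort w) i = count_list w i"
  by (metis count_mset mset_sort)

text \<open>The weakly increasing word with the given content works: all labels \<open>r\<close>
  come before the first \<open>r + 1\<close>.\<close>

lemma lattice_content:
  assumes dec: "\<And>i. a < i \<Longrightarrow> i < a + n \<Longrightarrow> f (Suc i) \<le> f i"
  shows "\<exists>w. set w \<subseteq> {a<..a + n} \<and> (\<forall>i\<in>{a<..a + n}. count_list w i = f i) \<and> lattice a n w"
proof -
  obtain w0 where w0: "set w0 \<subseteq> {a<..a + n}" "\<forall>i\<in>{a<..a + n}. count_list w0 i = f i"
    using word_with_content[of "{a<..a + n}" f] by auto
  define w where "w = sort w0"
  have w: "set w \<subseteq> {a<..a + n}" "\<forall>i\<in>{a<..a + n}. count_list w i = f i" "sorted w"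
    using w0 by (simp_all add: w_def count_list_sort)
  have "lattice a n w" unfolding lattice_def
  proof (intro allI impI)
    fix p q r assume pq: "w = p @ q" "a < r" "r < a + n"
    show "0 \<le> exc r (Suc r) p"
    proof (cases "Suc r \<in> set p")
      case True
      then have "r \<notin> set q" using w(3) pq(1) by (force simp: sorted_append)
      then have "count_list p r = count_list w r" by (simp add: pq(1) count_list_0_iff)
      then have "count_list p r = f r" using bspec[OF w(2), of r] pq(2,3) by simp
      moreover have "count_list p (Suc r) \<le> f (Suc r)" using bspec[OF w(2), of "Suc r"] pq by simp
      ultimately show ?thesis using dec[of r] pq by (simp add: exc_def)
    next
      case False
      then show ?thesis by (simp add: exc_def count_list_0_iff)
    qed
  qed
  with w show ?thesis by blast
qed

text \<open>The quotient is a Schur polynomial, realized as the generating polynomial of the set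
  \<open>X\<close> of fillings whose reading words lie in one Knuth class. The set is closed under
  the steps, so the polynomial is symmetric and \<open>lookup_alt_words\<close> applies. The only
  lattice word in \<open>X\<close> is \<open>w0\<close>, whose content is \<open>e\<close> minus the
  staircase, so the alternant is that of \<open>mono e\<close>.\<close>

lemma schur_nonneg:
  fixes e :: "nat \<Rightarrow>\<^sub>0 int"
  assumes dec: "\<And>i j. a < i \<Longrightarrow> i < j \<Longrightarrow> j \<le> a + n \<Longrightarrow> lk e j < lk e i"
    and pos: "\<And>i. i \<in> {a<..a + n} \<Longrightarrow> 0 \<le> lk e i" and sup: "\<And>i. i \<notin> {a<..a + n} \<Longrightarrow> lk e i = 0"
  shows "\<exists>g. altV {a<..a + n} (mono (rh a n)) * g = altV {a<..a + n} (mono e)"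
proof -
  let ?V = "{a<..a + n}"
  define f where "f i = nat (lk e i - (int (a + n) - int i))" for i
  have low: "int (a + n) - int i \<le> lk e i" if "i \<in> ?V" for i
    using strict_dec_lower[of a n "lk e" i] dec pos that by auto
  have fe: "int (f i) = lk e i - (int (a + n) - int i)" if "i \<in> ?V" for i using low[OF that] by (simp add: f_def)
  have "f (Suc i) \<le> f i" if "a < i" "i < a + n" for i
    using dec[of i "Suc i"] that by (simp add: f_def)
  then obtain w0 where w0: "set w0 \<subseteq> ?V" "\<forall>i\<in>?V. count_list w0 i = f i" "lattice a n w0"
    using lattice_content[of a n f] by blast
  let ?L = "Lr a a n"
  define X where "X = {w. length w = length w0 \<and> set w \<subseteq> ?V \<and> rd a ?L w \<approx> rd a ?L w0}"
  have finX: "finite X"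
    by (rule finite_subset[OF _ finite_lists_length_eq[of ?V "length w0"]]) (auto simp: X_def)
  have cl: "v \<in> X \<longleftrightarrow> v' \<in> X" if st: "a < r" "r < a + n" "fstep r (Suc r) v v'" for r v v'
  proof -
    obtain L1 L2 where L: "?L = L1 @ [Suc r, r] @ L2" using Lr_adj[of a r a n] st by blast
    have k: "rd a ?L v \<approx> rd a ?L v'"
      unfolding L by (rule fstep_rd[OF that(3)]) (use distinct_Lr[of a a n] in \<open>auto simp: L\<close>)
    have "rd a ?L v \<approx> rd a ?L w0 \<longleftrightarrow> rd a ?L v' \<approx> rd a ?L w0"
      using knuth_trans[OF k] knuth_trans[OF knuth_sym[OF k]] by blast
    moreover have "length v' = length v" using fstep_count[OF that(3)] by simp
    moreover have "set v \<subseteq> ?V \<longleftrightarrow> set v' \<subseteq> ?V" using fstep_set[OF that(3)] that by auto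
    ultimately show ?thesis unfolding X_def by (simp only: mem_Collect_eq)
  qed
  have symX: "tsym 1 ?V (wpoly X)" by (rule sym_words) (rule cl)
  have a1: "altV ?V (mono (rh a n) * wpoly X) = altV ?V (mono (rh a n)) * wpoly X"
    by (rule altV_mult_sym[OF _ symX]) simp
  have "altV ?V (mono (rh a n) * wpoly X) = altV ?V (mono e)"
  proof (rule sorted_eq)
    show "supp ?V (altV ?V (mono (rh a n) * wpoly X))"
    proof (intro supp_altV supp_mult supp_mono)
      show "supp ?V (wpoly X)" unfolding wpoly_def
        by (intro supp_sum supp_mono) (auto simp: X_def lookup_wexp count_list_0_iff)
    qed (auto simp: lookup_rh)
    show "supp ?V (altV ?V (mono e))" by (intro supp_altV supp_mono sup)
    fix b :: "nat \<Rightarrow>\<^sub>0 int"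
    assume bd: "\<And>i j. a < i \<Longrightarrow> i < j \<Longrightarrow> j \<le> a + n \<Longrightarrow> lk b j < lk b i"
      and bs: "\<And>i. i \<notin> ?V \<Longrightarrow> lk b i = 0"
    let ?Y = "{x \<in> X. lattice a n x \<and> (\<forall>i\<in>?V. int (count_list x i) = lk b i - (int (a + n) - int i))}"
    have "?Y = (if b = e then {w0} else {})"
    proof -
      have u: "x = w0" if "x \<in> X" "lattice a n x" for x
        using lattice_knuth_unique[OF that(2) w0(3)] that(1) w0(1) by (simp add: X_def)
      have "w0 \<in> X" using w0(1) by (simp add: X_def)
      moreover have "(\<forall>i\<in>?V. int (count_list w0 i) = lk b i - (int (a + n) - int i)) \<longleftrightarrow> b = e"
      proof
        assume A: "\<forall>i\<in>?V. int (count_list w0 i) = lk b i - (int (a + n) - int i)"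
        show "b = e"
        proof (rule poly_mapping_eqI)
          fix i show "lk b i = lk e i"
          proof (cases "i \<in> ?V")
            case True
            then show ?thesis using bspec[OF A True] bspec[OF w0(2) True] fe[OF True] by linarith
          next
            case False
            then show ?thesis using bs sup by metis
          qed
        qed
      next
        assume b: "b = e"
        show "\<forall>i\<in>?V. int (count_list w0 i) = lk b i - (int (a + n) - int i)"
        proof
          fix i assume i: "i \<in> ?V"
          show "int (count_list w0 i) = lk b i - (int (a + n) - int i)"
            unfolding b using bspec[OF w0(2) i] fe[OF i] by simp
        qed
      qed
      ultimately have "?Y = {x. x = w0 \<and> b = e}" using u w0(3) by blast
      then show ?thesis by auto
    qed
    then have "card ?Y = (if b = e then 1 else 0)" by simp
    moreover have "lk (altV ?V (mono (rh a n) * wpoly X)) b = int (card ?Y)"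
      by (rule lookup_alt_words[OF finX suffix_closed_steps]) (use cl bd bs in \<open>auto simp: X_def\<close>)
    ultimately show "lk (altV ?V (mono (rh a n) * wpoly X)) b = lk (altV ?V (mono e)) b"
      using lookup_alt_dec[OF bd dec] by simp
  qed (simp_all add: tsym_altV)
  then show ?thesis using a1 by metis
qed

lemma tsym_ones: "tsym 1 {a<..a + n} (mono (Poly_Mapping.map (\<lambda>c. t * c) (ones a n)))"
  unfolding tsym_def
proof (intro ballI impI)
  fix x y assume xy: "x \<in> {a<..a + n}" "y \<in> {a<..a + n}" "x \<noteq> y"
  let ?t = "Transposition.transpose x y" and ?o = "Poly_Mapping.map (\<lambda>c. t * c) (ones a n)"
  have "Poly_Mapping.map_key ?t ?o = ?o"
    using xy by (intro poly_mapping_eqI)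
      (auto simp: lookup_map_key Transposition.transpose_def Poly_Mapping.map.rep_eq lookup_ones when_def)
  then show "permute_vars ?t (mono ?o) = of_int 1 * mono ?o"
    by (simp add: pv_mono inv_equality[of ?t ?t])
qed

text \<open>With a repeated exponent the alternant vanishes. Otherwise the exponent is sorted, at
  the cost of a sign, and made nonnegative by a power of the product of all variables, which is
  symmetric and invertible.\<close>

lemma alt_quotient_mono:
  assumes sup: "\<And>i. i \<notin> {a<..a + n} \<Longrightarrow> lk e i = 0"
  shows "\<exists>g. altV {a<..a + n} (mono (rh a n)) * g = altV {a<..a + n} (mono e)"
proof (cases "inj_on (lk e) {a<..a + n}")
  case False
  let ?V = "{a<..a + n}"
  have "altV ?V (mono e) = 0"
  proof (rule poly_mapping_eqI, rule ccontr)
    fix b assume "lk (altV ?V (mono e)) b \<noteq> lk 0 b"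
    then have n: "lk (altV ?V (mono e)) b \<noteq> 0" by simp
    then obtain \<sigma> where s: "\<sigma> permutes ?V" "lk (mono e) (Poly_Mapping.map_key \<sigma> b) \<noteq> 0"
      unfolding lookup_altV by (metis (no_types, lifting) mem_Collect_eq mult_zero_right sum.neutral)
    then have e: "e = Poly_Mapping.map_key \<sigma> b" by (auto simp: lookup_single when_def split: if_splits)
    have "inj_on (lk b) ?V" by (rule tsym_distinct[OF tsym_altV n]) simp
    then have "inj_on (lk b \<circ> \<sigma>) ?V"
      using permutes_image[OF s(1)] permutes_inj_on[OF s(1)] by (intro comp_inj_on) auto
    moreover have "lk e = lk b \<circ> \<sigma>" unfolding e by (auto simp: fun_eq_iff lookup_map_key permutes_inj[OF s(1)])
    ultimately show False using False by simp
  qed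
  then show ?thesis by (intro exI[of _ 0]) simp
next
  case True
  let ?V = "{a<..a + n}"
  obtain \<sigma> where s: "\<sigma> permutes ?V" and dec: "\<And>i j. a < i \<Longrightarrow> i < j \<Longrightarrow> j \<le> a + n \<Longrightarrow> lk e (\<sigma> j) < lk e (\<sigma> i)"
    using sorting_permutation[OF True] by blast
  define e' where "e' = Poly_Mapping.map_key \<sigma> e"
  have le': "lk e' i = lk e (\<sigma> i)" for i by (simp add: e'_def lookup_map_key permutes_inj[OF s])
  have se': "lk e' i = 0" if "i \<notin> ?V" for i
    using sup[of "\<sigma> i"] permutes_in_image[OF s, of i] that by (metis le')
  \<comment> \<open>A shift large enough to make every exponent nonnegative.\<close>
  define t where "t = (\<Sum>i\<in>?V. \<bar>lk e' i\<bar>)"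
  define s1 where "s1 = Poly_Mapping.map (\<lambda>c. t * c) (ones a n)"
  have ls1: "lk s1 i = (if i \<in> ?V then t else 0)" for i
    by (simp add: s1_def Poly_Mapping.map.rep_eq lookup_ones when_def)
  have "\<exists>g. altV ?V (mono (rh a n)) * g = altV ?V (mono (e' + s1))"
  proof (rule schur_nonneg)
    show "lk (e' + s1) j < lk (e' + s1) i" if "a < i" "i < j" "j \<le> a + n" for i j
      using dec[OF that] that by (simp add: lookup_add ls1 le')
    show "0 \<le> lk (e' + s1) i" if "i \<in> ?V" for i
    proof -
      have "\<bar>lk e' i\<bar> \<le> t" unfolding t_def by (rule member_le_sum) (use that in auto)
      then show ?thesis using that by (simp add: lookup_add ls1)
    qed
    show "lk (e' + s1) i = 0" if "i \<notin> ?V" for i using se'[OF that] that by (auto simp: lookup_add ls1)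
  qed
  then obtain g where g: "altV ?V (mono (rh a n)) * g = altV ?V (mono e' * mono s1)" by (auto simp: mono_mult)
  also have "\<dots> = altV ?V (mono e') * mono s1" by (rule altV_mult_sym) (auto simp: s1_def tsym_ones)
  finally have "altV ?V (mono (rh a n)) * (g * mono (- s1)) = altV ?V (mono e') * (mono s1 * mono (- s1))"
    by (simp only: mult.assoc[symmetric])
  then have g': "altV ?V (mono (rh a n)) * (g * mono (- s1)) = altV ?V (mono e')" by (simp add: mono_mult)
  have si: "inv \<sigma> permutes ?V" using s by (rule permutes_inv)
  have "mono e' = permute_vars (inv \<sigma>) (mono e)"
    by (simp add: pv_mono inv_inv_eq[OF permutes_bij[OF s]] e'_def)
  then have "altV ?V (of_int (sign (inv \<sigma>)) * mono e') = altV ?V (mono e)"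
    using altV_pv[OF _ si, of "mono e"] by simp
  moreover have "altV ?V (of_int c * h) = of_int c * altV ?V h" for c h
    by (rule poly_mapping_eqI) (simp add: lookup_altV lookup_of_int_mult sum_distrib_left mult.left_commute)
  ultimately have "altV ?V (mono (rh a n)) * (of_int (sign (inv \<sigma>)) * (g * mono (- s1))) = altV ?V (mono e)"
    using g' by (metis mult.left_commute)
  then show ?thesis by blast
qed

lemma alt_quotient:
  assumes "supp {a<..a + n} f"
  shows "\<exists>g. altV {a<..a + n} (mono (rh a n)) * g = altV {a<..a + n} f"
proof -
  have "Poly_Mapping.keys f \<subseteq> {e. \<forall>i. i \<notin> {a<..a + n} \<longrightarrow> lk e i = 0}"
    using assms by (auto simp: supp_def in_keys_iff)
  then show ?thesis
  proof (induction f rule: laurent_induct)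
    case zero
    then show ?case by (intro exI[of _ 0]) (simp add: altV_def)
  next
    case (mono e)
    then show ?case using alt_quotient_mono by blast
  next
    case (diff f g)
    then obtain x y where "altV {a<..a + n} (mono (rh a n)) * x = altV {a<..a + n} f"
      "altV {a<..a + n} (mono (rh a n)) * y = altV {a<..a + n} g" by blast
    then show ?case by (intro exI[of _ "x - y"]) (simp add: right_diff_distrib altV_diff)
  qed
qed

lemma alt_rh_nonzero: "altV {a<..a + n} (mono (rh a n)) \<noteq> 0"
proof
  assume "altV {a<..a + n} (mono (rh a n)) = 0"
  moreover have "lk (altV {a<..a + n} (mono (rh a n))) (rh a n) = 1" by (rule lookup_alt_rh) (auto simp: lookup_rh)
  ultimately show False by simp
qed

lemma lookup_exponent: "lk (exponent \<gamma>) i = (if 1 \<le> i \<and> i \<le> length \<gamma> then \<gamma> ! (i - 1) else 0)"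
proof -
  have "lk (exponent \<gamma>) i = (\<Sum>j\<in>{1..length \<gamma>}. if i = j then \<gamma> ! (j - 1) else 0)"
    unfolding exponent_def lookup_sum by (intro sum.cong) (auto simp: lookup_single when_def)
  then show ?thesis by (simp only: sum.delta' finite_atLeastAtMost) auto
qed

lemma exponent_rho: "exponent (rho n) = rh 0 n"
  by (rule poly_mapping_eqI) (auto simp: lookup_exponent lookup_rh rho_def rev_nth of_nat_diff)

lemma altV_1: "alternant n = altV {0<..0 + n}"
proof -
  have "{1..n} = {0<..0 + n}" by auto
  then show ?thesis by (simp only: alternant_altV)
qed

text \<open>The definite description is justified by \<open>alt_quotient\<close> for existence and
  by cancelling the nonzero alternant of the staircase for uniqueness.\<close>

lemma weyl_pi_mult:
  assumes "supp {0<..0 + n} f"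
  shows "alternant n (xpow (rho n)) * weyl_pi n f = alternant n (xpow (rho n) * f)"
proof -
  let ?A = "alternant n (xpow (rho n))"
  have A: "?A = altV {0<..0 + n} (mono (rh 0 n))" unfolding altV_1 xpow_def exponent_rho ..
  have "supp {0<..0 + n} (xpow (rho n) * f)"
    unfolding xpow_def exponent_rho by (intro supp_mult assms supp_mono) (auto simp: lookup_rh)
  then obtain g where "altV {0<..0 + n} (mono (rh 0 n)) * g = altV {0<..0 + n} (xpow (rho n) * f)"
    using alt_quotient by blast
  then have g: "?A * g = alternant n (xpow (rho n) * f)" unfolding A unfolding altV_1 .
  have "weyl_pi n f = g" unfolding weyl_pi_def
  proof (rule the_equality)
    show "?A * g = alternant n (xpow (rho n) * f)" by (rule g)
  next
    fix g' assume "?A * g' = alternant n (xpow (rho n) * f)"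
    then have "?A * g' = ?A * g" using g by simp
    then show "g' = g" using alt_rh_nonzero[of 0 n] unfolding A by simp
  qed
  then show ?thesis using g by simp
qed

lemma dominant_dec:
  assumes "dominant n lam" "0 < i" "i < j" "j \<le> 0 + n"
  shows "lk (exponent lam + rh 0 n) j < lk (exponent lam + rh 0 n) i"
proof -
  have "lam ! (j - 1) \<le> lam ! (i - 1)"
    using assms sorted_wrt_nth_less[of "(\<ge>)" lam "i - 1" "j - 1"] by (auto simp: dominant_def)
  then show ?thesis using assms by (auto simp: lookup_add lookup_exponent lookup_rh dominant_def)
qed

lemma exponent_inj:
  assumes "length x = length y" "exponent x = exponent y" shows "x = y"
proof (rule nth_equalityI[OF assms(1)])
  fix i assume "i < length x"
  then show "x ! i = y ! i" using arg_cong[OF assms(2), of "\<lambda>e. lk e (Suc i)"] assms(1) by (simp add: lookup_exponent)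
qed

text \<open>Multiplied by the alternant of the staircase, \<open>schur n l\<close> becomes the
  alternant of \<open>l\<close> plus the staircase. For dominant weights these exponents are
  strictly decreasing and distinct, so each Schur coefficient is one coefficient of the alternant of
  \<open>f\<close>; in particular the expansion exists and is unique.\<close>

theorem lookup_schur_coeffs:
  assumes sf: "supp {0<..0 + n} f" and lam: "dominant n lam"
  shows "lk (schur_coeffs n (weyl_pi n f)) lam = lk (alternant n (xpow (rho n) * f)) (exponent lam + rh 0 n)"
proof -
  let ?V = "{0<..0 + n}" and ?A = "alternant n (xpow (rho n))"
  define h where "h = alternant n (xpow (rho n) * f)"
  have A: "?A = altV ?V (mono (rh 0 n))" unfolding altV_1 xpow_def exponent_rho ..
  have A0: "?A \<noteq> 0" unfolding A by (rule alt_rh_nonzero)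
  let ?E = "\<lambda>l. exponent l + rh 0 n"
  have supE: "lk (?E l) i = 0" if "dominant n l" "i \<notin> ?V" for l i
    using that by (auto simp: lookup_add lookup_exponent lookup_rh dominant_def)
  have sch: "?A * schur n l = altV ?V (mono (?E l))" if "dominant n l" for l
  proof -
    have "supp ?V (xpow l)" unfolding xpow_def using that by (intro supp_mono) (auto simp: lookup_exponent dominant_def)
    from weyl_pi_mult[OF this] show ?thesis
      unfolding schur_def by (simp add: altV_1 xpow_def mono_mult exponent_rho add.commute)
  qed
  have lsum: "lk (?A * (\<Sum>l\<in>Poly_Mapping.keys c. of_int (lk c l) * schur n l)) (?E m) = lk c m"
    if c: "\<forall>l\<in>Poly_Mapping.keys c. dominant n l" and m: "dominant n m" for c m
  proof -
    have "?A * (\<Sum>l\<in>Poly_Mapping.keys c. of_int (lk c l) * schur n l) =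
        (\<Sum>l\<in>Poly_Mapping.keys c. of_int (lk c l) * altV ?V (mono (?E l)))"
      unfolding sum_distrib_left using c sch by (intro sum.cong refl) (metis mult.left_commute)
    then have "lk (?A * (\<Sum>l\<in>Poly_Mapping.keys c. of_int (lk c l) * schur n l)) (?E m) =
        (\<Sum>l\<in>Poly_Mapping.keys c. lk c l * lk (altV ?V (mono (?E l))) (?E m))"
      by (simp add: lookup_sum lookup_of_int_mult)
    also have "\<dots> = (\<Sum>l\<in>Poly_Mapping.keys c. if l = m then lk c l else 0)"
    proof (intro sum.cong refl)
      fix l assume l: "l \<in> Poly_Mapping.keys c"
      have "lk (altV ?V (mono (?E l))) (?E m) = (if ?E m = ?E l then 1 else 0)"
        by (rule lookup_alt_dec) (use dominant_dec c l m in auto)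
      moreover have "?E m = ?E l \<longleftrightarrow> l = m" using exponent_inj[of l m] c l m by (auto simp: dominant_def)
      ultimately show "lk c l * lk (altV ?V (mono (?E l))) (?E m) = (if l = m then lk c l else 0)" by simp
    qed
    also have "\<dots> = lk c m" by (simp add: in_keys_iff)
    finally show ?thesis .
  qed
  have fin: "finite {l. (if dominant n l then lk h (?E l) else 0) \<noteq> 0}"
  proof (rule inj_on_finite[of ?E _ "Poly_Mapping.keys h"])
    show "inj_on ?E {l. (if dominant n l then lk h (?E l) else 0) \<noteq> 0}"
      by (auto simp: inj_on_def dominant_def intro: exponent_inj split: if_splits)
  qed (auto simp: in_keys_iff split: if_splits)
  define c where "c = Abs_poly_mapping (\<lambda>l. if dominant n l then lk h (?E l) else 0)"
  have lc: "lk c l = (if dominant n l then lk h (?E l) else 0)" for l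
    unfolding c_def using fin by (simp add: Abs_poly_mapping_inverse)
  have cdom: "\<forall>l\<in>Poly_Mapping.keys c. dominant n l" by (auto simp: in_keys_iff lc split: if_splits)
  have sh: "supp ?V h" unfolding h_def altV_1
    by (intro supp_altV supp_mult sf) (auto simp: xpow_def exponent_rho lookup_rh intro!: supp_mono)
  have "?A * weyl_pi n f = ?A * (\<Sum>l\<in>Poly_Mapping.keys c. of_int (lk c l) * schur n l)"
  proof -
    let ?S = "\<Sum>l\<in>Poly_Mapping.keys c. of_int (lk c l) * altV ?V (mono (?E l))"
    have S: "?A * (\<Sum>l\<in>Poly_Mapping.keys c. of_int (lk c l) * schur n l) = ?S"
      unfolding sum_distrib_left using cdom sch by (intro sum.cong refl) (metis mult.left_commute)
    have "h = ?S"
    proof (rule sorted_eq)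
      show "tsym (- 1) ?V h" unfolding h_def altV_1 by (rule tsym_altV) simp
      show "tsym (- 1) ?V ?S"
      proof -
        have "?S = altV ?V (\<Sum>l\<in>Poly_Mapping.keys c. of_int (lk c l) * mono (?E l))"
          unfolding altV_sum
          by (intro sum.cong refl poly_mapping_eqI) (simp add: lookup_altV lookup_of_int_mult sum_distrib_left mult.left_commute)
        then show ?thesis using tsym_altV[of ?V] by simp
      qed
      show "supp ?V h" by (rule sh)
      show "supp ?V ?S"
      proof (rule supp_sum)
        fix l assume "l \<in> Poly_Mapping.keys c"
        then have "supp ?V (altV ?V (mono (?E l)))" using cdom supE by (intro supp_altV supp_mono) blast
        then show "supp ?V (of_int (lk c l) * altV ?V (mono (?E l)))" by (simp add: supp_def lookup_of_int_mult)
      qed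
      fix e :: "nat \<Rightarrow>\<^sub>0 int"
      assume dec: "\<And>i j. 0 < i \<Longrightarrow> i < j \<Longrightarrow> j \<le> 0 + n \<Longrightarrow> lk e j < lk e i" and es: "\<And>i. i \<notin> ?V \<Longrightarrow> lk e i = 0"
      \<comment> \<open>Every strictly decreasing exponent supported on the variables is of the form
        \<open>?E m\<close> with \<open>m\<close> dominant, so \<open>c\<close> accounts for all
        coefficients of \<open>h\<close> that matter.\<close>
      define m where "m = map (\<lambda>i. lk e (Suc i) - (int n - int (Suc i))) [0..<n]"
      have me: "?E m = e"
        using es by (intro poly_mapping_eqI) (auto simp: lookup_add lookup_exponent lookup_rh m_def)
      have "dominant n m" unfolding dominant_def
      proof
        show "sorted_wrt (\<ge>) m" unfolding sorted_wrt_iff_nth_less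
        proof (intro allI impI)
          fix i j assume ij: "i < j" "j < length m"
          have "int (Suc j - Suc i) \<le> lk e (Suc i) - lk e (Suc j)"
            using ij
          proof (induction j)
            case (Suc j)
            have "lk e (Suc (Suc j)) < lk e (Suc j)" using Suc.prems by (intro dec) (auto simp: m_def)
            then show ?case using Suc by (cases "i = j") auto
          qed simp
          then show "m ! j \<le> m ! i" using ij by (simp add: m_def of_nat_diff)
        qed
      qed (simp add: m_def)
      then show "lk h e = lk ?S e" using lsum[OF cdom, of m] lc[of m] S me by simp
    qed
    then show ?thesis using S weyl_pi_mult[OF sf] by (simp add: h_def)
  qed
  then have g: "weyl_pi n f = (\<Sum>l\<in>Poly_Mapping.keys c. of_int (lk c l) * schur n l)" using A0 by simp
  have "schur_coeffs n (weyl_pi n f) = c" unfolding schur_coeffs_def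
  proof (rule the_equality)
    show "(\<forall>l\<in>Poly_Mapping.keys c. dominant n l) \<and> weyl_pi n f = (\<Sum>l\<in>Poly_Mapping.keys c. of_int (lk c l) * schur n l)"
      using cdom g by blast
    fix c' assume c': "(\<forall>l\<in>Poly_Mapping.keys c'. dominant n l) \<and> weyl_pi n f = (\<Sum>l\<in>Poly_Mapping.keys c'. of_int (lk c' l) * schur n l)"
    show "c' = c"
    proof (rule poly_mapping_eqI)
      fix l show "lk c' l = lk c l"
      proof (cases "dominant n l")
        case True
        then show ?thesis using lsum[of c' l] lsum[OF cdom, of l] c' g by metis
      next
        case False
        then have "l \<notin> Poly_Mapping.keys c'" using c' by blast
        then show ?thesis using False lc by (simp add: in_keys_iff)
      qed
    qed
  qed
  then show ?thesis using lc[of lam] lam by (simp add: h_def)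
qed

section \<open>The theorem\<close>

lemma mem_RR: "(i, j) \<in> RR a \<eta> \<longleftrightarrow> a < i \<and> j \<le> a + sum_list \<eta> \<and>
    (\<exists>r\<in>{1..length \<eta>}. i \<le> a + sum_list (take r \<eta>) \<and> a + sum_list (take r \<eta>) < j)"
proof (induction a \<eta> rule: RR.induct)
  case (2 a m \<eta>)
  have ex: "(\<exists>r\<in>{1..length (m # \<eta>)}. P r) \<longleftrightarrow> P 1 \<or> (\<exists>r\<in>{1..length \<eta>}. P (Suc r))" for P
  proof
    assume "\<exists>r\<in>{1..length (m # \<eta>)}. P r"
    then obtain r where r: "r \<in> {1..length (m # \<eta>)}" "P r" by blast
    show "P 1 \<or> (\<exists>r\<in>{1..length \<eta>}. P (Suc r))"
    proof (cases "r = 1")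
      case False
      then have "r - 1 \<in> {1..length \<eta>}" "P (Suc (r - 1))" using r by auto
      then show ?thesis by blast
    qed (use r in simp)
  qed auto
  have le: "sum_list (take r \<eta>) \<le> sum_list \<eta>" for r
    by (metis append_take_drop_id le_add1 sum_list_append)
  have 1: "(i, j) \<in> RR (a + m) \<eta> \<longleftrightarrow> a + m < i \<and> j \<le> a + m + sum_list \<eta> \<and>
    (\<exists>r\<in>{1..length \<eta>}. i \<le> a + m + sum_list (take r \<eta>) \<and> a + m + sum_list (take r \<eta>) < j)"
    using 2 .
  show ?case unfolding RR.simps Un_iff 1 ex
    by (cases "i \<le> a + m") (auto simp: add.assoc)
qed auto

lemma Roots_RR: "Roots \<eta> = RR 0 \<eta>"
proof (intro set_eqI)
  fix x :: "nat \<times> nat"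
  obtain i j where "x = (i, j)" by force
  then show "x \<in> Roots \<eta> \<longleftrightarrow> x \<in> RR 0 \<eta>" by (simp add: Roots_def mem_RR Suc_le_eq)
qed

lemma map_length_ones: "map length (map (\<lambda>m. replicate m (1::int)) \<eta>) = \<eta>"
  by (induction \<eta>) auto

lemma concat_ones: "concat (map (\<lambda>m. replicate m (1::int)) \<eta>) = replicate (sum_list \<eta>) 1"
  by (induction \<eta>) (auto simp: replicate_add)

lemma series_FF: "fps_const (xpow (replicate (sum_list \<eta>) 1)) * B_series \<eta> = FF 0 \<eta>"
proof -
  have "exponent (replicate (sum_list \<eta>) 1) = ones 0 (sum_list \<eta>)"
    by (rule poly_mapping_eqI) (auto simp: lookup_exponent lookup_ones)
  then show ?thesis by (simp add: xpow_def B_series_def FF_def Roots_RR)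
qed

theorem proposition53:
  fixes n :: nat and \<mu> \<eta> lam :: "nat list" and \<gamma> :: "int list" and R :: "int list list"
  assumes "partition_of \<mu> n"
    and "\<eta> = \<mu>" and "\<gamma> = replicate n 1" and "R = blocks \<eta> \<gamma>"
    and "partition_of lam n"
  shows "K_of_seq (weight_of n lam) R =
    (\<Sum>S | R_catabolizable R S \<and> shape S = lam. fps_X ^ charge S)"
proof -
  have n: "n = sum_list \<mu>" and pos: "\<forall>m\<in>set \<mu>. 0 < m"
    and lam: "sorted_wrt (\<ge>) lam" "\<forall>p\<in>set lam. 0 < p" "sum_list lam = n"
    using assms(1,5) by (auto simp: partition_of_def)
  have R: "R = map (\<lambda>m. replicate m 1) \<mu>" using assms(2-4) blocks_ones[of \<mu>] n by simp
  have len: "length lam \<le> n"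
  proof -
    have "length l \<le> sum_list l" if "\<forall>p\<in>set l. 0 < p" for l :: "nat list" using that by (induction l) auto
    then show ?thesis using lam(2,3) by blast
  qed
  define wt where "wt = weight_of n lam"
  have lwt: "length wt = n" using len by (simp add: wt_def weight_of_def)
  have wt: "wt ! i = (if i < length lam then int (lam ! i) else 0)" if "i < n" for i
    using that len by (auto simp: wt_def weight_of_def nth_append)
  have dom: "dominant n wt"
    unfolding dominant_def sorted_wrt_iff_nth_less
  proof (intro conjI allI impI)
    fix i j assume ij: "i < j" "j < length wt"
    show "wt ! j \<le> wt ! i"
    proof (cases "j < length lam")
      case True
      then have "lam ! j \<le> lam ! i" using sorted_wrt_nth_less[OF lam(1) ij(1)] by simp
      then show ?thesis using wt[of i] wt[of j] ij True lwt by simp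
    qed (use wt[of i] wt[of j] ij lwt in simp)
  qed (rule lwt)
  \<comment> \<open>The exponent at which the coefficient is read off: the padded partition plus the
    staircase, nonnegative and strictly decreasing.\<close>
  define e where "e = exponent wt + rh 0 n"
  have le: "lk e i = (if 0 < i \<and> i \<le> n then wt ! (i - 1) + (int n - int i) else 0)" for i
    by (auto simp: e_def lookup_add lookup_exponent lookup_rh lwt)
  let ?T = "{S. R_catabolizable R S \<and> shape S = lam}"
  have Rc: "R_catabolizable R S \<longleftrightarrow> column_strict S \<and> word_on 0 (row_word S) \<and> length (row_word S) = n \<and> good \<mu> (ct 0 (row_word S))" for S
    unfolding R_catabolizable_def R using catabolizable_iff[OF pos] n by simp
  \<comment> \<open>A sum over an infinite set would be 0 by convention. Catabolizable tableaux are
    standard, and a tableau is determined by its shape and its reading word.\<close>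
  have finT: "finite ?T"
  proof (rule inj_on_finite[of "\<lambda>S. (row_word S, shape S)" _ "{u. set u \<subseteq> {0<..n} \<and> length u = n} \<times> {lam}"])
    have "S = S'" if "row_word S = row_word S'" "shape S = shape S'" for S S'
      using that
    proof (induction S arbitrary: S')
      case (Cons r S)
      then obtain r' S1 where S': "S' = r' # S1" by (cases S') (auto simp: shape_def)
      then have "length r = length r'" "shape S = shape S1" using Cons.prems by (auto simp: shape_def)
      then show ?case using Cons S' by simp
    qed (simp add: shape_def)
    then show "inj_on (\<lambda>S. (row_word S, shape S)) ?T" by (auto simp: inj_on_def)
    show "(\<lambda>S. (row_word S, shape S)) ` ?T \<subseteq> {u. set u \<subseteq> {0<..n} \<and> length u = n} \<times> {lam}"
      by (auto simp: Rc word_on_def)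
    show "finite ({u. set u \<subseteq> {0<..n} \<and> length u = n} \<times> {lam})"
      using finite_lists_length_eq[of "{0<..n}" n] by simp
  qed
  show ?thesis
  proof (rule fps_ext)
    fix k
    have sup: "supp {0<..0 + n} (fps_nth (FF 0 \<mu>) k)" using supp_FF[of 0 \<mu> k] n by simp
    have "fps_nth (K_of_seq (weight_of n lam) R) k = lk (schur_coeffs n (weyl_pi n (fps_nth (FF 0 \<mu>) k))) wt"
      unfolding K_of_seq_def K_series_def H_series_def R concat_ones map_length_ones
      by (simp add: series_FF n[symmetric] wt_def del: fps_mult_left_const_nth) (simp add: n series_FF del: fps_mult_left_const_nth)
    also have "\<dots> = lk (altV {0<..0 + n} (mono (rh 0 n) * fps_nth (FF 0 \<mu>) k)) e"
      unfolding lookup_schur_coeffs[OF sup dom] altV_1 xpow_def exponent_rho e_def ..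
    also have "\<dots> = int (card {x \<in> cset 0 0 n \<mu> k. lattice 0 n x \<and> (\<forall>i\<in>{0<..0 + n}. int (count_list x i) = lk e i - (int (0 + n) - int i))})"
    proof (rule lookup_alt_FF[OF pos n])
      show "lk e j < lk e i" if "0 < i" "i < j" "j \<le> 0 + n" for i j
        unfolding e_def using dominant_dec[OF dom that] .
      show "0 \<le> lk e i" if "i \<in> {0<..0 + n}" for i using wt[of "i - 1"] that by (auto simp: le)
    qed (auto simp: le)
    also have "{x \<in> cset 0 0 n \<mu> k. lattice 0 n x \<and> (\<forall>i\<in>{0<..0 + n}. int (count_list x i) = lk e i - (int (0 + n) - int i))} =
      {x. length x = n \<and> set x \<subseteq> {0<..n} \<and> lattice 0 n x \<and>
        (good \<mu> (ct 0 (rd 0 (Lr 0 0 n) x)) \<and> chg 0 (rd 0 (Lr 0 0 n) x) = k) \<and>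
        (\<forall>i<n. count_list x (Suc i) = (if i < length lam then lam ! i else 0))}"
    proof -
      have "(\<forall>i\<in>{0<..0 + n}. int (count_list x i) = lk e i - (int (0 + n) - int i)) \<longleftrightarrow>
          (\<forall>i<n. count_list x (Suc i) = (if i < length lam then lam ! i else 0))" for x
      proof -
        have "{0<..0 + n} = Suc ` {..<n}" by (auto simp: image_iff Bex_def gr0_conv_Suc)
        then have "(\<forall>i\<in>{0<..0 + n}. int (count_list x i) = lk e i - (int (0 + n) - int i)) \<longleftrightarrow>
            (\<forall>i<n. int (count_list x (Suc i)) = lk e (Suc i) - (int n - int (Suc i)))" by auto
        also have "\<dots> \<longleftrightarrow> (\<forall>i<n. count_list x (Suc i) = (if i < length lam then lam ! i else 0))"
          by (intro all_cong) (auto simp: le wt)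
        finally show ?thesis .
      qed
      then show ?thesis by (auto simp: cset_def)
    qed
    also have "card \<dots> = card {S. column_strict S \<and> word_on 0 (row_word S) \<and> length (row_word S) = n \<and>
        (good \<mu> (ct 0 (row_word S)) \<and> chg 0 (row_word S) = k) \<and> shape S = lam}"
      by (rule card_tableaux[OF lam(2) len, of "\<lambda>u. good \<mu> (ct 0 u) \<and> chg 0 u = k", symmetric])
    \<comment> \<open>The criterion \<open>catabolizable_iff\<close> turns \<open>good\<close> back
      into catabolizability, and \<open>charge_chg\<close> identifies the two forms of the charge on
      standard words.\<close>
    also have "{S. column_strict S \<and> word_on 0 (row_word S) \<and> length (row_word S) = n \<and>
        (good \<mu> (ct 0 (row_word S)) \<and> chg 0 (row_word S) = k) \<and> shape S = lam} = {S \<in> ?T. charge S = k}"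
      using charge_chg by (auto simp: Rc charge_def)
    also have "int (card {S \<in> ?T. charge S = k}) = fps_nth (\<Sum>S\<in>?T. fps_X ^ charge S) k"
      using finT by (simp add: fps_sum_nth fps_X_power_nth sum.If_cases Int_def eq_commute conj_assoc)
    finally show "fps_nth (K_of_seq (weight_of n lam) R) k = fps_nth (\<Sum>S | R_catabolizable R S \<and> shape S = lam. fps_X ^ charge S) k" .
  qed
qed

end
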